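(* Let $\widetilde{\mathfrak L}=\widetilde{\mathfrak{sl}_2(\mathbb C_q)}$ be the Lie algebra described in the context, $U=\mathcal U(\widetilde{\mathfrak L})$, and let $\mathbf n=(n_1,n_2)\in\mathbb Z^2$. In each of the situations (1), (2), (3) below there exists a noncommutative and noncocommutative Hopf algebra structure $(U[[t]],\mu,\tau,\Delta,\epsilon,S)$ on $U[[t]]$ over $\mathbb C[[t]]$ which preserves the product and the counit of $U[[t]]$, and whose coproduct $\Delta$ and antipode $S$ are given on the basis elements of $\widetilde{\mathfrak L}$ by the listed formulas. Here $\mathbf m=(m_1,m_2)$ ranges over $\mathbb Z^2$ for $e_{\mathbf m},f_{\mathbf m}$ and over $\mathbb Z^2\setminus\{\mathbf 0\}$ for $g_{\mathbf m},h_{\mathbf m}$, and $i=1,2$. (1) $T=x_1d_1+x_2d_2$ with $x_1,x_2\in\mathbb C$, $E=h_{\mathbf n}$ with $[T,E]=E$, $r=x_1m_1+x_2m_2$; for $y=e,f,h,g$: $$\Delta(y_{\mathbf m})=y_{\mathbf m}\otimes(1-Et)^r+\sum_{j=0}^\infty\frac{\eta^y_{j,\mathbf m}}{j!}T^{<j>}\otimes(1-Et)^{-j}y_{\mathbf m+j\mathbf n}t^j,$$ $$S(y_{\mathbf m})=\sum_{j=0}^\infty\frac{(-1)^{j+1}\eta^y_{j,\mathbf m}}{j!}(1-Et)^{-r}y_{\mathbf m+j\mathbf n}T_1^{<j>}t^j,$$ $$\Delta(d_i)=d_i\otimes1+1\otimes d_i-n_iT\otimes1+n_iT\otimes(1-Et)^{-1},\qquad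 S(d_i)=-d_i+n_iTEt,$$ $$\Delta(d)=d\otimes1+1\otimes d,\qquad S(d)=-d.$$ (2) $T=x_1d_1+x_2d_2$ with $x_1,x_2\in\mathbb C$, $E=f_{\mathbf n}$ with $[T,E]=E$, $r=x_1m_1+x_2m_2$; for $y=f,g,h$: $$\Delta(y_{\mathbf m})=y_{\mathbf m}\otimes(1-Et)^r+1\otimes y_{\mathbf m}+\beta_{y_{\mathbf m}}T\otimes(1-Et)^{-1}f_{\mathbf m+\mathbf n}t,$$ $$S(y_{\mathbf m})=-(1-Et)^{r}y_{\mathbf m}+\beta_{y_{\mathbf m}}(1-Et)^{r}f_{\mathbf m+\mathbf n}T_1t;$$ if $\mathbf m+\mathbf n\ne\mathbf 0$, $$\Delta(e_{\mathbf m})=e_{\mathbf m}\otimes(1-Et)^r+1\otimes e_{\mathbf m}+q^{m_2n_1}T\otimes(1-Et)^{-1}g_{\mathbf m+\mathbf n}t-q^{m_1n_2}T\otimes(1-Et)^{-1}h_{\mathbf m+\mathbf n}t-s_{\mathbf m}T^{<2>}\otimes(1-Et)^{-2}f_{\mathbf m+2\mathbf n}t^2,$$ $$S(e_{\mathbf m})=q^{m_2n_1}(1-Et)^{r}g_{\mathbf m+\mathbf n}T_1t-q^{m_1n_2}(1-Et)^{r}h_{\mathbf m+\mathbf n}T_1t-(1-Et)^{r}e_{\mathbf m}+s_{\mathbf m}(1-Et)^{r}f_{\mathbf m+2\mathbf n}T_1^{<2>}t^2;$$ for $\mathbf m=-\mathbf n$, $$\Delta(e_{-\mathbf n})=e_{-\mathbf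 n}\otimes(1-Et)^{-1}+1\otimes e_{-\mathbf n}+q^{-n_1n_2}T\otimes(1-Et)^{-1}d\,t-q^{-n_1n_2}T^{<2>}\otimes(1-Et)^{-2}Et^2,$$ $$S(e_{-\mathbf n})=q^{-n_1n_2}(1-Et)^{-1}ET_1^{<2>}t^2-(1-Et)^{-1}e_{-\mathbf n}+q^{-n_1n_2}(1-Et)^{-1}d\,T_1t;$$ and $$\Delta(d)=d\otimes1+1\otimes d-2T\otimes(1-Et)^{-1}Et,\qquad S(d)=-d-2ET_1t,$$ $$\Delta(d_i)=d_i\otimes1+1\otimes d_i-n_iT\otimes1+n_iT\otimes(1-Et)^{-1},\qquad S(d_i)=-d_i+n_iTEt.$$ (3) $T=\frac12d$, $E=f_{\mathbf n}$; for $y=f,g,h$, with $\delta_{y,f}=1$ if $y=f$ and $0$ otherwise: $$\Delta(y_{\mathbf m})=y_{\mathbf m}\otimes(1-Et)^{\delta_{y,f}}+1\otimes y_{\mathbf m}+\beta_{y_{\mathbf m}}T\otimes(1-Et)^{-1}f_{\mathbf m+\mathbf n}t,$$ $$S(y_{\mathbf m})=-(1-Et)^{\delta_{y,f}}y_{\mathbf m}+\beta_{y_{\mathbf m}}f_{\mathbf m+\mathbf n}T_1t;$$ if $\mathbf m+\mathbf n\neq\mathbf 0$, $$\Delta(e_{\mathbf m})=e_{\mathbf m}\otimes(1-Et)^{-1}+1\otimes e_{\mathbf m}+q^{m_2n_1}T\otimes(1-Et)^{-1}g_{\mathbf m+\mathbf n}t-q^{m_1n_2}T\otimes(1-Et)^{-1}h_{\mathbf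 m+\mathbf n}t-s_{\mathbf m}T^{<2>}\otimes(1-Et)^{-2}f_{\mathbf m+2\mathbf n}t^2,$$ $$S(e_{\mathbf m})=q^{m_2n_1}(1-Et)^{-1}g_{\mathbf m+\mathbf n}T_1t-q^{m_1n_2}(1-Et)^{-1}T_1h_{\mathbf m+\mathbf n}t-(1-Et)^{-1}e_{\mathbf m}+s_{\mathbf m}(1-Et)^{-1}f_{\mathbf m+2\mathbf n}T_1^{<2>}t^2;$$ for $\mathbf m=-\mathbf n$, $$\Delta(e_{-\mathbf n})=e_{-\mathbf n}\otimes(1-Et)^{-1}+1\otimes e_{-\mathbf n}+q^{-n_1n_2}T\otimes(1-Et)^{-1}d\,t-q^{-n_1n_2}T^{<2>}\otimes(1-Et)^{-2}Et^2,$$ $$S(e_{-\mathbf n})=q^{-n_1n_2}(1-Et)^{-1}ET_1^{<2>}t^2-(1-Et)^{-1}e_{-\mathbf n}+q^{-n_1n_2}(1-Et)^{-1}d\,T_1t;$$ and $$\Delta(d)=d\otimes1+1\otimes d-2T\otimes(1-Et)^{-1}Et,\qquad S(d)=-d-2ET_1t,$$ $$\Delta(d_i)=d_i\otimes1+1\otimes d_i+n_iT\otimes(1-Et)^{-1}-n_iT\otimes1,\qquad S(d_i)=-d_i+n_iTEt.$$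
   Context: **The Lie algebra.** Let $q$ be a fixed nonzero complex number. $\mathfrak L=\mathfrak{sl}_2(\mathbb C_q)$ is the complex Lie algebra with basis $e_{\mathbf m},f_{\mathbf m}$ ($\mathbf m\in\mathbb Z^2$), $g_{\mathbf k},h_{\mathbf k}$ ($\mathbf k\in\mathbb Z^2\setminus\{\mathbf 0\}$), $d$; these are the matrices $E_{12}x^{m_1}y^{m_2}$, $E_{21}x^{m_1}y^{m_2}$, $E_{11}x^{k_1}y^{k_2}$, $E_{22}x^{k_1}y^{k_2}$, $E_{11}-E_{22}$ over the quantum torus $\mathbb C_q=\mathbb C_q[x^{\pm1},y^{\pm1}]$, $yx=qxy$. The brackets are $[e_{\mathbf m},e_{\mathbf m'}]=[f_{\mathbf m},f_{\mathbf m'}]=[d,h_{\mathbf k}]=[d,g_{\mathbf k}]=[g_{\mathbf k},h_{\mathbf k'}]=0$; $[g_{\mathbf k},e_{\mathbf m}]=q^{k_2m_1}e_{\mathbf k+\mathbf m}$, $[h_{\mathbf k},e_{\mathbf m}]=-q^{k_1m_2}e_{\mathbf k+\mathbf m}$, $[d,e_{\mathbf m}]=2e_{\mathbf m}$; $[h_{\mathbf k},f_{\mathbf m}]=q^{k_2m_1}f_{\mathbf k+\mathbf m}$, $[g_{\mathbf k},f_{\mathbf m}]=-q^{k_1m_2}f_{\mathbf k+\mathbf m}$, $[d,f_{\mathbf m}]=-2f_{\mathbf m}$; $[e_{\mathbf m},f_{\mathbf m'}]=q^{m_2m_1'}g_{\mathbf m+\mathbf m'}-q^{m_2'm_1}h_{\mathbf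 m+\mathbf m'}$ if $\mathbf m+\mathbf m'\ne\mathbf 0$, and $=q^{m_2m_1'}d$ if $\mathbf m+\mathbf m'=\mathbf 0$; $[g_{\mathbf k},g_{\mathbf k'}]=(q^{k_2k_1'}-q^{k_2'k_1})g_{\mathbf k+\mathbf k'}$ and $[h_{\mathbf k},h_{\mathbf k'}]=(q^{k_2k_1'}-q^{k_2'k_1})h_{\mathbf k+\mathbf k'}$ if $\mathbf k+\mathbf k'\neq\mathbf 0$, and both are $0$ if $\mathbf k+\mathbf k'=\mathbf 0$. $\mathfrak L$ is $\mathbb Z^2$-graded: $e_{\mathbf m},f_{\mathbf m},g_{\mathbf m},h_{\mathbf m}$ have degree $\mathbf m$ and $d$ has degree $\mathbf 0$. $\widetilde{\mathfrak L}=\widetilde{\mathfrak{sl}_2(\mathbb C_q)}=\mathfrak L\oplus\mathbb Cd_1\oplus\mathbb Cd_2$ with $[d_i,L]=m_iL$ for $L\in\mathfrak L$ of degree $\mathbf m$, and $[d_1,d_2]=[d,d_1]=[d,d_2]=0$. Convention: undefined terms are zero, e.g. $g_{\mathbf 0}=h_{\mathbf 0}=0$. **Hopf algebras.** $U=\mathcal U(\widetilde{\mathfrak L})$ has the standard Hopf structure with product $\mu$, unit $\tau$, and $\Delta_0(L)=L\otimes1+1\otimes L$, $S_0(L)=-L$, $\epsilon_0(L)=0$ for $L\in\widetilde{\mathfrak L}$; it induces a Hopf algebra structure on $U[[t]]$ over $\mathbb C[[t]]$, where $t$ is a formal variable and $U[[t]]$ is the algebra of formal power series with coefficients in $U$ (tensor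 products over $\mathbb C[[t]]$ are understood as completed). **Notation.** For $x$ in a unital $\mathbb C$-algebra, $a\in\mathbb C$, $j\ge0$: $x_a^{<j>}=(x+a)(x+a+1)\cdots(x+a+j-1)$, $x_a^{<0>}=1$, $x^{<j>}=x_0^{<j>}$, $x_a=x_a^{<1>}=x+a$. For $a\in\mathbb C$, $(1-Et)^a=\sum_{k\ge0}(-1)^k\binom akE^kt^k$ with $\binom ak=a(a-1)\cdots(a-k+1)/k!$. $\eta^y_{0,\mathbf m}=1$ for $y=e,f,g,h$, and for $j>0$: $\eta^g_{j,\mathbf m}=0$, $\eta^h_{j,\mathbf m}=(-1)^j\prod_{p=1}^j\big(q^{n_2(m_1+(p-1)n_1)}-q^{n_1(m_2+(p-1)n_2)}\big)$, $\eta^e_{j,\mathbf m}=\prod_{p=1}^jq^{n_1(m_2+(p-1)n_2)}$, $\eta^f_{j,\mathbf m}=(-1)^j\prod_{p=1}^jq^{n_2(m_1+(p-1)n_1)}$. $\beta_{f_{\mathbf m}}=0$, $\beta_{g_{\mathbf m}}=-q^{m_1n_2}$, $\beta_{h_{\mathbf m}}=q^{m_2n_1}$. $s_{\mathbf m}=q^{n_2m_1+n_1m_2+n_1n_2}$.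
   Formalization: In (1), n≠0 is required; in (3), T=½d is corrected to T=−½d so that [T,E]=E; in the antipodes of (2) and (3) the exponents r, δ_{y,f} and −1 of (1−Et) are corrected to −r, −δ_{y,f} and 1, as the antipode axiom forces. *)

theory Defs
  imports
    "HOL-Library.Poly_Mapping"
    "HOL-Library.Product_Plus"
    "HOL-Computational_Algebra.Formal_Power_Series"
    "HOL-Algebra.QuotRing"
    "HOL-Algebra.Module"
begin

section \<open>Algebras over the complex numbers and over formal power series\<close>

text \<open>
  A (not necessarily commutative) algebra over a commutative ring is a record of type
  \<open>module\<close>, which has a multiplication, a unit and a scalar multiplication. The locale
  \<open>algebra\<close> of the library is not used because it demands commutativity.
\<close>

definition ring_of_type :: "'a::ring_1 ring" where
  "ring_of_type = \<lparr>carrier = UNIV, mult = (*), one = 1, zero = 0, add = (+)\<rparr>"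

definition linear_map ::
  "('k, 'a) module \<Rightarrow> ('k, 'b) module \<Rightarrow> ('a \<Rightarrow> 'b) \<Rightarrow> bool" where
  "linear_map M N f \<longleftrightarrow>
     f \<in> carrier M \<rightarrow> carrier N \<and>
     (\<forall>x\<in>carrier M. \<forall>y\<in>carrier M. f (x \<oplus>\<^bsub>M\<^esub> y) = f x \<oplus>\<^bsub>N\<^esub> f y) \<and>
     (\<forall>c. \<forall>x\<in>carrier M. f (c \<odot>\<^bsub>M\<^esub> x) = c \<odot>\<^bsub>N\<^esub> f x)"

text \<open>The vector space \<open>'b \<Rightarrow>\<^sub>0 complex\<close> has basis \<open>'b\<close>.\<close>

definition scale :: "complex \<Rightarrow> ('b \<Rightarrow>\<^sub>0 complex) \<Rightarrow> ('b \<Rightarrow>\<^sub>0 complex)" where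
  "scale c p = Poly_Mapping.map ((*) c) p"

subsection \<open>Tensor products\<close>

text \<open>
  The tensor product of two complex algebras: the vector space with basis
  \<open>carrier M \<times> carrier N\<close>, modulo the subspace spanned by the bilinearity relations,
  with \<open>(x \<otimes> y)(x' \<otimes> y') = x x' \<otimes> y y'\<close>.
\<close>

definition tensor_rel ::
  "(complex, 'a) module \<Rightarrow> (complex, 'b) module \<Rightarrow> ('a \<times> 'b \<Rightarrow>\<^sub>0 complex) set" where
  "tensor_rel M N = Modules.module.span scale
     ({Poly_Mapping.single (x \<oplus>\<^bsub>M\<^esub> x', y) 1
         - Poly_Mapping.single (x, y) 1 - Poly_Mapping.single (x', y) 1
       | x x' y. x \<in> carrier M \<and> x' \<in> carrier M \<and> y \<in> carrier N} \<union>
      {Poly_Mapping.single (x, y \<oplus>\<^bsub>N\<^esub> y') 1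
         - Poly_Mapping.single (x, y) 1 - Poly_Mapping.single (x, y') 1
       | x y y'. x \<in> carrier M \<and> y \<in> carrier N \<and> y' \<in> carrier N} \<union>
      {Poly_Mapping.single (c \<odot>\<^bsub>M\<^esub> x, y) 1 - Poly_Mapping.single (x, y) c
       | c x y. x \<in> carrier M \<and> y \<in> carrier N} \<union>
      {Poly_Mapping.single (x, c \<odot>\<^bsub>N\<^esub> y) 1 - Poly_Mapping.single (x, y) c
       | c x y. x \<in> carrier M \<and> y \<in> carrier N})"

definition tensor_class ::
  "(complex, 'a) module \<Rightarrow> (complex, 'b) module \<Rightarrow>
   ('a \<times> 'b \<Rightarrow>\<^sub>0 complex) \<Rightarrow> ('a \<times> 'b \<Rightarrow>\<^sub>0 complex) set" where
  "tensor_class M N p = {p'. p' - p \<in> tensor_rel M N}"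

definition tensor_rep_mult ::
  "(complex, 'a) module \<Rightarrow> (complex, 'b) module \<Rightarrow>
   ('a \<times> 'b \<Rightarrow>\<^sub>0 complex) \<Rightarrow> ('a \<times> 'b \<Rightarrow>\<^sub>0 complex) \<Rightarrow> ('a \<times> 'b \<Rightarrow>\<^sub>0 complex)" where
  "tensor_rep_mult M N p p' =
     (\<Sum>(x, y)\<in>Poly_Mapping.keys p. \<Sum>(x', y')\<in>Poly_Mapping.keys p'.
        Poly_Mapping.single (x \<otimes>\<^bsub>M\<^esub> x', y \<otimes>\<^bsub>N\<^esub> y')
          (Poly_Mapping.lookup p (x, y) * Poly_Mapping.lookup p' (x', y')))"

definition tensor ::
  "(complex, 'a) module \<Rightarrow> (complex, 'b) module \<Rightarrow>
   (complex, ('a \<times> 'b \<Rightarrow>\<^sub>0 complex) set) module" where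
  "tensor M N =
     \<lparr>carrier = tensor_class M N ` {p. Poly_Mapping.keys p \<subseteq> carrier M \<times> carrier N},
      mult = (\<lambda>X Y. \<Union>p\<in>X. \<Union>p'\<in>Y. tensor_class M N (tensor_rep_mult M N p p')),
      one = tensor_class M N (Poly_Mapping.single (\<one>\<^bsub>M\<^esub>, \<one>\<^bsub>N\<^esub>) 1),
      zero = tensor_class M N 0,
      add = (\<lambda>X Y. \<Union>p\<in>X. \<Union>p'\<in>Y. tensor_class M N (p + p')),
      smult = (\<lambda>c X. \<Union>p\<in>X. tensor_class M N (scale c p))\<rparr>"

definition pure_tensor ::
  "(complex, 'a) module \<Rightarrow> (complex, 'b) module \<Rightarrow> 'a \<Rightarrow> 'b \<Rightarrow>
   ('a \<times> 'b \<Rightarrow>\<^sub>0 complex) set" where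
  "pure_tensor M N x y = tensor_class M N (Poly_Mapping.single (x, y) 1)"

subsection \<open>Formal power series and completed tensor products\<close>

text \<open>For a complex algebra \<open>A\<close>, the algebra \<open>A[[t]]\<close> over \<open>\<complex>[[t]]\<close>.\<close>

definition pseries :: "(complex, 'a) module \<Rightarrow> (complex fps, nat \<Rightarrow> 'a) module" where
  "pseries A =
     \<lparr>carrier = {f. \<forall>k. f k \<in> carrier A},
      mult = (\<lambda>f g k. \<Oplus>\<^bsub>A\<^esub>i\<in>{..k}. f i \<otimes>\<^bsub>A\<^esub> g (k - i)),
      one = (\<lambda>k. if k = 0 then \<one>\<^bsub>A\<^esub> else \<zero>\<^bsub>A\<^esub>),
      zero = (\<lambda>k. \<zero>\<^bsub>A\<^esub>),
      add = (\<lambda>f g k. f k \<oplus>\<^bsub>A\<^esub> g k),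
      smult = (\<lambda>c f k. \<Oplus>\<^bsub>A\<^esub>i\<in>{..k}. fps_nth c i \<odot>\<^bsub>A\<^esub> f (k - i))\<rparr>"

definition const :: "(complex, 'a) module \<Rightarrow> 'a \<Rightarrow> nat \<Rightarrow> 'a" where
  "const A x = (\<lambda>k. if k = 0 then x else \<zero>\<^bsub>A\<^esub>)"

text \<open>The \<open>t\<close>-adically convergent sum \<open>\<Sum>\<^sub>j X\<^sub>j t\<^sup>j\<close> of series \<open>X\<^sub>j \<in> A[[t]]\<close>.\<close>

definition tsum :: "(complex, 'a) module \<Rightarrow> (nat \<Rightarrow> nat \<Rightarrow> 'a) \<Rightarrow> nat \<Rightarrow> 'a" where
  "tsum A X = (\<lambda>k. \<Oplus>\<^bsub>A\<^esub>j\<in>{..k}. X j (k - j))"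

text \<open>
  The completed tensor product of \<open>M[[t]]\<close> and \<open>N[[t]]\<close> over \<open>\<complex>[[t]]\<close> is
  \<open>(M \<otimes> N)[[t]]\<close>, with the following pure tensors.
\<close>

definition ctensor ::
  "(complex, 'a) module \<Rightarrow> (complex, 'b) module \<Rightarrow> (nat \<Rightarrow> 'a) \<Rightarrow> (nat \<Rightarrow> 'b) \<Rightarrow>
   nat \<Rightarrow> ('a \<times> 'b \<Rightarrow>\<^sub>0 complex) set" where
  "ctensor M N f g = (\<lambda>k. \<Oplus>\<^bsub>tensor M N\<^esub>i\<in>{..k}. pure_tensor M N (f i) (g (k - i)))"

text \<open>
  The map out of the completed tensor product that is induced by a \<open>\<complex>[[t]]\<close>-bilinear map
  \<open>\<beta>\<close>. It is unique on the carrier: a \<open>\<complex>[[t]]\<close>-linear map is \<open>t\<close>-adically continuous, and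
  the linear combinations of pure tensors are \<open>t\<close>-adically dense in \<open>(M \<otimes> N)[[t]]\<close>.
\<close>

definition ctensor_lift ::
  "(complex, 'a) module \<Rightarrow> (complex, 'b) module \<Rightarrow> (complex fps, 'c) module \<Rightarrow>
   ((nat \<Rightarrow> 'a) \<Rightarrow> (nat \<Rightarrow> 'b) \<Rightarrow> 'c) \<Rightarrow>
   (nat \<Rightarrow> ('a \<times> 'b \<Rightarrow>\<^sub>0 complex) set) \<Rightarrow> 'c" where
  "ctensor_lift M N Q \<beta> =
     (SOME \<phi>. linear_map (pseries (tensor M N)) Q \<phi> \<and>
        (\<forall>f\<in>carrier (pseries M). \<forall>g\<in>carrier (pseries N). \<phi> (ctensor M N f g) = \<beta> f g))"

subsection \<open>Hopf algebras\<close>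

text \<open>
  Hopf algebra structures on the algebra \<open>A[[t]]\<close> over \<open>\<complex>[[t]]\<close>. The two sides of
  coassociativity, \<open>(\<Delta> \<otimes> id) \<Delta>\<close> and \<open>(id \<otimes> \<Delta>) \<Delta>\<close>, are compared in
  \<open>(A \<otimes> (A \<otimes> A))[[t]]\<close>, the inner lift on the left being the associativity isomorphism.
\<close>

definition is_hopf_algebra ::
  "(complex, 'a) module \<Rightarrow>
   ((nat \<Rightarrow> 'a) \<Rightarrow> nat \<Rightarrow> ('a \<times> 'a \<Rightarrow>\<^sub>0 complex) set) \<Rightarrow>
   ((nat \<Rightarrow> 'a) \<Rightarrow> complex fps) \<Rightarrow> ((nat \<Rightarrow> 'a) \<Rightarrow> nat \<Rightarrow> 'a) \<Rightarrow> bool" where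
  "is_hopf_algebra A \<Delta> \<epsilon> S \<longleftrightarrow>
    (let H = pseries A; A2 = tensor A A; H2 = pseries A2; H3 = pseries (tensor A A2);
         K = (ring_of_type :: complex fps ring) in
       ring H \<and> Module.module K H \<and>
       (\<forall>c. \<forall>x\<in>carrier H. \<forall>y\<in>carrier H.
          (c \<odot>\<^bsub>H\<^esub> x) \<otimes>\<^bsub>H\<^esub> y = c \<odot>\<^bsub>H\<^esub> (x \<otimes>\<^bsub>H\<^esub> y) \<and>
          x \<otimes>\<^bsub>H\<^esub> (c \<odot>\<^bsub>H\<^esub> y) = c \<odot>\<^bsub>H\<^esub> (x \<otimes>\<^bsub>H\<^esub> y)) \<and>
       \<Delta> \<in> ring_hom H H2 \<and> linear_map H H2 \<Delta> \<and>
       \<epsilon> \<in> ring_hom H K \<and> (\<forall>c. \<forall>x\<in>carrier H. \<epsilon> (c \<odot>\<^bsub>H\<^esub> x) = c * \<epsilon> x) \<and>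
       linear_map H H S \<and>
       (\<forall>x\<in>carrier H.
          ctensor_lift A A H3
            (\<lambda>a b. ctensor_lift A A H3 (\<lambda>a' a''. ctensor A A2 a' (ctensor A A a'' b)) (\<Delta> a)) (\<Delta> x)
          = ctensor_lift A A H3 (\<lambda>a b. ctensor A A2 a (\<Delta> b)) (\<Delta> x)) \<and>
       (\<forall>x\<in>carrier H.
          ctensor_lift A A H (\<lambda>a b. \<epsilon> a \<odot>\<^bsub>H\<^esub> b) (\<Delta> x) = x \<and>
          ctensor_lift A A H (\<lambda>a b. \<epsilon> b \<odot>\<^bsub>H\<^esub> a) (\<Delta> x) = x) \<and>
       (\<forall>x\<in>carrier H.
          ctensor_lift A A H (\<lambda>a b. S a \<otimes>\<^bsub>H\<^esub> b) (\<Delta> x) = \<epsilon> x \<odot>\<^bsub>H\<^esub> \<one>\<^bsub>H\<^esub> \<and>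
          ctensor_lift A A H (\<lambda>a b. a \<otimes>\<^bsub>H\<^esub> S b) (\<Delta> x) = \<epsilon> x \<odot>\<^bsub>H\<^esub> \<one>\<^bsub>H\<^esub>))"

definition noncommutative :: "(complex, 'a) module \<Rightarrow> bool" where
  "noncommutative A \<longleftrightarrow>
     (\<exists>x\<in>carrier (pseries A). \<exists>y\<in>carrier (pseries A).
        x \<otimes>\<^bsub>pseries A\<^esub> y \<noteq> y \<otimes>\<^bsub>pseries A\<^esub> x)"

definition noncocommutative ::
  "(complex, 'a) module \<Rightarrow>
   ((nat \<Rightarrow> 'a) \<Rightarrow> nat \<Rightarrow> ('a \<times> 'a \<Rightarrow>\<^sub>0 complex) set) \<Rightarrow> bool" where
  "noncocommutative A \<Delta> \<longleftrightarrow>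
     (\<exists>x\<in>carrier (pseries A).
        ctensor_lift A A (pseries (tensor A A)) (\<lambda>a b. ctensor A A b a) (\<Delta> x) \<noteq> \<Delta> x)"


section \<open>Universal enveloping algebras\<close>

text \<open>Words form the free monoid, so \<open>'b list \<Rightarrow>\<^sub>0 complex\<close> is the free algebra on \<open>'b\<close>.\<close>

instantiation list :: (type) monoid_add
begin

definition zero_list :: "'a list" where "zero_list = []"

definition plus_list :: "'a list \<Rightarrow> 'a list \<Rightarrow> 'a list" where "plus_list xs ys = xs @ ys"

instance by standard (simp_all add: zero_list_def plus_list_def)

end

text \<open>
  The free algebra on the basis \<open>'b\<close> is the tensor algebra of the space \<open>'b \<Rightarrow>\<^sub>0 complex\<close>,
  which it contains as the span of the words of length one.
\<close>

definition letters :: "('b \<Rightarrow>\<^sub>0 complex) \<Rightarrow> ('b list \<Rightarrow>\<^sub>0 complex)" where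
  "letters x = (\<Sum>b\<in>Poly_Mapping.keys x. Poly_Mapping.single [b] (Poly_Mapping.lookup x b))"

definition uea_ideal ::
  "(('b \<Rightarrow>\<^sub>0 complex) \<Rightarrow> ('b \<Rightarrow>\<^sub>0 complex) \<Rightarrow> ('b \<Rightarrow>\<^sub>0 complex)) \<Rightarrow> ('b list \<Rightarrow>\<^sub>0 complex) set" where
  "uea_ideal br =
     genideal ring_of_type
       {letters x * letters y - letters y * letters x - letters (br x y) | x y. True}"

definition uea ::
  "(('b \<Rightarrow>\<^sub>0 complex) \<Rightarrow> ('b \<Rightarrow>\<^sub>0 complex) \<Rightarrow> ('b \<Rightarrow>\<^sub>0 complex)) \<Rightarrow>
   (complex, ('b list \<Rightarrow>\<^sub>0 complex) set) module" where
  "uea br =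
     (let Q = ring_of_type Quot uea_ideal br in
       \<lparr>carrier = carrier Q, mult = mult Q, one = one Q, zero = zero Q, add = add Q,
        smult = (\<lambda>c X. \<Union>p\<in>X. uea_ideal br +>\<^bsub>ring_of_type\<^esub> scale c p)\<rparr>)"

definition uea_incl ::
  "(('b \<Rightarrow>\<^sub>0 complex) \<Rightarrow> ('b \<Rightarrow>\<^sub>0 complex) \<Rightarrow> ('b \<Rightarrow>\<^sub>0 complex)) \<Rightarrow>
   ('b \<Rightarrow>\<^sub>0 complex) \<Rightarrow> ('b list \<Rightarrow>\<^sub>0 complex) set" where
  "uea_incl br x = uea_ideal br +>\<^bsub>ring_of_type\<^esub> letters x"


section \<open>The Lie algebra\<close>

typedef nonzero_index = "{k :: int \<times> int. k \<noteq> 0}"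
  by (rule exI[of _ "(1, 0)"]) (simp add: zero_prod_def)

datatype gen =
    Egen "int \<times> int" | Fgen "int \<times> int" | Ggen nonzero_index | Hgen nonzero_index
  | Dgen | D1gen | D2gen

type_synonym lie = "gen \<Rightarrow>\<^sub>0 complex"

definition Le :: "int \<times> int \<Rightarrow> lie" where "Le m = Poly_Mapping.single (Egen m) 1"
definition Lf :: "int \<times> int \<Rightarrow> lie" where "Lf m = Poly_Mapping.single (Fgen m) 1"

text \<open>By convention \<open>g\<^sub>0 = h\<^sub>0 = 0\<close>.\<close>

definition Lg :: "int \<times> int \<Rightarrow> lie" where
  "Lg k = (if k = 0 then 0 else Poly_Mapping.single (Ggen (Abs_nonzero_index k)) 1)"
definition Lh :: "int \<times> int \<Rightarrow> lie" where
  "Lh k = (if k = 0 then 0 else Poly_Mapping.single (Hgen (Abs_nonzero_index k)) 1)"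

definition Ld :: lie where "Ld = Poly_Mapping.single Dgen 1"
definition Ld1 :: lie where "Ld1 = Poly_Mapping.single D1gen 1"
definition Ld2 :: lie where "Ld2 = Poly_Mapping.single D2gen 1"

fun gen_degree :: "gen \<Rightarrow> int \<times> int" where
  "gen_degree (Egen m) = m"
| "gen_degree (Fgen m) = m"
| "gen_degree (Ggen k) = Rep_nonzero_index k"
| "gen_degree (Hgen k) = Rep_nonzero_index k"
| "gen_degree _ = 0"

definition ef_bracket :: "complex \<Rightarrow> int \<times> int \<Rightarrow> int \<times> int \<Rightarrow> lie" where
  "ef_bracket q m m' =
     (if m + m' = 0 then scale (q powi (snd m * fst m')) Ld
      else scale (q powi (snd m * fst m')) (Lg (m + m'))
         - scale (q powi (snd m' * fst m)) (Lh (m + m')))"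

text \<open>The bracket of \<open>sl\<^sub>2(\<complex>\<^sub>q)\<close> on basis elements.\<close>

fun sl2_bracket :: "complex \<Rightarrow> gen \<Rightarrow> gen \<Rightarrow> lie" where
  "sl2_bracket q (Ggen k) (Egen m) =
     (let k = Rep_nonzero_index k in scale (q powi (snd k * fst m)) (Le (k + m)))"
| "sl2_bracket q (Egen m) (Ggen k) =
     (let k = Rep_nonzero_index k in - scale (q powi (snd k * fst m)) (Le (k + m)))"
| "sl2_bracket q (Hgen k) (Egen m) =
     (let k = Rep_nonzero_index k in - scale (q powi (fst k * snd m)) (Le (k + m)))"
| "sl2_bracket q (Egen m) (Hgen k) =
     (let k = Rep_nonzero_index k in scale (q powi (fst k * snd m)) (Le (k + m)))"
| "sl2_bracket q Dgen (Egen m) = scale 2 (Le m)"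
| "sl2_bracket q (Egen m) Dgen = - scale 2 (Le m)"
| "sl2_bracket q (Hgen k) (Fgen m) =
     (let k = Rep_nonzero_index k in scale (q powi (snd k * fst m)) (Lf (k + m)))"
| "sl2_bracket q (Fgen m) (Hgen k) =
     (let k = Rep_nonzero_index k in - scale (q powi (snd k * fst m)) (Lf (k + m)))"
| "sl2_bracket q (Ggen k) (Fgen m) =
     (let k = Rep_nonzero_index k in - scale (q powi (fst k * snd m)) (Lf (k + m)))"
| "sl2_bracket q (Fgen m) (Ggen k) =
     (let k = Rep_nonzero_index k in scale (q powi (fst k * snd m)) (Lf (k + m)))"
| "sl2_bracket q Dgen (Fgen m) = - scale 2 (Lf m)"
| "sl2_bracket q (Fgen m) Dgen = scale 2 (Lf m)"
| "sl2_bracket q (Egen m) (Fgen m') = ef_bracket q m m'"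
| "sl2_bracket q (Fgen m') (Egen m) = - ef_bracket q m m'"
| "sl2_bracket q (Ggen k) (Ggen k') =
     (let k = Rep_nonzero_index k; k' = Rep_nonzero_index k' in
        scale (q powi (snd k * fst k') - q powi (snd k' * fst k)) (Lg (k + k')))"
| "sl2_bracket q (Hgen k) (Hgen k') =
     (let k = Rep_nonzero_index k; k' = Rep_nonzero_index k' in
        scale (q powi (snd k * fst k') - q powi (snd k' * fst k)) (Lh (k + k')))"
| "sl2_bracket q _ _ = 0"

definition gen_bracket :: "complex \<Rightarrow> gen \<Rightarrow> gen \<Rightarrow> lie" where
  "gen_bracket q a b =
     (if a = D1gen then Poly_Mapping.single b (of_int (fst (gen_degree b)))
      else if a = D2gen then Poly_Mapping.single b (of_int (snd (gen_degree b)))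
      else if b = D1gen then - Poly_Mapping.single a (of_int (fst (gen_degree a)))
      else if b = D2gen then - Poly_Mapping.single a (of_int (snd (gen_degree a)))
      else sl2_bracket q a b)"

definition lie_bracket :: "complex \<Rightarrow> lie \<Rightarrow> lie \<Rightarrow> lie" where
  "lie_bracket q x y =
     (\<Sum>a\<in>Poly_Mapping.keys x. \<Sum>b\<in>Poly_Mapping.keys y.
        scale (Poly_Mapping.lookup x a * Poly_Mapping.lookup y b) (gen_bracket q a b))"

type_synonym uelt = "(gen list \<Rightarrow>\<^sub>0 complex) set"

definition U :: "complex \<Rightarrow> (complex, uelt) module" where
  "U q = uea (lie_bracket q)"

definition incl :: "complex \<Rightarrow> lie \<Rightarrow> uelt" where
  "incl q x = uea_incl (lie_bracket q) x"

definition constL :: "complex \<Rightarrow> lie \<Rightarrow> nat \<Rightarrow> uelt" where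
  "constL q x = const (U q) (incl q x)"


section \<open>The coproducts and antipodes\<close>

text \<open>
  The requirement on \<open>\<epsilon>\<close> says that the counit is the one induced by the standard Hopf structure
  of \<open>U\<close>: a \<open>\<complex>[[t]]\<close>-algebra homomorphism \<open>U[[t]] \<rightarrow> \<complex>[[t]]\<close> is determined by its values on
  the Lie algebra.
\<close>

definition quantization ::
  "complex \<Rightarrow> ((nat \<Rightarrow> uelt) \<Rightarrow> nat \<Rightarrow> (uelt \<times> uelt \<Rightarrow>\<^sub>0 complex) set) \<Rightarrow>
   ((nat \<Rightarrow> uelt) \<Rightarrow> complex fps) \<Rightarrow> ((nat \<Rightarrow> uelt) \<Rightarrow> nat \<Rightarrow> uelt) \<Rightarrow> bool" where
  "quantization q \<Delta> \<epsilon> S \<longleftrightarrow>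
     is_hopf_algebra (U q) \<Delta> \<epsilon> S \<and> (\<forall>x. \<epsilon> (constL q x) = 0) \<and>
     noncommutative (U q) \<and> noncocommutative (U q) \<Delta>"

text \<open>\<open>rising A a x j = (x + a)(x + a + 1) \<cdots> (x + a + j - 1)\<close>\<close>

primrec rising :: "(complex, 'a) module \<Rightarrow> complex \<Rightarrow> 'a \<Rightarrow> nat \<Rightarrow> 'a" where
  "rising A a x 0 = \<one>\<^bsub>A\<^esub>"
| "rising A a x (Suc j) = rising A a x j \<otimes>\<^bsub>A\<^esub> (x \<oplus>\<^bsub>A\<^esub> (a + of_nat j) \<odot>\<^bsub>A\<^esub> \<one>\<^bsub>A\<^esub>)"

definition risingT :: "complex \<Rightarrow> complex \<Rightarrow> lie \<Rightarrow> nat \<Rightarrow> nat \<Rightarrow> uelt" where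
  "risingT q a T j = const (U q) (rising (U q) a (incl q T) j)"

text \<open>\<open>(1 - E t)\<^sup>a\<close>\<close>

definition one_minus_pow :: "complex \<Rightarrow> lie \<Rightarrow> complex \<Rightarrow> nat \<Rightarrow> uelt" where
  "one_minus_pow q E a =
     (\<lambda>k. ((-1) ^ k * (a gchoose k)) \<odot>\<^bsub>U q\<^esub> (incl q E [^]\<^bsub>U q\<^esub> k))"

datatype family = FE | FF | FG | FH

fun elt :: "family \<Rightarrow> int \<times> int \<Rightarrow> lie" where
  "elt FE m = Le m" | "elt FF m = Lf m" | "elt FG m = Lg m" | "elt FH m = Lh m"

fun index_ok :: "family \<Rightarrow> int \<times> int \<Rightarrow> bool" where
  "index_ok FE m = True" | "index_ok FF m = True"
| "index_ok FG m = (m \<noteq> 0)" | "index_ok FH m = (m \<noteq> 0)"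

definition shift :: "int \<times> int \<Rightarrow> int \<times> int \<Rightarrow> nat \<Rightarrow> int \<times> int" where
  "shift m n j = (fst m + int j * fst n, snd m + int j * snd n)"

fun eta :: "complex \<Rightarrow> int \<times> int \<Rightarrow> family \<Rightarrow> nat \<Rightarrow> int \<times> int \<Rightarrow> complex" where
  "eta q n FG j m = (if j = 0 then 1 else 0)"
| "eta q n FH j m =
     (-1) ^ j * (\<Prod>p=1..j. q powi (snd n * (fst m + (int p - 1) * fst n))
                          - q powi (fst n * (snd m + (int p - 1) * snd n)))"
| "eta q n FE j m = (\<Prod>p=1..j. q powi (fst n * (snd m + (int p - 1) * snd n)))"
| "eta q n FF j m = (-1) ^ j * (\<Prod>p=1..j. q powi (snd n * (fst m + (int p - 1) * fst n)))"

text \<open>Only used for the families \<open>f\<close>, \<open>g\<close> and \<open>h\<close>.\<close>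

fun beta :: "complex \<Rightarrow> int \<times> int \<Rightarrow> family \<Rightarrow> int \<times> int \<Rightarrow> complex" where
  "beta q n FG m = - (q powi (fst m * snd n))"
| "beta q n FH m = q powi (snd m * fst n)"
| "beta q n _ m = 0"

definition s_coeff :: "complex \<Rightarrow> int \<times> int \<Rightarrow> int \<times> int \<Rightarrow> complex" where
  "s_coeff q n m = q powi (snd n * fst m + fst n * snd m + fst n * snd n)"

definition torusT :: "complex \<Rightarrow> complex \<Rightarrow> lie" where
  "torusT x1 x2 = scale x1 Ld1 + scale x2 Ld2"

definition torus_weight :: "complex \<Rightarrow> complex \<Rightarrow> int \<times> int \<Rightarrow> complex" where
  "torus_weight x1 x2 m = x1 * of_int (fst m) + x2 * of_int (snd m)"

text \<open>In the formulas below, \<open>fps_const a * fps_X ^ k\<close> is the scalar \<open>a t\<^sup>k\<close>.\<close>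

definition derivation_formulas ::
  "complex \<Rightarrow> int \<times> int \<Rightarrow> lie \<Rightarrow> lie \<Rightarrow>
   ((nat \<Rightarrow> uelt) \<Rightarrow> nat \<Rightarrow> (uelt \<times> uelt \<Rightarrow>\<^sub>0 complex) set) \<Rightarrow>
   ((nat \<Rightarrow> uelt) \<Rightarrow> nat \<Rightarrow> uelt) \<Rightarrow> bool" where
  "derivation_formulas q n T E \<Delta> S \<longleftrightarrow>
    (let H = pseries (U q); H2 = pseries (tensor (U q) (U q)); tn = ctensor (U q) (U q);
         c = constL q; P = one_minus_pow q E in
       \<forall>(d, k) \<in> {(Ld1, of_int (fst n)), (Ld2, of_int (snd n))}.
         \<Delta> (c d) = tn (c d) \<one>\<^bsub>H\<^esub> \<oplus>\<^bsub>H2\<^esub> tn \<one>\<^bsub>H\<^esub> (c d)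
             \<ominus>\<^bsub>H2\<^esub> fps_const k \<odot>\<^bsub>H2\<^esub> tn (c T) \<one>\<^bsub>H\<^esub>
             \<oplus>\<^bsub>H2\<^esub> fps_const k \<odot>\<^bsub>H2\<^esub> tn (c T) (P (-1)) \<and>
         S (c d) = \<ominus>\<^bsub>H\<^esub> c d \<oplus>\<^bsub>H\<^esub> (fps_const k * fps_X) \<odot>\<^bsub>H\<^esub> (c T \<otimes>\<^bsub>H\<^esub> c E))"

definition h_twist_formulas ::
  "complex \<Rightarrow> int \<times> int \<Rightarrow> complex \<Rightarrow> complex \<Rightarrow>
   ((nat \<Rightarrow> uelt) \<Rightarrow> nat \<Rightarrow> (uelt \<times> uelt \<Rightarrow>\<^sub>0 complex) set) \<Rightarrow>
   ((nat \<Rightarrow> uelt) \<Rightarrow> nat \<Rightarrow> uelt) \<Rightarrow> bool" where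
  "h_twist_formulas q n x1 x2 \<Delta> S \<longleftrightarrow>
    (let H = pseries (U q); H2 = pseries (tensor (U q) (U q)); tn = ctensor (U q) (U q);
         c = constL q; T = torusT x1 x2; E = Lh n; P = one_minus_pow q E in
       (\<forall>y m. index_ok y m \<longrightarrow>
          (let r = torus_weight x1 x2 m in
           \<Delta> (c (elt y m)) =
             tn (c (elt y m)) (P r) \<oplus>\<^bsub>H2\<^esub>
             tsum (tensor (U q) (U q)) (\<lambda>j.
               fps_const (eta q n y j m / fact j) \<odot>\<^bsub>H2\<^esub>
                 tn (risingT q 0 T j) (P (- of_nat j) \<otimes>\<^bsub>H\<^esub> c (elt y (shift m n j)))) \<and>
           S (c (elt y m)) =
             tsum (U q) (\<lambda>j.
               fps_const ((-1) ^ (j + 1) * eta q n y j m / fact j) \<odot>\<^bsub>H\<^esub>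
                 (P (- r) \<otimes>\<^bsub>H\<^esub> c (elt y (shift m n j)) \<otimes>\<^bsub>H\<^esub> risingT q 1 T j)))) \<and>
       derivation_formulas q n T E \<Delta> S \<and>
       \<Delta> (c Ld) = tn (c Ld) \<one>\<^bsub>H\<^esub> \<oplus>\<^bsub>H2\<^esub> tn \<one>\<^bsub>H\<^esub> (c Ld) \<and>
       S (c Ld) = \<ominus>\<^bsub>H\<^esub> c Ld)"

text \<open>
  Formulas for \<open>E = f\<^sub>n\<close>, where an element of weight \<open>r\<close> for \<open>ad T\<close> has the leading terms
  \<open>x \<otimes> (1 - E t)\<^sup>r + 1 \<otimes> x\<close> in its coproduct. Since \<open>1 - E t\<close> is grouplike, the antipode
  then starts with \<open>-(1 - E t)\<^sup>-\<^sup>r x\<close>; the exponent \<open>-r\<close> (rather than \<open>r\<close>) is forced by the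
  antipode axiom, already for \<open>x = E\<close>.
\<close>

definition f_twist_common_formulas ::
  "complex \<Rightarrow> int \<times> int \<Rightarrow> lie \<Rightarrow>
   ((nat \<Rightarrow> uelt) \<Rightarrow> nat \<Rightarrow> (uelt \<times> uelt \<Rightarrow>\<^sub>0 complex) set) \<Rightarrow>
   ((nat \<Rightarrow> uelt) \<Rightarrow> nat \<Rightarrow> uelt) \<Rightarrow> bool" where
  "f_twist_common_formulas q n T \<Delta> S \<longleftrightarrow>
    (let H = pseries (U q); H2 = pseries (tensor (U q) (U q)); tn = ctensor (U q) (U q);
         c = constL q; E = Lf n; P = one_minus_pow q E; b = q powi (- (fst n * snd n)) in
       \<Delta> (c (Le (- n))) =
         tn (c (Le (- n))) (P (-1)) \<oplus>\<^bsub>H2\<^esub> tn \<one>\<^bsub>H\<^esub> (c (Le (- n)))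
         \<oplus>\<^bsub>H2\<^esub> (fps_const b * fps_X) \<odot>\<^bsub>H2\<^esub> tn (c T) (P (-1) \<otimes>\<^bsub>H\<^esub> c Ld)
         \<ominus>\<^bsub>H2\<^esub> (fps_const b * fps_X ^ 2) \<odot>\<^bsub>H2\<^esub>
             tn (risingT q 0 T 2) (P (-2) \<otimes>\<^bsub>H\<^esub> c E) \<and>
       S (c (Le (- n))) =
         (fps_const b * fps_X ^ 2) \<odot>\<^bsub>H\<^esub> (P 1 \<otimes>\<^bsub>H\<^esub> c E \<otimes>\<^bsub>H\<^esub> risingT q 1 T 2)
         \<ominus>\<^bsub>H\<^esub> P 1 \<otimes>\<^bsub>H\<^esub> c (Le (- n))
         \<oplus>\<^bsub>H\<^esub> (fps_const b * fps_X) \<odot>\<^bsub>H\<^esub> (P 1 \<otimes>\<^bsub>H\<^esub> c Ld \<otimes>\<^bsub>H\<^esub> risingT q 1 T 1) \<and>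
       \<Delta> (c Ld) =
         tn (c Ld) \<one>\<^bsub>H\<^esub> \<oplus>\<^bsub>H2\<^esub> tn \<one>\<^bsub>H\<^esub> (c Ld)
         \<ominus>\<^bsub>H2\<^esub> (fps_const 2 * fps_X) \<odot>\<^bsub>H2\<^esub> tn (c T) (P (-1) \<otimes>\<^bsub>H\<^esub> c E) \<and>
       S (c Ld) =
         \<ominus>\<^bsub>H\<^esub> c Ld \<ominus>\<^bsub>H\<^esub> (fps_const 2 * fps_X) \<odot>\<^bsub>H\<^esub> (c E \<otimes>\<^bsub>H\<^esub> risingT q 1 T 1) \<and>
       derivation_formulas q n T E \<Delta> S)"

definition f_twist_torus_formulas ::
  "complex \<Rightarrow> int \<times> int \<Rightarrow> complex \<Rightarrow> complex \<Rightarrow>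
   ((nat \<Rightarrow> uelt) \<Rightarrow> nat \<Rightarrow> (uelt \<times> uelt \<Rightarrow>\<^sub>0 complex) set) \<Rightarrow>
   ((nat \<Rightarrow> uelt) \<Rightarrow> nat \<Rightarrow> uelt) \<Rightarrow> bool" where
  "f_twist_torus_formulas q n x1 x2 \<Delta> S \<longleftrightarrow>
    (let H = pseries (U q); H2 = pseries (tensor (U q) (U q)); tn = ctensor (U q) (U q);
         c = constL q; T = torusT x1 x2; P = one_minus_pow q (Lf n) in
       (\<forall>y m. y \<noteq> FE \<and> index_ok y m \<longrightarrow>
          (let r = torus_weight x1 x2 m in
           \<Delta> (c (elt y m)) =
             tn (c (elt y m)) (P r) \<oplus>\<^bsub>H2\<^esub> tn \<one>\<^bsub>H\<^esub> (c (elt y m))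
             \<oplus>\<^bsub>H2\<^esub> (fps_const (beta q n y m) * fps_X) \<odot>\<^bsub>H2\<^esub>
                 tn (c T) (P (-1) \<otimes>\<^bsub>H\<^esub> c (Lf (m + n))) \<and>
           S (c (elt y m)) =
             \<ominus>\<^bsub>H\<^esub> (P (- r) \<otimes>\<^bsub>H\<^esub> c (elt y m))
             \<oplus>\<^bsub>H\<^esub> (fps_const (beta q n y m) * fps_X) \<odot>\<^bsub>H\<^esub>
                 (P (- r) \<otimes>\<^bsub>H\<^esub> c (Lf (m + n)) \<otimes>\<^bsub>H\<^esub> risingT q 1 T 1))) \<and>
       (\<forall>m. m + n \<noteq> 0 \<longrightarrow>
          (let r = torus_weight x1 x2 m;
               a = q powi (snd m * fst n); b = q powi (fst m * snd n); s = s_coeff q n m in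
           \<Delta> (c (Le m)) =
             tn (c (Le m)) (P r) \<oplus>\<^bsub>H2\<^esub> tn \<one>\<^bsub>H\<^esub> (c (Le m))
             \<oplus>\<^bsub>H2\<^esub> (fps_const a * fps_X) \<odot>\<^bsub>H2\<^esub> tn (c T) (P (-1) \<otimes>\<^bsub>H\<^esub> c (Lg (m + n)))
             \<ominus>\<^bsub>H2\<^esub> (fps_const b * fps_X) \<odot>\<^bsub>H2\<^esub> tn (c T) (P (-1) \<otimes>\<^bsub>H\<^esub> c (Lh (m + n)))
             \<ominus>\<^bsub>H2\<^esub> (fps_const s * fps_X ^ 2) \<odot>\<^bsub>H2\<^esub>
                 tn (risingT q 0 T 2) (P (-2) \<otimes>\<^bsub>H\<^esub> c (Lf (shift m n 2))) \<and>
           S (c (Le m)) =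
             (fps_const a * fps_X) \<odot>\<^bsub>H\<^esub> (P (- r) \<otimes>\<^bsub>H\<^esub> c (Lg (m + n)) \<otimes>\<^bsub>H\<^esub> risingT q 1 T 1)
             \<ominus>\<^bsub>H\<^esub> (fps_const b * fps_X) \<odot>\<^bsub>H\<^esub>
                 (P (- r) \<otimes>\<^bsub>H\<^esub> c (Lh (m + n)) \<otimes>\<^bsub>H\<^esub> risingT q 1 T 1)
             \<ominus>\<^bsub>H\<^esub> P (- r) \<otimes>\<^bsub>H\<^esub> c (Le m)
             \<oplus>\<^bsub>H\<^esub> (fps_const s * fps_X ^ 2) \<odot>\<^bsub>H\<^esub>
                 (P (- r) \<otimes>\<^bsub>H\<^esub> c (Lf (shift m n 2)) \<otimes>\<^bsub>H\<^esub> risingT q 1 T 2))) \<and>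
       f_twist_common_formulas q n T \<Delta> S)"

text \<open>
  The sign in \<open>T = - d / 2\<close> is dictated by \<open>[d, f\<^sub>n] = - 2 f\<^sub>n\<close>: the coproducts below, with
  \<open>\<Delta>(f\<^sub>m) = f\<^sub>m \<otimes> (1 - E t) + 1 \<otimes> f\<^sub>m\<close>, are multiplicative only if \<open>[T, E] = E\<close>.
\<close>

definition cartanT :: lie where
  "cartanT = scale (- (1 / 2)) Ld"

lemma lie_bracket_cartanT: "lie_bracket q cartanT (Lf n) = Lf n"
proof -
  have scale_single: "scale c (Poly_Mapping.single b x) = Poly_Mapping.single b (c * x)"
    for c x :: complex and b :: gen
    by (simp add: scale_def)
  show ?thesis
    by (simp add: lie_bracket_def cartanT_def Ld_def Lf_def gen_bracket_def scale_single
        flip: single_uminus)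
qed

definition f_twist_cartan_formulas ::
  "complex \<Rightarrow> int \<times> int \<Rightarrow>
   ((nat \<Rightarrow> uelt) \<Rightarrow> nat \<Rightarrow> (uelt \<times> uelt \<Rightarrow>\<^sub>0 complex) set) \<Rightarrow>
   ((nat \<Rightarrow> uelt) \<Rightarrow> nat \<Rightarrow> uelt) \<Rightarrow> bool" where
  "f_twist_cartan_formulas q n \<Delta> S \<longleftrightarrow>
    (let H = pseries (U q); H2 = pseries (tensor (U q) (U q)); tn = ctensor (U q) (U q);
         c = constL q; T = cartanT; P = one_minus_pow q (Lf n) in
       (\<forall>y m. y \<noteq> FE \<and> index_ok y m \<longrightarrow>
          (let \<delta> = (if y = FF then 1 else 0) in
           \<Delta> (c (elt y m)) =
             tn (c (elt y m)) (P \<delta>) \<oplus>\<^bsub>H2\<^esub> tn \<one>\<^bsub>H\<^esub> (c (elt y m))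
             \<oplus>\<^bsub>H2\<^esub> (fps_const (beta q n y m) * fps_X) \<odot>\<^bsub>H2\<^esub>
                 tn (c T) (P (-1) \<otimes>\<^bsub>H\<^esub> c (Lf (m + n))) \<and>
           S (c (elt y m)) =
             \<ominus>\<^bsub>H\<^esub> (P (- \<delta>) \<otimes>\<^bsub>H\<^esub> c (elt y m))
             \<oplus>\<^bsub>H\<^esub> (fps_const (beta q n y m) * fps_X) \<odot>\<^bsub>H\<^esub>
                 (c (Lf (m + n)) \<otimes>\<^bsub>H\<^esub> risingT q 1 T 1))) \<and>
       (\<forall>m. m + n \<noteq> 0 \<longrightarrow>
          (let a = q powi (snd m * fst n); b = q powi (fst m * snd n); s = s_coeff q n m in
           \<Delta> (c (Le m)) =
             tn (c (Le m)) (P (-1)) \<oplus>\<^bsub>H2\<^esub> tn \<one>\<^bsub>H\<^esub> (c (Le m))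
             \<oplus>\<^bsub>H2\<^esub> (fps_const a * fps_X) \<odot>\<^bsub>H2\<^esub> tn (c T) (P (-1) \<otimes>\<^bsub>H\<^esub> c (Lg (m + n)))
             \<ominus>\<^bsub>H2\<^esub> (fps_const b * fps_X) \<odot>\<^bsub>H2\<^esub> tn (c T) (P (-1) \<otimes>\<^bsub>H\<^esub> c (Lh (m + n)))
             \<ominus>\<^bsub>H2\<^esub> (fps_const s * fps_X ^ 2) \<odot>\<^bsub>H2\<^esub>
                 tn (risingT q 0 T 2) (P (-2) \<otimes>\<^bsub>H\<^esub> c (Lf (shift m n 2))) \<and>
           S (c (Le m)) =
             (fps_const a * fps_X) \<odot>\<^bsub>H\<^esub> (P 1 \<otimes>\<^bsub>H\<^esub> c (Lg (m + n)) \<otimes>\<^bsub>H\<^esub> risingT q 1 T 1)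
             \<ominus>\<^bsub>H\<^esub> (fps_const b * fps_X) \<odot>\<^bsub>H\<^esub>
                 (P 1 \<otimes>\<^bsub>H\<^esub> risingT q 1 T 1 \<otimes>\<^bsub>H\<^esub> c (Lh (m + n)))
             \<ominus>\<^bsub>H\<^esub> P 1 \<otimes>\<^bsub>H\<^esub> c (Le m)
             \<oplus>\<^bsub>H\<^esub> (fps_const s * fps_X ^ 2) \<odot>\<^bsub>H\<^esub>
                 (P 1 \<otimes>\<^bsub>H\<^esub> c (Lf (shift m n 2)) \<otimes>\<^bsub>H\<^esub> risingT q 1 T 2))) \<and>
       f_twist_common_formulas q n T \<Delta> S)"

end

theory Submission
  imports Defs
begin

text \<open>
  Let \<open>\<tau>\<close>, \<open>\<epsilon>\<close> be elements of a Lie algebra with \<open>[\<tau>, \<epsilon>] = \<epsilon>\<close> and write \<open>T\<close>, \<open>E\<close> for their images in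
  the enveloping algebra \<open>U\<close>. The series
  \<open>F = (1 - 1 \<otimes> E t)\<^sup>T\<^sup>\<otimes>\<^sup>1\<close>, whose coefficient of \<open>t\<^sup>k\<close> is \<open>(- T) (- T + 1) \<cdots> (- T + k - 1) / k! \<otimes> E\<^sup>k\<close>,
  is an invertible element of \<open>(U \<otimes> U)[[t]]\<close> that satisfies Drinfeld's cocycle equation
  \<open>(F \<otimes> 1) (\<Delta>\<^sub>0 \<otimes> id)(F) = (1 \<otimes> F) (id \<otimes> \<Delta>\<^sub>0)(F)\<close> (the lemma \<open>npow_cocycle\<close>). Therefore
  \<open>\<Delta> = F \<Delta>\<^sub>0 F\<^sup>-\<^sup>1\<close> and \<open>S = u S\<^sub>0 u\<^sup>-\<^sup>1\<close>, with \<open>u\<close> obtained from \<open>F\<close> by applying \<open>S\<^sub>0\<close> to the second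
  factor and multiplying, define a Hopf algebra with the same product and counit
  (\<open>is_hopf_algebra_twisted\<close>).

  The explicit formulas result from moving an element \<open>y\<close> of weight \<open>r\<close>, \<open>[\<tau>, y] = r y\<close>, through
  these series. Since \<open>y T = (T - r) y\<close>, conjugation by \<open>F\<close> maps \<open>y \<otimes> 1\<close> to \<open>y \<otimes> (1 - E t)\<^sup>r\<close>. For
  \<open>1 \<otimes> y\<close> the expansion of \<open>y E\<^sup>n\<close> in terms of \<open>ad(E)\<^sup>j y\<close> gives a sum over \<open>j\<close> whose terms
  are \<open>T (T + 1) \<cdots> (T + j - 1) \<otimes> (1 - E t)\<^sup>-\<^sup>j ad(E)\<^sup>j y\<close> up to scalars; the antipode is similar
  (\<open>comult_weight\<close>, \<open>antipode_weight\<close>). It remains to know \<open>ad(\<epsilon>)\<^sup>j y\<close> on the basis. For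
  \<open>\<epsilon> = h\<^sub>n\<close> it is a multiple of one basis element, and up to sign the factors are the \<open>\<eta>\<close>; for \<open>\<epsilon> = f\<^sub>n\<close> it vanishes from \<open>j = 3\<close> on, so the sums are finite.

  The product is noncommutative because \<open>[T, E] = E \<noteq> 0\<close>, and the coproduct is not cocommutative
  because the coefficient of \<open>t\<close> in \<open>\<Delta>(T)\<close> is \<open>T \<otimes> E\<close>. That \<open>E \<noteq> 0\<close> is seen in the natural
  representation on column vectors over the quantum torus.

  Algebras occur as records with a carrier, for which the simplifier offers little support. The
  identities between normally ordered powers are therefore proved in a type class and transferred:
  the product of all complex algebras on a type is an instance of the class, and identities in it
  project to every single algebra (the type \<open>alg_prod\<close>).
\<close>

section \<open>Complex algebras as a type class and as records\<close>

text \<open>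
  The noncommutative computations take place in this class, where the simplifier can rewrite
  with ring identities.
\<close>

class complex_algebra = ring_1 +
  fixes scalar :: "complex \<Rightarrow> 'a"
  assumes scalar_add: "scalar (a + b) = scalar a + scalar b"
    and scalar_mult: "scalar (a * b) = scalar a * scalar b"
    and scalar_1 [simp]: "scalar 1 = 1"
    and scalar_commute: "scalar a * x = x * scalar a"
begin

lemma scalar_0 [simp]: "scalar 0 = 0"
  using scalar_add[of 0 0] by simp

lemma scalar_uminus: "scalar (- a) = - scalar a"
  using scalar_add[of a "- a"] by (simp add: eq_neg_iff_add_eq_0 add.commute)

lemma scalar_diff: "scalar (a - b) = scalar a - scalar b"
  using scalar_add[of a "- b"] by (simp add: scalar_uminus)

lemma scalar_of_nat [simp]: "scalar (of_nat n) = of_nat n"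
  by (induction n) (simp_all add: scalar_add)

lemma scalar_numeral [simp]: "scalar (numeral n) = numeral n"
  using scalar_of_nat[of "numeral n"] by simp

lemma scalar_left_commute: "x * (scalar a * y) = scalar a * (x * y)"
  using scalar_commute mult.assoc by metis

lemma scalar_sum: "scalar (sum f S) = (\<Sum>x\<in>S. scalar (f x))"
  by (induction S rule: infinite_finite_induct) (simp_all add: scalar_add)

end

locale complex_alg = ring A for A :: "(complex, 'a) module" (structure) +
  assumes smult_closed [simp, intro]: "x \<in> carrier A \<Longrightarrow> c \<odot> x \<in> carrier A"
    and smult_r_distr: "x \<in> carrier A \<Longrightarrow> y \<in> carrier A \<Longrightarrow> c \<odot> (x \<oplus> y) = c \<odot> x \<oplus> c \<odot> y"
    and smult_l_distr: "x \<in> carrier A \<Longrightarrow> (a + b) \<odot> x = a \<odot> x \<oplus> b \<odot> x"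
    and smult_assoc: "x \<in> carrier A \<Longrightarrow> (a * b) \<odot> x = a \<odot> (b \<odot> x)"
    and smult_one [simp]: "x \<in> carrier A \<Longrightarrow> 1 \<odot> x = x"
    and smult_mult_left: "x \<in> carrier A \<Longrightarrow> y \<in> carrier A \<Longrightarrow> (c \<odot> x) \<otimes> y = c \<odot> (x \<otimes> y)"
    and smult_mult_right: "x \<in> carrier A \<Longrightarrow> y \<in> carrier A \<Longrightarrow> x \<otimes> (c \<odot> y) = c \<odot> (x \<otimes> y)"

text \<open>
  The transfer device: the product, over all complex algebras \<open>R\<close> with elements in a type, of the
  algebras \<open>R\<close> themselves. It is an instance of \<open>complex_algebra\<close>, and its projections are
  homomorphisms, so every identity proved in the class projects to an identity in each record \<open>R\<close>.
  The extra factor \<open>\<complex>\<close> is there because the class demands \<open>0 \<noteq> 1\<close>, which fails in the product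
  if every \<open>R\<close> is zero.
\<close>

typedef 'a alg_prod =
  "{(z :: complex, f :: (complex, 'a) module \<Rightarrow> 'a).
      \<forall>R. if complex_alg R then f R \<in> carrier R else f R = undefined}"
proof
  show "(0, \<lambda>R. if complex_alg R then \<zero>\<^bsub>R\<^esub> else undefined) \<in>
    {(z :: complex, f :: (complex, 'a) module \<Rightarrow> 'a).
      \<forall>R. if complex_alg R then f R \<in> carrier R else f R = undefined}"
    by (auto simp: complex_alg_def ring.ring_simprules)
qed

definition base :: "'a alg_prod \<Rightarrow> complex" where
  "base x = fst (Rep_alg_prod x)"

definition proj :: "(complex, 'a) module \<Rightarrow> 'a alg_prod \<Rightarrow> 'a" where
  "proj R x = snd (Rep_alg_prod x) R"

definition tuple :: "complex \<Rightarrow> ((complex, 'a) module \<Rightarrow> 'a) \<Rightarrow> 'a alg_prod" where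
  "tuple z f = Abs_alg_prod (z, \<lambda>R. if complex_alg R then f R else undefined)"

lemma base_tuple: "(\<And>R. complex_alg R \<Longrightarrow> f R \<in> carrier R) \<Longrightarrow> base (tuple z f) = z"
  unfolding base_def tuple_def by (subst Abs_alg_prod_inverse) auto

lemma proj_tuple:
  "(\<And>R. complex_alg R \<Longrightarrow> f R \<in> carrier R) \<Longrightarrow> complex_alg R \<Longrightarrow> proj R (tuple z f) = f R"
  unfolding proj_def tuple_def by (subst Abs_alg_prod_inverse) auto

lemma proj_closed [simp, intro]: "complex_alg R \<Longrightarrow> proj R x \<in> carrier R"
  using Rep_alg_prod[of x] by (force simp: proj_def)

lemma alg_prod_eqI:
  assumes "base x = base y" and "\<And>R. complex_alg R \<Longrightarrow> proj R x = proj R y"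
  shows "x = y"
proof -
  have "snd (Rep_alg_prod x) R = snd (Rep_alg_prod y) R" for R
    using assms(2)[of R] Rep_alg_prod[of x] Rep_alg_prod[of y]
    by (cases "complex_alg R") (auto simp: proj_def split: prod.splits)
  then show ?thesis
    using assms(1) by (simp add: base_def prod_eq_iff fun_eq_iff flip: Rep_alg_prod_inject)
qed

instantiation alg_prod :: (type) complex_algebra
begin

definition "0 = tuple 0 (\<lambda>R. \<zero>\<^bsub>R\<^esub>)"
definition "1 = tuple 1 (\<lambda>R. \<one>\<^bsub>R\<^esub>)"
definition "x + y = tuple (base x + base y) (\<lambda>R. proj R x \<oplus>\<^bsub>R\<^esub> proj R y)"
definition "- x = tuple (- base x) (\<lambda>R. \<ominus>\<^bsub>R\<^esub> proj R x)"
definition "x - y = tuple (base x - base y) (\<lambda>R. proj R x \<ominus>\<^bsub>R\<^esub> proj R y)"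
definition "x * y = tuple (base x * base y) (\<lambda>R. proj R x \<otimes>\<^bsub>R\<^esub> proj R y)"
definition "scalar c = tuple c (\<lambda>R. c \<odot>\<^bsub>R\<^esub> \<one>\<^bsub>R\<^esub>)"

lemma in_carrier_simps:
  assumes "complex_alg R"
  shows "\<zero>\<^bsub>R\<^esub> \<in> carrier R" "\<one>\<^bsub>R\<^esub> \<in> carrier R" "proj R x \<oplus>\<^bsub>R\<^esub> proj R y \<in> carrier R"
    "\<ominus>\<^bsub>R\<^esub> proj R x \<in> carrier R" "proj R x \<ominus>\<^bsub>R\<^esub> proj R y \<in> carrier R"
    "proj R x \<otimes>\<^bsub>R\<^esub> proj R y \<in> carrier R" "c \<odot>\<^bsub>R\<^esub> \<one>\<^bsub>R\<^esub> \<in> carrier R"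
proof -
  interpret complex_alg R by fact
  show "\<zero>\<^bsub>R\<^esub> \<in> carrier R" "\<one>\<^bsub>R\<^esub> \<in> carrier R" "proj R x \<oplus>\<^bsub>R\<^esub> proj R y \<in> carrier R"
    "\<ominus>\<^bsub>R\<^esub> proj R x \<in> carrier R" "proj R x \<ominus>\<^bsub>R\<^esub> proj R y \<in> carrier R"
    "proj R x \<otimes>\<^bsub>R\<^esub> proj R y \<in> carrier R" "c \<odot>\<^bsub>R\<^esub> \<one>\<^bsub>R\<^esub> \<in> carrier R"
    using assms by simp_all
qed

lemmas alg_prod_ops = zero_alg_prod_def one_alg_prod_def plus_alg_prod_def uminus_alg_prod_def
  minus_alg_prod_def times_alg_prod_def scalar_alg_prod_def

lemma base_simps [simp]:
  fixes x y :: "'a alg_prod"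
  shows "base (0 :: 'a alg_prod) = 0" "base (1 :: 'a alg_prod) = 1" "base (x + y) = base x + base y"
    "base (- x) = - base x" "base (x - y) = base x - base y" "base (x * y) = base x * base y"
    "base (scalar c :: 'a alg_prod) = c"
  by (simp_all add: alg_prod_ops base_tuple in_carrier_simps)

lemma proj_simps [simp]:
  fixes x y :: "'a alg_prod"
  assumes "complex_alg R"
  shows "proj R 0 = \<zero>\<^bsub>R\<^esub>" "proj R 1 = \<one>\<^bsub>R\<^esub>" "proj R (x + y) = proj R x \<oplus>\<^bsub>R\<^esub> proj R y"
    "proj R (- x) = \<ominus>\<^bsub>R\<^esub> proj R x" "proj R (x - y) = proj R x \<ominus>\<^bsub>R\<^esub> proj R y"
    "proj R (x * y) = proj R x \<otimes>\<^bsub>R\<^esub> proj R y" "proj R (scalar c) = c \<odot>\<^bsub>R\<^esub> \<one>\<^bsub>R\<^esub>"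
  using assms by (simp_all add: alg_prod_ops proj_tuple in_carrier_simps)

instance
proof
  fix x y z :: "'a alg_prod" and a b :: complex
  have [simp]: "ring R" if "complex_alg R" for R :: "(complex, 'a) module"
    using that by (simp add: complex_alg_def)
  have r_one: "x \<otimes>\<^bsub>R\<^esub> \<one>\<^bsub>R\<^esub> = x" if "complex_alg R" "x \<in> carrier R" for R :: "(complex, 'a) module" and x
  proof -
    interpret complex_alg R by fact
    show ?thesis using that by simp
  qed
  note rs = ring.ring_simprules a_minus_def r_one
  show "x * y * z = x * (y * z)" "x + y + z = x + (y + z)" "x + y = y + x" "0 + x = x"
     "- x + x = 0" "x - y = x + - y" "1 * x = x" "x * 1 = x" "(x + y) * z = x * z + y * z" "x * (y + z) = x * y + x * z"
    by (rule alg_prod_eqI; simp add: rs ring.ring_simprules(13,23) algebra_simps)+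
  show "(0 :: 'a alg_prod) \<noteq> 1"
  proof
    assume "(0 :: 'a alg_prod) = 1"
    then have "base (0 :: 'a alg_prod) = base (1 :: 'a alg_prod)" by (rule arg_cong)
    then show False by simp
  qed
  show "scalar (a + b) = (scalar a + scalar b :: 'a alg_prod)"
    by (rule alg_prod_eqI) (simp_all add: complex_alg.smult_l_distr rs)
  show "scalar (a * b) = (scalar a * scalar b :: 'a alg_prod)"
    by (rule alg_prod_eqI)
      (simp_all add: complex_alg.smult_assoc rs complex_alg.smult_mult_left complex_alg.smult_closed)
  show "scalar 1 = (1 :: 'a alg_prod)"
    by (rule alg_prod_eqI) (simp_all add: complex_alg.smult_one rs)
  show "scalar a * x = x * scalar a"
    by (rule alg_prod_eqI)
      (simp_all add: complex_alg.smult_mult_left complex_alg.smult_mult_right rs)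
qed

end

text \<open>
  This section of the projection to \<open>R\<close> respects all operations except the unit. Hence elements
  are embedded one by one, and identities that involve \<open>1\<close> are proved upstairs and then projected.
\<close>

definition emb :: "(complex, 'a) module \<Rightarrow> 'a \<Rightarrow> 'a alg_prod" where
  "emb R x = tuple 0 (\<lambda>R'. if R' = R then x else \<zero>\<^bsub>R'\<^esub>)"

context complex_alg
begin

lemma base_emb [simp]: "x \<in> carrier A \<Longrightarrow> base (emb A x) = 0"
  by (simp add: emb_def base_tuple in_carrier_simps)

lemma proj_emb: "x \<in> carrier A \<Longrightarrow> complex_alg R \<Longrightarrow> proj R (emb A x) = (if R = A then x else \<zero>\<^bsub>R\<^esub>)"
  by (subst emb_def, subst proj_tuple) (simp_all add: in_carrier_simps)

lemma proj_emb_same [simp]: "x \<in> carrier A \<Longrightarrow> proj A (emb A x) = x"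
  by (simp add: proj_emb complex_alg_axioms)

lemma emb_inject: "x \<in> carrier A \<Longrightarrow> y \<in> carrier A \<Longrightarrow> emb A x = emb A y \<longleftrightarrow> x = y"
  by (metis proj_emb_same)

lemma smult_zero [simp]: "c \<odot> \<zero> = \<zero>"
  using smult_r_distr[of \<zero> \<zero> c] by simp

lemma zero_smult [simp]: "x \<in> carrier A \<Longrightarrow> 0 \<odot> x = \<zero>"
  using smult_l_distr[of x 0 0] by simp

lemma smult_minus_one: "x \<in> carrier A \<Longrightarrow> (- 1) \<odot> x = \<ominus> x"
  using smult_l_distr[of x "-1" 1] by (simp add: minus_equality)

lemma smult_r_minus: "x \<in> carrier A \<Longrightarrow> c \<odot> (\<ominus> x) = \<ominus> (c \<odot> x)"
  using smult_r_distr[of "\<ominus> x" x c] by (simp add: minus_equality l_neg)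

lemma emb_add: "x \<in> carrier A \<Longrightarrow> y \<in> carrier A \<Longrightarrow> emb A (x \<oplus> y) = emb A x + emb A y"
  and emb_mult: "x \<in> carrier A \<Longrightarrow> y \<in> carrier A \<Longrightarrow> emb A (x \<otimes> y) = emb A x * emb A y"
  and emb_uminus: "x \<in> carrier A \<Longrightarrow> emb A (\<ominus> x) = - emb A x"
  and emb_minus: "x \<in> carrier A \<Longrightarrow> y \<in> carrier A \<Longrightarrow> emb A (x \<ominus> y) = emb A x - emb A y"
  and emb_zero: "emb A \<zero> = 0"
  and emb_smult: "x \<in> carrier A \<Longrightarrow> emb A (c \<odot> x) = scalar c * emb A x"
  by (rule alg_prod_eqI;
      auto simp: proj_emb complex_alg_def ring.ring_simprules a_minus_def smult_mult_left
        complex_alg.smult_mult_left complex_alg.smult_zero)+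

lemmas emb_simps = emb_add emb_mult emb_uminus emb_minus emb_zero emb_smult

lemma emb_finsum:
  "finite S \<Longrightarrow> (\<And>i. i \<in> S \<Longrightarrow> f i \<in> carrier A) \<Longrightarrow> emb A (finsum A f S) = (\<Sum>i\<in>S. emb A (f i))"
  by (induction S rule: finite_induct) (simp_all add: emb_zero emb_add Pi_def finsum_insert)

lemma proj_sum: "finite S \<Longrightarrow> proj A (sum f S) = finsum A (\<lambda>i. proj A (f i)) S"
  by (induction S rule: finite_induct)
    (simp_all add: complex_alg_axioms Pi_def finsum_insert)

lemma proj_scalar_mult: "proj A (scalar c * x) = c \<odot> proj A x"
  by (simp add: complex_alg_axioms smult_mult_left)

lemma proj_power: "proj A (x ^ k) = proj A x [^] k"
  by (induction k) (simp_all add: complex_alg_axioms power_Suc2 del: power_Suc)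

end

section \<open>Rising factorials and normally ordered powers\<close>

primrec rise :: "complex \<Rightarrow> 'a::complex_algebra \<Rightarrow> nat \<Rightarrow> 'a" where
  "rise a X 0 = 1"
| "rise a X (Suc j) = rise a X j * (X + scalar (a + of_nat j))"

text \<open>
  The coefficient of \<open>t\<^sup>k\<close> in \<open>(1 - t)\<^sup>-\<^sup>X\<close>.
\<close>

definition rbinom :: "'a::complex_algebra \<Rightarrow> nat \<Rightarrow> 'a" where
  "rbinom X k = scalar (1 / fact k) * rise 0 X k"

lemma of_nat_mult_cancel:
  fixes x y :: "'a::complex_algebra"
  assumes "n > 0" and "of_nat n * x = of_nat n * y"
  shows "x = y"
proof -
  have "scalar (1 / of_nat n) * (of_nat n * x) = scalar (1 / of_nat n) * (of_nat n * y)"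
    using assms(2) by simp
  moreover have "scalar (1 / of_nat n) * (of_nat n * z) = z" for z :: 'a
    using assms(1) by (simp flip: scalar_of_nat mult.assoc scalar_mult)
  ultimately show ?thesis by simp
qed

lemma rbinom_0 [simp]: "rbinom X 0 = 1"
  by (simp add: rbinom_def)

lemma rbinom_Suc: "of_nat (Suc k) * rbinom X (Suc k) = rbinom X k * (X + of_nat k)"
proof -
  have "of_nat (Suc k) * rbinom X (Suc k)
      = scalar (of_nat (Suc k) * (1 / fact (Suc k))) * (rise 0 X k * (X + of_nat k))"
    by (simp only: rbinom_def rise.simps scalar_mult scalar_of_nat mult.assoc) simp
  also have "of_nat (Suc k) * (1 / fact (Suc k)) = (1 / fact k :: complex)"
    using of_nat_neq_0[of k, where 'a = complex] by (simp del: of_nat_Suc)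
  finally show ?thesis by (simp add: rbinom_def mult.assoc)
qed

lemma rbinom_zero: "rbinom (0 :: 'a::complex_algebra) k = (if k = 0 then 1 else 0)"
proof (cases k)
  case (Suc j)
  have "rise 0 (0 :: 'a) (Suc j) = 0" by (induction j) simp_all
  then show ?thesis using Suc by (simp add: rbinom_def del: rise.simps)
qed simp

lemma rise_intertwine:
  assumes "y * X' = X * y"
  shows "y * rise a X' k = rise a X k * y"
proof (induction k)
  case (Suc k)
  have "y * (X' + scalar b) = (X + scalar b) * y" for b
    using assms by (simp add: distrib_left distrib_right scalar_commute)
  then have "rise a X k * (y * (X' + scalar (a + of_nat k))) = rise a X k * ((X + scalar (a + of_nat k)) * y)"
    by simp
  then show ?case using Suc by (simp add: mult.assoc flip: mult.assoc[of y])
qed simp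

lemma rbinom_intertwine: "y * X' = X * y \<Longrightarrow> y * rbinom X' k = rbinom X k * y"
  by (simp add: rbinom_def scalar_left_commute rise_intertwine mult.assoc)

lemma rbinom_commute: "X * Y = Y * X \<Longrightarrow> rbinom X k * Y = Y * rbinom X k"
  using rbinom_intertwine[of Y X X k] by simp

lemma rise_add: "rise a X (j + l) = rise a X j * rise (a + of_nat j) X l"
  by (induction l) (simp_all add: mult.assoc add.assoc)

lemma rise_shift: "rise (a + b) X l = rise a (X + scalar b) l"
  by (induction l) (simp_all add: scalar_add add_ac)

text \<open>
  Both sides are \<open>(X)\<^sub>j\<^sub>+\<^sub>l / (j! l!)\<close>. This replaces the manipulation of factorials in all later
  sums.
\<close>

lemma rbinom_split:
  "of_nat ((j + l) choose j) * rbinom X (j + l) = rbinom X j * rbinom (X + of_nat j) l"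
proof -
  have "of_nat ((j + l) choose j) * rbinom X (j + l)
      = scalar (of_nat ((j + l) choose j) / fact (j + l)) * (rise 0 X j * rise (of_nat j) X l)"
    by (simp add: rbinom_def rise_add mult.assoc flip: scalar_of_nat scalar_mult mult.assoc[of "scalar _" "scalar _"])
  also have "of_nat ((j + l) choose j) / fact (j + l) = (1 / fact j * (1 / fact l) :: complex)"
    by (simp add: binomial_fact field_simps)
  also have "scalar \<dots> * (rise 0 X j * rise (of_nat j) X l)
      = scalar (1 / fact j) * rise 0 X j * (scalar (1 / fact l) * rise (of_nat j) X l)"
    by (simp only: scalar_mult mult.assoc scalar_left_commute[of "rise _ _ _"])
  also have "rise (of_nat j) X l = rise 0 (X + of_nat j) l"
    using rise_shift[of 0 "of_nat j" X l] by simp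
  finally show ?thesis by (simp add: rbinom_def)
qed

text \<open>
  The Vandermonde identity, that is, \<open>(1 - t)\<^sup>-\<^sup>X (1 - t)\<^sup>-\<^sup>Y = (1 - t)\<^sup>-\<^sup>(\<^sup>X\<^sup>+\<^sup>Y\<^sup>)\<close>. In the
  induction the factor \<open>X + Y + n\<close> is split as \<open>(X + k) + (Y + (n - k))\<close>, which raises one of
  the two indices.
\<close>

lemma rbinom_add:
  assumes "X * Y = Y * X"
  shows "rbinom (X + Y) n = (\<Sum>k\<le>n. rbinom X k * rbinom Y (n - k))"
proof (induction n)
  case (Suc n)
  define f where "f k l = rbinom X k * rbinom Y l" for k l
  have comm: "rbinom Y l * X = X * rbinom Y l" "rbinom X k * Y = Y * rbinom X k" for k l
    using assms rbinom_commute[of Y X l] rbinom_commute[of X Y k] by simp_all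
  have step: "f k (n - k) * (X + Y + of_nat n)
      = of_nat (Suc k) * f (Suc k) (n - k) + of_nat (Suc (n - k)) * f k (Suc (n - k))" if "k \<le> n" for k
  proof -
    have "f k (n - k) * (X + Y + of_nat n)
        = rbinom X k * (X + of_nat k) * rbinom Y (n - k)
          + rbinom X k * (rbinom Y (n - k) * (Y + of_nat (n - k)))"
    proof -
      have n: "(of_nat n :: 'a) = of_nat k + of_nat (n - k)"
        using that by (simp flip: of_nat_add)
      have c: "rbinom Y (n - k) * of_nat k = of_nat k * rbinom Y (n - k)"
        by (rule mult_of_nat_commute[symmetric])
      show ?thesis unfolding n f_def using comm c by (simp add: algebra_simps)
    qed
    also have "\<dots> = of_nat (Suc k) * rbinom X (Suc k) * rbinom Y (n - k)
          + rbinom X k * (of_nat (Suc (n - k)) * rbinom Y (Suc (n - k)))"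
      by (simp only: rbinom_Suc)
    also have "rbinom X k * (of_nat (Suc (n - k)) * rbinom Y (Suc (n - k)))
        = of_nat (Suc (n - k)) * (rbinom X k * rbinom Y (Suc (n - k)))"
      using scalar_left_commute[of "rbinom X k" "of_nat (Suc (n - k))" "rbinom Y (Suc (n - k))"]
      by (simp only: scalar_of_nat)
    finally show ?thesis by (simp only: f_def mult.assoc)
  qed
  have "of_nat (Suc n) * rbinom (X + Y) (Suc n) = rbinom (X + Y) n * (X + Y + of_nat n)"
    by (simp only: rbinom_Suc)
  also have "\<dots> = (\<Sum>k\<le>n. f k (n - k) * (X + Y + of_nat n))"
    by (simp add: Suc f_def sum_distrib_right)
  also have "\<dots> = (\<Sum>k\<le>n. of_nat (Suc k) * f (Suc k) (n - k)) + (\<Sum>k\<le>n. of_nat (Suc (n - k)) * f k (Suc (n - k)))"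
    by (simp add: step sum.distrib)
  also have "(\<Sum>k\<le>n. of_nat (Suc k) * f (Suc k) (n - k)) = (\<Sum>k\<le>Suc n. of_nat k * f k (Suc n - k))"
    using sum.atMost_Suc_shift[of "\<lambda>k. of_nat k * f k (Suc n - k)" n] by (simp del: of_nat_Suc sum.atMost_Suc)
  also have "(\<Sum>k\<le>n. of_nat (Suc (n - k)) * f k (Suc (n - k))) = (\<Sum>k\<le>Suc n. of_nat (Suc n - k) * f k (Suc n - k))"
    by (simp add: Suc_diff_le algebra_simps)
  also have "(\<Sum>k\<le>Suc n. of_nat k * f k (Suc n - k)) + (\<Sum>k\<le>Suc n. of_nat (Suc n - k) * f k (Suc n - k))
      = (\<Sum>k\<le>Suc n. of_nat (Suc n) * f k (Suc n - k))"
    by (subst sum.distrib[symmetric], rule sum.cong)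
      (auto simp flip: distrib_right of_nat_add simp del: of_nat_Suc)
  finally have "of_nat (Suc n) * rbinom (X + Y) (Suc n) = of_nat (Suc n) * (\<Sum>k\<le>Suc n. f k (Suc n - k))"
    by (simp only: sum_distrib_left)
  then show ?case unfolding f_def by (rule of_nat_mult_cancel[rotated]) simp
qed simp

text \<open>
  The power \<open>(1 - E t)\<^sup>-\<^sup>X\<close>, normally ordered: all \<open>X\<close> stand to the left of all \<open>E\<close>. The two
  need not commute, so this is a definition of the power rather than a formula for it.
\<close>

definition npow :: "'a::complex_algebra \<Rightarrow> 'a \<Rightarrow> 'a fps" where
  "npow E X = Abs_fps (\<lambda>k. rbinom X k * E ^ k)"

lemma npow_nth [simp]: "fps_nth (npow E X) k = rbinom X k * E ^ k"
  by (simp add: npow_def)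

lemma npow_0 [simp]: "npow E 0 = 1"
  by (rule fps_ext) (simp add: rbinom_zero)

lemma power_intertwine:
  fixes x :: "'a::monoid_mult"
  shows "x * a = b * x \<Longrightarrow> x * a ^ k = b ^ k * x"
proof (induction k)
  case (Suc k)
  then have "b ^ k * (x * a) = b ^ k * (b * x)" by simp
  then show ?case using Suc by (simp add: power_Suc2 mult.assoc flip: mult.assoc[of x] del: power_Suc)
qed simp

lemma npow_mult:
  assumes "X * Y = Y * X" and "E * Y = Y * E"
  shows "npow E X * npow E Y = npow E (X + Y)"
proof (rule fps_ext)
  fix n
  have "E ^ i * rbinom Y k = rbinom Y k * E ^ i" for i k
    using power_intertwine[of "rbinom Y k" E E i] rbinom_commute[of Y E k] assms(2) by simp
  then have "rbinom X i * E ^ i * (rbinom Y (n - i) * E ^ (n - i)) = rbinom X i * rbinom Y (n - i) * E ^ n"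
    if "i \<le> n" for i
  proof -
    have "E ^ n = E ^ i * E ^ (n - i)" using that by (simp flip: power_add)
    with \<open>\<And>k i. E ^ i * rbinom Y k = rbinom Y k * E ^ i\<close> show ?thesis
      by (simp only: mult.assoc mult.assoc[of "E ^ i" "rbinom Y _", symmetric])
  qed
  then show "fps_nth (npow E X * npow E Y) n = fps_nth (npow E (X + Y)) n"
    by (simp add: fps_mult_nth rbinom_add[OF assms(1)] sum_distrib_right atLeast0AtMost)
qed

lemma E_power_shift:
  fixes E X :: "'a::complex_algebra"
  assumes "E * X = X * E + E"
  shows "E ^ k * X = (X + of_nat k) * E ^ k"
proof (induction k)
  case (Suc k)
  have "E ^ Suc k * X = E * ((X + of_nat k) * E ^ k)" by (simp add: Suc mult.assoc)
  also have "\<dots> = (E * X + of_nat k * E) * E ^ k"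
  proof -
    have "E * of_nat k = of_nat k * E" by (simp only: mult_of_nat_commute)
    then show ?thesis by (simp only: mult.assoc[symmetric] distrib_left)
  qed
  also have "E * X + of_nat k * E = (X + of_nat (Suc k)) * E"
    by (simp add: assms algebra_simps)
  also have "\<dots> * E ^ k = (X + of_nat (Suc k)) * E ^ Suc k"
    by (simp add: mult.assoc)
  finally show ?case .
qed simp

text \<open>
  If \<open>[E, X] = E\<close> then \<open>E\<close> carries \<open>f(X)\<close> to \<open>f(X + 1)\<close> when it moves to the right. With
  \<open>[T, E] = E\<close> this applies to \<open>X = - T\<close>.
\<close>

lemma E_power_rbinom:
  fixes E X :: "'a::complex_algebra"
  assumes "E * X = X * E + E"
  shows "E ^ k * rbinom X j = rbinom (X + of_nat k) j * E ^ k"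
  by (rule rbinom_intertwine) (rule E_power_shift[OF assms])

lemma alternating_choose: "n > 0 \<Longrightarrow> (\<Sum>k\<le>n. (- 1) ^ k * of_nat (n choose k)) = (0 :: 'a::complex_algebra)"
proof -
  assume "n > 0"
  then have "(\<Sum>k\<le>n. (- 1) ^ k * of_nat (n choose k)) = (0 :: complex)"
    by (rule choose_alternating_sum)
  then have "scalar (\<Sum>k\<le>n. (- 1) ^ k * of_nat (n choose k)) = (0 :: 'a)" by simp
  moreover have "scalar ((-1) ^ k) = ((-1) ^ k :: 'a)" for k
    by (induction k) (simp_all add: scalar_mult scalar_uminus)
  ultimately show ?thesis by (simp add: scalar_sum scalar_mult)
qed

text \<open>
  Normal ordering of the product turns the coefficient of \<open>t\<^sup>n\<close> into an alternating sum of
  binomial coefficients. The sign of \<open>E\<close> in the left factor is essential: for \<open>[E, X] = E\<close> the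
  inverse of \<open>(1 - E t)\<^sup>-\<^sup>X\<close> is the power with \<open>- E\<close>, not the one with \<open>- X\<close>.
\<close>

lemma npow_uminus_mult:
  assumes "E * X = X * E + E"
  shows "npow (- E) X * npow E X = 1"
proof (rule fps_ext)
  fix n
  have summand: "rbinom X i * (- E) ^ i * (rbinom X (n - i) * E ^ (n - i))
      = (- 1) ^ i * of_nat (n choose i) * (rbinom X n * E ^ n)" if "i \<le> n" for i
  proof -
    have "rbinom X i * (- E) ^ i * (rbinom X (n - i) * E ^ (n - i))
        = (- 1) ^ i * (rbinom X i * (E ^ i * rbinom X (n - i)) * E ^ (n - i))"
    proof -
      have "(- E) ^ i = (- 1) ^ i * E ^ i" by (rule power_minus)
      moreover have "rbinom X i * (- 1) ^ i = (- 1) ^ i * rbinom X i"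
        by (cases "even i") simp_all
      ultimately show ?thesis by (simp only: mult.assoc[symmetric])
    qed
    also have "rbinom X i * (E ^ i * rbinom X (n - i)) * E ^ (n - i)
        = rbinom X i * rbinom (X + of_nat i) (n - i) * (E ^ i * E ^ (n - i))"
      by (simp add: E_power_rbinom[OF assms] mult.assoc)
    also have "E ^ i * E ^ (n - i) = E ^ n" using that by (simp flip: power_add)
    also have "rbinom X i * rbinom (X + of_nat i) (n - i) = of_nat (n choose i) * rbinom X n"
      using rbinom_split[of i "n - i" X] that by simp
    finally show ?thesis by (simp add: mult.assoc)
  qed
  have "fps_nth (npow (- E) X * npow E X) n
      = (\<Sum>i\<le>n. (- 1) ^ i * of_nat (n choose i)) * (rbinom X n * E ^ n)"
    by (simp only: fps_mult_nth atLeast0AtMost npow_nth sum_distrib_right)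
      (rule sum.cong, simp_all only: summand atMost_iff)
  then show "fps_nth (npow (- E) X * npow E X) n = fps_nth 1 n"
    using alternating_choose[of n, where 'a = 'a] by (cases "n = 0") simp_all
qed

text \<open>
  The induction step of every binomial expansion.
\<close>

lemma pascal_sum:
  fixes f :: "nat \<Rightarrow> nat \<Rightarrow> 'a::semiring_1"
  shows "(\<Sum>k\<le>n. of_nat (n choose k) * (f (Suc k) (n - k) + f k (Suc (n - k))))
    = (\<Sum>k\<le>Suc n. of_nat (Suc n choose k) * f k (Suc n - k))"
proof -
  have "(\<Sum>k\<le>Suc n. of_nat (Suc n choose k) * f k (Suc n - k))
      = f 0 (Suc n) + (\<Sum>k\<le>n. of_nat (n choose Suc k) * f (Suc k) (n - k))
        + (\<Sum>k\<le>n. of_nat (n choose k) * f (Suc k) (n - k))"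
    by (subst sum.atMost_Suc_shift) (simp add: distrib_right sum.distrib add_ac)
  also have "f 0 (Suc n) + (\<Sum>k\<le>n. of_nat (n choose Suc k) * f (Suc k) (n - k))
      = (\<Sum>k\<le>Suc n. of_nat (n choose k) * f k (Suc n - k))"
    by (subst sum.atMost_Suc_shift) simp
  also have "\<dots> = (\<Sum>k\<le>n. of_nat (n choose k) * f k (Suc (n - k)))"
    by (simp add: Suc_diff_le binomial_eq_0)
  finally show ?thesis by (simp add: distrib_left sum.distrib add.commute)
qed

lemma commuting_binomial:
  fixes a b :: "'a::semiring_1"
  assumes "a * b = b * a"
  shows "(a + b) ^ n = (\<Sum>k\<le>n. of_nat (n choose k) * (a ^ k * b ^ (n - k)))"
proof (induction n)
  case (Suc n)
  have b: "b * a ^ k = a ^ k * b" for k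
    using power_intertwine[of b a a k] assms by simp
  have "(a + b) * (of_nat c * (a ^ k * b ^ m)) = of_nat c * (a ^ Suc k * b ^ m + a ^ k * b ^ Suc m)" for c k m
  proof -
    have "(a + b) * (of_nat c * (a ^ k * b ^ m)) = of_nat c * ((a + b) * (a ^ k * b ^ m))"
      using mult_of_nat_commute[of c "a + b"] by (simp only: mult.assoc[symmetric])
    also have "(a + b) * (a ^ k * b ^ m) = a ^ Suc k * b ^ m + a ^ k * b ^ Suc m"
      by (simp add: distrib_right mult.assoc[symmetric] b)
    finally show ?thesis .
  qed
  then show ?case
    using pascal_sum[of n "\<lambda>k m. a ^ k * b ^ m"] by (simp add: Suc sum_distrib_left del: sum.atMost_Suc)
qed simp

lemma rbinom_exchange: "rbinom X j * rbinom (X + of_nat j) l = rbinom X l * rbinom (X + of_nat l) j"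
  using rbinom_split[of j l X] rbinom_split[of l j X] binomial_symmetric[of j "j + l"]
  by (simp add: add.commute)

lemma sum_triangle_swap:
  fixes f :: "nat \<Rightarrow> nat \<Rightarrow> nat \<Rightarrow> 'a::comm_monoid_add"
  shows "(\<Sum>i\<le>n. \<Sum>j\<le>n - i. f i j (n - (i + j))) = (\<Sum>j\<le>n. \<Sum>i\<le>n - j. f i j (n - (j + i)))"
proof -
  have "(\<Sum>i\<le>n. \<Sum>j\<le>n - i. f i j (n - (i + j)))
      = (\<Sum>(i, j)\<in>(SIGMA i:{..n}. {..n - i}). f i j (n - (i + j)))"
    by (subst sum.Sigma) simp_all
  also have "\<dots> = (\<Sum>(j, i)\<in>(SIGMA j:{..n}. {..n - j}). f i j (n - (j + i)))"
    by (rule sum.reindex_bij_witness[of _ prod.swap prod.swap]) (auto simp: add.commute)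
  also have "\<dots> = (\<Sum>j\<le>n. \<Sum>i\<le>n - j. f i j (n - (j + i)))"
    by (subst sum.Sigma) simp_all
  finally show ?thesis .
qed

text \<open>
  Drinfeld's cocycle equation for the twist, with \<open>E\<close>, \<open>E'\<close> for \<open>1 \<otimes> E \<otimes> 1\<close>, \<open>1 \<otimes> 1 \<otimes> E\<close> and
  \<open>Z\<close>, \<open>Y\<close> for \<open>- T \<otimes> 1 \<otimes> 1\<close>, \<open>1 \<otimes> - T \<otimes> 1\<close>. Both sides expand to the same triple sum: on the left
  \<open>E\<^sup>i\<close> moves past \<open>Z + Y\<close>, which becomes \<open>(Z + i) + Y\<close> and splits by the Vandermonde identity; on
  the right \<open>(E + E')\<^sup>m\<close> splits by the binomial theorem. The coefficients agree by \<open>rbinom_split\<close>.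
\<close>

lemma npow_cocycle:
  assumes EE: "E * E' = E' * E" and EY: "E * Y = Y * E + E" and E'Y: "E' * Y = Y * E'"
    and Z: "Z * E = E * Z" "Z * E' = E' * Z" "Z * Y = Y * Z"
  shows "npow E Z * npow E' (Z + Y) = npow E' Y * npow (E + E') Z"
proof (rule fps_ext)
  fix n
  \<comment> \<open>the common summand: \<open>i\<close> counts \<open>E\<close>, and \<open>j\<close>, \<open>l\<close> count the \<open>E'\<close> that come with \<open>Z\<close> and with \<open>Y\<close>\<close>
  define f where "f i j l = rbinom Z i * rbinom (Z + of_nat i) j * rbinom Y l * (E ^ i * E' ^ (j + l))" for i j l
  have "fps_nth (npow E Z * npow E' (Z + Y)) n = (\<Sum>i\<le>n. \<Sum>j\<le>n - i. f i j (n - i - j))"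
  proof -
    have "rbinom Z i * E ^ i * (rbinom (Z + Y) m * E' ^ m) = (\<Sum>j\<le>m. f i j (m - j))" for i m
    proof -
      have ZE: "E ^ i * Z = Z * E ^ i"
        using power_intertwine[of Z E E i] Z by simp
      have 1: "E ^ i * rbinom (Z + Y) m = rbinom (Z + of_nat i + Y) m * E ^ i"
        by (rule rbinom_intertwine)
          (simp add: distrib_left ZE E_power_shift[OF EY], simp add: algebra_simps)
      have "(Z + of_nat i) * Y = Y * (Z + of_nat i)"
        using Z by (simp add: distrib_left distrib_right mult_of_nat_commute)
      note 2 = rbinom_add[OF this, of m]
      have "rbinom Z i * E ^ i * (rbinom (Z + Y) m * E' ^ m)
          = rbinom Z i * (E ^ i * rbinom (Z + Y) m) * E' ^ m"
        by (simp only: mult.assoc)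
      also have "\<dots> = (\<Sum>j\<le>m. rbinom Z i * (rbinom (Z + of_nat i) j * rbinom Y (m - j)) * (E ^ i * E' ^ m))"
        by (simp only: 1 2 mult.assoc[symmetric] sum_distrib_left sum_distrib_right)
      finally show ?thesis by (simp add: f_def mult.assoc)
    qed
    then show ?thesis by (simp add: fps_mult_nth atLeast0AtMost)
  qed
  also have "\<dots> = (\<Sum>l\<le>n. \<Sum>i\<le>n - l. f i (n - l - i) l)"
  proof -
    have "(\<Sum>i\<le>n. \<Sum>j\<le>n - i. f i j (n - i - j)) = (\<Sum>i\<le>n. \<Sum>l\<le>n - i. f i (n - (i + l)) l)"
    proof (rule sum.cong)
      fix i assume "i \<in> {..n}"
      show "(\<Sum>j\<le>n - i. f i j (n - i - j)) = (\<Sum>l\<le>n - i. f i (n - (i + l)) l)"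
      proof (rule sum.reindex_bij_witness[of _ "\<lambda>l. n - i - l" "\<lambda>l. n - i - l"])
        fix a assume a: "a \<in> {..n - i}"
        then have "n - (i + (n - i - a)) = a" using \<open>i \<in> {..n}\<close> by auto
        then show "f i (n - (i + (n - i - a))) (n - i - a) = f i a (n - i - a)" by (simp only:)
      qed auto
    qed simp
    also have "\<dots> = (\<Sum>l\<le>n. \<Sum>i\<le>n - l. f i (n - (l + i)) l)"
      by (rule sum_triangle_swap[where f = "\<lambda>i l k. f i k l"])
    finally show ?thesis by simp
  qed
  also have "\<dots> = fps_nth (npow E' Y * npow (E + E') Z) n"
  proof -
    have "rbinom Y l * E' ^ l * (rbinom Z m * (E + E') ^ m) = (\<Sum>i\<le>m. f i (m - i) l)" for l m
    proof -
      have c: "E' ^ l * rbinom Z m = rbinom Z m * E' ^ l"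
        using power_intertwine[of "rbinom Z m" E' E' l] rbinom_commute[of Z E' m] Z by simp
      have d: "rbinom Y l * rbinom Z m = rbinom Z m * rbinom Y l" for m
        using rbinom_commute[of Y Z l] rbinom_commute[of Z "rbinom Y l" m] Z by simp
      have bin: "(E + E') ^ m = (\<Sum>i\<le>m. of_nat (m choose i) * (E ^ i * E' ^ (m - i)))"
        by (rule commuting_binomial[OF EE])
      have e: "E' ^ l * (of_nat (m choose i) * (E ^ i * E' ^ (m - i))) = of_nat (m choose i) * (E ^ i * E' ^ (m - i + l))" for i
      proof -
        have "E' ^ l * E ^ i = E ^ i * E' ^ l"
          by (rule power_intertwine) (rule power_intertwine[OF EE, symmetric])
        then have "E' ^ l * (E ^ i * E' ^ (m - i)) = E ^ i * E' ^ (m - i + l)"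
          by (simp only: power_add add.commute[of "m - i"] mult.assoc[symmetric])
        then show ?thesis
          using mult_of_nat_commute[of "m choose i" "E' ^ l"] by (metis mult.assoc)
      qed
      have "rbinom Y l * E' ^ l * (rbinom Z m * (E + E') ^ m)
        = rbinom Z m * rbinom Y l * (E' ^ l * (E + E') ^ m)"
        by (simp only: mult.assoc[symmetric] d[symmetric]) (simp only: mult.assoc c mult.assoc[of "E' ^ l", symmetric])
      also have "\<dots> = (\<Sum>i\<le>m. rbinom Z m * rbinom Y l * (of_nat (m choose i) * (E ^ i * E' ^ (m - i + l))))"
        by (simp only: bin e sum_distrib_left)
      also have "\<dots> = (\<Sum>i\<le>m. f i (m - i) l)"
      proof (rule sum.cong)
        fix i assume "i \<in> {..m}"
        then have "of_nat (m choose i) * rbinom Z m = rbinom Z i * rbinom (Z + of_nat i) (m - i)"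
          using rbinom_split[of i "m - i" Z] by simp
        then show "rbinom Z m * rbinom Y l * (of_nat (m choose i) * (E ^ i * E' ^ (m - i + l))) = f i (m - i) l"
          unfolding f_def using d[of m] mult_of_nat_commute[of "m choose i" "rbinom Z m * rbinom Y l"]
          by (simp only: mult.assoc[symmetric])
      qed simp
      finally show ?thesis .
    qed
    then show ?thesis by (simp add: fps_mult_nth atLeast0AtMost)
  qed
  finally show "fps_nth (npow E Z * npow E' (Z + Y)) n = fps_nth (npow E' Y * npow (E + E') Z) n" .
qed

text \<open>
  The series \<open>\<Sum>\<^sub>j X\<^sub>j t\<^sup>j\<close>, in which each \<open>X\<^sub>j\<close> is itself a series in \<open>t\<close>.
\<close>

definition tseries :: "(nat \<Rightarrow> 'a::complex_algebra fps) \<Rightarrow> 'a fps" where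
  "tseries X = Abs_fps (\<lambda>n. \<Sum>j\<le>n. fps_nth (X j) (n - j))"

lemma tseries_nth [simp]: "fps_nth (tseries X) n = (\<Sum>j\<le>n. fps_nth (X j) (n - j))"
  by (simp add: tseries_def)

lemma tseries_mult_left: "f * tseries X = tseries (\<lambda>j. f * X j)"
  by (rule fps_ext)
    (simp add: fps_mult_nth atLeast0AtMost sum_distrib_left
       sum_triangle_swap[where f = "\<lambda>i j k. fps_nth f i * fps_nth (X j) k"])

primrec iter_ad :: "'a::ring \<Rightarrow> nat \<Rightarrow> 'a \<Rightarrow> 'a" where
  "iter_ad E 0 y = y"
| "iter_ad E (Suc j) y = E * iter_ad E j y - iter_ad E j y * E"

text \<open>
  The iterated form of \<open>y E = E y - ad(E) y\<close>.
\<close>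

lemma mult_power_iter_ad:
  fixes E y :: "'a::ring_1"
  shows "y * E ^ n = (\<Sum>k\<le>n. of_nat (n choose k) * (E ^ (n - k) * ((- 1) ^ k * iter_ad E k y)))"
proof (induction n)
  case (Suc n)
  define f where "f k m = E ^ m * ((- 1) ^ k * iter_ad E k y)" for k m
  have "f k m * E = f (Suc k) m + f k (Suc m)" for k m
  proof -
    have "iter_ad E k y * E = E * iter_ad E k y - iter_ad E (Suc k) y" by simp
    then have "f k m * E = E ^ m * ((- 1) ^ k * (E * iter_ad E k y - iter_ad E (Suc k) y))"
      by (simp add: f_def mult.assoc)
    also have "\<dots> = f (Suc k) m + f k (Suc m)"
      by (cases "even k") (simp_all add: f_def algebra_simps power_Suc2 del: iter_ad.simps power_Suc)
    finally show ?thesis .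
  qed
  then have "y * E ^ Suc n = (\<Sum>k\<le>n. of_nat (n choose k) * (f (Suc k) (n - k) + f k (Suc (n - k))))"
    using Suc by (simp add: f_def sum_distrib_right mult.assoc power_Suc2 flip: mult.assoc[of y] del: power_Suc)
  then show ?case by (simp only: pascal_sum) (simp only: f_def)
qed simp

text \<open>
  To move \<open>y\<close> to the right through \<open>(1 - E t)\<^sup>-\<^sup>X\<close>, first exchange it with \<open>X\<close> (which shifts the
  exponent by the weight of \<open>y\<close>) and then with the powers of \<open>E\<close>. The binomial coefficients of the
  second exchange are absorbed by \<open>rbinom_split\<close>, and what remains is again a power of \<open>1 - E t\<close>.
\<close>

lemma mult_npow:
  assumes "y * X' = X * y"
  shows "fps_const y * npow E X'
    = tseries (\<lambda>j. fps_const ((- 1) ^ j * rbinom X j) * npow E (X + of_nat j) * fps_const (iter_ad E j y))"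
proof (rule fps_ext)
  fix n
  have "fps_nth (fps_const y * npow E X') n = rbinom X n * (y * E ^ n)"
    by (simp add: rbinom_intertwine[OF assms] flip: mult.assoc)
  also have "\<dots> = (\<Sum>k\<le>n. (- 1) ^ k * rbinom X k * (rbinom (X + of_nat k) (n - k) * E ^ (n - k)) * iter_ad E k y)"
    unfolding mult_power_iter_ad[of y E n] sum_distrib_left
  proof (rule sum.cong)
    fix k assume "k \<in> {..n}"
    then have *: "of_nat (n choose k) * rbinom X n = rbinom X k * rbinom (X + of_nat k) (n - k)"
      using rbinom_split[of k "n - k" X] by simp
    have "rbinom X n * (of_nat (n choose k) * (E ^ (n - k) * ((- 1) ^ k * iter_ad E k y)))
        = (- 1) ^ k * (of_nat (n choose k) * rbinom X n * (E ^ (n - k) * iter_ad E k y))"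
      using mult_of_nat_commute[of "n choose k" "rbinom X n"]
      by (cases "even k") (simp_all add: mult.assoc[symmetric])
    then show "rbinom X n * (of_nat (n choose k) * (E ^ (n - k) * ((- 1) ^ k * iter_ad E k y)))
        = (- 1) ^ k * rbinom X k * (rbinom (X + of_nat k) (n - k) * E ^ (n - k)) * iter_ad E k y"
      by (simp only: *) (simp only: mult.assoc)
  qed simp
  finally show "fps_nth (fps_const y * npow E X') n = fps_nth (tseries (\<lambda>j. fps_const ((- 1) ^ j * rbinom X j)
      * npow E (X + of_nat j) * fps_const (iter_ad E j y))) n"
    by simp
qed

text \<open>
  Conjugation by the twist of an element \<open>1 \<otimes> y\<close>, which commutes with \<open>X = T \<otimes> 1\<close>: here \<open>X\<close> and
  \<open>E\<close> commute, so the outer powers collapse to \<open>(1 - E t)\<^sup>-\<^sup>j\<close> in the \<open>j\<close>-th term.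
\<close>

lemma npow_conjugate_right:
  assumes "X * E = E * X" and "X * y = y * X"
  shows "npow E (- X) * fps_const y * npow E X
    = tseries (\<lambda>j. fps_const ((- 1) ^ j * rbinom X j) * npow E (of_nat j) * fps_const (iter_ad E j y))"
proof -
  have 1: "npow E (- X) * fps_const ((- 1) ^ j * rbinom X j) = fps_const ((- 1) ^ j * rbinom X j) * npow E (- X)" for j
  proof (rule fps_ext)
    fix k
    have a: "E ^ k * rbinom X j = rbinom X j * E ^ k"
      using rbinom_intertwine[of "E ^ k" X X j] power_intertwine[of X E E k] assms(1) by simp
    have b: "rbinom (- X) k * rbinom X j = rbinom X j * rbinom (- X) k"
      using rbinom_intertwine[of "rbinom (- X) k" X X j] rbinom_commute[of "- X" X k] by simp
    show "fps_nth (npow E (- X) * fps_const ((- 1) ^ j * rbinom X j)) k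
      = fps_nth (fps_const ((- 1) ^ j * rbinom X j) * npow E (- X)) k"
      by (cases "even j") (simp_all add: mult.assoc a, simp_all add: b flip: mult.assoc)
  qed
  have 2: "npow E (- X) * npow E (X + of_nat j) = npow E (of_nat j)" for j
    by (subst npow_mult) (simp_all add: assms distrib_left distrib_right mult_of_nat_commute)
  show ?thesis
    by (simp only: mult.assoc mult_npow[OF assms(2)[symmetric]] tseries_mult_left)
      (simp only: mult.assoc[symmetric] 1, simp only: mult.assoc[of _ "npow E _" "npow E _"] 2)
qed

text \<open>
  Conjugation by the twist of an element \<open>y \<otimes> 1\<close>: only the weight \<open>r\<close> of \<open>y\<close> matters, and the
  shift of \<open>X\<close> by \<open>r\<close> leaves the factor \<open>(1 - E t)\<^sup>r\<close>.
\<close>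

lemma npow_conjugate_left:
  assumes "X * E = E * X" and "y * E = E * y" and "X * y = y * X + scalar r * y"
  shows "npow E (- X) * fps_const y * npow E X = fps_const y * npow E (- scalar r)"
proof -
  have "y * X = (X - scalar r) * y"
    using assms(3) by (simp add: left_diff_distrib)
  then have 1: "y * rbinom X k = rbinom (X - scalar r) k * y" for k
    by (rule rbinom_intertwine)
  have E: "y * E ^ k = E ^ k * y" for k
    by (rule power_intertwine) (rule assms(2))
  have "fps_const y * npow E X = npow E (X - scalar r) * fps_const y"
    by (rule fps_ext) (simp add: mult.assoc[symmetric] 1, simp add: mult.assoc E)
  then have "npow E (- X) * fps_const y * npow E X = npow E (- X) * npow E (X - scalar r) * fps_const y"
    by (simp add: mult.assoc)
  also have "npow E (- X) * npow E (X - scalar r) = npow E (- scalar r)"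
    by (subst npow_mult)
      (simp_all add: assms(1) algebra_simps, simp_all add: scalar_commute)
  also have "npow E (- scalar r) * fps_const y = fps_const y * npow E (- scalar r)"
  proof (rule fps_ext)
    fix k
    have "rbinom (- scalar r) k * y = y * rbinom (- scalar r) k"
      by (rule rbinom_commute) (simp add: scalar_commute)
    then show "fps_nth (npow E (- scalar r) * fps_const y) k = fps_nth (fps_const y * npow E (- scalar r)) k"
      by (simp add: mult.assoc E[symmetric]) (simp add: mult.assoc[symmetric])
  qed
  finally show ?thesis .
qed

lemma iter_ad_weight:
  fixes T E y :: "'a::complex_algebra"
  assumes TE: "T * E = E * T + E" and Ty: "T * y = y * T + scalar r * y"
  shows "T * iter_ad E j y = iter_ad E j y * T + scalar (r + of_nat j) * iter_ad E j y"
proof (induction j)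
  case (Suc j)
  define z where "z = iter_ad E j y"
  define s where "s = r + of_nat j"
  have z: "T * z = z * T + scalar s * z" using Suc by (simp add: z_def s_def)
  have "T * (E * z) = E * z * T + scalar (s + 1) * (E * z)"
  proof -
    have "T * (E * z) = E * (T * z) + E * z" by (simp add: TE distrib_right flip: mult.assoc)
    also have "\<dots> = E * z * T + scalar (s + 1) * (E * z)"
      by (simp add: z distrib_left distrib_right scalar_add scalar_left_commute mult.assoc)
    finally show ?thesis .
  qed
  moreover have "T * (z * E) = z * E * T + scalar (s + 1) * (z * E)"
  proof -
    have "T * (z * E) = (T * z) * E" by (simp add: mult.assoc)
    also have "\<dots> = z * (T * E) + scalar s * (z * E)" by (simp add: z distrib_right mult.assoc)
    also have "\<dots> = z * E * T + scalar (s + 1) * (z * E)"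
      by (simp add: TE distrib_left distrib_right scalar_add mult.assoc)
    finally show ?thesis .
  qed
  ultimately show ?case
    by (simp add: z_def[symmetric] s_def algebra_simps)
qed (simp add: Ty)

text \<open>
  The factors of the rising factorial in reversed order, with all signs changed.
\<close>

lemma rise_uminus:
  "rise 0 (- T - of_nat j) j = (- 1) ^ j * rise 1 T j"
proof -
  have Suc_left: "rise a X (Suc k) = (X + scalar a) * rise (a + 1) X k" for a :: complex and X :: 'a and k
    using rise_add[of a X 1 k] by simp
  have "rise (a - of_nat k) (- T) k = (- 1) ^ k * rise (1 - a) T k" for a k
  proof (induction k arbitrary: a)
    case (Suc k)
    have c: "rise (1 - a) T k * T = T * rise (1 - a) T k"
      using rise_intertwine[of T T T "1 - a" k] by simp
    have "rise (a - of_nat (Suc k)) (- T) (Suc k)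
        = (- T + scalar (a - of_nat (Suc k))) * rise (a - of_nat (Suc k) + 1) (- T) k"
      by (rule Suc_left)
    also have "a - of_nat (Suc k) + 1 = a - of_nat k" by simp
    also have "(- T + scalar (a - of_nat (Suc k))) = - (T + scalar (1 - a + of_nat k))"
      by (simp add: scalar_add scalar_diff)
    also have "- (T + scalar (1 - a + of_nat k)) * rise (a - of_nat k) (- T) k
        = - ((- 1) ^ k * (rise (1 - a) T k * (T + scalar (1 - a + of_nat k))))"
    proof -
      have "(T + scalar (1 - a + of_nat k)) * rise (1 - a) T k = rise (1 - a) T k * (T + scalar (1 - a + of_nat k))"
        by (simp only: distrib_left distrib_right c scalar_commute)
      then have "- (T + scalar (1 - a + of_nat k)) * ((- 1) ^ k * rise (1 - a) T k)
          = - ((- 1) ^ k * (rise (1 - a) T k * (T + scalar (1 - a + of_nat k))))"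
        by (cases "even k") (simp_all only: simp_thms power_minus_even power_minus_odd power_one mult_1_left mult_minus_left mult_minus_right minus_minus)
      then show ?thesis by (simp only: Suc)
    qed
    finally show ?case by simp
  qed simp
  from this[of 0 j] show ?thesis
    using rise_shift[of 0 "- of_nat j" "- T" j] by (simp add: scalar_uminus)
qed

text \<open>
  The form of \<open>mult_npow\<close> for \<open>[T, E] = E\<close> in which the rising factorials stand on the far right.
  The power of \<open>1 - E t\<close> is the same in all terms, since by \<open>rbinom_exchange\<close> the factor
  \<open>rbinom (r - T) j\<close> can be moved through it unshifted; then it moves past \<open>ad(E)\<^sup>j y\<close>, whose weight
  is \<open>r + j\<close>.
\<close>

lemma mult_npow_weight:
  assumes TE: "T * E = E * T + E" and Ty: "T * y = y * T + scalar r * y"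
  shows "fps_const y * npow E (- T)
    = npow E (scalar r - T) * tseries (\<lambda>j. fps_const (iter_ad E j y * (scalar (1 / fact j) * rise 1 T j)))"
proof -
  have "y * (- T) = (scalar r - T) * y"
    using Ty by (simp add: left_diff_distrib)
  note 1 = mult_npow[OF this, of E]
  have "fps_const ((- 1) ^ j * rbinom (scalar r - T) j) * npow E (scalar r - T + of_nat j) * fps_const (iter_ad E j y)
      = npow E (scalar r - T) * fps_const (iter_ad E j y * (scalar (1 / fact j) * rise 1 T j))" for j
  proof (rule fps_ext)
    fix l
    define X where "X = scalar r - T"
    define z where "z = iter_ad E j y"
    have "E * X = X * E + E"
      by (simp add: X_def left_diff_distrib right_diff_distrib TE scalar_commute)
    note E = E_power_rbinom[OF this]
    have z: "T * z = z * T + scalar (r + of_nat j) * z"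
      unfolding z_def by (rule iter_ad_weight[OF TE Ty])
    then have "z * (- T - of_nat j) = X * z"
      by (simp add: X_def left_diff_distrib right_diff_distrib scalar_add distrib_right mult_of_nat_commute)
    then have "rbinom X j * z = z * rbinom (- T - of_nat j) j"
      by (simp add: rbinom_intertwine)
    also have "rbinom (- T - of_nat j) j = (- 1) ^ j * (scalar (1 / fact j) * rise 1 T j)"
      by (cases "even j") (simp_all add: rbinom_def rise_uminus)
    finally have zz: "(- 1) ^ j * (rbinom X j * z) = z * (scalar (1 / fact j) * rise 1 T j)"
      by (cases "even j") simp_all
    have "(- 1) ^ j * rbinom X j * (rbinom (X + of_nat j) l * E ^ l) * z
        = (- 1) ^ j * (rbinom X j * rbinom (X + of_nat j) l) * E ^ l * z"
      by (simp only: mult.assoc)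
    also have "\<dots> = (- 1) ^ j * (rbinom X l * rbinom (X + of_nat l) j) * E ^ l * z"
      by (simp only: rbinom_exchange)
    also have "\<dots> = (- 1) ^ j * rbinom X l * (E ^ l * rbinom X j) * z"
      by (simp only: E mult.assoc)
    also have "\<dots> = rbinom X l * E ^ l * ((- 1) ^ j * (rbinom X j * z))"
      by (cases "even j") (simp_all add: mult.assoc)
    finally show "fps_nth (fps_const ((- 1) ^ j * rbinom (scalar r - T) j) * npow E (scalar r - T + of_nat j)
        * fps_const (iter_ad E j y)) l
      = fps_nth (npow E (scalar r - T) * fps_const (iter_ad E j y * (scalar (1 / fact j) * rise 1 T j))) l"
      by (simp add: zz flip: X_def z_def)
  qed
  then show ?thesis by (simp only: 1 tseries_mult_left)
qed

text \<open>
  In the antipode \<open>u S\<^sub>0(y) v\<close> the power produced by \<open>v\<close> cancels against \<open>u\<close>, except for the factor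
  \<open>(1 - E t)\<^sup>-\<^sup>r\<close>.
\<close>

lemma npow_antipode_conjugate:
  assumes TE: "T * E = E * T + E" and Ty: "T * y = y * T + scalar r * y"
  shows "npow (- E) (- T) * fps_const y * npow E (- T)
    = npow E (scalar r) * tseries (\<lambda>j. fps_const (iter_ad E j y * (scalar (1 / fact j) * rise 1 T j)))"
proof -
  have "npow E (- T) * npow E (scalar r) = npow E (scalar r - T)"
    by (subst npow_mult) (simp_all add: scalar_commute)
  then have "npow (- E) (- T) * npow E (scalar r - T) = npow (- E) (- T) * npow E (- T) * npow E (scalar r)"
    by (simp add: mult.assoc)
  also have "npow (- E) (- T) * npow E (- T) = 1"
    by (rule npow_uminus_mult) (simp add: TE)
  finally show ?thesis
    by (simp add: mult.assoc mult_npow_weight[OF TE Ty] flip: mult.assoc[of "npow (- E) (- T)" "npow E (scalar r - T)"])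
qed

section \<open>Power series over algebras\<close>

definition sproj :: "(complex, 'a) module \<Rightarrow> 'a alg_prod fps \<Rightarrow> nat \<Rightarrow> 'a" where
  "sproj R f = (\<lambda>k. proj R (fps_nth f k))"

definition semb :: "(complex, 'a) module \<Rightarrow> (nat \<Rightarrow> 'a) \<Rightarrow> 'a alg_prod fps" where
  "semb R f = Abs_fps (\<lambda>k. emb R (f k))"

definition fps_scalar :: "complex fps \<Rightarrow> 'a::complex_algebra fps" where
  "fps_scalar c = Abs_fps (\<lambda>k. scalar (fps_nth c k))"

text \<open>
  The scalars \<open>\<complex>[[t]]\<close> become central elements of the power series ring, so that linearity over
  \<open>\<complex>[[t]]\<close> is a case of associativity.
\<close>

lemma fps_scalar_simps:
  "fps_scalar (c + d) = fps_scalar c + fps_scalar d"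
  "fps_scalar (c * d) = fps_scalar c * fps_scalar d"
  "fps_scalar 1 = 1" "fps_scalar 0 = 0"
  "fps_scalar (fps_const a) = fps_const (scalar a)"
  "fps_scalar fps_X = fps_X"
  "fps_scalar (- c) = - fps_scalar c"
  by (rule fps_ext; simp add: fps_scalar_def scalar_add fps_mult_nth scalar_sum scalar_mult fps_X_def scalar_uminus)+

lemma fps_scalar_commute: "fps_scalar c * f = f * fps_scalar c"
proof (rule fps_ext)
  fix n
  have "(\<Sum>i\<le>n. scalar (fps_nth c i) * fps_nth f (n - i)) = (\<Sum>i\<le>n. fps_nth f i * scalar (fps_nth c (n - i)))"
    by (rule sum.reindex_bij_witness[of _ "\<lambda>i. n - i" "\<lambda>i. n - i"]) (auto simp: scalar_commute)
  then show "fps_nth (fps_scalar c * f) n = fps_nth (f * fps_scalar c) n"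
    by (simp add: fps_scalar_def fps_mult_nth atLeast0AtMost)
qed

lemma pseries_carrier_iff: "f \<in> carrier (pseries R) \<longleftrightarrow> (\<forall>k. f k \<in> carrier R)"
  by (simp add: pseries_def)

context complex_alg
begin

lemma sproj_closed [simp, intro]: "sproj A f \<in> carrier (pseries A)"
  by (simp add: pseries_carrier_iff sproj_def complex_alg_axioms)

lemma sproj_semb [simp]: "f \<in> carrier (pseries A) \<Longrightarrow> sproj A (semb A f) = f"
  by (simp add: sproj_def semb_def pseries_carrier_iff)

lemma pseries_cases:
  assumes "f \<in> carrier (pseries A)" obtains g where "f = sproj A g"
  using assms sproj_semb by metis

lemma sproj_add: "sproj A (f + g) = sproj A f \<oplus>\<^bsub>pseries A\<^esub> sproj A g"
  and sproj_mult: "sproj A (f * g) = sproj A f \<otimes>\<^bsub>pseries A\<^esub> sproj A g"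
  and sproj_zero: "sproj A 0 = \<zero>\<^bsub>pseries A\<^esub>"
  and sproj_one: "sproj A 1 = \<one>\<^bsub>pseries A\<^esub>"
  and sproj_smult: "sproj A (fps_scalar c * f) = c \<odot>\<^bsub>pseries A\<^esub> sproj A f"
  by (auto simp: sproj_def pseries_def fps_mult_nth atLeast0AtMost proj_sum fps_scalar_def
      complex_alg_axioms smult_mult_left intro!: ext finsum_cong)

lemma sproj_const: "sproj A (fps_const x) = const A (proj A x)"
  by (auto simp: sproj_def const_def complex_alg_axioms)

text \<open>
  Every element of \<open>A[[t]]\<close> is the image of a power series over the product of all algebras, whose
  ring laws therefore project to \<open>A[[t]]\<close>.
\<close>

lemma ring_pseries: "ring (pseries A)"
proof -
  have neg: "\<exists>y\<in>carrier (pseries A). y \<oplus>\<^bsub>pseries A\<^esub> x = \<zero>\<^bsub>pseries A\<^esub>" if "x \<in> carrier (pseries A)" for x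
    using that
  proof (cases rule: pseries_cases)
    case (1 g)
    then have "sproj A (- g) \<oplus>\<^bsub>pseries A\<^esub> x = \<zero>\<^bsub>pseries A\<^esub>"
      by (simp flip: sproj_add sproj_zero)
    then show ?thesis by blast
  qed
  show ?thesis
    by (intro ringI abelian_groupI monoidI neg)
      (auto elim!: pseries_cases simp: algebra_simps
        simp flip: sproj_add sproj_zero sproj_mult sproj_one)
qed

end

sublocale complex_alg \<subseteq> S: ring "pseries A" by (rule ring_pseries)

context complex_alg
begin

lemma sproj_uminus: "sproj A (- f) = \<ominus>\<^bsub>pseries A\<^esub> sproj A f"
  by (rule S.minus_equality[symmetric]) (simp_all flip: sproj_add sproj_zero)

lemma sproj_diff: "sproj A (f - g) = sproj A f \<ominus>\<^bsub>pseries A\<^esub> sproj A g"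
  by (simp add: a_minus_def sproj_add flip: sproj_uminus) (simp flip: sproj_add)

end

lemma cring_ring_of_type: "cring (ring_of_type :: 'a::comm_ring_1 ring)"
  by (unfold_locales) (auto simp: ring_of_type_def Units_def algebra_simps intro: exI[of _ "- _"] left_minus right_minus)

lemma (in complex_alg) smult_pseries_closed:
  "f \<in> carrier (pseries A) \<Longrightarrow> c \<odot>\<^bsub>pseries A\<^esub> f \<in> carrier (pseries A)"
  by (erule pseries_cases) (simp flip: sproj_smult)

lemma (in complex_alg) pseries_smult_mult:
  assumes "f \<in> carrier (pseries A)" "g \<in> carrier (pseries A)"
  shows "(c \<odot>\<^bsub>pseries A\<^esub> f) \<otimes>\<^bsub>pseries A\<^esub> g = c \<odot>\<^bsub>pseries A\<^esub> (f \<otimes>\<^bsub>pseries A\<^esub> g)"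
    "f \<otimes>\<^bsub>pseries A\<^esub> (c \<odot>\<^bsub>pseries A\<^esub> g) = c \<odot>\<^bsub>pseries A\<^esub> (f \<otimes>\<^bsub>pseries A\<^esub> g)"
proof -
  from assms obtain f' g' where [simp]: "f = sproj A f'" "g = sproj A g'" by (metis pseries_cases)
  show "(c \<odot>\<^bsub>pseries A\<^esub> f) \<otimes>\<^bsub>pseries A\<^esub> g = c \<odot>\<^bsub>pseries A\<^esub> (f \<otimes>\<^bsub>pseries A\<^esub> g)"
    by (simp add: mult.assoc flip: sproj_mult sproj_smult)
  show "f \<otimes>\<^bsub>pseries A\<^esub> (c \<odot>\<^bsub>pseries A\<^esub> g) = c \<odot>\<^bsub>pseries A\<^esub> (f \<otimes>\<^bsub>pseries A\<^esub> g)"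
    by (simp flip: sproj_mult sproj_smult, simp only: fps_scalar_commute mult.assoc)
qed

lemma (in complex_alg) module_pseries: "Module.module (ring_of_type :: complex fps ring) (pseries A)"
proof (rule moduleI[OF cring_ring_of_type S.is_abelian_group])
  fix a b :: "complex fps" and x y
  assume x: "x \<in> carrier (pseries A)"
  then obtain x' where [simp]: "x = sproj A x'" by (metis pseries_cases)
  show "a \<odot>\<^bsub>pseries A\<^esub> x \<in> carrier (pseries A)" using x by (rule smult_pseries_closed)
  show "(a \<oplus>\<^bsub>ring_of_type\<^esub> b) \<odot>\<^bsub>pseries A\<^esub> x = a \<odot>\<^bsub>pseries A\<^esub> x \<oplus>\<^bsub>pseries A\<^esub> b \<odot>\<^bsub>pseries A\<^esub> x"
    by (simp add: ring_of_type_def fps_scalar_simps distrib_right flip: sproj_add sproj_smult)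
  show "(a \<otimes>\<^bsub>ring_of_type\<^esub> b) \<odot>\<^bsub>pseries A\<^esub> x = a \<odot>\<^bsub>pseries A\<^esub> (b \<odot>\<^bsub>pseries A\<^esub> x)"
    by (simp add: ring_of_type_def fps_scalar_simps mult.assoc flip: sproj_smult)
  show "\<one>\<^bsub>ring_of_type\<^esub> \<odot>\<^bsub>pseries A\<^esub> x = x"
    by (simp add: ring_of_type_def fps_scalar_simps flip: sproj_smult)
  assume y: "y \<in> carrier (pseries A)"
  then obtain y' where [simp]: "y = sproj A y'" by (metis pseries_cases)
  show "a \<odot>\<^bsub>pseries A\<^esub> (x \<oplus>\<^bsub>pseries A\<^esub> y) = a \<odot>\<^bsub>pseries A\<^esub> x \<oplus>\<^bsub>pseries A\<^esub> a \<odot>\<^bsub>pseries A\<^esub> y"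
    by (simp add: distrib_left flip: sproj_add sproj_smult)
qed

section \<open>Linear extension\<close>

definition key_sum :: "('k \<Rightarrow> complex \<Rightarrow> 'v::ab_group_add) \<Rightarrow> ('k \<Rightarrow>\<^sub>0 complex) \<Rightarrow> 'v" where
  "key_sum \<phi> p = (\<Sum>k\<in>Poly_Mapping.keys p. \<phi> k (Poly_Mapping.lookup p k))"

lemma lookup_scale [simp]: "Poly_Mapping.lookup (scale c p) k = c * Poly_Mapping.lookup p k"
  by (simp add: scale_def Poly_Mapping.map.rep_eq when_def)

lemma scale_single [simp]: "scale c (Poly_Mapping.single k a) = Poly_Mapping.single k (c * a)"
  by (rule poly_mapping_eqI) (simp add: lookup_single when_def)

lemma module_scale: "Modules.module scale"
  by unfold_locales (auto intro!: poly_mapping_eqI simp: lookup_add algebra_simps)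

interpretation pm: Modules.module scale by (rule module_scale)

lemma keys_scale: "Poly_Mapping.keys (scale c p) \<subseteq> Poly_Mapping.keys p"
  by (auto simp: in_keys_iff)

text \<open>
  Such a family determines an additive map on the space with basis \<open>'k\<close>, namely its \<open>key_sum\<close>.
\<close>

locale additive_family =
  fixes \<phi> :: "'k \<Rightarrow> complex \<Rightarrow> 'v::ab_group_add"
  assumes family_add: "\<phi> k (a + b) = \<phi> k a + \<phi> k b"
begin

lemma family_0 [simp]: "\<phi> k 0 = 0"
  using family_add[of k 0 0] by simp

lemma key_sum_superset:
  "finite S \<Longrightarrow> Poly_Mapping.keys p \<subseteq> S \<Longrightarrow> key_sum \<phi> p = (\<Sum>k\<in>S. \<phi> k (Poly_Mapping.lookup p k))"
  unfolding key_sum_def by (rule sum.mono_neutral_left) (auto simp: in_keys_iff)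

lemma key_sum_add: "key_sum \<phi> (p + q) = key_sum \<phi> p + key_sum \<phi> q"
proof -
  let ?S = "Poly_Mapping.keys p \<union> Poly_Mapping.keys q"
  have "key_sum \<phi> (p + q) = (\<Sum>k\<in>?S. \<phi> k (Poly_Mapping.lookup (p + q) k))"
    by (rule key_sum_superset) (simp_all add: Poly_Mapping.keys_add)
  also have "\<dots> = (\<Sum>k\<in>?S. \<phi> k (Poly_Mapping.lookup p k)) + (\<Sum>k\<in>?S. \<phi> k (Poly_Mapping.lookup q k))"
    by (simp add: lookup_add family_add sum.distrib)
  finally show ?thesis by (simp add: key_sum_superset[where S = ?S])
qed

lemma key_sum_0 [simp]: "key_sum \<phi> 0 = 0"
  by (simp add: key_sum_def)

lemma key_sum_uminus: "key_sum \<phi> (- p) = - key_sum \<phi> p"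
  using key_sum_add[of p "- p"] by (simp add: eq_neg_iff_add_eq_0 add.commute)

lemma key_sum_diff: "key_sum \<phi> (p - q) = key_sum \<phi> p - key_sum \<phi> q"
  using key_sum_add[of p "- q"] by (simp add: key_sum_uminus)

lemma key_sum_single [simp]: "key_sum \<phi> (Poly_Mapping.single k c) = \<phi> k c"
  by (cases "c = 0") (simp_all add: key_sum_def)

end

lemma poly_mapping_induct [consumes 1, case_names zero single add]:
  assumes "Poly_Mapping.keys p \<subseteq> S" "P 0" "\<And>k c. k \<in> S \<Longrightarrow> P (Poly_Mapping.single k c)"
    "\<And>p q. P p \<Longrightarrow> P q \<Longrightarrow> P (p + q)"
  shows "P (p :: 'k \<Rightarrow>\<^sub>0 complex)"
proof -
  interpret additive_family "Poly_Mapping.single :: 'k \<Rightarrow> complex \<Rightarrow> _"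
    by unfold_locales (rule single_add)
  have "p = (\<Sum>k\<in>Poly_Mapping.keys p. Poly_Mapping.single k (Poly_Mapping.lookup p k))"
    by (rule poly_mapping_eqI) (simp add: lookup_sum lookup_single when_def in_keys_iff sum.delta')
  moreover have "P (\<Sum>k\<in>T. Poly_Mapping.single k (Poly_Mapping.lookup p k))" if "T \<subseteq> S" "finite T" for T
    using that(2,1) by (induction T rule: finite_induct) (auto intro: assms)
  ultimately show ?thesis using assms(1) finite_keys by metis
qed

section \<open>Tensor products\<close>

locale tensor_product = M: complex_alg M + N: complex_alg N
  for M :: "(complex, 'a) module" and N :: "(complex, 'b) module"
begin

abbreviation "cls \<equiv> tensor_class M N"
abbreviation "W \<equiv> tensor_rel M N"
abbreviation "rmult \<equiv> tensor_rep_mult M N"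

definition reps :: "('a \<times> 'b \<Rightarrow>\<^sub>0 complex) set" where
  "reps = {p. Poly_Mapping.keys p \<subseteq> carrier M \<times> carrier N}"

lemma subspace_reps: "pm.subspace reps"
  unfolding reps_def
proof (rule pm.subspaceI)
  fix x y :: "'a \<times> 'b \<Rightarrow>\<^sub>0 complex" and c
  assume "x \<in> {p. Poly_Mapping.keys p \<subseteq> carrier M \<times> carrier N}"
    "y \<in> {p. Poly_Mapping.keys p \<subseteq> carrier M \<times> carrier N}"
  then show "x + y \<in> {p. Poly_Mapping.keys p \<subseteq> carrier M \<times> carrier N}"
    using Poly_Mapping.keys_add[of x y] by auto
next
  fix x :: "'a \<times> 'b \<Rightarrow>\<^sub>0 complex" and c
  assume "x \<in> {p. Poly_Mapping.keys p \<subseteq> carrier M \<times> carrier N}"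
  then show "scale c x \<in> {p. Poly_Mapping.keys p \<subseteq> carrier M \<times> carrier N}"
    using keys_scale[of c x] by auto
qed simp

lemma single_reps [simp]: "x \<in> carrier M \<Longrightarrow> y \<in> carrier N \<Longrightarrow> Poly_Mapping.single (x, y) c \<in> reps"
  by (simp add: reps_def)

lemma reps_closed [simp]:
  "0 \<in> reps" "p \<in> reps \<Longrightarrow> q \<in> reps \<Longrightarrow> p + q \<in> reps" "p \<in> reps \<Longrightarrow> scale c p \<in> reps"
  "p \<in> reps \<Longrightarrow> q \<in> reps \<Longrightarrow> p - q \<in> reps" "p \<in> reps \<Longrightarrow> - p \<in> reps"
  using pm.subspace_0[OF subspace_reps] pm.subspace_add[OF subspace_reps] pm.subspace_scale[OF subspace_reps]
    pm.subspace_diff[OF subspace_reps] pm.subspace_neg[OF subspace_reps]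
  by blast+

lemma reps_induct [consumes 1, case_names zero single add]:
  assumes "p \<in> reps" "P 0"
    "\<And>x y c. x \<in> carrier M \<Longrightarrow> y \<in> carrier N \<Longrightarrow> P (Poly_Mapping.single (x, y) c)"
    "\<And>p q. P p \<Longrightarrow> P q \<Longrightarrow> P (p + q)"
  shows "P p"
  using assms(1) unfolding reps_def mem_Collect_eq
  by (rule poly_mapping_induct) (use assms in auto)

lemma subspace_W: "pm.subspace W"
  by (simp add: tensor_rel_def)

lemma W_closed [simp]:
  "0 \<in> W" "p \<in> W \<Longrightarrow> q \<in> W \<Longrightarrow> p + q \<in> W" "p \<in> W \<Longrightarrow> scale c p \<in> W"
  "p \<in> W \<Longrightarrow> q \<in> W \<Longrightarrow> p - q \<in> W" "p \<in> W \<Longrightarrow> - p \<in> W"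
  using pm.subspace_0[OF subspace_W] pm.subspace_add[OF subspace_W] pm.subspace_scale[OF subspace_W]
    pm.subspace_diff[OF subspace_W] pm.subspace_neg[OF subspace_W]
  by blast+

text \<open>
  The bilinearity relations with an arbitrary coefficient \<open>c\<close>, which is the form in which they occur
  in products.
\<close>

lemma W_gen:
  "x \<in> carrier M \<Longrightarrow> x' \<in> carrier M \<Longrightarrow> y \<in> carrier N \<Longrightarrow>
    Poly_Mapping.single (x \<oplus>\<^bsub>M\<^esub> x', y) c - Poly_Mapping.single (x, y) c - Poly_Mapping.single (x', y) c \<in> W"
  "x \<in> carrier M \<Longrightarrow> y \<in> carrier N \<Longrightarrow> y' \<in> carrier N \<Longrightarrow>
    Poly_Mapping.single (x, y \<oplus>\<^bsub>N\<^esub> y') c - Poly_Mapping.single (x, y) c - Poly_Mapping.single (x, y') c \<in> W"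
  "x \<in> carrier M \<Longrightarrow> y \<in> carrier N \<Longrightarrow>
    Poly_Mapping.single (a \<odot>\<^bsub>M\<^esub> x, y) c - Poly_Mapping.single (x, y) (c * a) \<in> W"
  "x \<in> carrier M \<Longrightarrow> y \<in> carrier N \<Longrightarrow>
    Poly_Mapping.single (x, a \<odot>\<^bsub>N\<^esub> y) c - Poly_Mapping.single (x, y) (c * a) \<in> W"
proof -
  show "Poly_Mapping.single (x \<oplus>\<^bsub>M\<^esub> x', y) c - Poly_Mapping.single (x, y) c - Poly_Mapping.single (x', y) c \<in> W" if "x \<in> carrier M" "x' \<in> carrier M" "y \<in> carrier N"
  proof -
    have "Poly_Mapping.single (x \<oplus>\<^bsub>M\<^esub> x', y) 1 - Poly_Mapping.single (x, y) 1 - Poly_Mapping.single (x', y) 1 \<in> W"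
      unfolding tensor_rel_def by (rule pm.span_base) (use that in blast)
    from W_closed(3)[OF this, of c] show ?thesis by (simp add: pm.scale_right_diff_distrib)
  qed
  show "Poly_Mapping.single (x, y \<oplus>\<^bsub>N\<^esub> y') c - Poly_Mapping.single (x, y) c - Poly_Mapping.single (x, y') c \<in> W" if "x \<in> carrier M" "y \<in> carrier N" "y' \<in> carrier N"
  proof -
    have "Poly_Mapping.single (x, y \<oplus>\<^bsub>N\<^esub> y') 1 - Poly_Mapping.single (x, y) 1 - Poly_Mapping.single (x, y') 1 \<in> W"
      unfolding tensor_rel_def by (rule pm.span_base) (use that in blast)
    from W_closed(3)[OF this, of c] show ?thesis by (simp add: pm.scale_right_diff_distrib)
  qed
  show "Poly_Mapping.single (a \<odot>\<^bsub>M\<^esub> x, y) c - Poly_Mapping.single (x, y) (c * a) \<in> W" if "x \<in> carrier M" "y \<in> carrier N"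
  proof -
    have "Poly_Mapping.single (a \<odot>\<^bsub>M\<^esub> x, y) 1 - Poly_Mapping.single (x, y) a \<in> W"
      unfolding tensor_rel_def by (rule pm.span_base) (use that in blast)
    from W_closed(3)[OF this, of c] show ?thesis by (simp add: pm.scale_right_diff_distrib)
  qed
  show "Poly_Mapping.single (x, a \<odot>\<^bsub>N\<^esub> y) c - Poly_Mapping.single (x, y) (c * a) \<in> W" if "x \<in> carrier M" "y \<in> carrier N"
  proof -
    have "Poly_Mapping.single (x, a \<odot>\<^bsub>N\<^esub> y) 1 - Poly_Mapping.single (x, y) a \<in> W"
      unfolding tensor_rel_def by (rule pm.span_base) (use that in blast)
    from W_closed(3)[OF this, of c] show ?thesis by (simp add: pm.scale_right_diff_distrib)
  qed
qed

lemma W_induct [consumes 1, case_names zero scale add left right smult_left smult_right]: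
  assumes "w \<in> W" "P 0" "\<And>p c. p \<in> W \<Longrightarrow> P p \<Longrightarrow> P (scale c p)" "\<And>p q. P p \<Longrightarrow> P q \<Longrightarrow> P (p + q)"
    "\<And>x x' y. x \<in> carrier M \<Longrightarrow> x' \<in> carrier M \<Longrightarrow> y \<in> carrier N \<Longrightarrow>
      P (Poly_Mapping.single (x \<oplus>\<^bsub>M\<^esub> x', y) 1 - Poly_Mapping.single (x, y) 1 - Poly_Mapping.single (x', y) 1)"
    "\<And>x y y'. x \<in> carrier M \<Longrightarrow> y \<in> carrier N \<Longrightarrow> y' \<in> carrier N \<Longrightarrow>
      P (Poly_Mapping.single (x, y \<oplus>\<^bsub>N\<^esub> y') 1 - Poly_Mapping.single (x, y) 1 - Poly_Mapping.single (x, y') 1)"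
    "\<And>c x y. x \<in> carrier M \<Longrightarrow> y \<in> carrier N \<Longrightarrow>
      P (Poly_Mapping.single (c \<odot>\<^bsub>M\<^esub> x, y) 1 - Poly_Mapping.single (x, y) c)"
    "\<And>c x y. x \<in> carrier M \<Longrightarrow> y \<in> carrier N \<Longrightarrow>
      P (Poly_Mapping.single (x, c \<odot>\<^bsub>N\<^esub> y) 1 - Poly_Mapping.single (x, y) c)"
  shows "P w"
proof -
  define V where "V = W"
  have V: "p \<in> V \<Longrightarrow> scale c p \<in> V" "p \<in> V \<Longrightarrow> q \<in> V \<Longrightarrow> p + q \<in> V" "0 \<in> V" for p q c
    by (simp_all add: V_def)
  note gens = W_gen[where c = 1, folded V_def, unfolded mult_1_left]
  note closed = assms(3)[folded V_def]
  have "w \<in> V \<and> P w"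
    using assms(1) unfolding tensor_rel_def
  proof (rule pm.span_induct_alt)
    show "0 \<in> V \<and> P 0" using assms(2) V by simp
  next
    fix c x y
    assume y: "y \<in> V \<and> P y"
      and x: "x \<in> {Poly_Mapping.single (x \<oplus>\<^bsub>M\<^esub> x', y) 1 - Poly_Mapping.single (x, y) 1 - Poly_Mapping.single (x', y) 1
       | x x' y. x \<in> carrier M \<and> x' \<in> carrier M \<and> y \<in> carrier N} \<union>
      {Poly_Mapping.single (x, y \<oplus>\<^bsub>N\<^esub> y') 1 - Poly_Mapping.single (x, y) 1 - Poly_Mapping.single (x, y') 1
       | x y y'. x \<in> carrier M \<and> y \<in> carrier N \<and> y' \<in> carrier N} \<union>
      {Poly_Mapping.single (c \<odot>\<^bsub>M\<^esub> x, y) 1 - Poly_Mapping.single (x, y) c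
       | c x y. x \<in> carrier M \<and> y \<in> carrier N} \<union>
      {Poly_Mapping.single (x, c \<odot>\<^bsub>N\<^esub> y) 1 - Poly_Mapping.single (x, y) c
       | c x y. x \<in> carrier M \<and> y \<in> carrier N}"
    from x have "x \<in> V \<and> P x"
      by (elim UnE CollectE exE conjE, simp_all only:) (intro conjI gens assms(5-); assumption)+
    with y show "scale c x + y \<in> V \<and> P (scale c x + y)"
      by (intro conjI V assms(4) closed) simp_all
  qed
  then show ?thesis by simp
qed

lemma W_subset_reps: "w \<in> W \<Longrightarrow> w \<in> reps"
  by (induction rule: W_induct) simp_all

subsection \<open>Multiplication of representatives\<close>

definition row :: "'a \<times> 'b \<Rightarrow> complex \<Rightarrow> ('a \<times> 'b \<Rightarrow>\<^sub>0 complex) \<Rightarrow> ('a \<times> 'b \<Rightarrow>\<^sub>0 complex)" where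
  "row k c = key_sum (\<lambda>k' c'. Poly_Mapping.single (fst k \<otimes>\<^bsub>M\<^esub> fst k', snd k \<otimes>\<^bsub>N\<^esub> snd k') (c * c'))"

lemma additive_row:
  "additive_family (\<lambda>k' c'. Poly_Mapping.single (fst k \<otimes>\<^bsub>M\<^esub> fst k', snd k \<otimes>\<^bsub>N\<^esub> snd k') (c * c' :: complex))"
  by unfold_locales (simp add: distrib_left single_add)

lemma row_simps:
  "row k c (p + q) = row k c p + row k c q" "row k c (p - q) = row k c p - row k c q" "row k c 0 = 0"
  "row k c (Poly_Mapping.single k' c') = Poly_Mapping.single (fst k \<otimes>\<^bsub>M\<^esub> fst k', snd k \<otimes>\<^bsub>N\<^esub> snd k') (c * c')"
  unfolding row_def
  by (rule additive_family.key_sum_add[OF additive_row] additive_family.key_sum_diff[OF additive_row]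
      additive_family.key_sum_0[OF additive_row] additive_family.key_sum_single[OF additive_row])+

lemma rmult_eq: "rmult p p' = key_sum (\<lambda>k c. row k c p') p"
  by (simp add: tensor_rep_mult_def key_sum_def row_def case_prod_beta)

lemma additive_rmult: "additive_family (\<lambda>k c. row k c p')"
  by unfold_locales
    (simp add: row_def key_sum_def distrib_right single_add sum.distrib)

lemma rmult_simps:
  "rmult (p + q) p' = rmult p p' + rmult q p'" "rmult (p - q) p' = rmult p p' - rmult q p'" "rmult 0 p' = 0"
  "rmult p (p' + q') = rmult p p' + rmult p q'" "rmult p (p' - q') = rmult p p' - rmult p q'" "rmult p 0 = 0"
  "rmult (Poly_Mapping.single (x, y) c) (Poly_Mapping.single (x', y') c')
    = Poly_Mapping.single (x \<otimes>\<^bsub>M\<^esub> x', y \<otimes>\<^bsub>N\<^esub> y') (c * c')"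
proof -
  show "rmult (p + q) p' = rmult p p' + rmult q p'" "rmult (p - q) p' = rmult p p' - rmult q p'" "rmult 0 p' = 0"
    unfolding rmult_eq
    by (rule additive_family.key_sum_add[OF additive_rmult] additive_family.key_sum_diff[OF additive_rmult]
      additive_family.key_sum_0[OF additive_rmult])+
  show "rmult p (p' + q') = rmult p p' + rmult p q'" "rmult p (p' - q') = rmult p p' - rmult p q'" "rmult p 0 = 0"
    unfolding rmult_eq key_sum_def by (simp_all add: row_simps sum.distrib sum_subtractf)
  show "rmult (Poly_Mapping.single (x, y) c) (Poly_Mapping.single (x', y') c')
    = Poly_Mapping.single (x \<otimes>\<^bsub>M\<^esub> x', y \<otimes>\<^bsub>N\<^esub> y') (c * c')"
    unfolding rmult_eq by (subst additive_family.key_sum_single[OF additive_rmult]) (simp add: row_simps)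
qed

lemma rmult_closed [simp]: "p \<in> reps \<Longrightarrow> q \<in> reps \<Longrightarrow> rmult p q \<in> reps"
proof (induction rule: reps_induct)
  case (single x y c)
  from single(3) show ?case
    by (induction rule: reps_induct) (use single(1,2) in \<open>simp_all add: rmult_simps\<close>)
qed (simp_all add: rmult_simps)

lemma rmult_scale_left: "p \<in> reps \<Longrightarrow> q \<in> reps \<Longrightarrow> rmult (scale c p) q = scale c (rmult p q)"
proof (induction rule: reps_induct)
  case (single x y c)
  from single(3) show ?case
    by (induction rule: reps_induct) (simp_all add: rmult_simps pm.scale_right_distrib mult.assoc)
qed (simp_all add: rmult_simps pm.scale_right_distrib)

lemma rmult_scale_right: "p \<in> reps \<Longrightarrow> q \<in> reps \<Longrightarrow> rmult p (scale c q) = scale c (rmult p q)"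
proof (induction rule: reps_induct)
  case (single x y c)
  from single(3) show ?case
    by (induction rule: reps_induct) (simp_all add: rmult_simps pm.scale_right_distrib mult_ac)
qed (simp_all add: rmult_simps pm.scale_right_distrib)

lemma rmult_assoc: "p \<in> reps \<Longrightarrow> q \<in> reps \<Longrightarrow> s \<in> reps \<Longrightarrow> rmult (rmult p q) s = rmult p (rmult q s)"
proof (induction rule: reps_induct)
  case (single x y c)
  from single(3,4,1,2) show ?case
  proof (induction rule: reps_induct)
    case (single x' y' c')
    from single(3,1,2,4,5) show ?case
      by (induction rule: reps_induct) (simp_all add: rmult_simps M.m_assoc N.m_assoc mult.assoc)
  qed (simp_all add: rmult_simps)
qed (simp_all add: rmult_simps)

lemma rmult_one:
  "p \<in> reps \<Longrightarrow> rmult (Poly_Mapping.single (\<one>\<^bsub>M\<^esub>, \<one>\<^bsub>N\<^esub>) 1) p = p"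
  "p \<in> reps \<Longrightarrow> rmult p (Poly_Mapping.single (\<one>\<^bsub>M\<^esub>, \<one>\<^bsub>N\<^esub>) 1) = p"
  by (induction rule: reps_induct; simp add: rmult_simps)+

lemma rmult_W_left_single:
  assumes "p \<in> reps" "\<And>x y c. x \<in> carrier M \<Longrightarrow> y \<in> carrier N \<Longrightarrow> rmult w (Poly_Mapping.single (x, y) c) \<in> W"
  shows "rmult w p \<in> W"
  using assms(1) by (induction rule: reps_induct) (simp_all add: rmult_simps(4,6) assms(2))

lemma rmult_W_right_single:
  assumes "p \<in> reps" "\<And>x y c. x \<in> carrier M \<Longrightarrow> y \<in> carrier N \<Longrightarrow> rmult (Poly_Mapping.single (x, y) c) w \<in> W"
  shows "rmult p w \<in> W"
  using assms(1) by (induction rule: reps_induct) (simp_all add: rmult_simps(1,3) assms(2))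

text \<open>
  Together with the mirror image below, this says that the bilinearity relations form a two-sided
  ideal among the representatives, so that multiplication is well defined on classes.
\<close>

lemma rmult_W_left: "w \<in> W \<Longrightarrow> p \<in> reps \<Longrightarrow> rmult w p \<in> W"
proof (induction rule: W_induct)
  case (scale w c)
  then show ?case using W_subset_reps[of w] by (simp add: rmult_scale_left)
next
  case (left x x' y)
  from left(4) show ?case
    by (rule rmult_W_left_single) (use left(1-3) in \<open>simp_all add: rmult_simps M.l_distr W_gen\<close>)
next
  case (right x y y')
  from right(4) show ?case
    by (rule rmult_W_left_single) (use right(1-3) in \<open>simp_all add: rmult_simps N.l_distr W_gen\<close>)
next
  case (smult_left a x y)
  from smult_left(3) show ?case
    by (rule rmult_W_left_single) (use smult_left(1-2) in \<open>simp_all add: rmult_simps M.smult_mult_left W_gen mult.commute[of a]\<close>)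
next
  case (smult_right a x y)
  from smult_right(3) show ?case
    by (rule rmult_W_left_single) (use smult_right(1-2) in \<open>simp_all add: rmult_simps N.smult_mult_left W_gen mult.commute[of a]\<close>)
qed (simp_all add: rmult_simps)

lemma rmult_W_right: "w \<in> W \<Longrightarrow> p \<in> reps \<Longrightarrow> rmult p w \<in> W"
proof (induction rule: W_induct)
  case (scale w c)
  then show ?case using W_subset_reps[of w] by (simp add: rmult_scale_right)
next
  case (left x x' y)
  from left(4) show ?case
    by (rule rmult_W_right_single) (use left(1-3) in \<open>simp_all add: rmult_simps M.r_distr W_gen\<close>)
next
  case (right x y y')
  from right(4) show ?case
    by (rule rmult_W_right_single) (use right(1-3) in \<open>simp_all add: rmult_simps N.r_distr W_gen\<close>)
next
  case (smult_left a x y)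
  from smult_left(3) show ?case
    by (rule rmult_W_right_single) (use smult_left(1-2) in \<open>simp_all add: rmult_simps M.smult_mult_right W_gen mult.commute[of a]\<close>)
next
  case (smult_right a x y)
  from smult_right(3) show ?case
    by (rule rmult_W_right_single) (use smult_right(1-2) in \<open>simp_all add: rmult_simps N.smult_mult_right W_gen mult.commute[of a]\<close>)
qed (simp_all add: rmult_simps)

subsection \<open>The algebra of classes\<close>

lemma cls_eq_iff: "cls p = cls q \<longleftrightarrow> p - q \<in> W"
proof
  assume "cls p = cls q"
  moreover have "p \<in> cls p" by (simp add: tensor_class_def)
  ultimately show "p - q \<in> W" by (simp add: tensor_class_def)
next
  assume pq: "p - q \<in> W"
  have "x - p \<in> W \<longleftrightarrow> x - q \<in> W" for x
  proof
    assume "x - p \<in> W"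
    from W_closed(2)[OF this pq] show "x - q \<in> W" by (simp only: add_diff_eq diff_add_cancel)
  next
    assume "x - q \<in> W"
    from W_closed(4)[OF this pq] show "x - p \<in> W" by (simp only: diff_diff_eq2 diff_add_cancel)
  qed
  then show "cls p = cls q" by (simp add: tensor_class_def)
qed

lemma mem_cls: "p' \<in> cls p \<longleftrightarrow> p' - p \<in> W"
  by (simp add: tensor_class_def)

lemma mem_cls_reps: "p' \<in> cls p \<Longrightarrow> p \<in> reps \<Longrightarrow> p' \<in> reps"
  using W_subset_reps[of "p' - p"] reps_closed(2)[of "p' - p" p] by (simp only: mem_cls diff_add_cancel)

abbreviation "T \<equiv> tensor M N"

lemma carrier_T: "carrier T = cls ` reps"
  by (simp add: tensor_def reps_def)

lemma cls_closed [simp]: "p \<in> reps \<Longrightarrow> cls p \<in> carrier T"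
  by (simp add: carrier_T)

lemma T_cases:
  assumes "X \<in> carrier T" obtains p where "p \<in> reps" "X = cls p"
  using assms by (auto simp: carrier_T)

text \<open>
  Operations on classes are unions over all representatives. Such a union has a value by this lemma
  as soon as the result is independent of the representatives.
\<close>

lemma Union_const: "x0 \<in> X \<Longrightarrow> (\<And>x. x \<in> X \<Longrightarrow> f x = c) \<Longrightarrow> (\<Union>x\<in>X. f x) = c"
  by auto

lemma self_mem_cls [simp]: "p \<in> cls p"
  by (simp add: mem_cls)

lemma cls_add: "cls p \<oplus>\<^bsub>T\<^esub> cls q = cls (p + q)"
proof -
  have "cls (p' + q') = cls (p + q)" if "p' \<in> cls p" "q' \<in> cls q" for p' q'
    using W_closed(2)[of "p' - p" "q' - q"] that by (simp only: mem_cls cls_eq_iff add_diff_add)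
  then show ?thesis
    unfolding tensor_def ring.select_convs module.select_convs monoid.select_convs partial_object.select_convs
    by (intro Union_const[OF self_mem_cls]) assumption
qed

lemma cls_mult:
  assumes "p \<in> reps" "q \<in> reps"
  shows "cls p \<otimes>\<^bsub>T\<^esub> cls q = cls (rmult p q)"
proof -
  have "cls (rmult p' q') = cls (rmult p q)" if "p' \<in> cls p" "q' \<in> cls q" for p' q'
  proof -
    have "rmult p' q' - rmult p q = rmult (p' - p) q' + rmult p (q' - q)"
      by (simp add: rmult_simps)
    also have "\<dots> \<in> W"
      using that mem_cls_reps[OF that(2) assms(2)] assms
      by (intro W_closed(2) rmult_W_left rmult_W_right) (simp_all only: mem_cls)
    finally show ?thesis by (simp add: cls_eq_iff)
  qed
  then show ?thesis
    unfolding tensor_def ring.select_convs module.select_convs monoid.select_convs partial_object.select_convs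
    by (intro Union_const[OF self_mem_cls]) assumption
qed

lemma cls_smult: "c \<odot>\<^bsub>T\<^esub> cls p = cls (scale c p)"
proof -
  have "cls (scale c p') = cls (scale c p)" if "p' \<in> cls p" for p'
    using W_closed(3)[of "p' - p" c] that by (simp only: mem_cls cls_eq_iff pm.scale_right_diff_distrib)
  then show ?thesis
    unfolding tensor_def ring.select_convs module.select_convs monoid.select_convs partial_object.select_convs
    by (intro Union_const[OF self_mem_cls]) assumption
qed

lemma one_T: "\<one>\<^bsub>T\<^esub> = cls (Poly_Mapping.single (\<one>\<^bsub>M\<^esub>, \<one>\<^bsub>N\<^esub>) 1)"
  and zero_T: "\<zero>\<^bsub>T\<^esub> = cls 0"
  by (simp_all add: tensor_def)

lemma complex_alg_T: "complex_alg T"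
proof -
  have neg: "\<exists>y\<in>carrier T. y \<oplus>\<^bsub>T\<^esub> x = \<zero>\<^bsub>T\<^esub>" if "x \<in> carrier T" for x
    using that
  proof (cases rule: T_cases)
    case (1 p)
    then have "cls (- p) \<oplus>\<^bsub>T\<^esub> x = \<zero>\<^bsub>T\<^esub>" by (simp add: cls_add zero_T)
    with 1 show ?thesis by (intro bexI[of _ "cls (- p)"]) simp_all
  qed
  have "ring T"
    by (intro ringI abelian_groupI monoidI neg)
      (auto elim!: T_cases simp: cls_add cls_mult zero_T one_T rmult_simps rmult_assoc rmult_one add_ac)
  then show ?thesis
    by (intro complex_alg.intro complex_alg_axioms.intro)
      (auto elim!: T_cases simp: cls_add cls_mult cls_smult pm.scale_right_distrib pm.scale_left_distrib
        rmult_scale_left rmult_scale_right)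
qed

end

sublocale tensor_product \<subseteq> T: complex_alg "tensor M N" by (rule complex_alg_T)

context tensor_product
begin

abbreviation "pure \<equiv> pure_tensor M N"

lemma pure_closed [simp]: "x \<in> carrier M \<Longrightarrow> y \<in> carrier N \<Longrightarrow> pure x y \<in> carrier T"
  by (simp add: pure_tensor_def)

lemma pure_mult:
  "x \<in> carrier M \<Longrightarrow> y \<in> carrier N \<Longrightarrow> x' \<in> carrier M \<Longrightarrow> y' \<in> carrier N \<Longrightarrow>
    pure x y \<otimes>\<^bsub>T\<^esub> pure x' y' = pure (x \<otimes>\<^bsub>M\<^esub> x') (y \<otimes>\<^bsub>N\<^esub> y')"
  by (simp add: pure_tensor_def cls_mult rmult_simps)

lemma pure_one: "\<one>\<^bsub>T\<^esub> = pure \<one>\<^bsub>M\<^esub> \<one>\<^bsub>N\<^esub>"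
  by (simp add: pure_tensor_def one_T)

lemma pure_add_left:
  "x \<in> carrier M \<Longrightarrow> x' \<in> carrier M \<Longrightarrow> y \<in> carrier N \<Longrightarrow> pure (x \<oplus>\<^bsub>M\<^esub> x') y = pure x y \<oplus>\<^bsub>T\<^esub> pure x' y"
  using W_gen(1)[of x x' y 1] by (simp add: pure_tensor_def cls_add cls_eq_iff diff_diff_add)

lemma pure_add_right:
  "x \<in> carrier M \<Longrightarrow> y \<in> carrier N \<Longrightarrow> y' \<in> carrier N \<Longrightarrow> pure x (y \<oplus>\<^bsub>N\<^esub> y') = pure x y \<oplus>\<^bsub>T\<^esub> pure x y'"
  using W_gen(2)[of x y y' 1] by (simp add: pure_tensor_def cls_add cls_eq_iff diff_diff_add)

lemma pure_smult_left: "x \<in> carrier M \<Longrightarrow> y \<in> carrier N \<Longrightarrow> pure (c \<odot>\<^bsub>M\<^esub> x) y = c \<odot>\<^bsub>T\<^esub> pure x y"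
  using W_gen(3)[of x y c 1] by (simp add: pure_tensor_def cls_smult cls_eq_iff)

lemma pure_smult_right: "x \<in> carrier M \<Longrightarrow> y \<in> carrier N \<Longrightarrow> pure x (c \<odot>\<^bsub>N\<^esub> y) = c \<odot>\<^bsub>T\<^esub> pure x y"
  using W_gen(4)[of x y c 1] by (simp add: pure_tensor_def cls_smult cls_eq_iff)

text \<open>
  Scalars are absorbed into the left factor of a pure tensor, so sums suffice.
\<close>

lemma T_induct [consumes 1, case_names pure add]:
  assumes "X \<in> carrier T"
    and pure: "\<And>x y. x \<in> carrier M \<Longrightarrow> y \<in> carrier N \<Longrightarrow> P (pure x y)"
    and add: "\<And>X Y. X \<in> carrier T \<Longrightarrow> Y \<in> carrier T \<Longrightarrow> P X \<Longrightarrow> P Y \<Longrightarrow> P (X \<oplus>\<^bsub>T\<^esub> Y)"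
  shows "P X"
proof -
  obtain p where p: "p \<in> reps" "X = cls p" using assms(1) by (rule T_cases)
  have "cls p \<in> carrier T \<and> P (cls p)"
    using p(1)
  proof (induction rule: reps_induct)
    case zero
    have "cls 0 = pure (0 \<odot>\<^bsub>M\<^esub> \<one>\<^bsub>M\<^esub>) \<one>\<^bsub>N\<^esub>"
      using W_gen(3)[of "\<one>\<^bsub>M\<^esub>" "\<one>\<^bsub>N\<^esub>" 0 1] by (simp add: pure_tensor_def cls_eq_iff)
    then show ?case using pure[of "0 \<odot>\<^bsub>M\<^esub> \<one>\<^bsub>M\<^esub>" "\<one>\<^bsub>N\<^esub>"] by simp
  next
    case (single x y c)
    have "cls (Poly_Mapping.single (x, y) c) = pure (c \<odot>\<^bsub>M\<^esub> x) y"
      using single by (simp add: pure_smult_left) (simp add: pure_tensor_def cls_smult)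
    then show ?case using single pure[of "c \<odot>\<^bsub>M\<^esub> x" y] by simp
  next
    case (add p q)
    then show ?case
      using assms(3)[of "cls p" "cls q"] T.a_closed[of "cls p" "cls q"] by (simp add: cls_add)
  qed
  then show ?thesis using p(2) by simp
qed

end

section \<open>Linear maps and algebra homomorphisms\<close>

lemma linear_map_closed: "linear_map R S h \<Longrightarrow> x \<in> carrier R \<Longrightarrow> h x \<in> carrier S"
  and linear_map_add: "linear_map R S h \<Longrightarrow> x \<in> carrier R \<Longrightarrow> y \<in> carrier R \<Longrightarrow> h (x \<oplus>\<^bsub>R\<^esub> y) = h x \<oplus>\<^bsub>S\<^esub> h y"
  and linear_map_smult: "linear_map R S h \<Longrightarrow> x \<in> carrier R \<Longrightarrow> h (c \<odot>\<^bsub>R\<^esub> x) = c \<odot>\<^bsub>S\<^esub> h x"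
  by (auto simp: linear_map_def)

lemma linear_map_zero:
  assumes "ring R" "ring S" "linear_map R S h" shows "h \<zero>\<^bsub>R\<^esub> = \<zero>\<^bsub>S\<^esub>"
proof -
  interpret R: ring R by fact
  interpret S: ring S by fact
  have "h \<zero>\<^bsub>R\<^esub> \<oplus>\<^bsub>S\<^esub> h \<zero>\<^bsub>R\<^esub> = h \<zero>\<^bsub>R\<^esub>"
    using linear_map_add[OF assms(3), of "\<zero>\<^bsub>R\<^esub>" "\<zero>\<^bsub>R\<^esub>"] by simp
  then show ?thesis
    using linear_map_closed[OF assms(3), of "\<zero>\<^bsub>R\<^esub>"] S.add.l_cancel_one by auto
qed

lemma linear_map_finsum:
  assumes "ring R" "ring S" "linear_map R S h" "finite I" "\<And>i. i \<in> I \<Longrightarrow> f i \<in> carrier R"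
  shows "h (finsum R f I) = finsum S (\<lambda>i. h (f i)) I"
proof -
  interpret R: ring R by fact
  interpret S: ring S by fact
  show ?thesis
    using assms(4,5)
    by (induction I rule: finite_induct)
      (simp_all add: linear_map_zero[OF assms(1-3)] Pi_def R.finsum_insert S.finsum_insert
        linear_map_add[OF assms(3)] linear_map_closed[OF assms(3)])
qed

definition alg_hom :: "('k, 'a) module \<Rightarrow> ('k, 'b) module \<Rightarrow> ('a \<Rightarrow> 'b) \<Rightarrow> bool" where
  "alg_hom R S h \<longleftrightarrow> h \<in> ring_hom R S \<and> linear_map R S h"

lemma alg_hom_simps:
  assumes "alg_hom R S h"
  shows "x \<in> carrier R \<Longrightarrow> h x \<in> carrier S"
    "x \<in> carrier R \<Longrightarrow> y \<in> carrier R \<Longrightarrow> h (x \<oplus>\<^bsub>R\<^esub> y) = h x \<oplus>\<^bsub>S\<^esub> h y"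
    "x \<in> carrier R \<Longrightarrow> y \<in> carrier R \<Longrightarrow> h (x \<otimes>\<^bsub>R\<^esub> y) = h x \<otimes>\<^bsub>S\<^esub> h y"
    "x \<in> carrier R \<Longrightarrow> h (c \<odot>\<^bsub>R\<^esub> x) = c \<odot>\<^bsub>S\<^esub> h x"
    "h \<one>\<^bsub>R\<^esub> = \<one>\<^bsub>S\<^esub>"
  using assms by (auto simp: alg_hom_def linear_map_def ring_hom_def)

lemma alg_homI:
  assumes "\<And>x. x \<in> carrier R \<Longrightarrow> h x \<in> carrier S"
    "\<And>x y. x \<in> carrier R \<Longrightarrow> y \<in> carrier R \<Longrightarrow> h (x \<oplus>\<^bsub>R\<^esub> y) = h x \<oplus>\<^bsub>S\<^esub> h y"
    "\<And>x y. x \<in> carrier R \<Longrightarrow> y \<in> carrier R \<Longrightarrow> h (x \<otimes>\<^bsub>R\<^esub> y) = h x \<otimes>\<^bsub>S\<^esub> h y"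
    "\<And>c x. x \<in> carrier R \<Longrightarrow> h (c \<odot>\<^bsub>R\<^esub> x) = c \<odot>\<^bsub>S\<^esub> h x"
    "h \<one>\<^bsub>R\<^esub> = \<one>\<^bsub>S\<^esub>"
  shows "alg_hom R S h"
  using assms by (auto simp: alg_hom_def linear_map_def ring_hom_def)

lemma alg_hom_linear: "alg_hom R S h \<Longrightarrow> linear_map R S h"
  by (simp add: alg_hom_def)

lemma alg_hom_comp: "alg_hom R S h \<Longrightarrow> alg_hom S P g \<Longrightarrow> alg_hom R P (\<lambda>x. g (h x))"
  by (rule alg_homI) (simp_all add: alg_hom_simps)

lemma linear_map_comp: "linear_map R S h \<Longrightarrow> linear_map S P g \<Longrightarrow> linear_map R P (\<lambda>x. g (h x))"
  by (simp add: linear_map_def Pi_iff)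

section \<open>Coefficientwise extension to power series\<close>

definition coeffwise :: "('a \<Rightarrow> 'b) \<Rightarrow> (nat \<Rightarrow> 'a) \<Rightarrow> nat \<Rightarrow> 'b" where
  "coeffwise h f = (\<lambda>k. h (f k))"

lemma pseries_add: "f \<oplus>\<^bsub>pseries R\<^esub> g = (\<lambda>k. f k \<oplus>\<^bsub>R\<^esub> g k)"
  and pseries_mult: "f \<otimes>\<^bsub>pseries R\<^esub> g = (\<lambda>k. \<Oplus>\<^bsub>R\<^esub>i\<in>{..k}. f i \<otimes>\<^bsub>R\<^esub> g (k - i))"
  and pseries_smult: "c \<odot>\<^bsub>pseries R\<^esub> f = (\<lambda>k. \<Oplus>\<^bsub>R\<^esub>i\<in>{..k}. fps_nth c i \<odot>\<^bsub>R\<^esub> f (k - i))"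
  and pseries_one: "\<one>\<^bsub>pseries R\<^esub> = (\<lambda>k. if k = 0 then \<one>\<^bsub>R\<^esub> else \<zero>\<^bsub>R\<^esub>)"
  and pseries_zero: "\<zero>\<^bsub>pseries R\<^esub> = (\<lambda>k. \<zero>\<^bsub>R\<^esub>)"
  by (simp_all add: pseries_def)

lemma coeffwise_linear:
  assumes "complex_alg R" "complex_alg S" "linear_map R S h"
  shows "linear_map (pseries R) (pseries S) (coeffwise h)"
proof -
  interpret R: complex_alg R by fact
  interpret S: complex_alg S by fact
  note lin = linear_map_closed[OF assms(3)] linear_map_add[OF assms(3)] linear_map_smult[OF assms(3)]
  show ?thesis
    unfolding linear_map_def
    by (auto simp: coeffwise_def pseries_carrier_iff pseries_add pseries_smult lin
        linear_map_finsum[OF R.ring_axioms S.ring_axioms assms(3)] intro!: ext S.finsum_cong)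
qed

lemma coeffwise_alg_hom:
  assumes "complex_alg R" "complex_alg S" "alg_hom R S h"
  shows "alg_hom (pseries R) (pseries S) (coeffwise h)"
proof -
  interpret R: complex_alg R by fact
  interpret S: complex_alg S by fact
  note lin = alg_hom_linear[OF assms(3)]
  note lin' = coeffwise_linear[OF assms(1,2) lin]
  show ?thesis
    by (rule alg_homI)
      (auto simp: linear_map_closed[OF lin'] linear_map_add[OF lin'] linear_map_smult[OF lin'],
       auto simp: coeffwise_def pseries_carrier_iff pseries_mult pseries_one alg_hom_simps[OF assms(3)]
        linear_map_zero[OF R.ring_axioms S.ring_axioms lin]
        linear_map_finsum[OF R.ring_axioms S.ring_axioms lin] intro!: ext S.finsum_cong)
qed

lemma (in complex_alg) const_closed [simp, intro]: "x \<in> carrier A \<Longrightarrow> const A x \<in> carrier (pseries A)"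
  by (simp add: const_def pseries_carrier_iff)

lemma (in complex_alg) const_add:
  "x \<in> carrier A \<Longrightarrow> y \<in> carrier A \<Longrightarrow> const A (x \<oplus> y) = const A x \<oplus>\<^bsub>pseries A\<^esub> const A y"
  by (auto simp: const_def pseries_add)

lemma (in complex_alg) const_mult:
  assumes "x \<in> carrier A" "y \<in> carrier A"
  shows "const A (x \<otimes> y) = const A x \<otimes>\<^bsub>pseries A\<^esub> const A y"
proof -
  have "const A z = sproj A (fps_const (emb A z))" if "z \<in> carrier A" for z
    using that by (simp add: sproj_const)
  then show ?thesis
    using assms by (simp add: emb_mult flip: sproj_mult)
qed

lemma (in complex_alg) smult_fps_const:
  assumes "f \<in> carrier (pseries A)"
  shows "fps_const c \<odot>\<^bsub>pseries A\<^esub> f = (\<lambda>k. c \<odot> f k)"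
proof -
  obtain g where f: "f = sproj A g" using assms by (rule pseries_cases)
  show ?thesis
    unfolding f sproj_smult[symmetric] fps_scalar_simps by (auto simp: sproj_def proj_scalar_mult simp del: proj_simps(6))
qed

lemma (in complex_alg) const_smult:
  "x \<in> carrier A \<Longrightarrow> const A (c \<odot> x) = fps_const c \<odot>\<^bsub>pseries A\<^esub> const A x"
  by (simp add: smult_fps_const[OF const_closed]) (auto simp: const_def)

lemma (in complex_alg) smult_X:
  "f \<in> carrier (pseries A) \<Longrightarrow> fps_X \<odot>\<^bsub>pseries A\<^esub> f = (\<lambda>k. if k = 0 then \<zero> else f (k - 1))"
proof -
  assume "f \<in> carrier (pseries A)"
  then obtain g where f: "f = sproj A g" by (rule pseries_cases)
  show ?thesis
    unfolding f sproj_smult[symmetric] fps_scalar_simps by (auto simp: sproj_def complex_alg_axioms)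
qed

lemma (in complex_alg) pseries_unfold:
  assumes "f \<in> carrier (pseries A)"
  shows "f = const A (f 0) \<oplus>\<^bsub>pseries A\<^esub> fps_X \<odot>\<^bsub>pseries A\<^esub> (\<lambda>k. f (Suc k))"
proof -
  have "(\<lambda>k. f (Suc k)) \<in> carrier (pseries A)" using assms by (simp add: pseries_carrier_iff)
  then show ?thesis
    using assms by (auto simp: smult_X pseries_add const_def pseries_carrier_iff intro!: ext)
qed

text \<open>
  Linearity over \<open>\<complex>[[t]]\<close> implies continuity: \<open>f = f\<^sub>0 + t g\<close> gives \<open>\<phi>(f) = \<phi>(f\<^sub>0) + t \<phi>(g)\<close>, and
  the coefficient of \<open>t\<^sup>n\<close> follows by induction on \<open>n\<close>. In particular \<open>\<phi>\<close> is determined by its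
  values on constant series.
\<close>

lemma linear_map_coeff:
  assumes "complex_alg R" "complex_alg S" and lin: "linear_map (pseries R) (pseries S) \<phi>"
    and "f \<in> carrier (pseries R)"
  shows "\<phi> f n = (\<Oplus>\<^bsub>S\<^esub>k\<in>{..n}. \<phi> (const R (f k)) (n - k))"
proof -
  interpret R: complex_alg R by fact
  interpret S: complex_alg S by fact
  have unfold: "\<phi> f = \<phi> (const R (f 0)) \<oplus>\<^bsub>pseries S\<^esub> fps_X \<odot>\<^bsub>pseries S\<^esub> \<phi> (\<lambda>k. f (Suc k))"
    if f: "f \<in> carrier (pseries R)" for f
  proof -
    have g: "(\<lambda>k. f (Suc k)) \<in> carrier (pseries R)" "const R (f 0) \<in> carrier (pseries R)"
      using f by (simp add: pseries_carrier_iff, intro R.const_closed) (simp add: pseries_carrier_iff)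
    have "\<phi> f = \<phi> (const R (f 0) \<oplus>\<^bsub>pseries R\<^esub> fps_X \<odot>\<^bsub>pseries R\<^esub> (\<lambda>k. f (Suc k)))"
      using R.pseries_unfold[OF f] by simp
    then show ?thesis
      using g by (simp add: linear_map_add[OF lin] linear_map_smult[OF lin] R.smult_pseries_closed)
  qed
  show ?thesis
    using assms(4)
  proof (induction n arbitrary: f)
    case (0 f)
    let ?g = "\<lambda>k. f (Suc k)"
    have g: "?g \<in> carrier (pseries R)" using 0 by (simp add: pseries_carrier_iff)
    have c: "\<phi> (const R (f k)) \<in> carrier (pseries S)" for k
      using 0 by (intro linear_map_closed[OF lin] R.const_closed) (simp add: pseries_carrier_iff)
    have "\<phi> f = \<phi> (const R (f 0)) \<oplus>\<^bsub>pseries S\<^esub> fps_X \<odot>\<^bsub>pseries S\<^esub> \<phi> ?g"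
      by (rule unfold[OF 0])
    then have "\<phi> f 0 = \<phi> (const R (f 0)) 0"
      using c[of 0] linear_map_closed[OF lin g]
      by (simp add: pseries_add S.smult_X) (simp add: pseries_carrier_iff)
    then show ?case using c[of 0] by (simp add: pseries_carrier_iff)
  next
    case (Suc n f)
    let ?g = "\<lambda>k. f (Suc k)"
    have g: "?g \<in> carrier (pseries R)" using Suc.prems by (simp add: pseries_carrier_iff)
    have c: "\<phi> (const R (f k)) \<in> carrier (pseries S)" for k
      using Suc.prems by (intro linear_map_closed[OF lin] R.const_closed) (simp add: pseries_carrier_iff)
    have "\<phi> f = \<phi> (const R (f 0)) \<oplus>\<^bsub>pseries S\<^esub> fps_X \<odot>\<^bsub>pseries S\<^esub> \<phi> ?g"
      by (rule unfold[OF Suc.prems])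
    then have "\<phi> f (Suc n) = \<phi> (const R (f 0)) (Suc n) \<oplus>\<^bsub>S\<^esub> \<phi> ?g n"
      using g by (simp add: pseries_add S.smult_X linear_map_closed[OF lin])
    also have "\<phi> ?g n = (\<Oplus>\<^bsub>S\<^esub>k\<in>{..n}. \<phi> (const R (f (Suc k))) (n - k))"
      by (rule Suc.IH[OF g])
    also have "\<phi> (const R (f 0)) (Suc n) \<oplus>\<^bsub>S\<^esub> (\<Oplus>\<^bsub>S\<^esub>k\<in>{..n}. \<phi> (const R (f (Suc k))) (n - k))
        = (\<Oplus>\<^bsub>S\<^esub>k\<in>{..Suc n}. \<phi> (const R (f k)) (Suc n - k))"
      using c by (subst S.finsum_Suc2) (auto simp: pseries_carrier_iff intro!: S.a_comm S.finsum_closed)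
    finally show ?case .
  qed
qed

lemma linear_map_eqI:
  assumes "complex_alg R" "complex_alg S"
    and "linear_map (pseries R) (pseries S) \<phi>" "linear_map (pseries R) (pseries S) \<psi>"
    and eq: "\<And>x. x \<in> carrier R \<Longrightarrow> \<phi> (const R x) = \<psi> (const R x)"
    and f: "f \<in> carrier (pseries R)"
  shows "\<phi> f = \<psi> f"
proof (rule ext)
  fix n
  show "\<phi> f n = \<psi> f n"
    using f eq by (simp add: linear_map_coeff[OF assms(1-3)] linear_map_coeff[OF assms(1,2,4)] pseries_carrier_iff)
qed

section \<open>Maps out of tensor products\<close>

locale bilinear_map = tensor_product M N + C: complex_alg C
  for M :: "(complex, 'a) module" and N :: "(complex, 'b) module" and C :: "(complex, 'c) module" +
  fixes \<beta> :: "'a \<Rightarrow> 'b \<Rightarrow> 'c"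
  assumes linear_left: "y \<in> carrier N \<Longrightarrow> linear_map M C (\<lambda>x. \<beta> x y)"
    and linear_right: "x \<in> carrier M \<Longrightarrow> linear_map N C (\<lambda>y. \<beta> x y)"
begin

lemma \<beta>_simps:
  "x \<in> carrier M \<Longrightarrow> y \<in> carrier N \<Longrightarrow> \<beta> x y \<in> carrier C"
  "x \<in> carrier M \<Longrightarrow> x' \<in> carrier M \<Longrightarrow> y \<in> carrier N \<Longrightarrow> \<beta> (x \<oplus>\<^bsub>M\<^esub> x') y = \<beta> x y \<oplus>\<^bsub>C\<^esub> \<beta> x' y"
  "x \<in> carrier M \<Longrightarrow> y \<in> carrier N \<Longrightarrow> y' \<in> carrier N \<Longrightarrow> \<beta> x (y \<oplus>\<^bsub>N\<^esub> y') = \<beta> x y \<oplus>\<^bsub>C\<^esub> \<beta> x y'"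
  "x \<in> carrier M \<Longrightarrow> y \<in> carrier N \<Longrightarrow> \<beta> (c \<odot>\<^bsub>M\<^esub> x) y = c \<odot>\<^bsub>C\<^esub> \<beta> x y"
  "x \<in> carrier M \<Longrightarrow> y \<in> carrier N \<Longrightarrow> \<beta> x (c \<odot>\<^bsub>N\<^esub> y) = c \<odot>\<^bsub>C\<^esub> \<beta> x y"
  using linear_left linear_right by (auto simp: linear_map_def Pi_iff)

definition term_of :: "'a \<times> 'b \<Rightarrow> complex \<Rightarrow> 'c alg_prod" where
  "term_of k c = scalar c * emb C (\<beta> (fst k) (snd k))"

sublocale terms: additive_family term_of
  by unfold_locales (simp add: term_of_def scalar_add distrib_right)

lemma key_sum_scale: "key_sum term_of (scale c p) = scalar c * key_sum term_of p"
proof -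
  have "key_sum term_of (scale c p) = (\<Sum>k\<in>Poly_Mapping.keys p. term_of k (Poly_Mapping.lookup (scale c p) k))"
    by (rule terms.key_sum_superset) (simp_all add: keys_scale)
  then show ?thesis
    by (simp add: key_sum_def term_of_def scalar_mult sum_distrib_left mult.assoc)
qed

lemma key_sum_W: "w \<in> W \<Longrightarrow> key_sum term_of w = 0"
  by (induction rule: W_induct)
    (simp_all add: terms.key_sum_add terms.key_sum_diff key_sum_scale,
     simp_all add: term_of_def \<beta>_simps C.emb_simps)

text \<open>
  A bilinear map extends to representatives, where it kills the bilinearity relations; the value on
  a class may be computed at any representative.
\<close>

definition tlift :: "('a \<times> 'b \<Rightarrow>\<^sub>0 complex) set \<Rightarrow> 'c" where
  "tlift X = proj C (key_sum term_of (SOME p. p \<in> X))"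

lemma tlift_cls: "tlift (cls p) = proj C (key_sum term_of p)"
proof -
  have "(SOME q. q \<in> cls p) \<in> cls p" by (rule someI[of _ p]) simp
  then have "(SOME q. q \<in> cls p) - p \<in> W" by (simp only: mem_cls)
  from key_sum_W[OF this] show ?thesis by (simp add: tlift_def terms.key_sum_diff)
qed

lemma tlift_pure: "x \<in> carrier M \<Longrightarrow> y \<in> carrier N \<Longrightarrow> tlift (pure x y) = \<beta> x y"
  by (simp add: pure_tensor_def tlift_cls term_of_def \<beta>_simps)

lemma tlift_linear: "linear_map T C tlift"
  unfolding linear_map_def
  by (auto elim!: T_cases simp: cls_add cls_smult tlift_cls terms.key_sum_add key_sum_scale
      C.complex_alg_axioms C.proj_scalar_mult simp del: proj_simps(6))

end

context tensor_product
begin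

text \<open>
  The universal property of the tensor product of algebras: homomorphisms with commuting images
  factor through it.
\<close>

lemma hom_exists:
  assumes "complex_alg C" and \<phi>: "alg_hom M C \<phi>" and \<psi>: "alg_hom N C \<psi>"
    and comm: "\<And>x y. x \<in> carrier M \<Longrightarrow> y \<in> carrier N \<Longrightarrow> \<phi> x \<otimes>\<^bsub>C\<^esub> \<psi> y = \<psi> y \<otimes>\<^bsub>C\<^esub> \<phi> x"
  shows "\<exists>h. alg_hom T C h \<and> (\<forall>x\<in>carrier M. \<forall>y\<in>carrier N. h (pure x y) = \<phi> x \<otimes>\<^bsub>C\<^esub> \<psi> y)"
proof -
  interpret C: complex_alg C by fact
  note homs = alg_hom_simps[OF \<phi>] alg_hom_simps[OF \<psi>]
  interpret bilinear_map M N C "\<lambda>x y. \<phi> x \<otimes>\<^bsub>C\<^esub> \<psi> y"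
    by unfold_locales
      (auto simp: linear_map_def homs C.l_distr C.r_distr C.smult_mult_left C.smult_mult_right)
  have mult: "tlift (X \<otimes>\<^bsub>T\<^esub> Y) = tlift X \<otimes>\<^bsub>C\<^esub> tlift Y" if X: "X \<in> carrier T" and Y: "Y \<in> carrier T" for X Y
    using X
  proof (induction rule: T_induct)
    case (pure x y)
    show ?case using Y
    proof (induction rule: T_induct)
      case (pure x' y')
      have "\<phi> x \<otimes>\<^bsub>C\<^esub> \<phi> x' \<otimes>\<^bsub>C\<^esub> (\<psi> y \<otimes>\<^bsub>C\<^esub> \<psi> y') = \<phi> x \<otimes>\<^bsub>C\<^esub> (\<phi> x' \<otimes>\<^bsub>C\<^esub> \<psi> y) \<otimes>\<^bsub>C\<^esub> \<psi> y'"
        using pure \<open>x \<in> _\<close> \<open>y \<in> _\<close> by (simp add: C.m_assoc homs)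
      also have "\<phi> x' \<otimes>\<^bsub>C\<^esub> \<psi> y = \<psi> y \<otimes>\<^bsub>C\<^esub> \<phi> x'"
        using pure \<open>y \<in> _\<close> by (simp add: comm)
      also have "\<phi> x \<otimes>\<^bsub>C\<^esub> (\<psi> y \<otimes>\<^bsub>C\<^esub> \<phi> x') \<otimes>\<^bsub>C\<^esub> \<psi> y' = \<phi> x \<otimes>\<^bsub>C\<^esub> \<psi> y \<otimes>\<^bsub>C\<^esub> (\<phi> x' \<otimes>\<^bsub>C\<^esub> \<psi> y')"
        using pure \<open>x \<in> _\<close> \<open>y \<in> _\<close> by (simp add: C.m_assoc homs)
      finally show ?case
        using pure \<open>x \<in> _\<close> \<open>y \<in> _\<close> by (simp add: pure_mult tlift_pure homs)
    next
      case (add X Y)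
      with pure show ?case
        by (simp add: T.r_distr linear_map_add[OF tlift_linear] linear_map_closed[OF tlift_linear] C.r_distr)
    qed
  next
    case (add X' Y')
    with Y show ?case
      by (simp add: T.l_distr linear_map_add[OF tlift_linear] linear_map_closed[OF tlift_linear] C.l_distr)
  qed
  have "alg_hom T C tlift"
  proof (rule alg_homI)
    show "tlift \<one>\<^bsub>T\<^esub> = \<one>\<^bsub>C\<^esub>" by (simp add: pure_one tlift_pure homs)
  qed (use mult tlift_linear in \<open>auto simp: linear_map_def\<close>)
  then show ?thesis using tlift_pure by blast
qed

definition inl :: "'a \<Rightarrow> ('a \<times> 'b \<Rightarrow>\<^sub>0 complex) set" where "inl x = pure x \<one>\<^bsub>N\<^esub>"
definition inr :: "'b \<Rightarrow> ('a \<times> 'b \<Rightarrow>\<^sub>0 complex) set" where "inr y = pure \<one>\<^bsub>M\<^esub> y"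

lemma inl_hom: "alg_hom M T inl"
  by (rule alg_homI) (simp_all add: inl_def pure_add_left pure_mult pure_smult_left pure_one)

lemma inr_hom: "alg_hom N T inr"
  by (rule alg_homI) (simp_all add: inr_def pure_add_right pure_mult pure_smult_right pure_one)

lemma inl_inr: "x \<in> carrier M \<Longrightarrow> y \<in> carrier N \<Longrightarrow> inl x \<otimes>\<^bsub>T\<^esub> inr y = pure x y"
  and inr_inl: "x \<in> carrier M \<Longrightarrow> y \<in> carrier N \<Longrightarrow> inr y \<otimes>\<^bsub>T\<^esub> inl x = pure x y"
  by (simp_all add: inl_def inr_def pure_mult)

abbreviation "sinl \<equiv> coeffwise inl"
abbreviation "sinr \<equiv> coeffwise inr"

lemmas sinl_hom = coeffwise_alg_hom[OF M.complex_alg_axioms complex_alg_T inl_hom]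
lemmas sinr_hom = coeffwise_alg_hom[OF N.complex_alg_axioms complex_alg_T inr_hom]

lemma ctensor_eq:
  "f \<in> carrier (pseries M) \<Longrightarrow> g \<in> carrier (pseries N) \<Longrightarrow> ctensor M N f g = sinl f \<otimes>\<^bsub>pseries T\<^esub> sinr g"
  by (auto simp: ctensor_def pseries_mult coeffwise_def pseries_carrier_iff inl_inr intro!: ext T.finsum_cong)

lemma sinl_sinr_closed:
  "f \<in> carrier (pseries M) \<Longrightarrow> sinl f \<in> carrier (pseries T)" "g \<in> carrier (pseries N) \<Longrightarrow> sinr g \<in> carrier (pseries T)"
  by (simp_all add: alg_hom_simps[OF sinl_hom] alg_hom_simps[OF sinr_hom])

lemma ctensor_linear_left: "g \<in> carrier (pseries N) \<Longrightarrow> linear_map (pseries M) (pseries T) (\<lambda>f. ctensor M N f g)"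
  unfolding linear_map_def
  by (auto simp: ctensor_eq M.smult_pseries_closed alg_hom_simps[OF sinl_hom] alg_hom_simps[OF sinr_hom]
      T.S.l_distr T.pseries_smult_mult)

lemma ctensor_linear_right: "f \<in> carrier (pseries M) \<Longrightarrow> linear_map (pseries N) (pseries T) (\<lambda>g. ctensor M N f g)"
  unfolding linear_map_def
  by (auto simp: ctensor_eq N.smult_pseries_closed alg_hom_simps[OF sinl_hom] alg_hom_simps[OF sinr_hom]
      T.S.r_distr T.pseries_smult_mult)

lemma ctensor_const:
  "x \<in> carrier M \<Longrightarrow> y \<in> carrier N \<Longrightarrow> ctensor M N (const M x) (const N y) = const T (pure x y)"
proof -
  assume xy: "x \<in> carrier M" "y \<in> carrier N"
  have zero: "inl \<zero>\<^bsub>M\<^esub> = \<zero>\<^bsub>T\<^esub>" "inr \<zero>\<^bsub>N\<^esub> = \<zero>\<^bsub>T\<^esub>"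
    using linear_map_zero[OF M.ring_axioms T.ring_axioms alg_hom_linear[OF inl_hom]]
      linear_map_zero[OF N.ring_axioms T.ring_axioms alg_hom_linear[OF inr_hom]] by simp_all
  have "sinl (const M x) = const T (inl x)" "sinr (const N y) = const T (inr y)"
    by (auto simp: coeffwise_def const_def zero intro!: ext)
  then show ?thesis
    using xy by (simp add: ctensor_eq M.const_closed N.const_closed inl_inr
        alg_hom_simps[OF inl_hom] alg_hom_simps[OF inr_hom] flip: T.const_mult)
qed

lemma linear_map_ctensor_eqI:
  assumes "complex_alg C"
    and \<phi>: "linear_map (pseries T) (pseries C) \<phi>" and \<psi>: "linear_map (pseries T) (pseries C) \<psi>"
    and eq: "\<And>f g. f \<in> carrier (pseries M) \<Longrightarrow> g \<in> carrier (pseries N) \<Longrightarrow> \<phi> (ctensor M N f g) = \<psi> (ctensor M N f g)"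
    and X: "X \<in> carrier (pseries T)"
  shows "\<phi> X = \<psi> X"
proof -
  interpret C: complex_alg C by fact
  have "\<phi> (const T x) = \<psi> (const T x)" if "x \<in> carrier T" for x
    using that
  proof (induction rule: T_induct)
    case (pure x y)
    then show ?case using eq[of "const M x" "const N y"] by (simp add: ctensor_const)
  next
    case (add x y)
    then show ?case
      by (simp add: T.const_add linear_map_add[OF \<phi>] linear_map_add[OF \<psi>])
  qed
  then show ?thesis
    by (rule linear_map_eqI[OF complex_alg_T assms(1) \<phi> \<psi> _ X])
qed

text \<open>
  The lift is a choice, but a unique one. A map that is known to have the right values on pure
  tensors can thus replace it, and no property of the choice is used elsewhere.
\<close>

lemma ctensor_lift_eq:
  assumes "complex_alg C"
    and \<phi>: "linear_map (pseries T) (pseries C) \<phi>"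
    and eq: "\<And>f g. f \<in> carrier (pseries M) \<Longrightarrow> g \<in> carrier (pseries N) \<Longrightarrow> \<phi> (ctensor M N f g) = \<beta> f g"
    and X: "X \<in> carrier (pseries T)"
  shows "ctensor_lift M N (pseries C) \<beta> X = \<phi> X"
proof -
  let ?P = "\<lambda>\<phi>. linear_map (pseries T) (pseries C) \<phi> \<and>
    (\<forall>f\<in>carrier (pseries M). \<forall>g\<in>carrier (pseries N). \<phi> (ctensor M N f g) = \<beta> f g)"
  have "?P (ctensor_lift M N (pseries C) \<beta>)"
    unfolding ctensor_lift_def by (rule someI[of ?P \<phi>]) (simp add: \<phi> eq)
  then show ?thesis
    by (intro linear_map_ctensor_eqI[OF assms(1) _ \<phi> _ X]) (simp_all add: eq)
qed

text \<open>
  For each \<open>n\<close> the coefficient of \<open>t\<^sup>n\<close> of \<open>\<beta>\<close> on constants is a bilinear map over \<open>\<complex>\<close> and factors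
  through a linear map \<open>l\<^sub>n\<close> on \<open>M \<otimes> N\<close>. The lift is \<open>X \<mapsto> \<Sum>\<^sub>n\<^sub>,\<^sub>k l\<^sub>n(X\<^sub>k) t\<^sup>n\<^sup>+\<^sup>k\<close>; it agrees with
  \<open>\<beta>\<close> on all pairs of series because it does so on constants.
\<close>

lemma bilinear_lift_exists:
  assumes "complex_alg C"
    and left: "\<And>g. g \<in> carrier (pseries N) \<Longrightarrow> linear_map (pseries M) (pseries C) (\<lambda>f. \<beta> f g)"
    and right: "\<And>f. f \<in> carrier (pseries M) \<Longrightarrow> linear_map (pseries N) (pseries C) (\<lambda>g. \<beta> f g)"
  shows "\<exists>\<phi>. linear_map (pseries T) (pseries C) \<phi> \<and>
    (\<forall>f\<in>carrier (pseries M). \<forall>g\<in>carrier (pseries N). \<phi> (ctensor M N f g) = \<beta> f g)"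
proof -
  interpret C: complex_alg C by fact
  have "\<exists>l. linear_map T C l \<and> (\<forall>x\<in>carrier M. \<forall>y\<in>carrier N. l (pure x y) = \<beta> (const M x) (const N y) n)" for n
  proof -
    interpret bilinear_map M N C "\<lambda>x y. \<beta> (const M x) (const N y) n"
    proof
      fix y assume y: "y \<in> carrier N"
      note l = left[OF N.const_closed[OF y]]
      show "linear_map M C (\<lambda>x. \<beta> (const M x) (const N y) n)"
        unfolding linear_map_def
      proof (intro conjI ballI allI funcsetI)
        fix z assume z: "z \<in> carrier M"
        then have c: "\<beta> (const M z) (const N y) \<in> carrier (pseries C)" by (intro linear_map_closed[OF l] M.const_closed)
        then show "\<beta> (const M z) (const N y) n \<in> carrier C" by (simp add: pseries_carrier_iff)
        show "\<beta> (const M (c \<odot>\<^bsub>M\<^esub> z)) (const N y) n = c \<odot>\<^bsub>C\<^esub> \<beta> (const M z) (const N y) n" for c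
          using z c by (simp add: M.const_smult linear_map_smult[OF l] M.const_closed C.smult_fps_const)
        show "\<beta> (const M (z \<oplus>\<^bsub>M\<^esub> z')) (const N y) n = \<beta> (const M z) (const N y) n \<oplus>\<^bsub>C\<^esub> \<beta> (const M z') (const N y) n" if "z' \<in> carrier M" for z'
          using z that by (simp add: M.const_add linear_map_add[OF l] M.const_closed) (simp add: pseries_add)
      qed
    next
      fix x assume x: "x \<in> carrier M"
      note l = right[OF M.const_closed[OF x]]
      show "linear_map N C (\<lambda>y. \<beta> (const M x) (const N y) n)"
        unfolding linear_map_def
      proof (intro conjI ballI allI funcsetI)
        fix z assume z: "z \<in> carrier N"
        then have c: "\<beta> (const M x) (const N z) \<in> carrier (pseries C)" by (intro linear_map_closed[OF l] N.const_closed)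
        then show "\<beta> (const M x) (const N z) n \<in> carrier C" by (simp add: pseries_carrier_iff)
        show "\<beta> (const M x) (const N (c \<odot>\<^bsub>N\<^esub> z)) n = c \<odot>\<^bsub>C\<^esub> \<beta> (const M x) (const N z) n" for c
          using z c by (simp add: N.const_smult linear_map_smult[OF l] N.const_closed C.smult_fps_const)
        show "\<beta> (const M x) (const N (z \<oplus>\<^bsub>N\<^esub> z')) n = \<beta> (const M x) (const N z) n \<oplus>\<^bsub>C\<^esub> \<beta> (const M x) (const N z') n" if "z' \<in> carrier N" for z'
          using z that by (simp add: N.const_add linear_map_add[OF l] N.const_closed) (simp add: pseries_add)
      qed
    qed
    show ?thesis using tlift_linear tlift_pure by blast
  qed
  then obtain l where l: "\<And>n. linear_map T C (l n)"
    and l_pure: "\<And>n x y. x \<in> carrier M \<Longrightarrow> y \<in> carrier N \<Longrightarrow> l n (pure x y) = \<beta> (const M x) (const N y) n"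
    by metis
  note l_simps = linear_map_closed[OF l] linear_map_add[OF l] linear_map_smult[OF l]
  define \<phi> where "\<phi> X n = (\<Oplus>\<^bsub>C\<^esub>k\<in>{..n}. l (n - k) (X k))" for X n
  have lin: "linear_map (pseries T) (pseries C) \<phi>"
    unfolding linear_map_def
  proof (intro conjI ballI allI)
    show "\<phi> \<in> carrier (pseries T) \<rightarrow> carrier (pseries C)"
      by (auto simp: pseries_carrier_iff \<phi>_def l_simps)
    fix X assume X: "X \<in> carrier (pseries T)"
    then have X': "X k \<in> carrier T" for k by (simp add: pseries_carrier_iff)
    {
      fix Y assume "Y \<in> carrier (pseries T)"
      then show "\<phi> (X \<oplus>\<^bsub>pseries T\<^esub> Y) = \<phi> X \<oplus>\<^bsub>pseries C\<^esub> \<phi> Y"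
        using X' by (auto simp: pseries_carrier_iff \<phi>_def pseries_add l_simps Pi_def C.finsum_addf)
    }
    fix c
    show "\<phi> (c \<odot>\<^bsub>pseries T\<^esub> X) = c \<odot>\<^bsub>pseries C\<^esub> \<phi> X"
    proof
      fix n
      \<comment> \<open>both sides are sums over i + k + m = n of c_i times the m-th map at X_k\<close>
      define h where "h i k m = scalar (fps_nth c i) * emb C (l m (X k))" for i k m
      have "emb C (\<phi> (c \<odot>\<^bsub>pseries T\<^esub> X) n) = (\<Sum>k=0..n. \<Sum>i=0..k. h i (k - i) (n - k))"
        using X' by (simp add: \<phi>_def pseries_smult C.emb_finsum l_simps h_def C.emb_smult atLeast0AtMost
            linear_map_finsum[OF T.ring_axioms C.ring_axioms l])
      also have "\<dots> = (\<Sum>i=0..n. \<Sum>k=0..n - i. h i k (n - i - k))"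
        by (rule fps_mult_assoc_lemma)
      also have "\<dots> = emb C ((c \<odot>\<^bsub>pseries C\<^esub> \<phi> X) n)"
        using X' by (simp add: \<phi>_def pseries_smult C.emb_finsum l_simps h_def C.emb_smult atLeast0AtMost
            sum_distrib_left)
      finally show "\<phi> (c \<odot>\<^bsub>pseries T\<^esub> X) n = (c \<odot>\<^bsub>pseries C\<^esub> \<phi> X) n"
        using X' by (subst (asm) C.emb_inject) (auto simp: \<phi>_def pseries_smult l_simps)
    qed
  qed
  have \<phi>_const: "\<phi> (const T (pure x y)) = \<beta> (const M x) (const N y)" if xy: "x \<in> carrier M" "y \<in> carrier N" for x y
  proof
    fix n
    have "l m \<zero>\<^bsub>T\<^esub> = \<zero>\<^bsub>C\<^esub>" for m by (rule linear_map_zero[OF T.ring_axioms C.ring_axioms l])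
    then have "\<phi> (const T (pure x y)) n = (\<Oplus>\<^bsub>C\<^esub>k\<in>{..n}. if k = 0 then l n (pure x y) else \<zero>\<^bsub>C\<^esub>)"
      using xy unfolding \<phi>_def by (intro C.finsum_cong') (auto simp: const_def l_simps)
    also have "\<dots> = l n (pure x y)"
      using C.finsum_singleton[of 0 "{..n}" "\<lambda>_. l n (pure x y)"] xy by (simp add: l_simps eq_commute)
    finally show "\<phi> (const T (pure x y)) n = \<beta> (const M x) (const N y) n" using xy by (simp add: l_pure)
  qed
  have "\<phi> (ctensor M N f g) = \<beta> f g" if f: "f \<in> carrier (pseries M)" and g: "g \<in> carrier (pseries N)" for f g
  proof -
    have *: "\<phi> (ctensor M N f (const N y)) = \<beta> f (const N y)" if y: "y \<in> carrier N" for y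
    proof (rule linear_map_eqI[OF M.complex_alg_axioms assms(1) _ left[OF N.const_closed[OF y]] _ f])
      show "linear_map (pseries M) (pseries C) (\<lambda>f. \<phi> (ctensor M N f (const N y)))"
        by (rule linear_map_comp[OF ctensor_linear_left lin]) (simp add: y)
      show "\<And>x. x \<in> carrier M \<Longrightarrow> \<phi> (ctensor M N (const M x) (const N y)) = \<beta> (const M x) (const N y)"
        using y by (simp add: ctensor_const \<phi>_const)
    qed
    show ?thesis
      by (rule linear_map_eqI[OF N.complex_alg_axioms assms(1)
            linear_map_comp[OF ctensor_linear_right[OF f] lin] right[OF f] * g])
  qed
  with lin show ?thesis by blast
qed

end

section \<open>Opposite algebras and the ground field\<close>

text \<open>
  The antipode reverses products. It is treated as a homomorphism to the opposite algebra, so that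
  the universal property of the enveloping algebra applies to it.
\<close>

definition opposite :: "('k, 'a) module \<Rightarrow> ('k, 'a) module" where
  "opposite A = A\<lparr>mult := (\<lambda>x y. y \<otimes>\<^bsub>A\<^esub> x)\<rparr>"

lemma opposite_simps [simp]:
  "carrier (opposite A) = carrier A" "x \<otimes>\<^bsub>opposite A\<^esub> y = y \<otimes>\<^bsub>A\<^esub> x" "\<one>\<^bsub>opposite A\<^esub> = \<one>\<^bsub>A\<^esub>"
  "\<zero>\<^bsub>opposite A\<^esub> = \<zero>\<^bsub>A\<^esub>" "x \<oplus>\<^bsub>opposite A\<^esub> y = x \<oplus>\<^bsub>A\<^esub> y" "c \<odot>\<^bsub>opposite A\<^esub> x = c \<odot>\<^bsub>A\<^esub> x"
  by (simp_all add: opposite_def)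

lemma (in complex_alg) complex_alg_opposite: "complex_alg (opposite A)"
proof -
  have "\<exists>y\<in>carrier A. y \<oplus> x = \<zero>" if "x \<in> carrier A" for x
    using that by (intro bexI[of _ "\<ominus> x"]) (simp_all add: l_neg)
  then have "ring (opposite A)"
    by (intro ringI abelian_groupI monoidI) (simp_all add: ring_simprules)
  then show ?thesis
    by (intro complex_alg.intro complex_alg_axioms.intro)
      (simp_all add: smult_r_distr smult_l_distr smult_assoc smult_mult_left smult_mult_right)
qed

definition complex_field :: "(complex, complex) module" where
  "complex_field = \<lparr>carrier = UNIV, mult = (*), one = 1, zero = 0, add = (+), smult = (*)\<rparr>"

lemma complex_field_simps [simp]:
  "carrier complex_field = UNIV" "x \<otimes>\<^bsub>complex_field\<^esub> y = x * y" "\<one>\<^bsub>complex_field\<^esub> = 1"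
  "\<zero>\<^bsub>complex_field\<^esub> = 0" "x \<oplus>\<^bsub>complex_field\<^esub> y = x + y" "c \<odot>\<^bsub>complex_field\<^esub> x = c * x"
  by (simp_all add: complex_field_def)

lemma complex_alg_complex_field: "complex_alg complex_field"
proof -
  have "\<exists>y. y + x = 0" for x :: complex by (rule exI[of _ "- x"]) simp
  then have "ring complex_field"
    by (intro ringI abelian_groupI monoidI) (simp_all add: algebra_simps)
  then show ?thesis
    by (intro complex_alg.intro complex_alg_axioms.intro) (simp_all add: algebra_simps)
qed

section \<open>Universal enveloping algebras\<close>

lemma ring_of_type_simps [simp]:
  "carrier ring_of_type = UNIV" "x \<otimes>\<^bsub>ring_of_type\<^esub> y = x * y" "\<one>\<^bsub>ring_of_type\<^esub> = 1"
  "\<zero>\<^bsub>ring_of_type\<^esub> = 0" "x \<oplus>\<^bsub>ring_of_type\<^esub> y = x + y"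
  by (simp_all add: ring_of_type_def)

lemma ring_ring_of_type: "ring (ring_of_type :: 'a::ring_1 ring)"
proof -
  have "\<exists>y. y + x = 0" for x :: 'a by (rule exI[of _ "- x"]) simp
  then show ?thesis
    by (intro ringI abelian_groupI monoidI) (simp_all add: algebra_simps)
qed

interpretation letters: additive_family "\<lambda>b c. Poly_Mapping.single [b] c"
  by unfold_locales (rule single_add)

lemma letters_eq: "letters = key_sum (\<lambda>b c. Poly_Mapping.single [b] c)"
  by (simp add: letters_def key_sum_def fun_eq_iff)

lemma letters_simps:
  "letters (x + y) = letters x + letters y" "letters 0 = 0" "letters (x - y) = letters x - letters y"
  "letters (- x) = - letters x" "letters (Poly_Mapping.single b c) = Poly_Mapping.single [b] c"
  by (simp_all add: letters_eq letters.key_sum_add letters.key_sum_diff letters.key_sum_uminus)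

lemma scale_conv_mult: "scale c (p :: 'b::monoid_add \<Rightarrow>\<^sub>0 complex) = Poly_Mapping.single 0 c * p"
  by (simp add: scale_def mult_map_scale_conv_mult)

lemma letters_scale: "letters (scale c x) = scale c (letters x)"
proof -
  have "x \<in> {x. letters (scale c x) = scale c (letters x)}"
    using order_refl[of "Poly_Mapping.keys x"]
    by (induction x rule: poly_mapping_induct) (simp_all add: letters_simps pm.scale_right_distrib)
  then show ?thesis by simp
qed

lemma mult_scale_right: "p * scale c q = scale c (p * q :: 'b::monoid_add \<Rightarrow>\<^sub>0 complex)"
proof -
  have "p * Poly_Mapping.single 0 c = Poly_Mapping.single 0 c * p"
    using order_refl[of "Poly_Mapping.keys p"]
    by (induction p rule: poly_mapping_induct) (simp_all add: distrib_left distrib_right mult_single mult.commute)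
  then show ?thesis by (simp add: scale_conv_mult flip: mult.assoc)
qed

locale enveloping =
  fixes br :: "('b \<Rightarrow>\<^sub>0 complex) \<Rightarrow> ('b \<Rightarrow>\<^sub>0 complex) \<Rightarrow> ('b \<Rightarrow>\<^sub>0 complex)"
begin

abbreviation "I \<equiv> uea_ideal br"
abbreviation "UU \<equiv> uea br"
abbreviation "free_ring \<equiv> (ring_of_type :: ('b list \<Rightarrow>\<^sub>0 complex) ring)"

lemma ideal_I: "ideal I free_ring"
  unfolding uea_ideal_def by (rule ring.genideal_ideal[OF ring_ring_of_type]) simp

sublocale I: ideal I free_ring by (rule ideal_I)

lemma I_closed [simp]:
  "0 \<in> I" "p \<in> I \<Longrightarrow> q \<in> I \<Longrightarrow> p + q \<in> I" "p \<in> I \<Longrightarrow> r * p \<in> I" "p \<in> I \<Longrightarrow> p * r \<in> I"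
  using additive_subgroup.zero_closed[OF I.additive_subgroup_axioms]
    additive_subgroup.a_closed[OF I.additive_subgroup_axioms, of p q] I.I_l_closed I.I_r_closed by auto

lemma I_minus: "p \<in> I \<Longrightarrow> - p \<in> I"
  using I_closed(3)[of p "- 1"] by simp

lemma I_diff: "p \<in> I \<Longrightarrow> q \<in> I \<Longrightarrow> p - q \<in> I"
  using I_closed(2)[of p "- q"] I_minus[of q] by simp

definition ucls :: "('b list \<Rightarrow>\<^sub>0 complex) \<Rightarrow> ('b list \<Rightarrow>\<^sub>0 complex) set" where
  "ucls p = I +>\<^bsub>free_ring\<^esub> p"

lemma ucls_eq: "ucls p = {q. q - p \<in> I}"
proof -
  have "q - p \<in> I \<Longrightarrow> \<exists>h\<in>I. q = h + p" for q by (rule bexI[of _ "q - p"]) simp_all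
  then show ?thesis by (auto simp: ucls_def a_r_coset_def r_coset_def ring_of_type_def)
qed

lemma ucls_eq_iff: "ucls p = ucls q \<longleftrightarrow> p - q \<in> I"
proof
  assume "ucls p = ucls q"
  moreover have "p \<in> ucls p" by (simp add: ucls_eq)
  ultimately show "p - q \<in> I" by (simp add: ucls_eq)
next
  assume pq: "p - q \<in> I"
  have "x - p \<in> I \<longleftrightarrow> x - q \<in> I" for x
    using I_closed(2)[OF _ pq, of "x - p"] I_diff[OF _ pq, of "x - q"] by auto
  then show "ucls p = ucls q" by (simp add: ucls_eq)
qed

lemma carrier_UU: "carrier UU = range ucls"
  by (auto simp: uea_def Let_def FactRing_def A_RCOSETS_def RCOSETS_def ucls_def a_r_coset_def ring_of_type_def)

lemma ucls_add: "ucls p \<oplus>\<^bsub>UU\<^esub> ucls q = ucls (p + q)"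
  using I.a_rcos_sum[of p q] by (simp add: uea_def Let_def FactRing_def ucls_def)

lemma ucls_mult: "ucls p \<otimes>\<^bsub>UU\<^esub> ucls q = ucls (p * q)"
  using I.rcoset_mult_add[of p q] by (simp add: uea_def Let_def FactRing_def ucls_def)

lemma ucls_smult: "c \<odot>\<^bsub>UU\<^esub> ucls p = ucls (scale c p)"
proof -
  have "ucls (scale c q) = ucls (scale c p)" if "q \<in> ucls p" for q
    using that I_closed(3)[of "q - p" "Poly_Mapping.single 0 c"]
    by (simp add: ucls_eq_iff scale_conv_mult right_diff_distrib) (simp add: ucls_eq)
  moreover have "p \<in> ucls p" by (simp add: ucls_eq)
  moreover have "c \<odot>\<^bsub>UU\<^esub> ucls p = (\<Union>q\<in>ucls p. ucls (scale c q))"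
    by (simp add: uea_def Let_def ucls_def)
  ultimately show ?thesis by blast
qed

lemma UU_zero: "\<zero>\<^bsub>UU\<^esub> = ucls 0" and UU_one: "\<one>\<^bsub>UU\<^esub> = ucls 1"
proof -
  show "\<zero>\<^bsub>UU\<^esub> = ucls 0"
    using I.a_coset_add_zero[of I] by (simp add: uea_def Let_def FactRing_def ucls_def I.a_subset)
  show "\<one>\<^bsub>UU\<^esub> = ucls 1"
    by (simp add: uea_def Let_def FactRing_def ucls_def)
qed

lemma ucls_closed [simp]: "ucls p \<in> carrier UU"
  by (simp add: carrier_UU)

lemma complex_alg_UU: "complex_alg UU"
proof -
  have neg: "\<exists>y\<in>carrier UU. y \<oplus>\<^bsub>UU\<^esub> x = \<zero>\<^bsub>UU\<^esub>" if "x \<in> carrier UU" for x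
  proof -
    from that obtain p where "x = ucls p" by (auto simp: carrier_UU)
    then have "ucls (- p) \<oplus>\<^bsub>UU\<^esub> x = \<zero>\<^bsub>UU\<^esub>" by (simp add: ucls_add UU_zero)
    then show ?thesis by (intro bexI[of _ "ucls (- p)"]) simp_all
  qed
  have "ring UU"
    by (intro ringI abelian_groupI monoidI neg)
      (auto simp: carrier_UU ucls_add ucls_mult UU_zero UU_one algebra_simps)
  then show ?thesis
    by (intro complex_alg.intro complex_alg_axioms.intro)
      (auto simp: carrier_UU ucls_add ucls_mult ucls_smult pm.scale_right_distrib pm.scale_left_distrib
        mult_scale_right, auto simp: scale_conv_mult mult.assoc)
qed

lemmas [simp] = complex_alg_UU

sublocale UU: complex_alg UU by (rule complex_alg_UU)

abbreviation "iota \<equiv> uea_incl br"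

lemma iota_eq: "iota x = ucls (letters x)"
  by (simp add: uea_incl_def ucls_def)

lemma iota_simps:
  "iota (x + y) = iota x \<oplus>\<^bsub>UU\<^esub> iota y" "iota (scale c x) = c \<odot>\<^bsub>UU\<^esub> iota x" "iota x \<in> carrier UU"
  by (simp_all add: iota_eq letters_simps letters_scale ucls_add ucls_smult)

lemma iota_linear: "iota 0 = \<zero>\<^bsub>UU\<^esub>" "iota (- x) = \<ominus>\<^bsub>UU\<^esub> iota x" "iota (x - y) = iota x \<ominus>\<^bsub>UU\<^esub> iota y"
proof -
  show 0: "iota 0 = \<zero>\<^bsub>UU\<^esub>" by (simp add: iota_eq letters_simps UU_zero)
  show minus: "iota (- x) = \<ominus>\<^bsub>UU\<^esub> iota x" for x
    using iota_simps(1)[of "- x" x] by (intro UU.minus_equality[symmetric]) (simp_all add: iota_simps 0)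
  show "iota (x - y) = iota x \<ominus>\<^bsub>UU\<^esub> iota y"
    using iota_simps(1)[of x "- y"] by (simp add: minus a_minus_def)
qed

lemma iota_br: "iota (br x y) = iota x \<otimes>\<^bsub>UU\<^esub> iota y \<ominus>\<^bsub>UU\<^esub> iota y \<otimes>\<^bsub>UU\<^esub> iota x"
proof -
  let ?r = "letters x * letters y - letters y * letters x - letters (br x y)"
  have "?r \<in> I"
    unfolding uea_ideal_def by (rule set_mp[OF ring.genideal_self[OF ring_ring_of_type]]) auto
  then have "ucls (letters x * letters y - letters y * letters x) = iota (br x y)"
    by (simp add: iota_eq ucls_eq_iff)
  moreover have "ucls (p - q) = ucls p \<ominus>\<^bsub>UU\<^esub> ucls q" for p q
  proof -
    have "\<ominus>\<^bsub>UU\<^esub> ucls q = ucls (- q)"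
      by (rule UU.minus_equality) (simp_all add: ucls_add UU_zero)
    then show ?thesis by (simp add: a_minus_def ucls_add)
  qed
  ultimately show ?thesis by (simp add: iota_eq ucls_mult)
qed

text \<open>
  The image of a word of the free algebra is a product of generators.
\<close>

lemma UU_induct [consumes 1, case_names one smult add mult]:
  assumes "X \<in> carrier UU" and one: "P \<one>\<^bsub>UU\<^esub>"
    and smult: "\<And>c X. X \<in> carrier UU \<Longrightarrow> P X \<Longrightarrow> P (c \<odot>\<^bsub>UU\<^esub> X)"
    and add: "\<And>X Y. X \<in> carrier UU \<Longrightarrow> Y \<in> carrier UU \<Longrightarrow> P X \<Longrightarrow> P Y \<Longrightarrow> P (X \<oplus>\<^bsub>UU\<^esub> Y)"
    and mult: "\<And>b X. X \<in> carrier UU \<Longrightarrow> P X \<Longrightarrow> P (iota (Poly_Mapping.single b 1) \<otimes>\<^bsub>UU\<^esub> X)"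
  shows "P X"
proof -
  have word: "P (ucls (Poly_Mapping.single w 1))" for w
  proof (induction w)
    case Nil
    have "1 = Poly_Mapping.single ([] :: 'b list) (1 :: complex)" by (simp flip: zero_list_def)
    with one show ?case by (simp only: UU_one)
  next
    case (Cons b w)
    \<comment> \<open>a word is a product in the monoid of lists, whose operation is written as addition\<close>
    have "Poly_Mapping.single (b # w) 1 = Poly_Mapping.single [b] 1 * Poly_Mapping.single w (1 :: complex)"
      by (simp add: mult_single plus_list_def)
    then show ?case using mult[OF _ Cons, of b] by (simp add: iota_eq letters_simps ucls_mult)
  qed
  obtain p where p: "X = ucls p" using assms(1) by (auto simp: carrier_UU)
  have "P (ucls p)"
    using order_refl[of "Poly_Mapping.keys p"]
  proof (induction p rule: poly_mapping_induct)
    case zero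
    show ?case using smult[OF UU.one_closed one, of 0] by (simp add: UU_zero)
  next
    case (single w c)
    show ?case using smult[OF _ word[of w], of c] by (simp add: ucls_smult)
  next
    case (add p q)
    then show ?case using assms(4)[of "ucls p" "ucls q"] by (simp add: ucls_add)
  qed
  then show ?thesis by (simp add: p)
qed

lemma UU_hom_eqI:
  assumes "alg_hom UU C f" "alg_hom UU C g" "\<And>b. f (iota (Poly_Mapping.single b 1)) = g (iota (Poly_Mapping.single b 1))"
    and "X \<in> carrier UU"
  shows "f X = g X"
  using assms(4)
  by (induction rule: UU_induct)
    (simp_all add: assms(3) alg_hom_simps[OF assms(1)] alg_hom_simps[OF assms(2)] iota_simps)

text \<open>
  Evaluation of noncommutative polynomials.
\<close>

definition ev :: "('b \<Rightarrow> 'x::complex_algebra) \<Rightarrow> ('b list \<Rightarrow>\<^sub>0 complex) \<Rightarrow> 'x" where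
  "ev \<gamma> = key_sum (\<lambda>w c. scalar c * prod_list (map \<gamma> w))"

lemma additive_ev: "additive_family (\<lambda>w c. scalar c * prod_list (map \<gamma> w) :: 'x::complex_algebra)"
  by unfold_locales (simp add: scalar_add distrib_right)

lemma ev_simps:
  "ev \<gamma> (p + q) = ev \<gamma> p + ev \<gamma> q" "ev \<gamma> 0 = 0" "ev \<gamma> (p - q) = ev \<gamma> p - ev \<gamma> q"
  "ev \<gamma> (Poly_Mapping.single w c) = scalar c * prod_list (map \<gamma> w)"
  unfolding ev_def
  by (rule additive_family.key_sum_add[OF additive_ev] additive_family.key_sum_0[OF additive_ev]
      additive_family.key_sum_diff[OF additive_ev] additive_family.key_sum_single[OF additive_ev])+

lemma ev_one: "ev \<gamma> 1 = 1"
proof -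
  have "1 = Poly_Mapping.single ([] :: 'b list) (1 :: complex)" by (simp flip: zero_list_def)
  then have "ev \<gamma> 1 = ev \<gamma> (Poly_Mapping.single [] 1)" by (rule arg_cong)
  then show ?thesis by (simp add: ev_simps)
qed

lemma ev_mult: "ev \<gamma> (p * q) = ev \<gamma> p * ev \<gamma> q"
  using order_refl[of "Poly_Mapping.keys p"]
proof (induction p rule: poly_mapping_induct)
  case (single w c)
  show ?case
    using order_refl[of "Poly_Mapping.keys q"]
  proof (induction q rule: poly_mapping_induct)
    case (single w' c')
    show ?case
      by (simp add: mult_single ev_simps plus_list_def scalar_mult mult.assoc scalar_left_commute[of "prod_list _"])
  qed (simp_all add: ev_simps distrib_left)
qed (simp_all add: ev_simps distrib_right)

text \<open>
  The universal property of the enveloping algebra: evaluation of words at the values of \<open>\<phi>\<close> is a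
  homomorphism on the free algebra, and its kernel is an ideal that contains the relations.
\<close>

lemma UU_hom_exists:
  assumes "complex_alg C" and closed: "\<And>x. \<phi> x \<in> carrier C"
    and add: "\<And>x y. \<phi> (x + y) = \<phi> x \<oplus>\<^bsub>C\<^esub> \<phi> y" and smult: "\<And>c x. \<phi> (scale c x) = c \<odot>\<^bsub>C\<^esub> \<phi> x"
    and br: "\<And>x y. \<phi> (br x y) = \<phi> x \<otimes>\<^bsub>C\<^esub> \<phi> y \<ominus>\<^bsub>C\<^esub> \<phi> y \<otimes>\<^bsub>C\<^esub> \<phi> x"
  shows "\<exists>h. alg_hom UU C h \<and> (\<forall>x. h (iota x) = \<phi> x)"
proof -
  interpret C: complex_alg C by fact
  define \<gamma> where "\<gamma> b = emb C (\<phi> (Poly_Mapping.single b 1))" for b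
  define h0 where "h0 p = proj C (ev \<gamma> p)" for p
  have h0: "h0 (p + q) = h0 p \<oplus>\<^bsub>C\<^esub> h0 q" "h0 (p * q) = h0 p \<otimes>\<^bsub>C\<^esub> h0 q" "h0 0 = \<zero>\<^bsub>C\<^esub>" "h0 1 = \<one>\<^bsub>C\<^esub>"
    "h0 (p - q) = h0 p \<ominus>\<^bsub>C\<^esub> h0 q" "h0 p \<in> carrier C" for p q
    by (simp_all add: h0_def ev_simps ev_mult ev_one assms(1))
  have \<phi>0: "\<phi> 0 = \<zero>\<^bsub>C\<^esub>"
    using smult[of 0 0] closed[of 0] by simp
  have h0_letters: "h0 (letters x) = \<phi> x" for x
    using order_refl[of "Poly_Mapping.keys x"]
  proof (induction x rule: poly_mapping_induct)
    case (single b c)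
    have "\<phi> (Poly_Mapping.single b c) = c \<odot>\<^bsub>C\<^esub> \<phi> (Poly_Mapping.single b 1)"
      using smult[of c "Poly_Mapping.single b 1"] by simp
    then show ?case
      by (simp add: letters_simps h0_def ev_simps \<gamma>_def C.proj_scalar_mult closed del: proj_simps(6))
  qed (simp_all add: letters_simps h0 \<phi>0 add)
  have scale: "h0 (scale c p) = c \<odot>\<^bsub>C\<^esub> h0 p" for c p
  proof -
    have "h0 (Poly_Mapping.single 0 c) = c \<odot>\<^bsub>C\<^esub> \<one>\<^bsub>C\<^esub>"
      by (simp add: h0_def zero_list_def ev_simps assms(1))
    then show ?thesis by (simp add: scale_conv_mult h0 C.smult_mult_left)
  qed
  have kernel: "h0 p = \<zero>\<^bsub>C\<^esub>" if "p \<in> I" for p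
  proof -
    have "ideal {p. h0 p = \<zero>\<^bsub>C\<^esub>} free_ring"
    proof (rule idealI[OF ring_ring_of_type])
      have "a_inv free_ring p = - p" for p
        using ring.ring_simprules(9)[OF ring_ring_of_type, of p] by (simp add: eq_neg_iff_add_eq_0)
      then have inv: "m_inv (add_monoid free_ring) p = - p" for p by (simp add: a_inv_def)
      show "subgroup {p. h0 p = \<zero>\<^bsub>C\<^esub>} (add_monoid free_ring)"
      proof (rule subgroup.intro)
        show "m_inv (add_monoid free_ring) p \<in> {p. h0 p = \<zero>\<^bsub>C\<^esub>}" if "p \<in> {p. h0 p = \<zero>\<^bsub>C\<^esub>}" for p
          using that h0(5)[of 0 p] by (simp only: inv) (simp add: h0 a_minus_def)
      qed (simp_all add: h0)
    qed (simp_all add: h0)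
    moreover have "h0 (letters x * letters y - letters y * letters x - letters (br x y)) = \<zero>\<^bsub>C\<^esub>" for x y
      by (simp add: h0 h0_letters br closed C.r_neg a_minus_def)
    ultimately have "I \<subseteq> {p. h0 p = \<zero>\<^bsub>C\<^esub>}"
      unfolding uea_ideal_def by (intro ring.genideal_minimal[OF ring_ring_of_type]) auto
    with that show ?thesis by auto
  qed
  define h where "h X = h0 (SOME p. X = ucls p)" for X
  have h_ucls: "h (ucls p) = h0 p" for p
  proof -
    define q where "q = (SOME q. ucls p = ucls q)"
    have "ucls p = ucls q" unfolding q_def by (rule someI[of _ p]) simp
    then have "h0 (p - q) = \<zero>\<^bsub>C\<^esub>" by (intro kernel) (simp only: ucls_eq_iff)
    moreover have "h0 p = h0 (p - q) \<oplus>\<^bsub>C\<^esub> h0 q" using h0(1)[of "p - q" q] by simp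
    ultimately have "h0 p = h0 q" using h0(6)[of q] by (simp only: C.l_zero)
    then show ?thesis by (simp add: h_def q_def[symmetric])
  qed
  have "alg_hom UU C h"
    by (rule alg_homI) (auto simp: carrier_UU ucls_add ucls_mult ucls_smult h_ucls h0 scale UU_one)
  moreover have "h (iota x) = \<phi> x" for x
    by (simp add: iota_eq h_ucls h0_letters)
  ultimately show ?thesis by blast
qed

end

section \<open>Twists of Hopf algebras\<close>

definition tensor_hom ::
  "(complex, 'a) module \<Rightarrow> (complex, 'b) module \<Rightarrow> (complex, 'c) module \<Rightarrow> ('a \<Rightarrow> 'c) \<Rightarrow> ('b \<Rightarrow> 'c) \<Rightarrow>
   ('a \<times> 'b \<Rightarrow>\<^sub>0 complex) set \<Rightarrow> 'c" where
  "tensor_hom M N C \<phi> \<psi> = (SOME h. alg_hom (tensor M N) C h \<and>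
     (\<forall>x\<in>carrier M. \<forall>y\<in>carrier N. h (pure_tensor M N x y) = \<phi> x \<otimes>\<^bsub>C\<^esub> \<psi> y))"

context tensor_product
begin

lemma
  assumes "complex_alg C" "alg_hom M C \<phi>" "alg_hom N C \<psi>"
    and "\<forall>x\<in>carrier M. \<forall>y\<in>carrier N. \<phi> x \<otimes>\<^bsub>C\<^esub> \<psi> y = \<psi> y \<otimes>\<^bsub>C\<^esub> \<phi> x"
  shows tensor_hom: "alg_hom T C (tensor_hom M N C \<phi> \<psi>)"
    and tensor_hom_pure: "x \<in> carrier M \<Longrightarrow> y \<in> carrier N \<Longrightarrow> tensor_hom M N C \<phi> \<psi> (pure x y) = \<phi> x \<otimes>\<^bsub>C\<^esub> \<psi> y"
    and tensor_hom_inl: "x \<in> carrier M \<Longrightarrow> tensor_hom M N C \<phi> \<psi> (inl x) = \<phi> x"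
    and tensor_hom_inr: "y \<in> carrier N \<Longrightarrow> tensor_hom M N C \<phi> \<psi> (inr y) = \<psi> y"
    and tensor_hom_ctensor: "f \<in> carrier (pseries M) \<Longrightarrow> g \<in> carrier (pseries N) \<Longrightarrow>
      coeffwise (tensor_hom M N C \<phi> \<psi>) (ctensor M N f g) = coeffwise \<phi> f \<otimes>\<^bsub>pseries C\<^esub> coeffwise \<psi> g"
proof -
  interpret C: complex_alg C by fact
  let ?h = "tensor_hom M N C \<phi> \<psi>"
  have "\<exists>h. alg_hom T C h \<and> (\<forall>x\<in>carrier M. \<forall>y\<in>carrier N. h (pure x y) = \<phi> x \<otimes>\<^bsub>C\<^esub> \<psi> y)"
    using assms(4) by (intro hom_exists[OF assms(1-3)]) blast
  from someI_ex[OF this] have *: "alg_hom T C ?h \<and> (\<forall>x\<in>carrier M. \<forall>y\<in>carrier N. ?h (pure x y) = \<phi> x \<otimes>\<^bsub>C\<^esub> \<psi> y)"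
    unfolding tensor_hom_def .
  then show h: "alg_hom T C ?h" by blast
  show pure: "?h (pure x y) = \<phi> x \<otimes>\<^bsub>C\<^esub> \<psi> y" if "x \<in> carrier M" "y \<in> carrier N" for x y
    using * that by blast
  show l: "?h (inl x) = \<phi> x" if "x \<in> carrier M" for x
    using that by (simp add: inl_def pure alg_hom_simps[OF assms(2)] alg_hom_simps[OF assms(3)])
  show r: "?h (inr y) = \<psi> y" if "y \<in> carrier N" for y
    using that by (simp add: inr_def pure alg_hom_simps[OF assms(2)] alg_hom_simps[OF assms(3)])
  assume f: "f \<in> carrier (pseries M)" and g: "g \<in> carrier (pseries N)"
  note sh = coeffwise_alg_hom[OF complex_alg_T assms(1) h]
  have "coeffwise ?h (ctensor M N f g) = coeffwise ?h (sinl f) \<otimes>\<^bsub>pseries C\<^esub> coeffwise ?h (sinr g)"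
    using f g by (simp add: ctensor_eq alg_hom_simps[OF sh] sinl_sinr_closed)
  also have "coeffwise ?h (sinl f) = coeffwise \<phi> f"
    using f by (simp add: coeffwise_def l pseries_carrier_iff)
  also have "coeffwise ?h (sinr g) = coeffwise \<psi> g"
    using g by (simp add: coeffwise_def r pseries_carrier_iff)
  finally show "coeffwise ?h (ctensor M N f g) = coeffwise \<phi> f \<otimes>\<^bsub>pseries C\<^esub> coeffwise \<psi> g" .
qed

end

lemma coeffwise_commute:
  assumes "complex_alg C"
    and "\<And>k. f k \<in> carrier C" "\<And>k. g k \<in> carrier C" "\<And>i j. f i \<otimes>\<^bsub>C\<^esub> g j = g j \<otimes>\<^bsub>C\<^esub> f i"
  shows "f \<otimes>\<^bsub>pseries C\<^esub> g = g \<otimes>\<^bsub>pseries C\<^esub> f"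
proof
  interpret C: complex_alg C by fact
  fix n
  have "(\<Sum>i\<le>n. emb C (f i) * emb C (g (n - i))) = (\<Sum>i\<le>n. emb C (g i) * emb C (f (n - i)))"
    using assms by (intro sum.reindex_bij_witness[of _ "\<lambda>i. n - i" "\<lambda>i. n - i"]) (auto simp flip: C.emb_mult)
  then have "emb C ((f \<otimes>\<^bsub>pseries C\<^esub> g) n) = emb C ((g \<otimes>\<^bsub>pseries C\<^esub> f) n)"
    using assms(2,3) by (simp add: pseries_mult C.emb_finsum C.emb_mult)
  then show "(f \<otimes>\<^bsub>pseries C\<^esub> g) n = (g \<otimes>\<^bsub>pseries C\<^esub> f) n"
    using assms by (subst (asm) C.emb_inject) (simp_all add: pseries_mult)
qed

text \<open>
  The maps of a Hopf algebra over \<open>\<complex>\<close>. Within this locale \<open>j1\<close>, \<open>j2\<close>, \<open>j3\<close> are the three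
  embeddings into \<open>A \<otimes> (A \<otimes> A)\<close>; \<open>j12\<close> is \<open>X \<mapsto> X \<otimes> 1\<close> up to the associativity isomorphism; \<open>D1\<close>,
  \<open>D2\<close> are \<open>\<Delta>\<^sub>0 \<otimes> id\<close>, \<open>id \<otimes> \<Delta>\<^sub>0\<close>, and \<open>E1\<close>, \<open>E2\<close> are the applications of the counit to the left and
  to the right factor. All of them are algebra homomorphisms, which is what makes twisting work.
\<close>

locale hopf_data = complex_alg A for A :: "(complex, 'a) module" (structure) +
  fixes D0 :: "'a \<Rightarrow> ('a \<times> 'a \<Rightarrow>\<^sub>0 complex) set" and S0 :: "'a \<Rightarrow> 'a" and e0 :: "'a \<Rightarrow> complex"
  assumes D0: "alg_hom A (tensor A A) D0"
    and S0: "alg_hom A (opposite A) S0"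
    and e0: "alg_hom A complex_field e0"
begin

sublocale A2: tensor_product A A by unfold_locales
sublocale A3: tensor_product A "tensor A A" by unfold_locales

abbreviation "H \<equiv> pseries A"
abbreviation "H2 \<equiv> pseries (tensor A A)"
abbreviation "H3 \<equiv> pseries (tensor A (tensor A A))"

definition "j1 = A3.inl"
definition "j2 = (\<lambda>x. A3.inr (A2.inl x))"
definition "j3 = (\<lambda>x. A3.inr (A2.inr x))"

lemma j_hom: "alg_hom A A3.T j1" "alg_hom A A3.T j2" "alg_hom A A3.T j3"
  unfolding j1_def j2_def j3_def
  using A3.inl_hom alg_hom_comp[OF A2.inl_hom A3.inr_hom] alg_hom_comp[OF A2.inr_hom A3.inr_hom] by simp_all

lemma j1_inr: "x \<in> carrier A \<Longrightarrow> Y \<in> carrier A2.T \<Longrightarrow> j1 x \<otimes>\<^bsub>A3.T\<^esub> A3.inr Y = A3.inr Y \<otimes>\<^bsub>A3.T\<^esub> j1 x"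
  by (simp add: j1_def A3.inl_inr A3.inr_inl)

lemma j2_j3: "x \<in> carrier A \<Longrightarrow> y \<in> carrier A \<Longrightarrow> j2 x \<otimes>\<^bsub>A3.T\<^esub> j3 y = j3 y \<otimes>\<^bsub>A3.T\<^esub> j2 x"
  by (simp add: j2_def j3_def A2.inl_inr A2.inr_inl alg_hom_simps[OF A2.inl_hom] alg_hom_simps[OF A2.inr_hom]
      flip: alg_hom_simps(3)[OF A3.inr_hom])

lemma j1_j2: "x \<in> carrier A \<Longrightarrow> y \<in> carrier A \<Longrightarrow> j1 x \<otimes>\<^bsub>A3.T\<^esub> j2 y = j2 y \<otimes>\<^bsub>A3.T\<^esub> j1 x"
  and j1_j3: "x \<in> carrier A \<Longrightarrow> y \<in> carrier A \<Longrightarrow> j1 x \<otimes>\<^bsub>A3.T\<^esub> j3 y = j3 y \<otimes>\<^bsub>A3.T\<^esub> j1 x"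
  by (simp_all add: j2_def j3_def j1_inr alg_hom_simps[OF A2.inl_hom] alg_hom_simps[OF A2.inr_hom])

lemma j1_j2_ball: "\<forall>x\<in>carrier A. \<forall>y\<in>carrier A. j1 x \<otimes>\<^bsub>A3.T\<^esub> j2 y = j2 y \<otimes>\<^bsub>A3.T\<^esub> j1 x"
  by (simp add: j1_j2)

definition "j12 = tensor_hom A A A3.T j1 j2"

lemmas j12_assms = A3.complex_alg_T j_hom(1) j_hom(2) j1_j2_ball
lemmas j12 = A2.tensor_hom[OF j12_assms, folded j12_def]
lemmas j12_ctensor = A2.tensor_hom_ctensor[OF j12_assms, folded j12_def]
lemmas j12_pure = A2.tensor_hom_pure[OF j12_assms, folded j12_def]
lemmas j12_inl = A2.tensor_hom_inl[OF j12_assms, folded j12_def]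
lemmas j12_inr = A2.tensor_hom_inr[OF j12_assms, folded j12_def]

lemma j12_j3: "X \<in> carrier A2.T \<Longrightarrow> y \<in> carrier A \<Longrightarrow> j12 X \<otimes>\<^bsub>A3.T\<^esub> j3 y = j3 y \<otimes>\<^bsub>A3.T\<^esub> j12 X"
proof (induction rule: A2.T_induct)
  case (pure x x')
  have "j1 x \<otimes>\<^bsub>A3.T\<^esub> j2 x' \<otimes>\<^bsub>A3.T\<^esub> j3 y = j1 x \<otimes>\<^bsub>A3.T\<^esub> (j3 y \<otimes>\<^bsub>A3.T\<^esub> j2 x')"
    using pure by (simp add: A3.T.m_assoc alg_hom_simps[OF j_hom(1)] alg_hom_simps[OF j_hom(2)] alg_hom_simps[OF j_hom(3)] j2_j3)
  also have "\<dots> = j1 x \<otimes>\<^bsub>A3.T\<^esub> j3 y \<otimes>\<^bsub>A3.T\<^esub> j2 x'"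
    using pure by (simp add: A3.T.m_assoc alg_hom_simps[OF j_hom(1)] alg_hom_simps[OF j_hom(2)] alg_hom_simps[OF j_hom(3)])
  also have "\<dots> = j3 y \<otimes>\<^bsub>A3.T\<^esub> (j1 x \<otimes>\<^bsub>A3.T\<^esub> j2 x')"
    using pure by (simp add: j1_j3 A3.T.m_assoc alg_hom_simps[OF j_hom(1)] alg_hom_simps[OF j_hom(2)] alg_hom_simps[OF j_hom(3)])
  finally show ?case using pure by (simp add: j12_pure)
next
  case (add X Y)
  then show ?case
    by (simp add: alg_hom_simps[OF j12] alg_hom_simps[OF j_hom(3)] A3.T.l_distr A3.T.r_distr)
qed

definition "D1 = tensor_hom A A A3.T (\<lambda>x. j12 (D0 x)) j3"
definition "D2 = tensor_hom A A A3.T j1 (\<lambda>x. A3.inr (D0 x))"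

lemma D1_comm: "\<forall>x\<in>carrier A. \<forall>y\<in>carrier A. j12 (D0 x) \<otimes>\<^bsub>A3.T\<^esub> j3 y = j3 y \<otimes>\<^bsub>A3.T\<^esub> j12 (D0 x)"
  by (simp add: j12_j3 alg_hom_simps[OF D0])

lemma D2_comm: "\<forall>x\<in>carrier A. \<forall>y\<in>carrier A. j1 x \<otimes>\<^bsub>A3.T\<^esub> A3.inr (D0 y) = A3.inr (D0 y) \<otimes>\<^bsub>A3.T\<^esub> j1 x"
  by (simp add: j1_inr alg_hom_simps[OF D0])

lemmas D1_assms = A3.complex_alg_T alg_hom_comp[OF D0 j12] j_hom(3) D1_comm
lemmas D2_assms = A3.complex_alg_T j_hom(1) alg_hom_comp[OF D0 A3.inr_hom] D2_comm
lemmas D1 = A2.tensor_hom[OF D1_assms, folded D1_def]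
lemmas D1_ctensor = A2.tensor_hom_ctensor[OF D1_assms, folded D1_def]
lemmas D1_inl = A2.tensor_hom_inl[OF D1_assms, folded D1_def]
lemmas D1_inr = A2.tensor_hom_inr[OF D1_assms, folded D1_def]
lemmas D2 = A2.tensor_hom[OF D2_assms, folded D2_def]
lemmas D2_ctensor = A2.tensor_hom_ctensor[OF D2_assms, folded D2_def]
lemmas D2_inl = A2.tensor_hom_inl[OF D2_assms, folded D2_def]
lemmas D2_inr = A2.tensor_hom_inr[OF D2_assms, folded D2_def]

lemma unit_hom: "alg_hom A A (\<lambda>x. e0 x \<odot> \<one>)" "alg_hom A A (\<lambda>x. x)"
proof -
  show "alg_hom A A (\<lambda>x. e0 x \<odot> \<one>)"
    by (rule alg_homI) (simp_all add: alg_hom_simps[OF e0] smult_l_distr smult_assoc smult_mult_left)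
  show "alg_hom A A (\<lambda>x. x)" by (rule alg_homI) simp_all
qed

lemma unit_comm:
  "\<forall>x\<in>carrier A. \<forall>y\<in>carrier A. (e0 x \<odot> \<one>) \<otimes> y = y \<otimes> (e0 x \<odot> \<one>)"
  "\<forall>x\<in>carrier A. \<forall>y\<in>carrier A. x \<otimes> (e0 y \<odot> \<one>) = (e0 y \<odot> \<one>) \<otimes> x"
  by (simp_all add: smult_mult_left smult_mult_right)

definition "E1 = tensor_hom A A A (\<lambda>x. e0 x \<odot> \<one>) (\<lambda>x. x)"
definition "E2 = tensor_hom A A A (\<lambda>x. x) (\<lambda>x. e0 x \<odot> \<one>)"

lemmas E1_assms = complex_alg_axioms unit_hom(1) unit_hom(2) unit_comm(1)
lemmas E2_assms = complex_alg_axioms unit_hom(2) unit_hom(1) unit_comm(2)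
lemmas E1 = A2.tensor_hom[OF E1_assms, folded E1_def]
lemmas E1_ctensor = A2.tensor_hom_ctensor[OF E1_assms, folded E1_def]
lemmas E1_pure = A2.tensor_hom_pure[OF E1_assms, folded E1_def]
lemmas E2 = A2.tensor_hom[OF E2_assms, folded E2_def]
lemmas E2_ctensor = A2.tensor_hom_ctensor[OF E2_assms, folded E2_def]
lemmas E2_pure = A2.tensor_hom_pure[OF E2_assms, folded E2_def]

abbreviation "s h \<equiv> coeffwise h"

lemma S0_simps:
  "x \<in> carrier A \<Longrightarrow> S0 x \<in> carrier A"
  "x \<in> carrier A \<Longrightarrow> y \<in> carrier A \<Longrightarrow> S0 (x \<oplus> y) = S0 x \<oplus> S0 y"
  "x \<in> carrier A \<Longrightarrow> y \<in> carrier A \<Longrightarrow> S0 (x \<otimes> y) = S0 y \<otimes> S0 x"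
  "x \<in> carrier A \<Longrightarrow> S0 (c \<odot> x) = c \<odot> S0 x"
  "S0 \<one> = \<one>"
  using alg_hom_simps[OF S0] by simp_all

lemma S0_linear: "linear_map A A S0"
  unfolding linear_map_def by (auto simp: S0_simps)

lemmas sS0_linear = coeffwise_linear[OF complex_alg_axioms complex_alg_axioms S0_linear]

lemma pseries_opposite_mult:
  assumes "f \<in> carrier H" "g \<in> carrier H"
  shows "f \<otimes>\<^bsub>pseries (opposite A)\<^esub> g = g \<otimes>\<^bsub>H\<^esub> f"
proof
  fix n
  have *: "finsum (opposite A) h I = finsum A h I" if "finite I" "\<And>i. i \<in> I \<Longrightarrow> h i \<in> carrier A" for h :: "nat \<Rightarrow> 'a" and I
  proof -
    interpret op: complex_alg "opposite A" by (rule complex_alg_opposite)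
    show ?thesis using that by (induction I rule: finite_induct) (simp_all add: op.finsum_insert finsum_insert Pi_def)
  qed
  have "(\<Sum>i\<le>n. emb A (g (n - i)) * emb A (f i)) = (\<Sum>i\<le>n. emb A (g i) * emb A (f (n - i)))"
    by (rule sum.reindex_bij_witness[of _ "\<lambda>i. n - i" "\<lambda>i. n - i"]) auto
  then have "emb A ((f \<otimes>\<^bsub>pseries (opposite A)\<^esub> g) n) = emb A ((g \<otimes>\<^bsub>H\<^esub> f) n)"
    using assms by (simp add: pseries_mult pseries_carrier_iff * emb_finsum emb_mult)
  then show "(f \<otimes>\<^bsub>pseries (opposite A)\<^esub> g) n = (g \<otimes>\<^bsub>H\<^esub> f) n"
    using assms by (subst (asm) emb_inject) (simp_all add: pseries_mult pseries_carrier_iff *)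
qed

lemma sS0_mult:
  assumes "f \<in> carrier H" "g \<in> carrier H"
  shows "s S0 (f \<otimes>\<^bsub>H\<^esub> g) = s S0 g \<otimes>\<^bsub>H\<^esub> s S0 f"
proof -
  have c: "s S0 f \<in> carrier H" "s S0 g \<in> carrier H"
    using assms by (simp_all add: linear_map_closed[OF sS0_linear])
  show ?thesis
    using alg_hom_simps(3)[OF coeffwise_alg_hom[OF complex_alg_axioms complex_alg_opposite S0], of f g] assms c
    by (simp add: pseries_opposite_mult pseries_carrier_iff)
qed

lemma ctensor_mult:
  assumes "f \<in> carrier H" "g \<in> carrier H" "f' \<in> carrier H" "g' \<in> carrier H"
  shows "ctensor A A f g \<otimes>\<^bsub>H2\<^esub> ctensor A A f' g' = ctensor A A (f \<otimes>\<^bsub>H\<^esub> f') (g \<otimes>\<^bsub>H\<^esub> g')"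
proof -
  note cl = assms A2.sinl_sinr_closed
  have "A2.sinr g \<otimes>\<^bsub>H2\<^esub> A2.sinl f' = A2.sinl f' \<otimes>\<^bsub>H2\<^esub> A2.sinr g"
    using assms by (intro coeffwise_commute[OF A2.complex_alg_T])
      (simp_all add: coeffwise_def pseries_carrier_iff A2.inl_inr A2.inr_inl
        alg_hom_simps[OF A2.inl_hom] alg_hom_simps[OF A2.inr_hom])
  then have "A2.sinl f \<otimes>\<^bsub>H2\<^esub> A2.sinr g \<otimes>\<^bsub>H2\<^esub> (A2.sinl f' \<otimes>\<^bsub>H2\<^esub> A2.sinr g')
      = A2.sinl f \<otimes>\<^bsub>H2\<^esub> (A2.sinl f' \<otimes>\<^bsub>H2\<^esub> A2.sinr g) \<otimes>\<^bsub>H2\<^esub> A2.sinr g'"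
    using cl by (simp add: A2.T.S.m_assoc flip: A2.T.S.m_assoc[of "A2.sinr g" "A2.sinl f'"])
  then show ?thesis
    using cl by (simp add: A2.ctensor_eq alg_hom_simps[OF A2.sinl_hom] alg_hom_simps[OF A2.sinr_hom] A2.T.S.m_assoc)
qed

lemma ctensor_closed: "f \<in> carrier H \<Longrightarrow> g \<in> carrier H \<Longrightarrow> ctensor A A f g \<in> carrier H2"
  by (simp add: A2.ctensor_eq A2.sinl_sinr_closed)

end

lemma (in complex_alg) mult_linear:
  assumes "g \<in> carrier (pseries A)"
  shows "linear_map (pseries A) (pseries A) (\<lambda>f. f \<otimes>\<^bsub>pseries A\<^esub> g)"
    "linear_map (pseries A) (pseries A) (\<lambda>f. g \<otimes>\<^bsub>pseries A\<^esub> f)"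
    "linear_map (pseries A) (pseries A) (\<lambda>f. c \<odot>\<^bsub>pseries A\<^esub> f)"
proof -
  interpret Mod: Module.module "ring_of_type :: complex fps ring" "pseries A" by (rule module_pseries)
  show "linear_map (pseries A) (pseries A) (\<lambda>f. f \<otimes>\<^bsub>pseries A\<^esub> g)"
    "linear_map (pseries A) (pseries A) (\<lambda>f. g \<otimes>\<^bsub>pseries A\<^esub> f)"
    unfolding linear_map_def using assms by (auto simp: S.l_distr S.r_distr pseries_smult_mult)
  show "linear_map (pseries A) (pseries A) (\<lambda>f. c \<odot>\<^bsub>pseries A\<^esub> f)"
    unfolding linear_map_def
    using Mod.smult_assoc1[of c, symmetric] Mod.smult_assoc1[of _ c]
    by (auto simp: smult_pseries_closed Mod.smult_r_distr mult.commute)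
qed

lemma (in complex_alg) smult_one_pseries: "c \<odot>\<^bsub>pseries A\<^esub> \<one>\<^bsub>pseries A\<^esub> = (\<lambda>k. fps_nth c k \<odot> \<one>)"
proof -
  have "c \<odot>\<^bsub>pseries A\<^esub> \<one>\<^bsub>pseries A\<^esub> = sproj A (fps_scalar c)"
    by (simp flip: sproj_one sproj_smult)
  then show ?thesis by (simp add: sproj_def fps_scalar_def complex_alg_axioms)
qed

context hopf_data
begin

text \<open>
  The contractions \<open>a \<otimes> b \<mapsto> S\<^sub>0(a) w b\<close> and \<open>a \<otimes> b \<mapsto> a w S\<^sub>0(b)\<close>. The parameter \<open>w\<close> makes them
  composable: \<open>mL w (X Y)\<close> first contracts \<open>X\<close> around \<open>w\<close> and then \<open>Y\<close> around the result.
\<close>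

definition mL :: "(nat \<Rightarrow> 'a) \<Rightarrow> (nat \<Rightarrow> ('a \<times> 'a \<Rightarrow>\<^sub>0 complex) set) \<Rightarrow> nat \<Rightarrow> 'a" where
  "mL w = (SOME \<phi>. linear_map H2 H \<phi> \<and>
     (\<forall>f\<in>carrier H. \<forall>g\<in>carrier H. \<phi> (ctensor A A f g) = s S0 f \<otimes>\<^bsub>H\<^esub> w \<otimes>\<^bsub>H\<^esub> g))"

definition mR :: "(nat \<Rightarrow> 'a) \<Rightarrow> (nat \<Rightarrow> ('a \<times> 'a \<Rightarrow>\<^sub>0 complex) set) \<Rightarrow> nat \<Rightarrow> 'a" where
  "mR w = (SOME \<phi>. linear_map H2 H \<phi> \<and>
     (\<forall>f\<in>carrier H. \<forall>g\<in>carrier H. \<phi> (ctensor A A f g) = f \<otimes>\<^bsub>H\<^esub> w \<otimes>\<^bsub>H\<^esub> s S0 g))"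

lemma sS0_closed [simp]: "f \<in> carrier H \<Longrightarrow> s S0 f \<in> carrier H"
  by (rule linear_map_closed[OF sS0_linear])

lemma mL:
  assumes w: "w \<in> carrier H"
  shows mL_linear: "linear_map H2 H (mL w)"
    and mL_ctensor: "f \<in> carrier H \<Longrightarrow> g \<in> carrier H \<Longrightarrow> mL w (ctensor A A f g) = s S0 f \<otimes>\<^bsub>H\<^esub> w \<otimes>\<^bsub>H\<^esub> g"
proof -
  have "\<exists>\<phi>. linear_map H2 H \<phi> \<and>
     (\<forall>f\<in>carrier H. \<forall>g\<in>carrier H. \<phi> (ctensor A A f g) = s S0 f \<otimes>\<^bsub>H\<^esub> w \<otimes>\<^bsub>H\<^esub> g)"
    using linear_map_comp[OF sS0_linear linear_map_comp[OF mult_linear(1)[OF w] mult_linear(1)]] mult_linear(2) w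
    by (intro A2.bilinear_lift_exists complex_alg_axioms) simp_all
  from someI_ex[OF this] show "linear_map H2 H (mL w)"
    "f \<in> carrier H \<Longrightarrow> g \<in> carrier H \<Longrightarrow> mL w (ctensor A A f g) = s S0 f \<otimes>\<^bsub>H\<^esub> w \<otimes>\<^bsub>H\<^esub> g"
    unfolding mL_def by blast+
qed

lemma mR:
  assumes w: "w \<in> carrier H"
  shows mR_linear: "linear_map H2 H (mR w)"
    and mR_ctensor: "f \<in> carrier H \<Longrightarrow> g \<in> carrier H \<Longrightarrow> mR w (ctensor A A f g) = f \<otimes>\<^bsub>H\<^esub> w \<otimes>\<^bsub>H\<^esub> s S0 g"
proof -
  have "\<exists>\<phi>. linear_map H2 H \<phi> \<and>
     (\<forall>f\<in>carrier H. \<forall>g\<in>carrier H. \<phi> (ctensor A A f g) = f \<otimes>\<^bsub>H\<^esub> w \<otimes>\<^bsub>H\<^esub> s S0 g)"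
    using linear_map_comp[OF sS0_linear mult_linear(2)] linear_map_comp[OF mult_linear(1)[OF w] mult_linear(1)] w
    by (intro A2.bilinear_lift_exists complex_alg_axioms) simp_all
  from someI_ex[OF this] show "linear_map H2 H (mR w)"
    "f \<in> carrier H \<Longrightarrow> g \<in> carrier H \<Longrightarrow> mR w (ctensor A A f g) = f \<otimes>\<^bsub>H\<^esub> w \<otimes>\<^bsub>H\<^esub> s S0 g"
    unfolding mR_def by blast+
qed

lemma mL_mult_ctensor:
  assumes "w \<in> carrier H" "X \<in> carrier H2" "a \<in> carrier H" "b \<in> carrier H"
  shows "mL w (X \<otimes>\<^bsub>H2\<^esub> ctensor A A a b) = s S0 a \<otimes>\<^bsub>H\<^esub> mL w X \<otimes>\<^bsub>H\<^esub> b"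
proof (rule A2.linear_map_ctensor_eqI[OF complex_alg_axioms _ _ _ assms(2)])
  show "linear_map H2 H (\<lambda>X. mL w (X \<otimes>\<^bsub>H2\<^esub> ctensor A A a b))"
    using assms by (intro linear_map_comp[OF A2.T.mult_linear(1) mL_linear] ctensor_closed)
  show "linear_map H2 H (\<lambda>X. s S0 a \<otimes>\<^bsub>H\<^esub> mL w X \<otimes>\<^bsub>H\<^esub> b)"
    using assms by (intro linear_map_comp[OF mL_linear linear_map_comp[OF mult_linear(2) mult_linear(1)]]) simp_all
  show "mL w (ctensor A A f g \<otimes>\<^bsub>H2\<^esub> ctensor A A a b) = s S0 a \<otimes>\<^bsub>H\<^esub> mL w (ctensor A A f g) \<otimes>\<^bsub>H\<^esub> b"
    if "f \<in> carrier H" "g \<in> carrier H" for f g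
    using that assms by (simp add: ctensor_mult mL_ctensor sS0_mult S.m_assoc)
qed

lemma mR_mult_ctensor:
  assumes "w \<in> carrier H" "X \<in> carrier H2" "a \<in> carrier H" "b \<in> carrier H"
  shows "mR w (ctensor A A a b \<otimes>\<^bsub>H2\<^esub> X) = a \<otimes>\<^bsub>H\<^esub> mR w X \<otimes>\<^bsub>H\<^esub> s S0 b"
proof (rule A2.linear_map_ctensor_eqI[OF complex_alg_axioms _ _ _ assms(2)])
  show "linear_map H2 H (\<lambda>X. mR w (ctensor A A a b \<otimes>\<^bsub>H2\<^esub> X))"
    using assms by (intro linear_map_comp[OF A2.T.mult_linear(2) mR_linear] ctensor_closed)
  show "linear_map H2 H (\<lambda>X. a \<otimes>\<^bsub>H\<^esub> mR w X \<otimes>\<^bsub>H\<^esub> s S0 b)"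
    using assms by (intro linear_map_comp[OF mR_linear linear_map_comp[OF mult_linear(2) mult_linear(1)]]) simp_all
  show "mR w (ctensor A A a b \<otimes>\<^bsub>H2\<^esub> ctensor A A f g) = a \<otimes>\<^bsub>H\<^esub> mR w (ctensor A A f g) \<otimes>\<^bsub>H\<^esub> s S0 b"
    if "f \<in> carrier H" "g \<in> carrier H" for f g
    using that assms by (simp add: ctensor_mult mR_ctensor sS0_mult S.m_assoc)
qed

text \<open>
  If the contraction of \<open>X\<close> around \<open>w\<close> is a scalar multiple of \<open>w'\<close>, then \<open>w'\<close> may be put in its
  place. With \<open>X = F\<close>, \<open>\<Delta>\<^sub>0(x)\<close>, \<open>G\<close> in turn this evaluates the contraction of \<open>F \<Delta>\<^sub>0(x) G\<close>.
\<close>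

lemma mL_mult:
  assumes "w \<in> carrier H" "w' \<in> carrier H" "X \<in> carrier H2" "Y \<in> carrier H2" "mL w X = c \<odot>\<^bsub>H\<^esub> w'"
  shows "mL w (X \<otimes>\<^bsub>H2\<^esub> Y) = c \<odot>\<^bsub>H\<^esub> mL w' Y"
proof (rule A2.linear_map_ctensor_eqI[OF complex_alg_axioms _ _ _ assms(4)])
  show "linear_map H2 H (\<lambda>Y. mL w (X \<otimes>\<^bsub>H2\<^esub> Y))"
    using assms by (intro linear_map_comp[OF A2.T.mult_linear(2) mL_linear])
  show "linear_map H2 H (\<lambda>Y. c \<odot>\<^bsub>H\<^esub> mL w' Y)"
    using assms by (intro linear_map_comp[OF mL_linear mult_linear(3)[OF assms(1)]])
  show "mL w (X \<otimes>\<^bsub>H2\<^esub> ctensor A A f g) = c \<odot>\<^bsub>H\<^esub> mL w' (ctensor A A f g)"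
    if "f \<in> carrier H" "g \<in> carrier H" for f g
    using that assms by (simp add: mL_mult_ctensor mL_ctensor pseries_smult_mult smult_pseries_closed)
qed

lemma mR_mult:
  assumes "w \<in> carrier H" "w' \<in> carrier H" "X \<in> carrier H2" "Y \<in> carrier H2" "mR w X = c \<odot>\<^bsub>H\<^esub> w'"
  shows "mR w (Y \<otimes>\<^bsub>H2\<^esub> X) = c \<odot>\<^bsub>H\<^esub> mR w' Y"
proof (rule A2.linear_map_ctensor_eqI[OF complex_alg_axioms _ _ _ assms(4)])
  show "linear_map H2 H (\<lambda>Y. mR w (Y \<otimes>\<^bsub>H2\<^esub> X))"
    using assms by (intro linear_map_comp[OF A2.T.mult_linear(1) mR_linear])
  show "linear_map H2 H (\<lambda>Y. c \<odot>\<^bsub>H\<^esub> mR w' Y)"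
    using assms by (intro linear_map_comp[OF mR_linear mult_linear(3)[OF assms(1)]])
  show "mR w (ctensor A A f g \<otimes>\<^bsub>H2\<^esub> X) = c \<odot>\<^bsub>H\<^esub> mR w' (ctensor A A f g)"
    if "f \<in> carrier H" "g \<in> carrier H" for f g
    using that assms by (simp add: mR_mult_ctensor mR_ctensor pseries_smult_mult smult_pseries_closed)
qed

definition counit :: "(nat \<Rightarrow> 'a) \<Rightarrow> complex fps" where
  "counit f = Abs_fps (\<lambda>k. e0 (f k))"

lemma coeffwise_unit: "s (\<lambda>x. e0 x \<odot> \<one>) f = counit f \<odot>\<^bsub>H\<^esub> \<one>\<^bsub>H\<^esub>"
  by (simp add: smult_one_pseries counit_def coeffwise_def)

end

text \<open>
  The antipode axioms are stated through the existence of linear contraction maps on \<open>A \<otimes> A\<close>.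
  These are not homomorphisms, so they do not come from the universal property used for the other
  maps.
\<close>

locale hopf_algebra_data = hopf_data +
  assumes coassoc0: "x \<in> carrier A \<Longrightarrow> D1 (D0 x) = D2 (D0 x)"
    and counit0: "x \<in> carrier A \<Longrightarrow> E1 (D0 x) = x" "x \<in> carrier A \<Longrightarrow> E2 (D0 x) = x"
    and antipode0_left: "\<exists>l. linear_map A2.T A l \<and> (\<forall>x\<in>carrier A. \<forall>y\<in>carrier A. l (A2.pure x y) = S0 x \<otimes> y)
      \<and> (\<forall>x\<in>carrier A. l (D0 x) = e0 x \<odot> \<one>)"
    and antipode0_right: "\<exists>l. linear_map A2.T A l \<and> (\<forall>x\<in>carrier A. \<forall>y\<in>carrier A. l (A2.pure x y) = x \<otimes> S0 y)
      \<and> (\<forall>x\<in>carrier A. l (D0 x) = e0 x \<odot> \<one>)"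
begin

lemma mL_D0: assumes "f \<in> carrier H" shows "mL \<one>\<^bsub>H\<^esub> (s D0 f) = counit f \<odot>\<^bsub>H\<^esub> \<one>\<^bsub>H\<^esub>"
proof -
  obtain l where l: "linear_map A2.T A l" "\<And>x y. x \<in> carrier A \<Longrightarrow> y \<in> carrier A \<Longrightarrow> l (A2.pure x y) = S0 x \<otimes> y"
    "\<And>x. x \<in> carrier A \<Longrightarrow> l (D0 x) = e0 x \<odot> \<one>"
    using antipode0_left by blast
  have "mL \<one>\<^bsub>H\<^esub> X = s l X" if "X \<in> carrier H2" for X
  proof (rule A2.linear_map_ctensor_eqI[OF complex_alg_axioms mL_linear _ _ that])
    show "linear_map H2 H (s l)" by (rule coeffwise_linear[OF A2.complex_alg_T complex_alg_axioms l(1)])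
    fix a b assume "a \<in> carrier H" "b \<in> carrier H"
    then show "mL \<one>\<^bsub>H\<^esub> (ctensor A A a b) = s l (ctensor A A a b)"
      by (simp add: mL_ctensor, simp add: coeffwise_def ctensor_def pseries_mult pseries_carrier_iff
          linear_map_finsum[OF A2.T.ring_axioms ring_axioms l(1)] l(2))
  qed simp
  moreover have "s l (s D0 f) = s (\<lambda>x. e0 x \<odot> \<one>) f"
    using assms by (simp add: coeffwise_def l(3) pseries_carrier_iff)
  ultimately show ?thesis
    using assms by (simp add: coeffwise_unit alg_hom_simps[OF coeffwise_alg_hom[OF complex_alg_axioms A2.complex_alg_T D0]])
qed

lemma mR_D0: assumes "f \<in> carrier H" shows "mR \<one>\<^bsub>H\<^esub> (s D0 f) = counit f \<odot>\<^bsub>H\<^esub> \<one>\<^bsub>H\<^esub>"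
proof -
  obtain l where l: "linear_map A2.T A l" "\<And>x y. x \<in> carrier A \<Longrightarrow> y \<in> carrier A \<Longrightarrow> l (A2.pure x y) = x \<otimes> S0 y"
    "\<And>x. x \<in> carrier A \<Longrightarrow> l (D0 x) = e0 x \<odot> \<one>"
    using antipode0_right by blast
  have "mR \<one>\<^bsub>H\<^esub> X = s l X" if "X \<in> carrier H2" for X
  proof (rule A2.linear_map_ctensor_eqI[OF complex_alg_axioms mR_linear _ _ that])
    show "linear_map H2 H (s l)" by (rule coeffwise_linear[OF A2.complex_alg_T complex_alg_axioms l(1)])
    fix a b assume "a \<in> carrier H" "b \<in> carrier H"
    then show "mR \<one>\<^bsub>H\<^esub> (ctensor A A a b) = s l (ctensor A A a b)"
      by (simp add: mR_ctensor, simp add: coeffwise_def ctensor_def pseries_mult pseries_carrier_iff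
          linear_map_finsum[OF A2.T.ring_axioms ring_axioms l(1)] l(2))
  qed simp
  moreover have "s l (s D0 f) = s (\<lambda>x. e0 x \<odot> \<one>) f"
    using assms by (simp add: coeffwise_def l(3) pseries_carrier_iff)
  ultimately show ?thesis
    using assms by (simp add: coeffwise_unit alg_hom_simps[OF coeffwise_alg_hom[OF complex_alg_axioms A2.complex_alg_T D0]])
qed

end

lemma finsum_complex_field: "finite I \<Longrightarrow> finsum complex_field f I = sum f I"
proof -
  interpret C: complex_alg complex_field by (rule complex_alg_complex_field)
  show "finite I \<Longrightarrow> finsum complex_field f I = sum f I"
    by (induction I rule: finite_induct) (simp_all add: C.finsum_insert Pi_def)
qed

context hopf_data
begin

lemma counit_hom:
  "counit \<in> ring_hom H (ring_of_type :: complex fps ring)"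
  "f \<in> carrier H \<Longrightarrow> counit (c \<odot>\<^bsub>H\<^esub> f) = c * counit f"
proof -
  interpret C: complex_alg complex_field by (rule complex_alg_complex_field)
  note sums = linear_map_finsum[OF ring_axioms C.ring_axioms alg_hom_linear[OF e0]]
  have e0_zero: "e0 \<zero> = 0"
    using linear_map_zero[OF ring_axioms C.ring_axioms alg_hom_linear[OF e0]] by simp
  note e0_simps = alg_hom_simps[OF e0, unfolded complex_field_simps]
  show "counit \<in> ring_hom H (ring_of_type :: complex fps ring)"
  proof (rule ring_hom_memI)
    fix f g assume "f \<in> carrier H" "g \<in> carrier H"
    then show "counit (f \<otimes>\<^bsub>H\<^esub> g) = counit f \<otimes>\<^bsub>ring_of_type\<^esub> counit g"
      "counit (f \<oplus>\<^bsub>H\<^esub> g) = counit f \<oplus>\<^bsub>ring_of_type\<^esub> counit g"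
      by (auto intro!: fps_ext simp: counit_def pseries_mult pseries_add pseries_carrier_iff sums
          finsum_complex_field e0_simps fps_mult_nth atLeast0AtMost)
  qed (auto intro!: fps_ext simp: counit_def pseries_one e0_simps e0_zero)
  show "f \<in> carrier H \<Longrightarrow> counit (c \<odot>\<^bsub>H\<^esub> f) = c * counit f"
    by (auto intro!: fps_ext simp: counit_def pseries_smult pseries_carrier_iff sums
        finsum_complex_field e0_simps fps_mult_nth atLeast0AtMost)
qed

end

text \<open>
  Drinfeld twists. Write \<open>F = \<Sum> a \<otimes> b\<close> and \<open>G = F\<^sup>-\<^sup>1 = \<Sum> c \<otimes> d\<close>. The conditions in \<open>contract\<close> read
  \<open>\<Sum> S\<^sub>0(a) v b = 1\<close>, \<open>\<Sum> S\<^sub>0(c) d = v\<close>, \<open>\<Sum> c u S\<^sub>0(d) = 1\<close> and \<open>\<Sum> a S\<^sub>0(b) = u\<close>. They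
  say that \<open>u\<close> and \<open>v\<close> are the contractions of \<open>F\<close> and \<open>G\<close>, and that \<open>F\<close> contracted around
  \<open>v\<close> and \<open>G\<close> contracted around \<open>u\<close> cancel; the antipode axioms for \<open>u S\<^sub>0 v\<close> need exactly this.
\<close>

locale twisted_hopf_algebra = hopf_algebra_data +
  fixes F G :: "nat \<Rightarrow> ('a \<times> 'a \<Rightarrow>\<^sub>0 complex) set" and u v :: "nat \<Rightarrow> 'a"
  assumes twist_closed [simp]: "F \<in> carrier H2" "G \<in> carrier H2" "u \<in> carrier H" "v \<in> carrier H"
    and FG: "F \<otimes>\<^bsub>H2\<^esub> G = \<one>\<^bsub>H2\<^esub>" and GF: "G \<otimes>\<^bsub>H2\<^esub> F = \<one>\<^bsub>H2\<^esub>" and uv: "u \<otimes>\<^bsub>H\<^esub> v = \<one>\<^bsub>H\<^esub>"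
    and cocycle: "s j12 F \<otimes>\<^bsub>H3\<^esub> s D1 F = s A3.inr F \<otimes>\<^bsub>H3\<^esub> s D2 F"
    and counital: "s E1 F = \<one>\<^bsub>H\<^esub>" "s E2 F = \<one>\<^bsub>H\<^esub>" "s E1 G = \<one>\<^bsub>H\<^esub>" "s E2 G = \<one>\<^bsub>H\<^esub>"
    and contract: "mL v F = \<one>\<^bsub>H\<^esub>" "mL \<one>\<^bsub>H\<^esub> G = v" "mR u G = \<one>\<^bsub>H\<^esub>" "mR \<one>\<^bsub>H\<^esub> F = u"
begin

definition twisted_comult :: "(nat \<Rightarrow> 'a) \<Rightarrow> nat \<Rightarrow> ('a \<times> 'a \<Rightarrow>\<^sub>0 complex) set" where
  "twisted_comult f = F \<otimes>\<^bsub>H2\<^esub> (s D0 f \<otimes>\<^bsub>H2\<^esub> G)"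

definition twisted_antipode :: "(nat \<Rightarrow> 'a) \<Rightarrow> nat \<Rightarrow> 'a" where
  "twisted_antipode f = u \<otimes>\<^bsub>H\<^esub> (s S0 f \<otimes>\<^bsub>H\<^esub> v)"

lemmas sD0 = coeffwise_alg_hom[OF complex_alg_axioms A2.complex_alg_T D0]
lemmas sj12 = coeffwise_alg_hom[OF A2.complex_alg_T A3.complex_alg_T j12]
lemmas sD1 = coeffwise_alg_hom[OF A2.complex_alg_T A3.complex_alg_T D1]
lemmas sD2 = coeffwise_alg_hom[OF A2.complex_alg_T A3.complex_alg_T D2]
lemmas sE1 = coeffwise_alg_hom[OF A2.complex_alg_T complex_alg_axioms E1]
lemmas sE2 = coeffwise_alg_hom[OF A2.complex_alg_T complex_alg_axioms E2]
lemmas sj1 = coeffwise_alg_hom[OF complex_alg_axioms A3.complex_alg_T j_hom(1)]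
lemmas sj2 = coeffwise_alg_hom[OF complex_alg_axioms A3.complex_alg_T j_hom(2)]
lemmas sj3 = coeffwise_alg_hom[OF complex_alg_axioms A3.complex_alg_T j_hom(3)]

lemmas closed [simp] = alg_hom_simps(1)[OF sD0] alg_hom_simps(1)[OF sj12] alg_hom_simps(1)[OF sD1]
  alg_hom_simps(1)[OF sD2] alg_hom_simps(1)[OF sE1] alg_hom_simps(1)[OF sE2] alg_hom_simps(1)[OF sj1]
  alg_hom_simps(1)[OF sj2] alg_hom_simps(1)[OF sj3] alg_hom_simps(1)[OF A3.sinr_hom] A3.complex_alg_T

lemma twisted_comult_closed [simp]: "f \<in> carrier H \<Longrightarrow> twisted_comult f \<in> carrier H2"
  by (simp add: twisted_comult_def)

lemma twisted_comult_linear: "linear_map H H2 twisted_comult"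
  unfolding twisted_comult_def
  by (intro linear_map_comp[OF alg_hom_linear[OF sD0] linear_map_comp[OF A2.T.mult_linear(1) A2.T.mult_linear(2)]])
    simp_all

lemma twisted_comult_hom: "twisted_comult \<in> ring_hom H H2"
proof (rule ring_hom_memI)
  fix f g assume f: "f \<in> carrier H" and g: "g \<in> carrier H"
  have "twisted_comult f \<otimes>\<^bsub>H2\<^esub> twisted_comult g
      = F \<otimes>\<^bsub>H2\<^esub> (s D0 f \<otimes>\<^bsub>H2\<^esub> ((G \<otimes>\<^bsub>H2\<^esub> F) \<otimes>\<^bsub>H2\<^esub> (s D0 g \<otimes>\<^bsub>H2\<^esub> G)))"
    using f g by (simp add: twisted_comult_def A2.T.S.m_assoc)
  then show "twisted_comult (f \<otimes>\<^bsub>H\<^esub> g) = twisted_comult f \<otimes>\<^bsub>H2\<^esub> twisted_comult g"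
    using f g by (simp add: GF twisted_comult_def alg_hom_simps[OF sD0] A2.T.S.m_assoc)
  show "twisted_comult (f \<oplus>\<^bsub>H\<^esub> g) = twisted_comult f \<oplus>\<^bsub>H2\<^esub> twisted_comult g"
    using f g by (rule linear_map_add[OF twisted_comult_linear])
qed (simp_all add: twisted_comult_def alg_hom_simps[OF sD0] FG)

lemma twisted_antipode_linear: "linear_map H H twisted_antipode"
  unfolding twisted_antipode_def
  by (intro linear_map_comp[OF sS0_linear linear_map_comp[OF mult_linear(1) mult_linear(2)]]) simp_all

lemma lift_inner:
  assumes "b \<in> carrier H" "Y \<in> carrier H2"
  shows "ctensor_lift A A H3 (\<lambda>a' a''. ctensor A A2.T a' (ctensor A A a'' b)) Y = s j12 Y \<otimes>\<^bsub>H3\<^esub> s j3 b"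
proof (rule A2.ctensor_lift_eq[OF A3.complex_alg_T _ _ assms(2)])
  show "linear_map H2 H3 (\<lambda>Y. s j12 Y \<otimes>\<^bsub>H3\<^esub> s j3 b)"
    by (intro linear_map_comp[OF alg_hom_linear[OF sj12] A3.T.mult_linear(1)] alg_hom_simps(1)[OF sj3] assms(1))
  fix f g assume "f \<in> carrier H" "g \<in> carrier H"
  moreover have "s A3.inr (A2.sinl g) = s j2 g" "s A3.inr (A2.sinr b) = s j3 b" for g
    by (simp_all add: coeffwise_def j2_def j3_def)
  ultimately show "s j12 (ctensor A A f g) \<otimes>\<^bsub>H3\<^esub> s j3 b = ctensor A A2.T f (ctensor A A g b)"
    using assms by (simp add: j12_ctensor A3.ctensor_eq ctensor_closed A3.T.S.m_assoc alg_hom_simps(1)[OF sj3])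
      (simp add: A2.ctensor_eq A2.sinl_sinr_closed alg_hom_simps[OF A3.sinr_hom] j1_def)
qed

text \<open>
  Both sides of coassociativity are conjugates of an iterated undeformed coproduct: here by
  \<open>F \<otimes> 1\<close>, which commutes with the third tensor factor, and below by \<open>1 \<otimes> F\<close>, which commutes with
  the first.
\<close>

lemma lift_left:
  assumes "X \<in> carrier H2"
  shows "ctensor_lift A A H3 (\<lambda>a b. ctensor_lift A A H3 (\<lambda>a' a''. ctensor A A2.T a' (ctensor A A a'' b))
      (twisted_comult a)) X = s j12 F \<otimes>\<^bsub>H3\<^esub> (s D1 X \<otimes>\<^bsub>H3\<^esub> s j12 G)"
proof (rule A2.ctensor_lift_eq[OF A3.complex_alg_T _ _ assms])
  show "linear_map H2 H3 (\<lambda>X. s j12 F \<otimes>\<^bsub>H3\<^esub> (s D1 X \<otimes>\<^bsub>H3\<^esub> s j12 G))"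
    by (intro linear_map_comp[OF alg_hom_linear[OF sD1] linear_map_comp[OF A3.T.mult_linear(1) A3.T.mult_linear(2)]])
      simp_all
  fix f g assume f: "f \<in> carrier H" and g: "g \<in> carrier H"
  have comm: "s j3 g \<otimes>\<^bsub>H3\<^esub> s j12 G = s j12 G \<otimes>\<^bsub>H3\<^esub> s j3 g"
    using g twist_closed(2) by (intro coeffwise_commute[OF A3.complex_alg_T])
      (auto simp: coeffwise_def pseries_carrier_iff j12_j3 alg_hom_simps[OF j12] alg_hom_simps[OF j_hom(3)]
        simp del: twist_closed)
  have "s D1 (ctensor A A f g) = s j12 (s D0 f) \<otimes>\<^bsub>H3\<^esub> s j3 g"
    using f g by (simp add: D1_ctensor) (simp add: coeffwise_def)
  then show "s j12 F \<otimes>\<^bsub>H3\<^esub> (s D1 (ctensor A A f g) \<otimes>\<^bsub>H3\<^esub> s j12 G) =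
    ctensor_lift A A H3 (\<lambda>a' a''. ctensor A A2.T a' (ctensor A A a'' g)) (twisted_comult f)"
    using f g by (simp add: lift_inner) (simp add: twisted_comult_def alg_hom_simps[OF sj12] A3.T.S.m_assoc comm)
qed

lemma lift_right:
  assumes "X \<in> carrier H2"
  shows "ctensor_lift A A H3 (\<lambda>a b. ctensor A A2.T a (twisted_comult b)) X
    = s A3.inr F \<otimes>\<^bsub>H3\<^esub> (s D2 X \<otimes>\<^bsub>H3\<^esub> s A3.inr G)"
proof (rule A2.ctensor_lift_eq[OF A3.complex_alg_T _ _ assms])
  show "linear_map H2 H3 (\<lambda>X. s A3.inr F \<otimes>\<^bsub>H3\<^esub> (s D2 X \<otimes>\<^bsub>H3\<^esub> s A3.inr G))"
    by (intro linear_map_comp[OF alg_hom_linear[OF sD2] linear_map_comp[OF A3.T.mult_linear(1) A3.T.mult_linear(2)]])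
      simp_all
  fix f g assume f: "f \<in> carrier H" and g: "g \<in> carrier H"
  have comm: "s A3.inr F \<otimes>\<^bsub>H3\<^esub> s j1 f = s j1 f \<otimes>\<^bsub>H3\<^esub> s A3.inr F"
    using f twist_closed(1) by (intro coeffwise_commute[OF A3.complex_alg_T])
      (auto simp: coeffwise_def pseries_carrier_iff j1_inr alg_hom_simps[OF A3.inr_hom] alg_hom_simps[OF j_hom(1)]
        simp del: twist_closed)
  have "s D2 (ctensor A A f g) = s j1 f \<otimes>\<^bsub>H3\<^esub> s A3.inr (s D0 g)"
    using f g by (simp add: D2_ctensor) (simp add: coeffwise_def)
  then have "s A3.inr F \<otimes>\<^bsub>H3\<^esub> (s D2 (ctensor A A f g) \<otimes>\<^bsub>H3\<^esub> s A3.inr G)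
      = (s A3.inr F \<otimes>\<^bsub>H3\<^esub> s j1 f) \<otimes>\<^bsub>H3\<^esub> (s A3.inr (s D0 g) \<otimes>\<^bsub>H3\<^esub> s A3.inr G)"
    using f g by (simp add: A3.T.S.m_assoc)
  also have "\<dots> = s j1 f \<otimes>\<^bsub>H3\<^esub> s A3.inr (twisted_comult g)"
    using f g by (simp add: comm twisted_comult_def alg_hom_simps[OF A3.sinr_hom] A3.T.S.m_assoc)
  also have "\<dots> = ctensor A A2.T f (twisted_comult g)"
    using f g by (simp add: A3.ctensor_eq j1_def)
  finally show "s A3.inr F \<otimes>\<^bsub>H3\<^esub> (s D2 (ctensor A A f g) \<otimes>\<^bsub>H3\<^esub> s A3.inr G) = ctensor A A2.T f (twisted_comult g)" .
qed

lemma cocycle_inverse: "s D1 G \<otimes>\<^bsub>H3\<^esub> s j12 G = s D2 G \<otimes>\<^bsub>H3\<^esub> s A3.inr G"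
proof -
  let ?P = "s j12 F \<otimes>\<^bsub>H3\<^esub> s D1 F" and ?Q = "s D1 G \<otimes>\<^bsub>H3\<^esub> s j12 G" and ?Q' = "s D2 G \<otimes>\<^bsub>H3\<^esub> s A3.inr G"
  have inverse: "h G \<otimes>\<^bsub>H3\<^esub> h F = \<one>\<^bsub>H3\<^esub>" "h F \<otimes>\<^bsub>H3\<^esub> h G = \<one>\<^bsub>H3\<^esub>" if "alg_hom H2 H3 h" for h
    using that by (simp_all add: GF FG alg_hom_simps[OF that] flip: alg_hom_simps(3)[OF that])
  have assoc: "a \<otimes>\<^bsub>H3\<^esub> b \<otimes>\<^bsub>H3\<^esub> (c \<otimes>\<^bsub>H3\<^esub> d) = a \<otimes>\<^bsub>H3\<^esub> (b \<otimes>\<^bsub>H3\<^esub> c) \<otimes>\<^bsub>H3\<^esub> d"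
    if "a \<in> carrier H3" "b \<in> carrier H3" "c \<in> carrier H3" "d \<in> carrier H3" for a b c d
    using that by (simp add: A3.T.S.m_assoc)
  have QP: "?Q \<otimes>\<^bsub>H3\<^esub> ?P = \<one>\<^bsub>H3\<^esub>"
    by (simp add: assoc inverse(1)[OF sj12] inverse(1)[OF sD1])
  have "?P \<otimes>\<^bsub>H3\<^esub> ?Q' = \<one>\<^bsub>H3\<^esub>"
    by (simp add: cocycle assoc inverse(2)[OF A3.sinr_hom] inverse(2)[OF sD2])
  then have "?Q = ?Q \<otimes>\<^bsub>H3\<^esub> (?P \<otimes>\<^bsub>H3\<^esub> ?Q')" by simp
  also have "\<dots> = (?Q \<otimes>\<^bsub>H3\<^esub> ?P) \<otimes>\<^bsub>H3\<^esub> ?Q'" by (rule A3.T.S.m_assoc[symmetric]) simp_all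
  finally show ?thesis by (simp add: QP)
qed

text \<open>
  By the cocycle equation and its inverse the two conjugating elements agree; in the middle is the
  coassociativity of \<open>\<Delta>\<^sub>0\<close>.
\<close>

lemma coassociative:
  assumes "x \<in> carrier H"
  shows "s j12 F \<otimes>\<^bsub>H3\<^esub> (s D1 (twisted_comult x) \<otimes>\<^bsub>H3\<^esub> s j12 G)
    = s A3.inr F \<otimes>\<^bsub>H3\<^esub> (s D2 (twisted_comult x) \<otimes>\<^bsub>H3\<^esub> s A3.inr G)"
proof -
  have D: "s D1 (s D0 x) = s D2 (s D0 x)"
    using assms by (simp add: coeffwise_def coassoc0 pseries_carrier_iff)
  have "s j12 F \<otimes>\<^bsub>H3\<^esub> (s D1 (twisted_comult x) \<otimes>\<^bsub>H3\<^esub> s j12 G)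
      = (s j12 F \<otimes>\<^bsub>H3\<^esub> s D1 F) \<otimes>\<^bsub>H3\<^esub> (s D1 (s D0 x) \<otimes>\<^bsub>H3\<^esub> (s D1 G \<otimes>\<^bsub>H3\<^esub> s j12 G))"
    using assms by (simp add: twisted_comult_def alg_hom_simps[OF sD1] A3.T.S.m_assoc)
  also have "\<dots> = (s A3.inr F \<otimes>\<^bsub>H3\<^esub> s D2 F) \<otimes>\<^bsub>H3\<^esub> (s D2 (s D0 x) \<otimes>\<^bsub>H3\<^esub> (s D2 G \<otimes>\<^bsub>H3\<^esub> s A3.inr G))"
    by (simp only: cocycle cocycle_inverse D)
  also have "\<dots> = s A3.inr F \<otimes>\<^bsub>H3\<^esub> (s D2 (twisted_comult x) \<otimes>\<^bsub>H3\<^esub> s A3.inr G)"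
    using assms by (simp add: twisted_comult_def alg_hom_simps[OF sD2] A3.T.S.m_assoc)
  finally show ?thesis .
qed

lemma counit_left:
  assumes "x \<in> carrier H"
  shows "ctensor_lift A A H (\<lambda>a b. counit a \<odot>\<^bsub>H\<^esub> b) (twisted_comult x) = x"
proof -
  have "ctensor_lift A A H (\<lambda>a b. counit a \<odot>\<^bsub>H\<^esub> b) (twisted_comult x) = s E1 (twisted_comult x)"
  proof (rule A2.ctensor_lift_eq[OF complex_alg_axioms alg_hom_linear[OF sE1]])
    fix f g assume "f \<in> carrier H" "g \<in> carrier H"
    moreover have "s (\<lambda>x. x) g = g" by (simp add: coeffwise_def)
    ultimately show "s E1 (ctensor A A f g) = counit f \<odot>\<^bsub>H\<^esub> g"
      by (simp add: E1_ctensor coeffwise_unit pseries_smult_mult)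
  qed (rule twisted_comult_closed[OF assms])
  also have "s E1 (s D0 x) = x"
    using assms by (simp add: coeffwise_def counit0 pseries_carrier_iff)
  then have "s E1 (twisted_comult x) = x"
    using assms by (simp add: twisted_comult_def alg_hom_simps[OF sE1] counital)
  finally show ?thesis .
qed

lemma counit_right:
  assumes "x \<in> carrier H"
  shows "ctensor_lift A A H (\<lambda>a b. counit b \<odot>\<^bsub>H\<^esub> a) (twisted_comult x) = x"
proof -
  have "ctensor_lift A A H (\<lambda>a b. counit b \<odot>\<^bsub>H\<^esub> a) (twisted_comult x) = s E2 (twisted_comult x)"
  proof (rule A2.ctensor_lift_eq[OF complex_alg_axioms alg_hom_linear[OF sE2]])
    fix f g assume "f \<in> carrier H" "g \<in> carrier H"
    moreover have "s (\<lambda>x. x) f = f" by (simp add: coeffwise_def)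
    ultimately show "s E2 (ctensor A A f g) = counit g \<odot>\<^bsub>H\<^esub> f"
      by (simp add: E2_ctensor coeffwise_unit pseries_smult_mult)
  qed (rule twisted_comult_closed[OF assms])
  also have "s E2 (s D0 x) = x"
    using assms by (simp add: coeffwise_def counit0 pseries_carrier_iff)
  then have "s E2 (twisted_comult x) = x"
    using assms by (simp add: twisted_comult_def alg_hom_simps[OF sE2] counital)
  finally show ?thesis .
qed

lemma antipode_left:
  assumes "x \<in> carrier H"
  shows "ctensor_lift A A H (\<lambda>a b. twisted_antipode a \<otimes>\<^bsub>H\<^esub> b) (twisted_comult x) = counit x \<odot>\<^bsub>H\<^esub> \<one>\<^bsub>H\<^esub>"
proof -
  interpret Mod: Module.module "ring_of_type :: complex fps ring" H by (rule module_pseries)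
  have "ctensor_lift A A H (\<lambda>a b. twisted_antipode a \<otimes>\<^bsub>H\<^esub> b) (twisted_comult x) = u \<otimes>\<^bsub>H\<^esub> mL v (twisted_comult x)"
  proof (rule A2.ctensor_lift_eq[OF complex_alg_axioms, where \<phi> = "\<lambda>X. u \<otimes>\<^bsub>H\<^esub> mL v X"])
    show "linear_map H2 H (\<lambda>X. u \<otimes>\<^bsub>H\<^esub> mL v X)"
      by (intro linear_map_comp[OF mL_linear mult_linear(2)]) simp_all
    fix f g assume "f \<in> carrier H" "g \<in> carrier H"
    then show "u \<otimes>\<^bsub>H\<^esub> mL v (ctensor A A f g) = twisted_antipode f \<otimes>\<^bsub>H\<^esub> g"
      by (simp add: mL_ctensor twisted_antipode_def S.m_assoc)
  next
    show "twisted_comult x \<in> carrier H2" by (rule twisted_comult_closed[OF assms])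
  qed
  also have "mL v (twisted_comult x) = mL \<one>\<^bsub>H\<^esub> (s D0 x \<otimes>\<^bsub>H2\<^esub> G)"
    unfolding twisted_comult_def using assms mL_mult[of v "\<one>\<^bsub>H\<^esub>" F "s D0 x \<otimes>\<^bsub>H2\<^esub> G" 1] Mod.smult_one
    by (simp add: contract linear_map_closed[OF mL_linear])
  also have "\<dots> = counit x \<odot>\<^bsub>H\<^esub> v"
    using assms mL_mult[of "\<one>\<^bsub>H\<^esub>" "\<one>\<^bsub>H\<^esub>" "s D0 x" G "counit x"] by (simp add: mL_D0 contract)
  finally show ?thesis by (simp add: pseries_smult_mult uv)
qed

lemma antipode_right:
  assumes "x \<in> carrier H"
  shows "ctensor_lift A A H (\<lambda>a b. a \<otimes>\<^bsub>H\<^esub> twisted_antipode b) (twisted_comult x) = counit x \<odot>\<^bsub>H\<^esub> \<one>\<^bsub>H\<^esub>"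
proof -
  interpret Mod: Module.module "ring_of_type :: complex fps ring" H by (rule module_pseries)
  have "ctensor_lift A A H (\<lambda>a b. a \<otimes>\<^bsub>H\<^esub> twisted_antipode b) (twisted_comult x) = mR u (twisted_comult x) \<otimes>\<^bsub>H\<^esub> v"
  proof (rule A2.ctensor_lift_eq[OF complex_alg_axioms, where \<phi> = "\<lambda>X. mR u X \<otimes>\<^bsub>H\<^esub> v"])
    show "linear_map H2 H (\<lambda>X. mR u X \<otimes>\<^bsub>H\<^esub> v)"
      by (intro linear_map_comp[OF mR_linear mult_linear(1)]) simp_all
    fix f g assume "f \<in> carrier H" "g \<in> carrier H"
    then show "mR u (ctensor A A f g) \<otimes>\<^bsub>H\<^esub> v = f \<otimes>\<^bsub>H\<^esub> twisted_antipode g"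
      by (simp add: mR_ctensor twisted_antipode_def S.m_assoc)
  next
    show "twisted_comult x \<in> carrier H2" by (rule twisted_comult_closed[OF assms])
  qed
  also have "mR u (s D0 x \<otimes>\<^bsub>H2\<^esub> G) = counit x \<odot>\<^bsub>H\<^esub> \<one>\<^bsub>H\<^esub>"
    using assms mR_mult[of u "\<one>\<^bsub>H\<^esub>" G "s D0 x" 1] Mod.smult_one
    by (simp add: contract mR_D0 smult_pseries_closed)
  then have "mR u (twisted_comult x) = counit x \<odot>\<^bsub>H\<^esub> u"
    unfolding twisted_comult_def
    using assms mR_mult[of u "\<one>\<^bsub>H\<^esub>" "s D0 x \<otimes>\<^bsub>H2\<^esub> G" F "counit x"] by (simp add: contract)
  finally show ?thesis by (simp add: pseries_smult_mult uv)
qed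

theorem is_hopf_algebra_twisted: "is_hopf_algebra A twisted_comult counit twisted_antipode"
  unfolding is_hopf_algebra_def Let_def
  by (intro conjI ballI allI S.ring_axioms module_pseries pseries_smult_mult twisted_comult_hom
      twisted_comult_linear counit_hom twisted_antipode_linear counit_left counit_right antipode_left antipode_right)
    (simp_all add: lift_left lift_right coassociative)

end

section \<open>The standard Hopf structure of an enveloping algebra\<close>

context enveloping
begin

sublocale UU2: tensor_product UU UU by unfold_locales

text \<open>
  The three structure maps are determined by their values on the Lie algebra, where they exist by
  the universal property.
\<close>

definition "Delta0 = (SOME h. alg_hom UU (tensor UU UU) h \<and>
  (\<forall>x. h (iota x) = UU2.inl (iota x) \<oplus>\<^bsub>tensor UU UU\<^esub> UU2.inr (iota x)))"

definition "antipode0 = (SOME h. alg_hom UU (opposite UU) h \<and> (\<forall>x. h (iota x) = \<ominus>\<^bsub>UU\<^esub> iota x))"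

definition "counit0 = (SOME h. alg_hom UU complex_field h \<and> (\<forall>x. h (iota x) = 0))"

lemmas in_simps = alg_hom_simps[OF UU2.inl_hom] alg_hom_simps[OF UU2.inr_hom]

lemma commutator_inl_inr:
  fixes x y :: "'b \<Rightarrow>\<^sub>0 complex"
  defines "P \<equiv> \<lambda>x. UU2.inl (iota x) \<oplus>\<^bsub>tensor UU UU\<^esub> UU2.inr (iota x)"
  shows "P (br x y) = P x \<otimes>\<^bsub>tensor UU UU\<^esub> P y \<ominus>\<^bsub>tensor UU UU\<^esub> P y \<otimes>\<^bsub>tensor UU UU\<^esub> P x"
proof -
  let ?e = "emb (tensor UU UU)"
  define X X' Y Y' where "X = ?e (UU2.inl (iota x))" "X' = ?e (UU2.inr (iota x))"
    "Y = ?e (UU2.inl (iota y))" "Y' = ?e (UU2.inr (iota y))"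
  note defs = this
  have comm: "X * Y' = Y' * X" "X' * Y = Y * X'"
    unfolding defs by (simp_all add: in_simps iota_simps UU2.inl_inr UU2.inr_inl flip: UU2.T.emb_mult)
  have l: "UU2.inl (iota (br x y)) = UU2.inl (iota x) \<otimes>\<^bsub>UU2.T\<^esub> UU2.inl (iota y) \<ominus>\<^bsub>UU2.T\<^esub> UU2.inl (iota y) \<otimes>\<^bsub>UU2.T\<^esub> UU2.inl (iota x)"
    and r: "UU2.inr (iota (br x y)) = UU2.inr (iota x) \<otimes>\<^bsub>UU2.T\<^esub> UU2.inr (iota y) \<ominus>\<^bsub>UU2.T\<^esub> UU2.inr (iota y) \<otimes>\<^bsub>UU2.T\<^esub> UU2.inr (iota x)"
    by (simp_all add: iota_br a_minus_def in_simps iota_simps UU.smult_minus_one[symmetric] UU2.T.smult_minus_one[symmetric])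
  have "?e (P (br x y)) = (X * Y - Y * X) + (X' * Y' - Y' * X')"
    unfolding P_def l r defs by (simp add: in_simps iota_simps UU2.T.emb_simps)
  also have "\<dots> = (X + X') * (Y + Y') - (Y + Y') * (X + X')"
    by (simp add: algebra_simps comm)
  also have "\<dots> = ?e (P x \<otimes>\<^bsub>UU2.T\<^esub> P y \<ominus>\<^bsub>UU2.T\<^esub> P y \<otimes>\<^bsub>UU2.T\<^esub> P x)"
    unfolding P_def defs by (simp add: in_simps iota_simps UU2.T.emb_simps)
  finally show ?thesis
    by (subst (asm) UU2.T.emb_inject) (simp_all add: P_def in_simps iota_simps)
qed

lemma Delta0: "alg_hom UU (tensor UU UU) Delta0"
  and Delta0_iota: "Delta0 (iota x) = UU2.inl (iota x) \<oplus>\<^bsub>tensor UU UU\<^esub> UU2.inr (iota x)"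
proof -
  have "\<exists>h. alg_hom UU (tensor UU UU) h \<and> (\<forall>x. h (iota x) = UU2.inl (iota x) \<oplus>\<^bsub>tensor UU UU\<^esub> UU2.inr (iota x))"
    by (rule UU_hom_exists[OF UU2.complex_alg_T _ _ _ commutator_inl_inr])
      (simp_all add: in_simps iota_simps UU2.T.smult_r_distr UU2.T.a_ac)
  from someI_ex[OF this] show "alg_hom UU (tensor UU UU) Delta0"
    "Delta0 (iota x) = UU2.inl (iota x) \<oplus>\<^bsub>tensor UU UU\<^esub> UU2.inr (iota x)"
    unfolding Delta0_def by blast+
qed

lemma antipode0: "alg_hom UU (opposite UU) antipode0"
  and antipode0_iota: "antipode0 (iota x) = \<ominus>\<^bsub>UU\<^esub> iota x"
proof -
  interpret op: complex_alg "opposite UU" by (rule UU.complex_alg_opposite)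
  have op_minus: "\<ominus>\<^bsub>opposite UU\<^esub> x = \<ominus>\<^bsub>UU\<^esub> x" if "x \<in> carrier UU" for x
    using that op.minus_equality[of "\<ominus>\<^bsub>UU\<^esub> x" x] by (simp add: UU.l_neg)
  have "\<exists>h. alg_hom UU (opposite UU) h \<and> (\<forall>x. h (iota x) = \<ominus>\<^bsub>UU\<^esub> iota x)"
    by (rule UU_hom_exists[OF UU.complex_alg_opposite])
      (simp_all add: iota_simps UU.minus_add UU.smult_r_minus iota_br a_minus_def op_minus UU.l_minus UU.r_minus UU.a_ac)
  from someI_ex[OF this] show "alg_hom UU (opposite UU) antipode0" "antipode0 (iota x) = \<ominus>\<^bsub>UU\<^esub> iota x"
    unfolding antipode0_def by blast+
qed

lemma counit0: "alg_hom UU complex_field counit0"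
  and counit0_iota: "counit0 (iota x) = 0"
proof -
  interpret C: complex_alg complex_field by (rule complex_alg_complex_field)
  have "\<ominus>\<^bsub>complex_field\<^esub> 0 = 0" using C.minus_zero by simp
  then have "\<exists>h. alg_hom UU complex_field h \<and> (\<forall>x. h (iota x) = 0)"
    by (intro UU_hom_exists complex_alg_complex_field) (simp_all add: a_minus_def)
  from someI_ex[OF this] show "alg_hom UU complex_field counit0" "counit0 (iota x) = 0"
    unfolding counit0_def by blast+
qed

sublocale hopf: hopf_data UU Delta0 antipode0 counit0
  by unfold_locales (rule Delta0 antipode0 counit0)+

lemmas hom_simps = alg_hom_simps[OF Delta0] alg_hom_simps[OF counit0, unfolded complex_field_simps] hopf.S0_simps

text \<open>
  It suffices to go from \<open>X\<close> to \<open>b X\<close> for a generator \<open>b\<close>. With \<open>Z = \<Delta>\<^sub>0(X)\<close> one has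
  \<open>\<Delta>\<^sub>0(b X) = (b \<otimes> 1) Z + (1 \<otimes> b) Z\<close>. In the left contraction the two terms cancel; in the right
  contraction they give the commutator of \<open>b\<close> with the contraction of \<open>Z\<close>, which is a scalar by
  induction.
\<close>

lemma antipode0_exists:
  "\<exists>l. linear_map UU2.T UU l \<and> (\<forall>x\<in>carrier UU. \<forall>y\<in>carrier UU. l (UU2.pure x y) = antipode0 x \<otimes>\<^bsub>UU\<^esub> y)
    \<and> (\<forall>x\<in>carrier UU. l (Delta0 x) = counit0 x \<odot>\<^bsub>UU\<^esub> \<one>\<^bsub>UU\<^esub>)"
  "\<exists>l. linear_map UU2.T UU l \<and> (\<forall>x\<in>carrier UU. \<forall>y\<in>carrier UU. l (UU2.pure x y) = x \<otimes>\<^bsub>UU\<^esub> antipode0 y)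
    \<and> (\<forall>x\<in>carrier UU. l (Delta0 x) = counit0 x \<odot>\<^bsub>UU\<^esub> \<one>\<^bsub>UU\<^esub>)"
proof -
  interpret L: bilinear_map UU UU UU "\<lambda>x y. antipode0 x \<otimes>\<^bsub>UU\<^esub> y"
    by unfold_locales (auto simp: linear_map_def hopf.S0_simps UU.l_distr UU.r_distr UU.smult_mult_left UU.smult_mult_right)
  interpret R: bilinear_map UU UU UU "\<lambda>x y. x \<otimes>\<^bsub>UU\<^esub> antipode0 y"
    by unfold_locales (auto simp: linear_map_def hopf.S0_simps UU.l_distr UU.r_distr UU.smult_mult_left UU.smult_mult_right)
  note L = linear_map_closed[OF L.tlift_linear] linear_map_add[OF L.tlift_linear] linear_map_smult[OF L.tlift_linear]
  note R = linear_map_closed[OF R.tlift_linear] linear_map_add[OF R.tlift_linear] linear_map_smult[OF R.tlift_linear]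
  have L_gen: "L.tlift (UU2.inl (iota b) \<otimes>\<^bsub>UU2.T\<^esub> Z) \<oplus>\<^bsub>UU\<^esub> L.tlift (UU2.inr (iota b) \<otimes>\<^bsub>UU2.T\<^esub> Z) = \<zero>\<^bsub>UU\<^esub>"
    if "Z \<in> carrier UU2.T" for b Z
    using that
  proof (induction rule: UU2.T_induct)
    case (pure x y)
    then show ?case
      by (simp add: UU2.inl_def UU2.inr_def UU2.pure_mult iota_simps L.tlift_pure hopf.S0_simps antipode0_iota
          UU.m_assoc UU.l_minus UU.r_minus UU.l_neg)
  next
    case (add X Y)
    then have "L.tlift (UU2.inl (iota b) \<otimes>\<^bsub>UU2.T\<^esub> (X \<oplus>\<^bsub>UU2.T\<^esub> Y)) \<oplus>\<^bsub>UU\<^esub> L.tlift (UU2.inr (iota b) \<otimes>\<^bsub>UU2.T\<^esub> (X \<oplus>\<^bsub>UU2.T\<^esub> Y))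
      = (L.tlift (UU2.inl (iota b) \<otimes>\<^bsub>UU2.T\<^esub> X) \<oplus>\<^bsub>UU\<^esub> L.tlift (UU2.inr (iota b) \<otimes>\<^bsub>UU2.T\<^esub> X))
        \<oplus>\<^bsub>UU\<^esub> (L.tlift (UU2.inl (iota b) \<otimes>\<^bsub>UU2.T\<^esub> Y) \<oplus>\<^bsub>UU\<^esub> L.tlift (UU2.inr (iota b) \<otimes>\<^bsub>UU2.T\<^esub> Y))"
      by (simp add: L UU2.T.r_distr in_simps iota_simps UU.a_ac)
    with add show ?case by simp
  qed
  have R_gen: "R.tlift (UU2.inl (iota b) \<otimes>\<^bsub>UU2.T\<^esub> Z) \<oplus>\<^bsub>UU\<^esub> R.tlift (UU2.inr (iota b) \<otimes>\<^bsub>UU2.T\<^esub> Z)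
      = iota b \<otimes>\<^bsub>UU\<^esub> R.tlift Z \<ominus>\<^bsub>UU\<^esub> R.tlift Z \<otimes>\<^bsub>UU\<^esub> iota b"
    if "Z \<in> carrier UU2.T" for b Z
    using that
  proof (induction rule: UU2.T_induct)
    case (pure x y)
    then show ?case
      by (simp add: UU2.inl_def UU2.inr_def UU2.pure_mult iota_simps R.tlift_pure hopf.S0_simps antipode0_iota
          UU.m_assoc UU.l_minus UU.r_minus a_minus_def)
  next
    case (add X Y)
    have "R.tlift (UU2.inl (iota b) \<otimes>\<^bsub>UU2.T\<^esub> (X \<oplus>\<^bsub>UU2.T\<^esub> Y)) \<oplus>\<^bsub>UU\<^esub> R.tlift (UU2.inr (iota b) \<otimes>\<^bsub>UU2.T\<^esub> (X \<oplus>\<^bsub>UU2.T\<^esub> Y))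
      = (R.tlift (UU2.inl (iota b) \<otimes>\<^bsub>UU2.T\<^esub> X) \<oplus>\<^bsub>UU\<^esub> R.tlift (UU2.inr (iota b) \<otimes>\<^bsub>UU2.T\<^esub> X))
        \<oplus>\<^bsub>UU\<^esub> (R.tlift (UU2.inl (iota b) \<otimes>\<^bsub>UU2.T\<^esub> Y) \<oplus>\<^bsub>UU\<^esub> R.tlift (UU2.inr (iota b) \<otimes>\<^bsub>UU2.T\<^esub> Y))"
      using add(1,2) by (simp add: R UU2.T.r_distr in_simps iota_simps UU.a_ac)
    also have "\<dots> = iota b \<otimes>\<^bsub>UU\<^esub> R.tlift (X \<oplus>\<^bsub>UU2.T\<^esub> Y) \<ominus>\<^bsub>UU\<^esub> R.tlift (X \<oplus>\<^bsub>UU2.T\<^esub> Y) \<otimes>\<^bsub>UU\<^esub> iota b"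
      using add by (simp add: R iota_simps UU.l_distr UU.r_distr a_minus_def UU.minus_add UU.a_ac)
    finally show ?case .
  qed
  have "L.tlift (Delta0 x) = counit0 x \<odot>\<^bsub>UU\<^esub> \<one>\<^bsub>UU\<^esub>" if "x \<in> carrier UU" for x
    using that
  proof (induction rule: UU_induct)
    case one
    show ?case by (simp add: hom_simps UU2.pure_one L.tlift_pure)
  next
    case (mult b X)
    then have "L.tlift (Delta0 (iota (Poly_Mapping.single b 1) \<otimes>\<^bsub>UU\<^esub> X)) = \<zero>\<^bsub>UU\<^esub>"
      using L_gen[of "Delta0 X"]
      by (simp add: hom_simps iota_simps Delta0_iota UU2.T.l_distr in_simps L)
    with mult show ?case by (simp add: hom_simps iota_simps counit0_iota)
  qed (simp_all add: hom_simps L UU.smult_l_distr UU.smult_assoc)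
  then show "\<exists>l. linear_map UU2.T UU l \<and> (\<forall>x\<in>carrier UU. \<forall>y\<in>carrier UU. l (UU2.pure x y) = antipode0 x \<otimes>\<^bsub>UU\<^esub> y)
    \<and> (\<forall>x\<in>carrier UU. l (Delta0 x) = counit0 x \<odot>\<^bsub>UU\<^esub> \<one>\<^bsub>UU\<^esub>)"
    using L.tlift_linear L.tlift_pure by blast
  have "R.tlift (Delta0 x) = counit0 x \<odot>\<^bsub>UU\<^esub> \<one>\<^bsub>UU\<^esub>" if "x \<in> carrier UU" for x
    using that
  proof (induction rule: UU_induct)
    case one
    show ?case by (simp add: hom_simps UU2.pure_one R.tlift_pure)
  next
    case (mult b X)
    then have "R.tlift (Delta0 (iota (Poly_Mapping.single b 1) \<otimes>\<^bsub>UU\<^esub> X)) = \<zero>\<^bsub>UU\<^esub>"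
      using R_gen[of "Delta0 X"]
      by (simp add: hom_simps iota_simps Delta0_iota UU2.T.l_distr in_simps R UU.smult_mult_left
          UU.smult_mult_right a_minus_def UU.r_neg)
    with mult show ?case by (simp add: hom_simps iota_simps counit0_iota)
  qed (simp_all add: hom_simps R UU.smult_l_distr UU.smult_assoc)
  then show "\<exists>l. linear_map UU2.T UU l \<and> (\<forall>x\<in>carrier UU. \<forall>y\<in>carrier UU. l (UU2.pure x y) = x \<otimes>\<^bsub>UU\<^esub> antipode0 y)
    \<and> (\<forall>x\<in>carrier UU. l (Delta0 x) = counit0 x \<odot>\<^bsub>UU\<^esub> \<one>\<^bsub>UU\<^esub>)"
    using R.tlift_linear R.tlift_pure by blast
qed

sublocale hopf: hopf_algebra_data UU Delta0 antipode0 counit0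
proof
  fix x assume x: "x \<in> carrier UU"
  show "hopf.D1 (Delta0 x) = hopf.D2 (Delta0 x)"
  proof (rule UU_hom_eqI[OF alg_hom_comp[OF Delta0 hopf.D1] alg_hom_comp[OF Delta0 hopf.D2] _ x])
    fix b
    show "hopf.D1 (Delta0 (iota (Poly_Mapping.single b 1))) = hopf.D2 (Delta0 (iota (Poly_Mapping.single b 1)))"
      by (simp add: Delta0_iota in_simps iota_simps alg_hom_simps[OF hopf.D1] alg_hom_simps[OF hopf.D2]
          hopf.D1_inl hopf.D1_inr hopf.D2_inl hopf.D2_inr alg_hom_simps[OF hopf.j12] hopf.j12_inl hopf.j12_inr
          alg_hom_simps[OF hopf.A3.inr_hom])
        (simp add: hopf.j2_def hopf.j3_def alg_hom_simps[OF hopf.j_hom(1)] in_simps iota_simps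
          alg_hom_simps[OF hopf.A3.inr_hom] hopf.A3.T.a_assoc)
  qed
  show "hopf.E1 (Delta0 x) = x"
  proof (rule UU_hom_eqI[OF alg_hom_comp[OF Delta0 hopf.E1] hopf.unit_hom(2) _ x])
    fix b
    show "hopf.E1 (Delta0 (iota (Poly_Mapping.single b 1))) = iota (Poly_Mapping.single b 1)"
      by (simp add: Delta0_iota in_simps iota_simps alg_hom_simps[OF hopf.E1] UU2.inl_def UU2.inr_def
          hopf.E1_pure counit0_iota hom_simps)
  qed
  show "hopf.E2 (Delta0 x) = x"
  proof (rule UU_hom_eqI[OF alg_hom_comp[OF Delta0 hopf.E2] hopf.unit_hom(2) _ x])
    fix b
    show "hopf.E2 (Delta0 (iota (Poly_Mapping.single b 1))) = iota (Poly_Mapping.single b 1)"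
      by (simp add: Delta0_iota in_simps iota_simps alg_hom_simps[OF hopf.E2] UU2.inl_def UU2.inr_def
          hopf.E2_pure counit0_iota hom_simps)
  qed
qed (rule antipode0_exists)+

end

section \<open>Normally ordered powers and their contractions in an algebra\<close>

text \<open>
  The normally ordered power of the previous sections for elements of a record.
\<close>

definition rpow :: "(complex, 'a) module \<Rightarrow> 'a \<Rightarrow> 'a \<Rightarrow> nat \<Rightarrow> 'a" where
  "rpow R E X = (\<lambda>k. ((1 / fact k) \<odot>\<^bsub>R\<^esub> rising R 0 X k) \<otimes>\<^bsub>R\<^esub> (E [^]\<^bsub>R\<^esub> k))"

context complex_alg
begin

lemma rising_proj: "rising A a (proj A X) k = proj A (rise a X k)"
  by (induction k) (simp_all add: complex_alg_axioms)

lemma rising_closed [simp]: "X \<in> carrier A \<Longrightarrow> rising A a X k \<in> carrier A"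
  by (induction k) simp_all

lemma rbinom_proj: "proj A (rbinom X k) = (1 / fact k) \<odot> rising A 0 (proj A X) k"
  by (simp add: rbinom_def proj_scalar_mult rising_proj del: proj_simps(6))

lemma rpow_proj: "rpow A (proj A E) (proj A X) = sproj A (npow E X)"
  by (simp add: rpow_def sproj_def complex_alg_axioms rbinom_proj proj_power)

lemma rpow_emb: "E \<in> carrier A \<Longrightarrow> X \<in> carrier A \<Longrightarrow> rpow A E X = sproj A (npow (emb A E) (emb A X))"
  by (simp flip: rpow_proj)

lemma rpow_closed [simp]: "E \<in> carrier A \<Longrightarrow> X \<in> carrier A \<Longrightarrow> rpow A E X \<in> carrier (pseries A)"
  by (simp add: rpow_emb)

lemma rpow_zero: "E \<in> carrier A \<Longrightarrow> rpow A E \<zero> = \<one>\<^bsub>pseries A\<^esub>"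
  using rpow_proj[of "emb A E" 0] by (simp add: complex_alg_axioms sproj_one)

lemma rpow_zero_base: "X \<in> carrier A \<Longrightarrow> rpow A \<zero> X = \<one>\<^bsub>pseries A\<^esub>"
proof -
  assume "X \<in> carrier A"
  moreover have "npow 0 X = 1" for X :: "'a alg_prod"
    by (rule fps_ext) (simp add: power_0_left)
  ultimately show ?thesis
    using rpow_proj[of 0 "emb A X"] by (simp add: complex_alg_axioms sproj_one)
qed

lemma sproj_tseries: "sproj A (tseries f) = tsum A (\<lambda>j. sproj A (f j))"
  by (simp add: sproj_def tsum_def proj_sum)

end

lemma hom_rising:
  assumes "complex_alg R" "complex_alg S" "alg_hom R S h" "x \<in> carrier R"
  shows "h (rising R a x k) = rising S a (h x) k"
proof -
  interpret R: complex_alg R by fact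
  interpret S: complex_alg S by fact
  show ?thesis using assms(4) by (induction k) (simp_all add: alg_hom_simps[OF assms(3)])
qed

lemma hom_power:
  assumes "complex_alg R" "complex_alg S" "alg_hom R S h" "x \<in> carrier R"
  shows "h (x [^]\<^bsub>R\<^esub> (k :: nat)) = h x [^]\<^bsub>S\<^esub> k"
proof -
  interpret R: complex_alg R by fact
  interpret S: complex_alg S by fact
  show ?thesis using assms(4) by (induction k) (simp_all add: alg_hom_simps[OF assms(3)])
qed

lemma hom_rpow:
  assumes "complex_alg R" "complex_alg S" "alg_hom R S h" "E \<in> carrier R" "X \<in> carrier R"
  shows "coeffwise h (rpow R E X) = rpow S (h E) (h X)"
proof -
  interpret R: complex_alg R by fact
  interpret S: complex_alg S by fact
  show ?thesis
    using assms(4,5)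
    by (simp add: coeffwise_def rpow_def alg_hom_simps[OF assms(3)] hom_rising[OF assms(1-3)] hom_power[OF assms(1-3)])
qed

lemma hom_uminus:
  assumes "complex_alg R" "complex_alg S" "alg_hom R S h" "x \<in> carrier R"
  shows "h (\<ominus>\<^bsub>R\<^esub> x) = \<ominus>\<^bsub>S\<^esub> h x"
proof -
  interpret R: complex_alg R by fact
  interpret S: complex_alg S by fact
  show ?thesis
    using assms(4) by (simp add: alg_hom_simps[OF assms(3)] flip: R.smult_minus_one S.smult_minus_one)
qed

text \<open>
  In these two lemmas the contraction of the twist inserts a series between the two tensor factors
  of each term: the series \<open>1\<close> leaves a normally ordered power, and a power with the opposite
  exponent cancels by the Vandermonde identity.
\<close>

lemma tseries_npow_contract:
  "tseries (\<lambda>k. fps_const (rbinom Y k) * fps_const (E ^ k)) = npow E Y"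
  by (rule fps_ext) (simp add: if_distrib sum.delta cong: if_cong)

lemma tseries_npow_cancel:
  "tseries (\<lambda>k. fps_const (rbinom X k) * npow E (- X) * fps_const (E ^ k)) = 1"
proof (rule fps_ext)
  fix n
  have "rbinom X k * (rbinom (- X) (n - k) * E ^ (n - k)) * E ^ k = rbinom X k * rbinom (- X) (n - k) * E ^ n" if "k \<le> n" for k
    using that by (simp add: mult.assoc flip: power_add)
  then have "fps_nth (tseries (\<lambda>k. fps_const (rbinom X k) * npow E (- X) * fps_const (E ^ k))) n = rbinom (X + - X) n * E ^ n"
    by (subst rbinom_add) (simp_all add: sum_distrib_right)
  then show "fps_nth (tseries (\<lambda>k. fps_const (rbinom X k) * npow E (- X) * fps_const (E ^ k))) n = fps_nth 1 n"
    by (simp add: rbinom_zero)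
qed

lemma (in hopf_data) mL_pure_series:
  assumes "w \<in> carrier H" and a: "\<And>k. a k \<in> carrier A" and b: "\<And>k. b k \<in> carrier A"
  shows "mL w (\<lambda>k. A2.pure (a k) (b k)) = tsum A (\<lambda>k. const A (S0 (a k)) \<otimes>\<^bsub>H\<^esub> w \<otimes>\<^bsub>H\<^esub> const A (b k))"
    and "mR w (\<lambda>k. A2.pure (a k) (b k)) = tsum A (\<lambda>k. const A (a k) \<otimes>\<^bsub>H\<^esub> w \<otimes>\<^bsub>H\<^esub> const A (S0 (b k)))"
proof -
  have S0_const: "s S0 (const A x) = const A (S0 x)" for x
    using linear_map_zero[OF ring_axioms ring_axioms S0_linear] by (auto simp: coeffwise_def const_def)
  have X: "(\<lambda>k. A2.pure (a k) (b k)) \<in> carrier H2" using a b by (simp add: pseries_carrier_iff)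
  have "mL w (const A2.T (A2.pure (a k) (b k))) = const A (S0 (a k)) \<otimes>\<^bsub>H\<^esub> w \<otimes>\<^bsub>H\<^esub> const A (b k)" for k
    using mL_ctensor[OF assms(1), of "const A (a k)" "const A (b k)"] a b
    by (simp add: A2.ctensor_const S0_const const_closed)
  then show "mL w (\<lambda>k. A2.pure (a k) (b k)) = tsum A (\<lambda>k. const A (S0 (a k)) \<otimes>\<^bsub>H\<^esub> w \<otimes>\<^bsub>H\<^esub> const A (b k))"
    by (intro ext, subst linear_map_coeff[OF A2.complex_alg_T complex_alg_axioms mL_linear[OF assms(1)] X])
      (simp add: tsum_def)
  have "mR w (const A2.T (A2.pure (a k) (b k))) = const A (a k) \<otimes>\<^bsub>H\<^esub> w \<otimes>\<^bsub>H\<^esub> const A (S0 (b k))" for k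
    using mR_ctensor[OF assms(1), of "const A (a k)" "const A (b k)"] a b
    by (simp add: A2.ctensor_const S0_const const_closed)
  then show "mR w (\<lambda>k. A2.pure (a k) (b k)) = tsum A (\<lambda>k. const A (a k) \<otimes>\<^bsub>H\<^esub> w \<otimes>\<^bsub>H\<^esub> const A (S0 (b k)))"
    by (intro ext, subst linear_map_coeff[OF A2.complex_alg_T complex_alg_axioms mR_linear[OF assms(1)] X])
      (simp add: tsum_def)
qed

section \<open>The Jordanian twist\<close>

text \<open>
  Elements \<open>\<tau>\<close>, \<open>\<epsilon>\<close> of a Lie algebra that span a two-dimensional nonabelian subalgebra.
\<close>

locale jordanian = enveloping br for br :: "('b \<Rightarrow>\<^sub>0 complex) \<Rightarrow> ('b \<Rightarrow>\<^sub>0 complex) \<Rightarrow> ('b \<Rightarrow>\<^sub>0 complex)" +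
  fixes \<tau> \<epsilon> :: "'b \<Rightarrow>\<^sub>0 complex"
  assumes br_\<tau>_\<epsilon>: "br \<tau> \<epsilon> = \<epsilon>"
begin

abbreviation "T \<equiv> iota \<tau>"
abbreviation "E \<equiv> iota \<epsilon>"

lemmas TE_closed [simp] = iota_simps(3)[of \<tau>] iota_simps(3)[of \<epsilon>]

text \<open>
  Primed and numbered copies live in the product of all algebras: \<open>T'\<close>, \<open>E'\<close> over \<open>U\<close>, and
  \<open>T1\<close>, \<open>E2\<close> for \<open>T \<otimes> 1\<close>, \<open>1 \<otimes> E\<close> over \<open>U \<otimes> U\<close>.
\<close>

definition "T' = emb UU T"
definition "E' = emb UU E"

lemma proj_TE [simp]: "proj UU T' = T" "proj UU E' = E"
  by (simp_all add: T'_def E'_def)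

lemma T'_E': "T' * E' = E' * T' + E'"
proof -
  have "emb UU E = emb UU (T \<otimes>\<^bsub>UU\<^esub> E \<ominus>\<^bsub>UU\<^esub> E \<otimes>\<^bsub>UU\<^esub> T)"
    using iota_br[of \<tau> \<epsilon>] by (simp add: br_\<tau>_\<epsilon>)
  then have "emb UU E = emb UU T * emb UU E - emb UU E * emb UU T"
    by (simp only: UU.emb_simps TE_closed UU.m_closed)
  then show ?thesis unfolding T'_def E'_def by (simp only: eq_diff_eq add.commute)
qed

definition "T1 = emb UU2.T (UU2.inl T)"
definition "E2 = emb UU2.T (UU2.inr E)"

lemma proj_T1_E2 [simp]: "proj UU2.T T1 = UU2.inl T" "proj UU2.T E2 = UU2.inr E"
  by (simp_all add: T1_def E2_def in_simps)

lemma T1_E2: "T1 * E2 = E2 * T1"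
  by (simp add: T1_def E2_def in_simps UU2.inl_inr UU2.inr_inl flip: UU2.T.emb_mult)

text \<open>
  The twist \<open>F = (1 - 1 \<otimes> E t)\<^sup>T\<^sup>\<otimes>\<^sup>1\<close> and its inverse \<open>G\<close>, with \<open>u = \<Sum> a S\<^sub>0(b)\<close> for \<open>F = \<Sum> a \<otimes> b\<close>
  and \<open>v = \<Sum> S\<^sub>0(c) d\<close> for \<open>G = \<Sum> c \<otimes> d\<close>. Both \<open>u\<close> and \<open>v\<close> are normally ordered powers,
  since \<open>S\<^sub>0\<close> changes the signs of \<open>T\<close> and \<open>E\<close>.
\<close>

definition "F = rpow UU2.T (UU2.inr E) (\<ominus>\<^bsub>UU2.T\<^esub> UU2.inl T)"
definition "G = rpow UU2.T (UU2.inr E) (UU2.inl T)"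
definition "u = rpow UU (\<ominus>\<^bsub>UU\<^esub> E) (\<ominus>\<^bsub>UU\<^esub> T)"
definition "v = rpow UU E (\<ominus>\<^bsub>UU\<^esub> T)"

lemma twist_sproj:
  "F = sproj UU2.T (npow E2 (- T1))" "G = sproj UU2.T (npow E2 T1)"
  "u = sproj UU (npow (- E') (- T'))" "v = sproj UU (npow E' (- T'))"
  unfolding F_def G_def u_def v_def
  using UU2.T.rpow_proj[of E2 "- T1"] UU2.T.rpow_proj[of E2 T1] UU.rpow_proj[of "- E'" "- T'"] UU.rpow_proj[of E' "- T'"]
  by (simp_all add: UU2.complex_alg_T)

lemma rpow_pure:
  assumes "x \<in> carrier UU"
  shows "rpow UU2.T (UU2.inr E) (UU2.inl x) = (\<lambda>k. UU2.pure ((1 / fact k) \<odot>\<^bsub>UU\<^esub> rising UU 0 x k) (E [^]\<^bsub>UU\<^esub> k))"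
  using assms
  by (simp add: rpow_def in_simps UU2.inl_inr
      flip: hom_rising[OF complex_alg_UU UU2.complex_alg_T UU2.inl_hom] hom_power[OF complex_alg_UU UU2.complex_alg_T UU2.inr_hom]
        UU2.T.smult_mult_left)
    (simp add: UU2.T.smult_mult_left in_simps UU2.inl_inr flip: UU2.pure_smult_left)

lemma antipode0_rising:
  assumes "x \<in> carrier UU" "antipode0 x = y"
  shows "antipode0 (rising UU 0 x k) = rising UU 0 y k"
proof -
  have y: "y \<in> carrier UU" using assms by (auto simp: hom_simps)
  obtain Y where Y: "y = proj UU Y" using y UU.proj_emb_same by metis
  have comm: "(y \<oplus>\<^bsub>UU\<^esub> c \<odot>\<^bsub>UU\<^esub> \<one>\<^bsub>UU\<^esub>) \<otimes>\<^bsub>UU\<^esub> rising UU 0 y k = rising UU 0 y k \<otimes>\<^bsub>UU\<^esub> (y \<oplus>\<^bsub>UU\<^esub> c \<odot>\<^bsub>UU\<^esub> \<one>\<^bsub>UU\<^esub>)" for c k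
  proof -
    have "(Y + scalar c) * rise 0 Y k = rise 0 Y k * (Y + scalar c)"
      by (rule rise_intertwine) (simp add: distrib_left distrib_right scalar_commute)
    then have "proj UU ((Y + scalar c) * rise 0 Y k) = proj UU (rise 0 Y k * (Y + scalar c))" by simp
    then show ?thesis by (simp add: Y UU.rising_proj)
  qed
  show ?thesis
    by (induction k) (use assms comm in \<open>simp_all add: hom_simps\<close>)
qed

lemma antipode0_power:
  assumes "x \<in> carrier UU"
  shows "antipode0 (x [^]\<^bsub>UU\<^esub> (k :: nat)) = antipode0 x [^]\<^bsub>UU\<^esub> k"
  by (induction k) (use assms in \<open>simp_all add: hom_simps UU.nat_pow_comm[of _ 1 k, simplified] flip: UU.nat_pow_Suc2\<close>)

text \<open>
  The four homomorphisms map \<open>F\<close> to normally ordered powers of the generators of \<open>U\<^sup>\<otimes>\<^sup>3\<close>, which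
  satisfy \<open>npow_cocycle\<close>.
\<close>

lemma twist_cocycle:
  "coeffwise hopf.j12 F \<otimes>\<^bsub>pseries hopf.A3.T\<^esub> coeffwise hopf.D1 F
    = coeffwise hopf.A3.inr F \<otimes>\<^bsub>pseries hopf.A3.T\<^esub> coeffwise hopf.D2 F"
proof -
  note T3 = hopf.A3.complex_alg_T
  note j = alg_hom_simps[OF hopf.j_hom(1)] alg_hom_simps[OF hopf.j_hom(2)] alg_hom_simps[OF hopf.j_hom(3)]
  note rpow_simps = hom_rpow[OF UU2.complex_alg_T T3] hom_uminus[OF UU2.complex_alg_T T3]
  define e2 e3 t1 t2 where defs: "e2 = emb hopf.A3.T (hopf.j2 E)" "e3 = emb hopf.A3.T (hopf.j3 E)"
    "t1 = emb hopf.A3.T (hopf.j1 T)" "t2 = emb hopf.A3.T (hopf.j2 T)"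
  have proj: "proj hopf.A3.T e2 = hopf.j2 E" "proj hopf.A3.T e3 = hopf.j3 E"
    "proj hopf.A3.T t1 = hopf.j1 T" "proj hopf.A3.T t2 = hopf.j2 T"
    by (simp_all add: defs j)
  have inr: "hopf.A3.inr (UU2.inr E) = hopf.j3 E" "hopf.A3.inr (UU2.inl x) = hopf.j2 x" for x
    by (simp_all add: hopf.j2_def hopf.j3_def)
  have 1: "coeffwise hopf.j12 F = sproj hopf.A3.T (npow e2 (- t1))"
    unfolding F_def using hopf.A3.T.rpow_proj[of e2 "- t1"]
    by (simp add: rpow_simps[OF hopf.j12] in_simps hopf.j12_inl hopf.j12_inr proj T3)
  have 2: "coeffwise hopf.D1 F = sproj hopf.A3.T (npow e3 (- t1 + - t2))"
    unfolding F_def using hopf.A3.T.rpow_proj[of e3 "- t1 + - t2"]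
    by (simp add: rpow_simps[OF hopf.D1] in_simps hopf.D1_inl hopf.D1_inr proj T3 Delta0_iota
        alg_hom_simps[OF hopf.j12] hopf.j12_inl hopf.j12_inr j hopf.A3.T.minus_add a_minus_def)
  have 3: "coeffwise hopf.A3.inr F = sproj hopf.A3.T (npow e3 (- t2))"
    unfolding F_def using hopf.A3.T.rpow_proj[of e3 "- t2"]
    by (simp add: rpow_simps[OF hopf.A3.inr_hom] in_simps proj T3 inr)
  have 4: "coeffwise hopf.D2 F = sproj hopf.A3.T (npow (e2 + e3) (- t1))"
    unfolding F_def using hopf.A3.T.rpow_proj[of "e2 + e3" "- t1"]
    by (simp add: rpow_simps[OF hopf.D2] in_simps hopf.D2_inl hopf.D2_inr proj T3 Delta0_iota
        alg_hom_simps[OF hopf.A3.inr_hom] inr)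
  have comm: "e2 * e3 = e3 * e2" "t1 * e2 = e2 * t1" "t1 * e3 = e3 * t1" "t1 * t2 = t2 * t1" "t2 * e3 = e3 * t2"
    by (simp_all add: defs j hopf.j2_j3 hopf.j1_j2 hopf.j1_j3 flip: hopf.A3.T.emb_mult)
  have "hopf.j2 E = hopf.j2 T \<otimes>\<^bsub>hopf.A3.T\<^esub> hopf.j2 E \<ominus>\<^bsub>hopf.A3.T\<^esub> hopf.j2 E \<otimes>\<^bsub>hopf.A3.T\<^esub> hopf.j2 T"
    using arg_cong[OF iota_br[of \<tau> \<epsilon>], of hopf.j2]
    by (simp add: br_\<tau>_\<epsilon> a_minus_def j hom_uminus[OF complex_alg_UU T3 hopf.j_hom(2)])
  then have "e2 = t2 * e2 - e2 * t2"
    unfolding defs by (metis hopf.A3.T.emb_minus hopf.A3.T.emb_mult hopf.A3.T.m_closed j(6) TE_closed)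
  then have "t2 * e2 = e2 * t2 + e2" by (simp only: eq_diff_eq add.commute)
  then have "npow e2 (- t1) * npow e3 (- t1 + - t2) = npow e3 (- t2) * npow (e2 + e3) (- t1)"
    using comm by (intro npow_cocycle) simp_all
  then show ?thesis
    unfolding 1 2 3 4 by (simp flip: hopf.A3.T.sproj_mult)
qed

lemma twist_counital:
  "coeffwise hopf.E1 F = \<one>\<^bsub>pseries UU\<^esub>" "coeffwise hopf.E2 F = \<one>\<^bsub>pseries UU\<^esub>"
  "coeffwise hopf.E1 G = \<one>\<^bsub>pseries UU\<^esub>" "coeffwise hopf.E2 G = \<one>\<^bsub>pseries UU\<^esub>"
proof -
  have E1: "hopf.E1 (UU2.inl T) = \<zero>\<^bsub>UU\<^esub>" "hopf.E1 (UU2.inr E) = E"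
    by (simp_all add: UU2.inl_def UU2.inr_def hopf.E1_pure counit0_iota hom_simps)
  have E2: "hopf.E2 (UU2.inl T) = T" "hopf.E2 (UU2.inr E) = \<zero>\<^bsub>UU\<^esub>"
    by (simp_all add: UU2.inl_def UU2.inr_def hopf.E2_pure counit0_iota hom_simps)
  note rpow_simps = hom_rpow[OF UU2.complex_alg_T complex_alg_UU] hom_uminus[OF UU2.complex_alg_T complex_alg_UU]
  show "coeffwise hopf.E1 F = \<one>\<^bsub>pseries UU\<^esub>" "coeffwise hopf.E1 G = \<one>\<^bsub>pseries UU\<^esub>"
    unfolding F_def G_def by (simp_all add: rpow_simps[OF hopf.E1] in_simps E1 UU.rpow_zero)
  show "coeffwise hopf.E2 F = \<one>\<^bsub>pseries UU\<^esub>" "coeffwise hopf.E2 G = \<one>\<^bsub>pseries UU\<^esub>"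
    unfolding F_def G_def by (simp_all add: rpow_simps[OF hopf.E2] in_simps E2 UU.rpow_zero_base)
qed

text \<open>
  The \<open>k\<close>-th coefficient of the twist is a pure tensor, so its contraction can be written down.
\<close>

lemma contract_rpow:
  assumes "x \<in> carrier UU" "w \<in> carrier (pseries UU)" "antipode0 x = y"
  shows "hopf.mL w (rpow UU2.T (UU2.inr E) (UU2.inl x))
      = tsum UU (\<lambda>k. const UU ((1 / fact k) \<odot>\<^bsub>UU\<^esub> rising UU 0 y k) \<otimes>\<^bsub>pseries UU\<^esub> w \<otimes>\<^bsub>pseries UU\<^esub> const UU (E [^]\<^bsub>UU\<^esub> k))"
    "hopf.mR w (rpow UU2.T (UU2.inr E) (UU2.inl x))
      = tsum UU (\<lambda>k. const UU ((1 / fact k) \<odot>\<^bsub>UU\<^esub> rising UU 0 x k) \<otimes>\<^bsub>pseries UU\<^esub> w \<otimes>\<^bsub>pseries UU\<^esub> const UU ((\<ominus>\<^bsub>UU\<^esub> E) [^]\<^bsub>UU\<^esub> k))"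
  using assms
  by (simp_all add: rpow_pure hopf.mL_pure_series hopf.S0_simps antipode0_rising
      antipode0_power antipode0_iota)

lemma contract_sproj:
  assumes "proj UU Y = y" "proj UU P = p" "w = sproj UU W"
  shows "tsum UU (\<lambda>k. const UU ((1 / fact k) \<odot>\<^bsub>UU\<^esub> rising UU 0 y k) \<otimes>\<^bsub>pseries UU\<^esub> w \<otimes>\<^bsub>pseries UU\<^esub> const UU (p [^]\<^bsub>UU\<^esub> k))
    = sproj UU (tseries (\<lambda>k. fps_const (rbinom Y k) * W * fps_const (P ^ k)))"
  unfolding assms(1,2)[symmetric] assms(3)
  by (simp add: UU.sproj_tseries UU.sproj_mult UU.sproj_const UU.rbinom_proj UU.proj_power)

lemma antipode0_T: "antipode0 T = \<ominus>\<^bsub>UU\<^esub> T" "antipode0 (\<ominus>\<^bsub>UU\<^esub> T) = T"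
  by (simp_all add: antipode0_iota hom_uminus[OF complex_alg_UU UU.complex_alg_opposite antipode0] flip: iota_linear)

lemma F_inl: "F = rpow UU2.T (UU2.inr E) (UU2.inl (\<ominus>\<^bsub>UU\<^esub> T))"
  by (simp add: F_def hom_uminus[OF complex_alg_UU UU2.complex_alg_T UU2.inl_hom])

lemma twist_closed: "F \<in> carrier (pseries UU2.T)" "G \<in> carrier (pseries UU2.T)" "u \<in> carrier (pseries UU)" "v \<in> carrier (pseries UU)"
  by (simp_all add: twist_sproj)

lemma twist_contract:
  "hopf.mL v F = \<one>\<^bsub>pseries UU\<^esub>" "hopf.mL \<one>\<^bsub>pseries UU\<^esub> G = v"
  "hopf.mR u G = \<one>\<^bsub>pseries UU\<^esub>" "hopf.mR \<one>\<^bsub>pseries UU\<^esub> F = u"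
proof -
  have minus: "proj UU (- T') = \<ominus>\<^bsub>UU\<^esub> T" "proj UU (- E') = \<ominus>\<^bsub>UU\<^esub> E" by simp_all
  note one = UU.sproj_one[symmetric]
  have "hopf.mL v F = sproj UU (tseries (\<lambda>k. fps_const (rbinom T' k) * npow E' (- T') * fps_const (E' ^ k)))"
    unfolding F_inl
    by (rule trans[OF contract_rpow(1)[OF _ twist_closed(4) antipode0_T(2)] contract_sproj[OF proj_TE(1) proj_TE(2) twist_sproj(4)]]) simp_all
  then show "hopf.mL v F = \<one>\<^bsub>pseries UU\<^esub>"
    by (simp add: tseries_npow_cancel UU.sproj_one)
  have "hopf.mL \<one>\<^bsub>pseries UU\<^esub> G = sproj UU (tseries (\<lambda>k. fps_const (rbinom (- T') k) * 1 * fps_const (E' ^ k)))"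
    unfolding G_def
    by (rule trans[OF contract_rpow(1)[OF _ UU.S.one_closed antipode0_T(1)] contract_sproj[OF minus(1) proj_TE(2) one]]) simp_all
  then show "hopf.mL \<one>\<^bsub>pseries UU\<^esub> G = v"
    by (simp only: mult_1_right tseries_npow_contract twist_sproj)
  have "hopf.mR u G = sproj UU (tseries (\<lambda>k. fps_const (rbinom T' k) * npow (- E') (- T') * fps_const ((- E') ^ k)))"
    unfolding G_def
    by (rule trans[OF contract_rpow(2)[OF _ twist_closed(3) antipode0_T(1)] contract_sproj[OF proj_TE(1) minus(2) twist_sproj(3)]]) simp_all
  then show "hopf.mR u G = \<one>\<^bsub>pseries UU\<^esub>"
    by (simp add: tseries_npow_cancel UU.sproj_one)
  have "hopf.mR \<one>\<^bsub>pseries UU\<^esub> F = sproj UU (tseries (\<lambda>k. fps_const (rbinom (- T') k) * 1 * fps_const ((- E') ^ k)))"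
    unfolding F_inl
    by (rule trans[OF contract_rpow(2)[OF _ UU.S.one_closed antipode0_T(2)] contract_sproj[OF minus(1) minus(2) one]]) simp_all
  then show "hopf.mR \<one>\<^bsub>pseries UU\<^esub> F = u"
    by (simp only: mult_1_right tseries_npow_contract twist_sproj)
qed

sublocale twist: twisted_hopf_algebra UU Delta0 antipode0 counit0 F G u v
proof
  have "npow E2 (- T1) * npow E2 T1 = 1" "npow E2 T1 * npow E2 (- T1) = 1"
    by (simp_all add: npow_mult T1_E2)
  then show "F \<otimes>\<^bsub>pseries UU2.T\<^esub> G = \<one>\<^bsub>pseries UU2.T\<^esub>" "G \<otimes>\<^bsub>pseries UU2.T\<^esub> F = \<one>\<^bsub>pseries UU2.T\<^esub>"
    by (simp_all add: twist_sproj UU2.T.sproj_one flip: UU2.T.sproj_mult)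
  have "npow (- E') (- T') * npow E' (- T') = 1"
    by (rule npow_uminus_mult) (simp add: T'_E')
  then show "u \<otimes>\<^bsub>pseries UU\<^esub> v = \<one>\<^bsub>pseries UU\<^esub>"
    by (simp add: twist_sproj UU.sproj_one flip: UU.sproj_mult)
qed (rule twist_closed twist_cocycle twist_counital twist_contract)+

subsection \<open>The coproduct and the antipode on weight vectors\<close>

text \<open>
  The ordinary power \<open>(1 - E t)\<^sup>a\<close>, which is the normally ordered one with a scalar exponent.
\<close>

definition opow :: "complex \<Rightarrow> nat \<Rightarrow> ('b list \<Rightarrow>\<^sub>0 complex) set" where
  "opow a = (\<lambda>k. ((-1) ^ k * (a gchoose k)) \<odot>\<^bsub>UU\<^esub> (E [^]\<^bsub>UU\<^esub> k))"

lemma rise_scalar: "rise a (scalar x) k = scalar (pochhammer (a + x) k)"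
  by (induction k) (simp_all add: pochhammer_Suc scalar_mult scalar_add add_ac)

lemma rbinom_scalar: "rbinom (scalar (- a)) k = scalar ((- 1) ^ k * (a gchoose k))"
  by (simp add: rbinom_def rise_scalar gbinomial_pochhammer flip: scalar_mult)

lemma opow_sproj: "opow a = sproj UU (npow E' (scalar (- a)))"
  by (simp add: opow_def sproj_def rbinom_scalar UU.proj_scalar_mult UU.proj_power del: proj_simps(6))

lemma opow_closed [simp]: "opow a \<in> carrier (pseries UU)"
  by (simp add: opow_sproj)

lemma sinr_opow: "UU2.sinr (opow a) = sproj UU2.T (npow E2 (scalar (- a)))"
  by (simp add: opow_def coeffwise_def sproj_def rbinom_scalar UU2.T.proj_scalar_mult UU2.T.proj_power in_simps
      hom_power[OF complex_alg_UU UU2.complex_alg_T UU2.inr_hom] del: proj_simps(6))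

lemma coeffwise_const:
  assumes "complex_alg R" "complex_alg S" "linear_map R S h"
  shows "coeffwise h (const R x) = const S (h x)"
  using linear_map_zero[OF _ _ assms(3)] assms(1,2)
  by (auto simp: coeffwise_def const_def complex_alg_def)

lemma emb_iter:
  "emb UU (iota ((br \<epsilon> ^^ j) y)) = iter_ad E' j (emb UU (iota y))"
  by (induction j) (simp_all add: iota_br iota_simps UU.emb_simps E'_def)

lemma emb_inr_iter:
  "emb UU2.T (UU2.inr (iota ((br \<epsilon> ^^ j) y))) = iter_ad E2 j (emb UU2.T (UU2.inr (iota y)))"
  by (induction j)
    (simp_all add: iota_br a_minus_def hom_uminus[OF complex_alg_UU UU2.complex_alg_T UU2.inr_hom]
      in_simps iota_simps UU2.T.emb_simps E2_def)

lemma emb_weight: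
  assumes "br \<tau> y = scale r y"
  shows "T' * emb UU (iota y) = emb UU (iota y) * T' + scalar r * emb UU (iota y)"
    and "T1 * emb UU2.T (UU2.inl (iota y)) = emb UU2.T (UU2.inl (iota y)) * T1 + scalar r * emb UU2.T (UU2.inl (iota y))"
proof -
  have *: "T \<otimes>\<^bsub>UU\<^esub> iota y \<ominus>\<^bsub>UU\<^esub> iota y \<otimes>\<^bsub>UU\<^esub> T = r \<odot>\<^bsub>UU\<^esub> iota y"
    using iota_br[of \<tau> y] by (simp add: assms iota_simps)
  from arg_cong[OF this, of "emb UU"]
  have "T' * emb UU (iota y) - emb UU (iota y) * T' = scalar r * emb UU (iota y)"
    by (simp add: UU.emb_simps iota_simps T'_def)
  then show "T' * emb UU (iota y) = emb UU (iota y) * T' + scalar r * emb UU (iota y)"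
    by (simp only: diff_eq_eq add.commute)
  from arg_cong[OF *, of "\<lambda>x. emb UU2.T (UU2.inl x)"]
  have "T1 * emb UU2.T (UU2.inl (iota y)) - emb UU2.T (UU2.inl (iota y)) * T1 = scalar r * emb UU2.T (UU2.inl (iota y))"
    by (simp add: a_minus_def hom_uminus[OF complex_alg_UU UU2.complex_alg_T UU2.inl_hom]
        in_simps iota_simps UU2.T.emb_simps T1_def)
  then show "T1 * emb UU2.T (UU2.inl (iota y)) = emb UU2.T (UU2.inl (iota y)) * T1 + scalar r * emb UU2.T (UU2.inl (iota y))"
    by (simp only: diff_eq_eq add.commute)
qed

text \<open>
  The terms of \<open>\<Delta>\<^sub>0(y) = y \<otimes> 1 + 1 \<otimes> y\<close> are conjugated separately: the first commutes with \<open>1 \<otimes> E\<close>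
  and has a weight for \<open>T \<otimes> 1\<close>; the second commutes with \<open>T \<otimes> 1\<close>.
\<close>

theorem comult_weight:
  assumes "br \<tau> y = scale r y"
  shows "twist.twisted_comult (const UU (iota y)) =
    ctensor UU UU (const UU (iota y)) (opow r) \<oplus>\<^bsub>pseries UU2.T\<^esub>
    tsum UU2.T (\<lambda>j. fps_const ((- 1) ^ j / fact j) \<odot>\<^bsub>pseries UU2.T\<^esub>
      ctensor UU UU (const UU (rising UU 0 T j))
        (opow (- of_nat j) \<otimes>\<^bsub>pseries UU\<^esub> const UU (iota ((br \<epsilon> ^^ j) y))))"
proof -
  define Y1 Y2 where Y: "Y1 = emb UU2.T (UU2.inl (iota y))" "Y2 = emb UU2.T (UU2.inr (iota y))"
  have pY: "proj UU2.T Y1 = UU2.inl (iota y)" "proj UU2.T Y2 = UU2.inr (iota y)"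
    by (simp_all add: Y in_simps iota_simps)
  have D0: "coeffwise Delta0 (const UU (iota y)) = sproj UU2.T (fps_const (Y1 + Y2))"
    by (simp add: coeffwise_const[OF complex_alg_UU UU2.complex_alg_T alg_hom_linear[OF Delta0]]
        UU2.T.sproj_const Delta0_iota pY UU2.complex_alg_T)
  have "twist.twisted_comult (const UU (iota y))
      = sproj UU2.T (npow E2 (- T1) * (fps_const (Y1 + Y2) * npow E2 T1))"
    by (simp only: twist.twisted_comult_def D0 UU2.T.sproj_mult) (simp only: twist_sproj)
  also have "npow E2 (- T1) * (fps_const (Y1 + Y2) * npow E2 T1)
      = npow E2 (- T1) * fps_const Y1 * npow E2 T1 + npow E2 (- T1) * fps_const Y2 * npow E2 T1"
    by (simp add: distrib_left distrib_right mult.assoc flip: fps_const_add)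
  also have "npow E2 (- T1) * fps_const Y1 * npow E2 T1 = fps_const Y1 * npow E2 (- scalar r)"
    by (rule npow_conjugate_left[OF T1_E2 _ emb_weight(2)[OF assms, folded Y]])
      (simp add: Y E2_def in_simps iota_simps UU2.inl_inr UU2.inr_inl flip: UU2.T.emb_mult)
  also have "npow E2 (- T1) * fps_const Y2 * npow E2 T1
      = tseries (\<lambda>j. fps_const ((- 1) ^ j * rbinom T1 j) * npow E2 (of_nat j) * fps_const (iter_ad E2 j Y2))"
    by (rule npow_conjugate_right[OF T1_E2])
      (simp add: Y T1_def in_simps iota_simps UU2.inl_inr UU2.inr_inl flip: UU2.T.emb_mult)
  finally have *: "twist.twisted_comult (const UU (iota y))
    = sproj UU2.T (fps_const Y1 * npow E2 (- scalar r)) \<oplus>\<^bsub>pseries UU2.T\<^esub>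
      tsum UU2.T (\<lambda>j. sproj UU2.T (fps_const ((- 1) ^ j * rbinom T1 j) * npow E2 (of_nat j) * fps_const (iter_ad E2 j Y2)))"
    by (simp only: UU2.T.sproj_add UU2.T.sproj_tseries)
  have sinl_const: "UU2.sinl (const UU x) = const UU2.T (UU2.inl x)" for x
    by (rule coeffwise_const[OF complex_alg_UU UU2.complex_alg_T alg_hom_linear[OF UU2.inl_hom]])
  have sinr_const: "UU2.sinr (const UU x) = const UU2.T (UU2.inr x)" for x
    by (rule coeffwise_const[OF complex_alg_UU UU2.complex_alg_T alg_hom_linear[OF UU2.inr_hom]])
  have 1: "sproj UU2.T (fps_const Y1 * npow E2 (- scalar r)) = ctensor UU UU (const UU (iota y)) (opow r)"
    using iota_simps(3)[of y]
    by (simp add: UU2.ctensor_eq UU.const_closed sinl_const sinr_opow UU2.T.sproj_mult UU2.T.sproj_const pY scalar_uminus)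
  have 2: "sproj UU2.T (fps_const ((- 1) ^ j * rbinom T1 j) * npow E2 (of_nat j) * fps_const (iter_ad E2 j Y2))
    = fps_const ((- 1) ^ j / fact j) \<odot>\<^bsub>pseries UU2.T\<^esub>
      ctensor UU UU (const UU (rising UU 0 T j)) (opow (- of_nat j) \<otimes>\<^bsub>pseries UU\<^esub> const UU (iota ((br \<epsilon> ^^ j) y)))" for j
  proof -
    have "(- 1) ^ j * rbinom T1 j = scalar ((- 1) ^ j / fact j) * rise 0 T1 j"
    proof -
      have "scalar ((- 1) ^ j / fact j) * z = (- 1) ^ j * (scalar (1 / fact j) * z)"
        for z :: "(('b list \<Rightarrow>\<^sub>0 complex) set \<times> ('b list \<Rightarrow>\<^sub>0 complex) set \<Rightarrow>\<^sub>0 complex) set alg_prod"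
        by (cases "even j") (simp_all add: scalar_uminus)
      then show ?thesis by (simp add: rbinom_def mult.assoc)
    qed
    then have "fps_const ((- 1) ^ j * rbinom T1 j) = fps_scalar (fps_const ((- 1) ^ j / fact j)) * fps_const (rise 0 T1 j)"
      by (simp add: fps_scalar_simps)
    then have "sproj UU2.T (fps_const ((- 1) ^ j * rbinom T1 j) * npow E2 (of_nat j) * fps_const (iter_ad E2 j Y2))
      = fps_const ((- 1) ^ j / fact j) \<odot>\<^bsub>pseries UU2.T\<^esub>
        (const UU2.T (rising UU2.T 0 (UU2.inl T) j) \<otimes>\<^bsub>pseries UU2.T\<^esub>
          (sproj UU2.T (npow E2 (of_nat j)) \<otimes>\<^bsub>pseries UU2.T\<^esub> const UU2.T (UU2.inr (iota ((br \<epsilon> ^^ j) y)))))"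
      by (simp only: mult.assoc UU2.T.sproj_smult, simp only: UU2.T.sproj_mult UU2.T.sproj_const UU2.T.rising_proj[symmetric] proj_T1_E2)
        (simp only: Y emb_inr_iter[symmetric] UU2.T.proj_emb_same in_simps(6) iota_simps(3))
    also have "sproj UU2.T (npow E2 (of_nat j)) = UU2.sinr (opow (- of_nat j))"
      by (simp add: sinr_opow)
    also have "UU2.sinr (opow (- of_nat j)) \<otimes>\<^bsub>pseries UU2.T\<^esub> const UU2.T (UU2.inr (iota ((br \<epsilon> ^^ j) y)))
      = UU2.sinr (opow (- of_nat j) \<otimes>\<^bsub>pseries UU\<^esub> const UU (iota ((br \<epsilon> ^^ j) y)))"
      by (simp add: alg_hom_simps[OF UU2.sinr_hom] UU.const_closed iota_simps sinr_const)
    also have "const UU2.T (rising UU2.T 0 (UU2.inl T) j) = UU2.sinl (const UU (rising UU 0 T j))"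
      by (simp add: sinl_const hom_rising[OF complex_alg_UU UU2.complex_alg_T UU2.inl_hom])
    finally show ?thesis
      by (simp add: UU2.ctensor_eq UU.const_closed iota_simps)
  qed
  show ?thesis unfolding * 1 2 ..
qed

theorem antipode_weight:
  assumes "br \<tau> y = scale r y"
  shows "twist.twisted_antipode (const UU (iota y)) =
    tsum UU (\<lambda>j. fps_const (- 1 / fact j) \<odot>\<^bsub>pseries UU\<^esub>
      (opow (- r) \<otimes>\<^bsub>pseries UU\<^esub> const UU (iota ((br \<epsilon> ^^ j) y)) \<otimes>\<^bsub>pseries UU\<^esub> const UU (rising UU 1 T j)))"
proof -
  define Y where Y: "Y = emb UU (iota y)"
  have S0: "coeffwise antipode0 (const UU (iota y)) = sproj UU (fps_const (- Y))"
    by (simp add: coeffwise_const[OF complex_alg_UU complex_alg_UU hopf.S0_linear]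
        UU.sproj_const antipode0_iota Y iota_simps)
  have "twist.twisted_antipode (const UU (iota y)) = sproj UU (npow (- E') (- T') * (fps_const (- Y) * npow E' (- T')))"
    by (simp only: twist.twisted_antipode_def S0 UU.sproj_mult) (simp only: twist_sproj)
  also have "npow (- E') (- T') * (fps_const (- Y) * npow E' (- T')) = - (npow (- E') (- T') * fps_const Y * npow E' (- T'))"
    by (simp add: mult.assoc flip: fps_const_neg)
  also have "npow (- E') (- T') * fps_const Y * npow E' (- T')
      = npow E' (scalar r) * tseries (\<lambda>j. fps_const (iter_ad E' j Y * (scalar (1 / fact j) * rise 1 T' j)))"
    by (rule npow_antipode_conjugate[OF T'_E' emb_weight(1)[OF assms, folded Y]])
  also have "- (npow E' (scalar r) * tseries (\<lambda>j. fps_const (iter_ad E' j Y * (scalar (1 / fact j) * rise 1 T' j))))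
      = tseries (\<lambda>j. - npow E' (scalar r) * fps_const (iter_ad E' j Y * (scalar (1 / fact j) * rise 1 T' j)))"
    by (subst tseries_mult_left[symmetric]) simp
  finally have *: "twist.twisted_antipode (const UU (iota y)) = tsum UU (\<lambda>j. sproj UU
      (- npow E' (scalar r) * fps_const (iter_ad E' j Y * (scalar (1 / fact j) * rise 1 T' j))))"
    by (simp only: UU.sproj_tseries)
  have "sproj UU (- npow E' (scalar r) * fps_const (iter_ad E' j Y * (scalar (1 / fact j) * rise 1 T' j)))
    = fps_const (- 1 / fact j) \<odot>\<^bsub>pseries UU\<^esub>
      (opow (- r) \<otimes>\<^bsub>pseries UU\<^esub> const UU (iota ((br \<epsilon> ^^ j) y)) \<otimes>\<^bsub>pseries UU\<^esub> const UU (rising UU 1 T j))" for j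
  proof -
    have "- npow E' (scalar r) * fps_const (iter_ad E' j Y * (scalar (1 / fact j) * rise 1 T' j))
      = fps_scalar (fps_const (- 1 / fact j)) * (npow E' (scalar r) * fps_const (iter_ad E' j Y) * fps_const (rise 1 T' j))"
    proof -
      have "iter_ad E' j Y * (scalar (1 / fact j) * rise 1 T' j) = scalar (1 / fact j) * (iter_ad E' j Y * rise 1 T' j)"
        by (rule scalar_left_commute)
      then have "fps_const (iter_ad E' j Y * (scalar (1 / fact j) * rise 1 T' j))
          = fps_scalar (fps_const (1 / fact j)) * (fps_const (iter_ad E' j Y) * fps_const (rise 1 T' j))"
        by (simp add: fps_scalar_simps)
      moreover have "fps_scalar (fps_const (- 1 / fact j)) = - (fps_scalar (fps_const (1 / fact j)) :: ('b list \<Rightarrow>\<^sub>0 complex) set alg_prod fps)"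
        by (simp flip: fps_scalar_simps(7))
      moreover have "npow E' (scalar r) * (fps_scalar c * f) = fps_scalar c * (npow E' (scalar r) * f)" for c f
        by (metis fps_scalar_commute mult.assoc)
      ultimately show ?thesis by (simp add: mult.assoc)
    qed
    then show ?thesis
      by (simp only: UU.sproj_smult, simp only: UU.sproj_mult UU.sproj_const UU.rising_proj[symmetric] proj_TE)
        (simp only: Y emb_iter[symmetric] UU.proj_emb_same iota_simps(3) opow_sproj minus_minus)
  qed
  then show ?thesis unfolding * by simp
qed

end

lemma tseries_unfold: "tseries x = x 0 + fps_X * tseries (\<lambda>j. x (Suc j))"
proof (rule fps_ext)
  fix n
  show "fps_nth (tseries x) n = fps_nth (x 0 + fps_X * tseries (\<lambda>j. x (Suc j))) n"
    by (cases n) (simp_all add: sum.atMost_Suc_shift del: sum.atMost_Suc)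
qed

lemma tseries_0: "tseries (\<lambda>j. 0) = 0"
  by (rule fps_ext) simp

text \<open>
  Needed for an element \<open>\<epsilon>\<close> whose adjoint action vanishes in the third power.
\<close>

lemma (in complex_alg) tsum_truncate:
  assumes "\<And>j. X j \<in> carrier (pseries A)" "\<And>j. j \<ge> 3 \<Longrightarrow> X j = \<zero>\<^bsub>pseries A\<^esub>"
  shows "tsum A X = X 0 \<oplus>\<^bsub>pseries A\<^esub> fps_X \<odot>\<^bsub>pseries A\<^esub> X 1 \<oplus>\<^bsub>pseries A\<^esub> fps_X ^ 2 \<odot>\<^bsub>pseries A\<^esub> X 2"
proof -
  define x where "x j = (if j \<ge> 3 then 0 else semb A (X j))" for j
  have X: "X j = sproj A (x j)" for j
    using assms by (simp add: x_def sproj_zero)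
  have "tseries x = x 0 + fps_X * (x 1 + fps_X * (x 2 + fps_X * tseries (\<lambda>j. 0)))"
    by (subst tseries_unfold, subst tseries_unfold, subst tseries_unfold) (simp add: x_def numeral_eq_Suc)
  also have "\<dots> = x 0 + fps_scalar fps_X * x 1 + fps_scalar (fps_X ^ 2) * x 2"
    by (simp add: tseries_0 fps_scalar_simps power2_eq_square distrib_left mult.assoc add.assoc)
  finally have "sproj A (tseries x) = sproj A (x 0 + fps_scalar fps_X * x 1 + fps_scalar (fps_X ^ 2) * x 2)"
    by simp
  then show ?thesis
    by (simp only: sproj_tseries sproj_add sproj_smult X[symmetric])
qed

context jordanian
begin

abbreviation "cst x \<equiv> const UU (iota x)"

lemma cst_closed [simp]: "cst x \<in> carrier (pseries UU)"
  by (simp add: UU.const_closed iota_simps)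

lemma cst_linear:
  "cst (x + y) = cst x \<oplus>\<^bsub>pseries UU\<^esub> cst y" "cst (scale c x) = fps_const c \<odot>\<^bsub>pseries UU\<^esub> cst x"
  "cst 0 = \<zero>\<^bsub>pseries UU\<^esub>" "cst (- x) = \<ominus>\<^bsub>pseries UU\<^esub> cst x" "cst (x - y) = cst x \<ominus>\<^bsub>pseries UU\<^esub> cst y"
proof -
  show add: "cst (x + y) = cst x \<oplus>\<^bsub>pseries UU\<^esub> cst y" for x y
    by (simp add: iota_simps UU.const_add)
  show "cst (scale c x) = fps_const c \<odot>\<^bsub>pseries UU\<^esub> cst x"
    by (simp add: iota_simps UU.const_smult)
  show zero: "cst 0 = \<zero>\<^bsub>pseries UU\<^esub>"
    by (simp add: iota_linear const_def pseries_zero)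
  show minus: "cst (- x) = \<ominus>\<^bsub>pseries UU\<^esub> cst x" for x
    using add[of "- x" x] zero by (intro UU.S.minus_equality[symmetric]) simp_all
  show "cst (x - y) = cst x \<ominus>\<^bsub>pseries UU\<^esub> cst y"
    using add[of x "- y"] by (simp add: minus a_minus_def)
qed

definition "cT a j = const UU (rising UU a T j)"

lemma cT_closed [simp]: "cT a j \<in> carrier (pseries UU)"
  by (simp add: cT_def UU.const_closed)

lemma cT_simps: "cT a 0 = \<one>\<^bsub>pseries UU\<^esub>" "cT 0 1 = cst \<tau>"
  by (simp_all add: cT_def const_def pseries_one)

text \<open>
  The \<open>j\<close>-th terms of coproduct and antipode, as functions of the Lie algebra element. They are
  linear in it, so a formula for \<open>ad(\<epsilon>)\<^sup>j y\<close> as a linear combination of basis elements can be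
  substituted.
\<close>

definition right_term :: "nat \<Rightarrow> ('b \<Rightarrow>\<^sub>0 complex) \<Rightarrow> nat \<Rightarrow> (('b list \<Rightarrow>\<^sub>0 complex) set \<times> ('b list \<Rightarrow>\<^sub>0 complex) set \<Rightarrow>\<^sub>0 complex) set" where
  "right_term j x = ctensor UU UU (cT 0 j) (opow (- of_nat j) \<otimes>\<^bsub>pseries UU\<^esub> cst x)"

definition anti_term :: "complex \<Rightarrow> nat \<Rightarrow> ('b \<Rightarrow>\<^sub>0 complex) \<Rightarrow> nat \<Rightarrow> ('b list \<Rightarrow>\<^sub>0 complex) set" where
  "anti_term r j x = opow (- r) \<otimes>\<^bsub>pseries UU\<^esub> cst x \<otimes>\<^bsub>pseries UU\<^esub> cT 1 j"

lemma right_term_closed [simp]: "right_term j x \<in> carrier (pseries UU2.T)"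
  by (simp add: right_term_def hopf.ctensor_closed)

lemma anti_term_closed [simp]: "anti_term r j x \<in> carrier (pseries UU)"
  by (simp add: anti_term_def)

lemma linear_map_minus:
  assumes "complex_alg R" "complex_alg S" "linear_map (pseries R) (pseries S) h" "x \<in> carrier (pseries R)"
  shows "h (\<ominus>\<^bsub>pseries R\<^esub> x) = \<ominus>\<^bsub>pseries S\<^esub> h x"
proof -
  interpret R: complex_alg R by fact
  interpret S: complex_alg S by fact
  have "h (\<ominus>\<^bsub>pseries R\<^esub> x) \<oplus>\<^bsub>pseries S\<^esub> h x = \<zero>\<^bsub>pseries S\<^esub>"
    using assms(4) linear_map_zero[OF R.ring_pseries S.ring_pseries assms(3)]
    by (simp add: R.S.l_neg flip: linear_map_add[OF assms(3)])
  then show ?thesis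
    using assms(4) by (intro S.S.minus_equality[symmetric]) (simp_all add: linear_map_closed[OF assms(3)])
qed

lemma right_term_linear:
  "right_term j (x + y) = right_term j x \<oplus>\<^bsub>pseries UU2.T\<^esub> right_term j y"
  "right_term j (scale c x) = fps_const c \<odot>\<^bsub>pseries UU2.T\<^esub> right_term j x"
  "right_term j 0 = \<zero>\<^bsub>pseries UU2.T\<^esub>"
  "right_term j (- x) = \<ominus>\<^bsub>pseries UU2.T\<^esub> right_term j x"
  "right_term j (x - y) = right_term j x \<ominus>\<^bsub>pseries UU2.T\<^esub> right_term j y"
proof -
  note lin = linear_map_comp[OF UU.mult_linear(2) UU2.ctensor_linear_right, OF opow_closed cT_closed]
  show add: "right_term j (x + y) = right_term j x \<oplus>\<^bsub>pseries UU2.T\<^esub> right_term j y" for x y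
    using linear_map_add[OF lin] by (simp add: right_term_def cst_linear)
  show "right_term j (scale c x) = fps_const c \<odot>\<^bsub>pseries UU2.T\<^esub> right_term j x"
    using linear_map_smult[OF lin] by (simp add: right_term_def cst_linear)
  show "right_term j 0 = \<zero>\<^bsub>pseries UU2.T\<^esub>"
    using linear_map_zero[OF UU.ring_pseries UU2.T.ring_pseries lin] by (simp add: right_term_def cst_linear)
  show minus: "right_term j (- x) = \<ominus>\<^bsub>pseries UU2.T\<^esub> right_term j x" for x
    using linear_map_minus[OF complex_alg_UU UU2.complex_alg_T lin] by (simp add: right_term_def cst_linear(4))
  show "right_term j (x - y) = right_term j x \<ominus>\<^bsub>pseries UU2.T\<^esub> right_term j y"
    using add[of x "- y"] by (simp add: minus a_minus_def)
qed

lemma anti_term_linear: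
  "anti_term r j (x + y) = anti_term r j x \<oplus>\<^bsub>pseries UU\<^esub> anti_term r j y"
  "anti_term r j (scale c x) = fps_const c \<odot>\<^bsub>pseries UU\<^esub> anti_term r j x"
  "anti_term r j 0 = \<zero>\<^bsub>pseries UU\<^esub>"
  "anti_term r j (- x) = \<ominus>\<^bsub>pseries UU\<^esub> anti_term r j x"
  "anti_term r j (x - y) = anti_term r j x \<ominus>\<^bsub>pseries UU\<^esub> anti_term r j y"
proof -
  note lin = linear_map_comp[OF UU.mult_linear(2) UU.mult_linear(1), OF opow_closed cT_closed]
  show add: "anti_term r j (x + y) = anti_term r j x \<oplus>\<^bsub>pseries UU\<^esub> anti_term r j y" for x y
    using linear_map_add[OF lin] by (simp add: anti_term_def cst_linear)
  show "anti_term r j (scale c x) = fps_const c \<odot>\<^bsub>pseries UU\<^esub> anti_term r j x"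
    using linear_map_smult[OF lin] by (simp add: anti_term_def cst_linear)
  show "anti_term r j 0 = \<zero>\<^bsub>pseries UU\<^esub>"
    using linear_map_zero[OF UU.ring_pseries UU.ring_pseries lin] by (simp add: anti_term_def cst_linear)
  show minus: "anti_term r j (- x) = \<ominus>\<^bsub>pseries UU\<^esub> anti_term r j x" for x
    using linear_map_minus[OF complex_alg_UU complex_alg_UU lin] by (simp add: anti_term_def cst_linear(4))
  show "anti_term r j (x - y) = anti_term r j x \<ominus>\<^bsub>pseries UU\<^esub> anti_term r j y"
    using add[of x "- y"] by (simp add: minus a_minus_def)
qed

lemma fps_const_smult_assoc:
  "complex_alg R \<Longrightarrow> f \<in> carrier (pseries R) \<Longrightarrow> c \<odot>\<^bsub>pseries R\<^esub> (d \<odot>\<^bsub>pseries R\<^esub> f) = (c * d) \<odot>\<^bsub>pseries R\<^esub> f"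
  using Module.module.smult_assoc1[OF complex_alg.module_pseries, of R c d f] by simp

text \<open>
  The case in which \<open>ad(\<epsilon>)\<^sup>j y\<close> is a multiple of one element \<open>w\<^sub>j\<close>. The sign is split off so that
  \<open>\<eta>\<close> is the coefficient that occurs in the coproduct.
\<close>

lemma comult_family:
  assumes "br \<tau> y = scale r y" "\<And>j. (br \<epsilon> ^^ j) y = scale ((- 1) ^ j * \<eta> j) (w j)"
  shows "twist.twisted_comult (cst y) = ctensor UU UU (cst y) (opow r) \<oplus>\<^bsub>pseries UU2.T\<^esub>
    tsum UU2.T (\<lambda>j. fps_const (\<eta> j / fact j) \<odot>\<^bsub>pseries UU2.T\<^esub> right_term j (w j))"
    and "twist.twisted_antipode (cst y) =
      tsum UU (\<lambda>j. fps_const ((- 1) ^ (j + 1) * \<eta> j / fact j) \<odot>\<^bsub>pseries UU\<^esub> anti_term r j (w j))"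
proof -
  have "fps_const ((- 1) ^ j / fact j) \<odot>\<^bsub>pseries UU2.T\<^esub> right_term j ((br \<epsilon> ^^ j) y)
    = fps_const (\<eta> j / fact j) \<odot>\<^bsub>pseries UU2.T\<^esub> right_term j (w j)" for j
    by (simp add: assms(2) right_term_linear fps_const_smult_assoc[OF UU2.complex_alg_T])
  then show "twist.twisted_comult (cst y) = ctensor UU UU (cst y) (opow r) \<oplus>\<^bsub>pseries UU2.T\<^esub>
    tsum UU2.T (\<lambda>j. fps_const (\<eta> j / fact j) \<odot>\<^bsub>pseries UU2.T\<^esub> right_term j (w j))"
    using comult_weight[OF assms(1)] by (simp add: right_term_def cT_def)
  have "fps_const (- 1 / fact j) \<odot>\<^bsub>pseries UU\<^esub> anti_term r j ((br \<epsilon> ^^ j) y)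
    = fps_const ((- 1) ^ (j + 1) * \<eta> j / fact j) \<odot>\<^bsub>pseries UU\<^esub> anti_term r j (w j)" for j
    by (simp add: assms(2) anti_term_linear fps_const_smult_assoc[OF complex_alg_UU])
  then show "twist.twisted_antipode (cst y) =
      tsum UU (\<lambda>j. fps_const ((- 1) ^ (j + 1) * \<eta> j / fact j) \<odot>\<^bsub>pseries UU\<^esub> anti_term r j (w j))"
    using antipode_weight[OF assms(1)] by (simp add: anti_term_def cT_def)
qed

lemma opow_0: "opow 0 = \<one>\<^bsub>pseries UU\<^esub>"
  by (simp add: opow_sproj UU.sproj_one)

text \<open>
  The case \<open>ad(\<epsilon>)\<^sup>3 y = 0\<close>. The sign and the factor 2 in the definitions of \<open>z1\<close> and \<open>z2\<close> cancel
  \<open>(- 1)\<^sup>j / j!\<close>.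
\<close>

lemma comult_nilpotent:
  assumes "br \<tau> y = scale r y" and z: "br \<epsilon> y = - z1" "br \<epsilon> (br \<epsilon> y) = scale 2 z2" "br \<epsilon> (br \<epsilon> (br \<epsilon> y)) = 0"
    and br_0: "br \<epsilon> 0 = 0"
  shows "twist.twisted_comult (cst y) = ctensor UU UU (cst y) (opow r) \<oplus>\<^bsub>pseries UU2.T\<^esub>
      ctensor UU UU \<one>\<^bsub>pseries UU\<^esub> (cst y) \<oplus>\<^bsub>pseries UU2.T\<^esub> fps_X \<odot>\<^bsub>pseries UU2.T\<^esub> right_term 1 z1
      \<oplus>\<^bsub>pseries UU2.T\<^esub> fps_X ^ 2 \<odot>\<^bsub>pseries UU2.T\<^esub> right_term 2 z2"
    and "twist.twisted_antipode (cst y) = \<ominus>\<^bsub>pseries UU\<^esub> (opow (- r) \<otimes>\<^bsub>pseries UU\<^esub> cst y)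
      \<oplus>\<^bsub>pseries UU\<^esub> fps_X \<odot>\<^bsub>pseries UU\<^esub> anti_term r 1 z1
      \<ominus>\<^bsub>pseries UU\<^esub> fps_X ^ 2 \<odot>\<^bsub>pseries UU\<^esub> anti_term r 2 z2"
proof -
  have ge3: "(br \<epsilon> ^^ j) y = 0" if "j \<ge> 3" for j
    using that
  proof (induction rule: dec_induct)
    case base
    show ?case using z(3) by (simp add: numeral_eq_Suc)
  qed (simp add: br_0)
  define X where "X j = fps_const ((- 1) ^ j / fact j) \<odot>\<^bsub>pseries UU2.T\<^esub> right_term j ((br \<epsilon> ^^ j) y)" for j
  define Y where "Y j = fps_const (- 1 / fact j) \<odot>\<^bsub>pseries UU\<^esub> anti_term r j ((br \<epsilon> ^^ j) y)" for j
  have X: "X j = right_term j (scale ((- 1) ^ j / fact j) ((br \<epsilon> ^^ j) y))" for j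
    by (simp add: X_def right_term_linear)
  have Y: "Y j = anti_term r j (scale (- 1 / fact j) ((br \<epsilon> ^^ j) y))" for j
    by (simp only: Y_def anti_term_linear(2))
  have minus: "scale (- 1) x = - x" for x :: "'b \<Rightarrow>\<^sub>0 complex"
    by (rule poly_mapping_eqI) simp
  have X012: "X 0 = ctensor UU UU \<one>\<^bsub>pseries UU\<^esub> (cst y)" "X 1 = right_term 1 z1" "X 2 = right_term 2 z2"
    using z by (simp_all add: X minus numeral_2_eq_2) (simp_all add: right_term_def cT_simps opow_0)
  have Y012: "Y 0 = \<ominus>\<^bsub>pseries UU\<^esub> (opow (- r) \<otimes>\<^bsub>pseries UU\<^esub> cst y)" "Y 1 = anti_term r 1 z1"
    "Y 2 = \<ominus>\<^bsub>pseries UU\<^esub> anti_term r 2 z2"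
    using z by (simp_all add: Y minus numeral_2_eq_2 flip: anti_term_linear(4))
      (simp_all add: anti_term_linear(4), simp add: anti_term_def cT_simps)
  have "tsum UU2.T X = X 0 \<oplus>\<^bsub>pseries UU2.T\<^esub> fps_X \<odot>\<^bsub>pseries UU2.T\<^esub> X 1 \<oplus>\<^bsub>pseries UU2.T\<^esub> fps_X ^ 2 \<odot>\<^bsub>pseries UU2.T\<^esub> X 2"
    by (rule UU2.T.tsum_truncate) (simp_all add: X ge3 right_term_linear UU2.T.smult_pseries_closed)
  then show "twist.twisted_comult (cst y) = ctensor UU UU (cst y) (opow r) \<oplus>\<^bsub>pseries UU2.T\<^esub>
      ctensor UU UU \<one>\<^bsub>pseries UU\<^esub> (cst y) \<oplus>\<^bsub>pseries UU2.T\<^esub> fps_X \<odot>\<^bsub>pseries UU2.T\<^esub> right_term 1 z1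
      \<oplus>\<^bsub>pseries UU2.T\<^esub> fps_X ^ 2 \<odot>\<^bsub>pseries UU2.T\<^esub> right_term 2 z2"
    using comult_weight[OF assms(1)] unfolding X012
    by (simp add: X_def[abs_def] right_term_def cT_def)
      (simp add: UU2.T.S.a_assoc hopf.ctensor_closed UU2.T.smult_pseries_closed flip: right_term_def cT_def)
  have "tsum UU Y = Y 0 \<oplus>\<^bsub>pseries UU\<^esub> fps_X \<odot>\<^bsub>pseries UU\<^esub> Y 1 \<oplus>\<^bsub>pseries UU\<^esub> fps_X ^ 2 \<odot>\<^bsub>pseries UU\<^esub> Y 2"
    by (rule UU.tsum_truncate) (simp_all add: Y ge3 anti_term_linear UU.smult_pseries_closed)
  moreover have "fps_X ^ 2 \<odot>\<^bsub>pseries UU\<^esub> (\<ominus>\<^bsub>pseries UU\<^esub> anti_term r 2 z2) = \<ominus>\<^bsub>pseries UU\<^esub> (fps_X ^ 2 \<odot>\<^bsub>pseries UU\<^esub> anti_term r 2 z2)"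
    by (rule linear_map_minus[OF complex_alg_UU complex_alg_UU UU.mult_linear(3)[OF opow_closed] anti_term_closed])
  ultimately show "twist.twisted_antipode (cst y) = \<ominus>\<^bsub>pseries UU\<^esub> (opow (- r) \<otimes>\<^bsub>pseries UU\<^esub> cst y)
      \<oplus>\<^bsub>pseries UU\<^esub> fps_X \<odot>\<^bsub>pseries UU\<^esub> anti_term r 1 z1
      \<ominus>\<^bsub>pseries UU\<^esub> fps_X ^ 2 \<odot>\<^bsub>pseries UU\<^esub> anti_term r 2 z2"
    using antipode_weight[OF assms(1)] unfolding Y012
    by (simp add: Y_def[abs_def] anti_term_def cT_def a_minus_def)
qed

section \<open>Noncommutativity and noncocommutativity\<close>

lemma noncommutative:
  assumes "E \<noteq> \<zero>\<^bsub>UU\<^esub>"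
  shows "noncommutative UU"
proof -
  have "T \<otimes>\<^bsub>UU\<^esub> E \<noteq> E \<otimes>\<^bsub>UU\<^esub> T"
  proof
    assume "T \<otimes>\<^bsub>UU\<^esub> E = E \<otimes>\<^bsub>UU\<^esub> T"
    then have "E = \<zero>\<^bsub>UU\<^esub>" using iota_br[of \<tau> \<epsilon>] by (simp add: br_\<tau>_\<epsilon> a_minus_def UU.r_neg)
    with assms show False by simp
  qed
  moreover have "x = y" if "const UU x = const UU y" for x y
    using fun_cong[OF that, of 0] by (simp add: const_def)
  ultimately have "cst \<tau> \<otimes>\<^bsub>pseries UU\<^esub> cst \<epsilon> \<noteq> cst \<epsilon> \<otimes>\<^bsub>pseries UU\<^esub> cst \<tau>"
    by (metis UU.const_mult TE_closed)
  then show ?thesis unfolding noncommutative_def using cst_closed by blast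
qed

text \<open>
  The deformation is visible in first order at \<open>T\<close>: the coefficient is
  \<open>- (T \<otimes> E) \<Delta>\<^sub>0(T) + \<Delta>\<^sub>0(T) (T \<otimes> E) = T \<otimes> [T, E]\<close>.
\<close>

lemma comult_T_coeff: "twist.twisted_comult (cst \<tau>) 1 = UU2.pure T E"
proof -
  define T2 where "T2 = emb UU2.T (UU2.inr T)"
  have D0: "coeffwise Delta0 (cst \<tau>) = sproj UU2.T (fps_const (T1 + T2))"
    by (simp add: coeffwise_const[OF complex_alg_UU UU2.complex_alg_T alg_hom_linear[OF Delta0]]
        UU2.T.sproj_const Delta0_iota UU2.complex_alg_T T2_def in_simps)
  have "UU2.inr E = UU2.inr T \<otimes>\<^bsub>UU2.T\<^esub> UU2.inr E \<ominus>\<^bsub>UU2.T\<^esub> UU2.inr E \<otimes>\<^bsub>UU2.T\<^esub> UU2.inr T"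
    using arg_cong[OF iota_br[of \<tau> \<epsilon>], of UU2.inr]
    by (simp add: br_\<tau>_\<epsilon> a_minus_def in_simps hom_uminus[OF complex_alg_UU UU2.complex_alg_T UU2.inr_hom])
  from arg_cong[OF this, of "emb UU2.T"] have "E2 = T2 * E2 - E2 * T2"
    by (simp only: UU2.T.emb_simps E2_def T2_def in_simps TE_closed UU2.T.m_closed)
  then have T2_E2: "T2 * E2 = E2 * T2 + E2" by (simp only: eq_diff_eq add.commute)
  have T1_T2: "T1 * T2 = T2 * T1"
    by (simp add: T1_def T2_def in_simps UU2.inl_inr UU2.inr_inl flip: UU2.T.emb_mult)
  have "fps_nth (npow E2 (- T1) * (fps_const (T1 + T2) * npow E2 T1)) 1 = (T1 + T2) * (T1 * E2) - T1 * E2 * (T1 + T2)"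
    by (simp add: fps_mult_nth rbinom_def)
  also have "\<dots> = T1 * (T2 * E2 - E2 * T2)"
  proof -
    have "T1 * (T1 * E2) = T1 * (E2 * T1)" by (simp only: T1_E2)
    moreover have "T2 * (T1 * E2) = T1 * (T2 * E2)" by (simp only: mult.assoc[symmetric] T1_T2)
    ultimately show ?thesis by (simp add: algebra_simps)
  qed
  also have "\<dots> = T1 * E2" by (simp add: T2_E2)
  finally have "proj UU2.T (fps_nth (npow E2 (- T1) * (fps_const (T1 + T2) * npow E2 T1)) 1) = UU2.inl T \<otimes>\<^bsub>UU2.T\<^esub> UU2.inr E"
    by (simp add: UU2.complex_alg_T)
  moreover have "twist.twisted_comult (cst \<tau>) = sproj UU2.T (npow E2 (- T1) * (fps_const (T1 + T2) * npow E2 T1))"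
    by (simp only: twist.twisted_comult_def D0 UU2.T.sproj_mult) (simp only: twist_sproj)
  ultimately show ?thesis by (simp add: sproj_def UU2.inl_inr)
qed

text \<open>
  Otherwise \<open>T \<otimes> E = E \<otimes> T\<close>. Applying a functional \<open>\<psi>\<close> to the left factor makes \<open>\<psi>(E) T\<close> a multiple
  of \<open>E\<close>, which contradicts \<open>[T, E] = E\<close> if \<open>\<psi>(E) \<noteq> 0\<close>. The functional takes the place of a
  basis of \<open>U\<close>: it can be a matrix coefficient of a representation.
\<close>

lemma noncocommutative:
  assumes \<psi>: "linear_map UU complex_field \<psi>" and nonzero: "\<psi> E \<noteq> 0"
  shows "noncocommutative UU twist.twisted_comult"
proof -
  interpret C: complex_alg complex_field by (rule complex_alg_complex_field)
  define \<sigma> where "\<sigma> = tensor_hom UU UU UU2.T UU2.inr UU2.inl"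
  have comm: "\<forall>x\<in>carrier UU. \<forall>y\<in>carrier UU. UU2.inr x \<otimes>\<^bsub>UU2.T\<^esub> UU2.inl y = UU2.inl y \<otimes>\<^bsub>UU2.T\<^esub> UU2.inr x"
    by (simp add: UU2.inl_inr UU2.inr_inl)
  note \<sigma>_assms = UU2.complex_alg_T UU2.inr_hom UU2.inl_hom comm
  note \<sigma>_hom = UU2.tensor_hom[OF \<sigma>_assms, folded \<sigma>_def]
  have X: "twist.twisted_comult (cst \<tau>) \<in> carrier (pseries UU2.T)" by simp
  have lift: "ctensor_lift UU UU (pseries UU2.T) (\<lambda>a b. ctensor UU UU b a) (twist.twisted_comult (cst \<tau>))
      = coeffwise \<sigma> (twist.twisted_comult (cst \<tau>))"
  proof (rule UU2.ctensor_lift_eq[OF UU2.complex_alg_T alg_hom_linear[OF coeffwise_alg_hom[OF UU2.complex_alg_T UU2.complex_alg_T \<sigma>_hom]] _ X])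
    fix f g assume fg: "f \<in> carrier (pseries UU)" "g \<in> carrier (pseries UU)"
    have "coeffwise \<sigma> (ctensor UU UU f g) = UU2.sinr f \<otimes>\<^bsub>pseries UU2.T\<^esub> UU2.sinl g"
      using UU2.tensor_hom_ctensor[OF \<sigma>_assms fg] by (simp add: \<sigma>_def)
    also have "\<dots> = UU2.sinl g \<otimes>\<^bsub>pseries UU2.T\<^esub> UU2.sinr f"
      using fg by (intro coeffwise_commute[OF UU2.complex_alg_T])
        (simp_all add: coeffwise_def pseries_carrier_iff in_simps UU2.inl_inr UU2.inr_inl)
    finally show "coeffwise \<sigma> (ctensor UU UU f g) = ctensor UU UU g f"
      using fg by (simp add: UU2.ctensor_eq)
  qed
  have swap: "a \<odot>\<^bsub>UU\<^esub> (b \<odot>\<^bsub>UU\<^esub> x) = b \<odot>\<^bsub>UU\<^esub> (a \<odot>\<^bsub>UU\<^esub> x)" if "x \<in> carrier UU" for a b x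
    using that by (simp add: mult.commute flip: UU.smult_assoc)
  interpret L: bilinear_map UU UU UU "\<lambda>x y. \<psi> x \<odot>\<^bsub>UU\<^esub> y"
  proof
    fix y assume "y \<in> carrier UU"
    then show "linear_map UU UU (\<lambda>x. \<psi> x \<odot>\<^bsub>UU\<^esub> y)"
      by (auto simp: linear_map_def UU.smult_l_distr UU.smult_assoc linear_map_add[OF \<psi>] linear_map_smult[OF \<psi>])
  next
    fix x
    show "linear_map UU UU (\<lambda>y. \<psi> x \<odot>\<^bsub>UU\<^esub> y)"
      by (auto simp: linear_map_def UU.smult_r_distr intro!: swap)
  qed
  have "coeffwise \<sigma> (twist.twisted_comult (cst \<tau>)) \<noteq> twist.twisted_comult (cst \<tau>)"
  proof
    assume "coeffwise \<sigma> (twist.twisted_comult (cst \<tau>)) = twist.twisted_comult (cst \<tau>)"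
    from fun_cong[OF this, of 1] have "\<sigma> (UU2.pure T E) = UU2.pure T E"
      by (simp add: coeffwise_def comult_T_coeff[simplified])
    moreover have "\<sigma> (UU2.pure T E) = UU2.pure E T"
      using UU2.tensor_hom_pure[OF \<sigma>_assms, of T E] by (simp add: \<sigma>_def UU2.inr_inl)
    ultimately have "L.tlift (UU2.pure E T) = L.tlift (UU2.pure T E)" by simp
    then have eq: "\<psi> E \<odot>\<^bsub>UU\<^esub> T = \<psi> T \<odot>\<^bsub>UU\<^esub> E" by (simp add: L.tlift_pure)
    \<comment> \<open>the commutator of \<open>\<psi>(E) T\<close> with \<open>E\<close> vanishes, as \<open>\<psi>(E) T\<close> is a multiple of \<open>E\<close>\<close>
    have "\<psi> E \<odot>\<^bsub>UU\<^esub> (T \<otimes>\<^bsub>UU\<^esub> E \<ominus>\<^bsub>UU\<^esub> E \<otimes>\<^bsub>UU\<^esub> T) = (\<psi> E \<odot>\<^bsub>UU\<^esub> T) \<otimes>\<^bsub>UU\<^esub> E \<ominus>\<^bsub>UU\<^esub> E \<otimes>\<^bsub>UU\<^esub> (\<psi> E \<odot>\<^bsub>UU\<^esub> T)"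
      by (simp add: a_minus_def UU.smult_r_distr UU.smult_r_minus UU.smult_mult_left UU.smult_mult_right)
    also have "\<dots> = \<zero>\<^bsub>UU\<^esub>"
      by (simp add: eq a_minus_def UU.smult_mult_left UU.smult_mult_right UU.r_neg)
    finally have "\<psi> E \<odot>\<^bsub>UU\<^esub> E = \<zero>\<^bsub>UU\<^esub>" using iota_br[of \<tau> \<epsilon>] by (simp add: br_\<tau>_\<epsilon>)
    from arg_cong[OF this, of \<psi>] have "\<psi> E * \<psi> E = 0"
      using linear_map_smult[OF \<psi>, of E "\<psi> E"] linear_map_zero[OF UU.ring_axioms C.ring_axioms \<psi>] by simp
    with nonzero show False by simp
  qed
  then show ?thesis
    unfolding noncocommutative_def lift[symmetric] by (intro bexI[of _ "cst \<tau>"]) simp_all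
qed

lemma smult_simps:
  "f \<in> carrier (pseries UU) \<Longrightarrow> c \<odot>\<^bsub>pseries UU\<^esub> (d \<odot>\<^bsub>pseries UU\<^esub> f) = (d * c) \<odot>\<^bsub>pseries UU\<^esub> f"
  "f \<in> carrier (pseries UU) \<Longrightarrow> g \<in> carrier (pseries UU) \<Longrightarrow>
    c \<odot>\<^bsub>pseries UU\<^esub> (f \<oplus>\<^bsub>pseries UU\<^esub> g) = c \<odot>\<^bsub>pseries UU\<^esub> f \<oplus>\<^bsub>pseries UU\<^esub> c \<odot>\<^bsub>pseries UU\<^esub> g"
  "f \<in> carrier (pseries UU) \<Longrightarrow> c \<odot>\<^bsub>pseries UU\<^esub> (\<ominus>\<^bsub>pseries UU\<^esub> f) = \<ominus>\<^bsub>pseries UU\<^esub> (c \<odot>\<^bsub>pseries UU\<^esub> f)"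
  "c \<odot>\<^bsub>pseries UU\<^esub> \<zero>\<^bsub>pseries UU\<^esub> = \<zero>\<^bsub>pseries UU\<^esub>"
  "X \<in> carrier (pseries UU2.T) \<Longrightarrow> c \<odot>\<^bsub>pseries UU2.T\<^esub> (d \<odot>\<^bsub>pseries UU2.T\<^esub> X) = (d * c) \<odot>\<^bsub>pseries UU2.T\<^esub> X"
  "X \<in> carrier (pseries UU2.T) \<Longrightarrow> Y \<in> carrier (pseries UU2.T) \<Longrightarrow>
    c \<odot>\<^bsub>pseries UU2.T\<^esub> (X \<oplus>\<^bsub>pseries UU2.T\<^esub> Y) = c \<odot>\<^bsub>pseries UU2.T\<^esub> X \<oplus>\<^bsub>pseries UU2.T\<^esub> c \<odot>\<^bsub>pseries UU2.T\<^esub> Y"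
  "X \<in> carrier (pseries UU2.T) \<Longrightarrow> c \<odot>\<^bsub>pseries UU2.T\<^esub> (\<ominus>\<^bsub>pseries UU2.T\<^esub> X) = \<ominus>\<^bsub>pseries UU2.T\<^esub> (c \<odot>\<^bsub>pseries UU2.T\<^esub> X)"
  "c \<odot>\<^bsub>pseries UU2.T\<^esub> \<zero>\<^bsub>pseries UU2.T\<^esub> = \<zero>\<^bsub>pseries UU2.T\<^esub>"
proof -
  show "f \<in> carrier (pseries UU) \<Longrightarrow> c \<odot>\<^bsub>pseries UU\<^esub> (d \<odot>\<^bsub>pseries UU\<^esub> f) = (d * c) \<odot>\<^bsub>pseries UU\<^esub> f"
    by (simp add: fps_const_smult_assoc mult.commute)
  show "X \<in> carrier (pseries UU2.T) \<Longrightarrow> c \<odot>\<^bsub>pseries UU2.T\<^esub> (d \<odot>\<^bsub>pseries UU2.T\<^esub> X) = (d * c) \<odot>\<^bsub>pseries UU2.T\<^esub> X"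
    by (simp add: fps_const_smult_assoc[OF UU2.complex_alg_T] mult.commute)
qed (rule linear_map_add[OF UU.mult_linear(3)[OF UU.S.one_closed]]
    linear_map_minus[OF complex_alg_UU complex_alg_UU UU.mult_linear(3)[OF UU.S.one_closed]]
    linear_map_zero[OF UU.ring_pseries UU.ring_pseries UU.mult_linear(3)[OF UU.S.one_closed]]
    linear_map_add[OF UU2.T.mult_linear(3)[OF UU2.T.S.one_closed]]
    linear_map_minus[OF UU2.complex_alg_T UU2.complex_alg_T UU2.T.mult_linear(3)[OF UU2.T.S.one_closed]]
    linear_map_zero[OF UU2.T.ring_pseries UU2.T.ring_pseries UU2.T.mult_linear(3)[OF UU2.T.S.one_closed]]; assumption)+

text \<open>
  The formula for \<open>\<Delta>(d\<^sub>i)\<close> contains \<open>(1 - E t)\<^sup>-\<^sup>1\<close> without a factor \<open>E t\<close>; this identity removes it.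
\<close>

lemma opow_E: "fps_X \<odot>\<^bsub>pseries UU\<^esub> (opow (- 1) \<otimes>\<^bsub>pseries UU\<^esub> cst \<epsilon>) = opow (- 1) \<ominus>\<^bsub>pseries UU\<^esub> \<one>\<^bsub>pseries UU\<^esub>"
proof -
  have one: "rbinom 1 k = (1 :: ('b list \<Rightarrow>\<^sub>0 complex) set alg_prod)" for k
    using rise_scalar[of 0 1 k, where 'a = "('b list \<Rightarrow>\<^sub>0 complex) set alg_prod"]
    by (simp add: rbinom_def pochhammer_fact[symmetric] flip: scalar_mult)
  have "fps_scalar fps_X * (npow E' (scalar 1) * fps_const E') = npow E' (scalar 1) - 1"
  proof (rule fps_ext)
    fix n
    show "fps_nth (fps_scalar fps_X * (npow E' (scalar 1) * fps_const E')) n = fps_nth (npow E' (scalar 1) - 1) n"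
      by (cases n) (simp_all add: fps_scalar_simps one power_commutes)
  qed
  then have "sproj UU (fps_scalar fps_X * (npow E' (scalar 1) * fps_const E')) = sproj UU (npow E' (scalar 1) - 1)"
    by simp
  then show ?thesis
    unfolding UU.sproj_smult
    unfolding UU.sproj_diff UU.sproj_one UU.sproj_mult UU.sproj_const proj_TE
    by (simp add: opow_sproj)
qed

lemma E_rising: "cst \<epsilon> \<otimes>\<^bsub>pseries UU\<^esub> cT 1 1 = cst \<tau> \<otimes>\<^bsub>pseries UU\<^esub> cst \<epsilon>"
proof -
  have "E' * (T' + 1) = T' * E'" by (simp add: T'_E' distrib_left)
  from arg_cong[OF this, of "proj UU"] have "E \<otimes>\<^bsub>UU\<^esub> (T \<oplus>\<^bsub>UU\<^esub> \<one>\<^bsub>UU\<^esub>) = T \<otimes>\<^bsub>UU\<^esub> E" by simp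
  then show ?thesis by (simp add: cT_def flip: UU.const_mult)
qed

text \<open>
  An element that commutes with \<open>\<tau>\<close> and has \<open>\<epsilon>\<close> as an eigenvector, such as the degree
  derivations. All terms from \<open>j = 2\<close> on vanish.
\<close>

lemma derivation_case:
  assumes "br \<tau> y = 0" "br \<epsilon> y = - scale k \<epsilon>" "br \<epsilon> (- scale k \<epsilon>) = 0" "br \<epsilon> 0 = 0"
  shows "twist.twisted_comult (cst y) = ctensor UU UU (cst y) \<one>\<^bsub>pseries UU\<^esub>
      \<oplus>\<^bsub>pseries UU2.T\<^esub> ctensor UU UU \<one>\<^bsub>pseries UU\<^esub> (cst y)
      \<ominus>\<^bsub>pseries UU2.T\<^esub> fps_const k \<odot>\<^bsub>pseries UU2.T\<^esub> ctensor UU UU (cst \<tau>) \<one>\<^bsub>pseries UU\<^esub>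
      \<oplus>\<^bsub>pseries UU2.T\<^esub> fps_const k \<odot>\<^bsub>pseries UU2.T\<^esub> ctensor UU UU (cst \<tau>) (opow (- 1))"
    and "twist.twisted_antipode (cst y) = \<ominus>\<^bsub>pseries UU\<^esub> cst y
      \<oplus>\<^bsub>pseries UU\<^esub> (fps_const k * fps_X) \<odot>\<^bsub>pseries UU\<^esub> (cst \<tau> \<otimes>\<^bsub>pseries UU\<^esub> cst \<epsilon>)"
proof -
  have weight: "br \<tau> y = scale 0 y"
    using assms(1) by (auto intro!: poly_mapping_eqI)
  have bb: "br \<epsilon> (br \<epsilon> y) = scale 2 0" "br \<epsilon> (br \<epsilon> (br \<epsilon> y)) = 0"
    by (simp_all add: assms)
  note nil = comult_nilpotent[OF weight assms(2) bb assms(4)]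
  have "fps_X \<odot>\<^bsub>pseries UU2.T\<^esub> right_term 1 \<epsilon> = ctensor UU UU (cst \<tau>) (fps_X \<odot>\<^bsub>pseries UU\<^esub> (opow (- 1) \<otimes>\<^bsub>pseries UU\<^esub> cst \<epsilon>))"
    using linear_map_smult[OF UU2.ctensor_linear_right[OF cst_closed]] by (simp add: right_term_def cT_simps[simplified])
  also have "\<dots> = ctensor UU UU (cst \<tau>) (opow (- 1)) \<ominus>\<^bsub>pseries UU2.T\<^esub> ctensor UU UU (cst \<tau>) \<one>\<^bsub>pseries UU\<^esub>"
    unfolding opow_E a_minus_def
    by (simp add: linear_map_add[OF UU2.ctensor_linear_right[OF cst_closed]]
        linear_map_minus[OF complex_alg_UU UU2.complex_alg_T UU2.ctensor_linear_right[OF cst_closed]])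
  finally have X: "fps_X \<odot>\<^bsub>pseries UU2.T\<^esub> (fps_const k \<odot>\<^bsub>pseries UU2.T\<^esub> right_term 1 \<epsilon>)
      = fps_const k \<odot>\<^bsub>pseries UU2.T\<^esub> ctensor UU UU (cst \<tau>) (opow (- 1)) \<ominus>\<^bsub>pseries UU2.T\<^esub>
        fps_const k \<odot>\<^bsub>pseries UU2.T\<^esub> ctensor UU UU (cst \<tau>) \<one>\<^bsub>pseries UU\<^esub>"
  proof -
    assume *: "fps_X \<odot>\<^bsub>pseries UU2.T\<^esub> right_term 1 \<epsilon> =
      ctensor UU UU (cst \<tau>) (opow (- 1)) \<ominus>\<^bsub>pseries UU2.T\<^esub> ctensor UU UU (cst \<tau>) \<one>\<^bsub>pseries UU\<^esub>"
    have "fps_X \<odot>\<^bsub>pseries UU2.T\<^esub> (fps_const k \<odot>\<^bsub>pseries UU2.T\<^esub> right_term 1 \<epsilon>)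
        = fps_const k \<odot>\<^bsub>pseries UU2.T\<^esub> (fps_X \<odot>\<^bsub>pseries UU2.T\<^esub> right_term 1 \<epsilon>)"
      by (simp add: smult_simps(5) mult.commute)
    then show ?thesis
      unfolding * by (simp add: a_minus_def smult_simps(6-8) hopf.ctensor_closed)
  qed
  show "twist.twisted_comult (cst y) = ctensor UU UU (cst y) \<one>\<^bsub>pseries UU\<^esub>
      \<oplus>\<^bsub>pseries UU2.T\<^esub> ctensor UU UU \<one>\<^bsub>pseries UU\<^esub> (cst y)
      \<ominus>\<^bsub>pseries UU2.T\<^esub> fps_const k \<odot>\<^bsub>pseries UU2.T\<^esub> ctensor UU UU (cst \<tau>) \<one>\<^bsub>pseries UU\<^esub>
      \<oplus>\<^bsub>pseries UU2.T\<^esub> fps_const k \<odot>\<^bsub>pseries UU2.T\<^esub> ctensor UU UU (cst \<tau>) (opow (- 1))"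
    unfolding nil(1)
    by (simp add: right_term_linear X smult_simps(6-8) opow_0 del: One_nat_def)
      (simp add: a_minus_def hopf.ctensor_closed UU2.T.smult_pseries_closed UU2.T.S.a_ac)
  show "twist.twisted_antipode (cst y) = \<ominus>\<^bsub>pseries UU\<^esub> cst y
      \<oplus>\<^bsub>pseries UU\<^esub> (fps_const k * fps_X) \<odot>\<^bsub>pseries UU\<^esub> (cst \<tau> \<otimes>\<^bsub>pseries UU\<^esub> cst \<epsilon>)"
  proof -
    have "anti_term 0 1 \<epsilon> = cst \<tau> \<otimes>\<^bsub>pseries UU\<^esub> cst \<epsilon>"
      using E_rising by (simp add: anti_term_def opow_0)
    then show ?thesis
      unfolding nil(2) anti_term_linear(2)
      by (simp add: anti_term_linear smult_simps opow_0 a_minus_def UU.smult_pseries_closed)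
  qed
qed

end

section \<open>Brackets of the basis elements\<close>

lemma additive_bracket_row: "additive_family (\<lambda>b d. scale (c * d) (gen_bracket q a b))"
  by unfold_locales (simp add: distrib_left pm.scale_left_distrib)

lemma additive_bracket: "additive_family (\<lambda>a c. key_sum (\<lambda>b d. scale (c * d) (gen_bracket q a b)) y)"
  by unfold_locales (simp add: key_sum_def distrib_right pm.scale_left_distrib sum.distrib)

lemma lie_bracket_eq: "lie_bracket q x y = key_sum (\<lambda>a c. key_sum (\<lambda>b d. scale (c * d) (gen_bracket q a b)) y) x"
  by (simp add: lie_bracket_def key_sum_def)

lemma lie_bracket_simps:
  "lie_bracket q (x + x') y = lie_bracket q x y + lie_bracket q x' y"
  "lie_bracket q (x - x') y = lie_bracket q x y - lie_bracket q x' y"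
  "lie_bracket q (- x) y = - lie_bracket q x y" "lie_bracket q 0 y = 0"
  "lie_bracket q x (y + y') = lie_bracket q x y + lie_bracket q x y'"
  "lie_bracket q x (y - y') = lie_bracket q x y - lie_bracket q x y'"
  "lie_bracket q x (- y) = - lie_bracket q x y" "lie_bracket q x 0 = 0"
  "lie_bracket q (Poly_Mapping.single a c) (Poly_Mapping.single b d) = scale (c * d) (gen_bracket q a b)"
proof -
  note left = additive_family.key_sum_add[OF additive_bracket] additive_family.key_sum_diff[OF additive_bracket]
    additive_family.key_sum_uminus[OF additive_bracket] additive_family.key_sum_0[OF additive_bracket]
  note right = additive_family.key_sum_add[OF additive_bracket_row] additive_family.key_sum_diff[OF additive_bracket_row]
    additive_family.key_sum_uminus[OF additive_bracket_row] additive_family.key_sum_0[OF additive_bracket_row]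
  show "lie_bracket q (x + x') y = lie_bracket q x y + lie_bracket q x' y"
    "lie_bracket q (x - x') y = lie_bracket q x y - lie_bracket q x' y"
    "lie_bracket q (- x) y = - lie_bracket q x y" "lie_bracket q 0 y = 0"
    unfolding lie_bracket_eq by (rule left)+
  show "lie_bracket q x (y + y') = lie_bracket q x y + lie_bracket q x y'"
    "lie_bracket q x (y - y') = lie_bracket q x y - lie_bracket q x y'"
    "lie_bracket q x (- y) = - lie_bracket q x y" "lie_bracket q x 0 = 0"
    unfolding lie_bracket_eq right
    by (simp_all add: key_sum_def sum.distrib sum_subtractf sum_negf)
  show "lie_bracket q (Poly_Mapping.single a c) (Poly_Mapping.single b d) = scale (c * d) (gen_bracket q a b)"
    unfolding lie_bracket_eq
    by (subst additive_family.key_sum_single[OF additive_bracket], subst additive_family.key_sum_single[OF additive_bracket_row]) (rule refl)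
qed

lemma lie_bracket_scale:
  "lie_bracket q (scale c x) y = scale c (lie_bracket q x y)"
  "lie_bracket q x (scale c y) = scale c (lie_bracket q x y)"
proof -
  have "lie_bracket q (scale c x) y = scale c (lie_bracket q x y) \<and> lie_bracket q x (scale c y) = scale c (lie_bracket q x y)"
    using order_refl[of "Poly_Mapping.keys x"]
  proof (induction x rule: poly_mapping_induct)
    case (single a b)
    show ?case
      using order_refl[of "Poly_Mapping.keys y"]
    proof (induction y rule: poly_mapping_induct)
      case (single a' b')
      show ?case by (simp add: lie_bracket_simps mult_ac)
    qed (simp_all add: lie_bracket_simps pm.scale_right_distrib)
  qed (simp_all add: lie_bracket_simps pm.scale_right_distrib)
  then show "lie_bracket q (scale c x) y = scale c (lie_bracket q x y)"
    "lie_bracket q x (scale c y) = scale c (lie_bracket q x y)" by auto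
qed

lemma scale_pair: "scale a (scale b x) = scale (a * b) x" for x :: "'b \<Rightarrow>\<^sub>0 complex"
  by (rule poly_mapping_eqI) simp

lemma Rep_Abs_index [simp]: "k \<noteq> 0 \<Longrightarrow> Rep_nonzero_index (Abs_nonzero_index k) = k"
  by (simp add: Abs_nonzero_index_inverse)

lemmas basis_defs = Le_def Lf_def Lg_def Lh_def Ld_def Ld1_def Ld2_def

lemma uminus_scale: "- x = scale (- 1) x" for x :: "'b \<Rightarrow>\<^sub>0 complex"
  by (rule poly_mapping_eqI) simp

lemma bracket_Lf:
  "lie_bracket q (Lf n) (Le m) = - ef_bracket q m n"
  "lie_bracket q (Lf n) (Lf m) = 0"
  "k \<noteq> 0 \<Longrightarrow> lie_bracket q (Lf n) (Lg k) = scale (q powi (fst k * snd n)) (Lf (k + n))"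
  "k \<noteq> 0 \<Longrightarrow> lie_bracket q (Lf n) (Lh k) = - scale (q powi (snd k * fst n)) (Lf (k + n))"
  "lie_bracket q (Lf n) Ld = scale 2 (Lf n)"
  "lie_bracket q (Lf n) Ld1 = - scale (of_int (fst n)) (Lf n)"
  "lie_bracket q (Lf n) Ld2 = - scale (of_int (snd n)) (Lf n)"
  by (simp_all add: basis_defs lie_bracket_simps gen_bracket_def)

lemma bracket_Lh:
  assumes "n \<noteq> 0"
  shows "lie_bracket q (Lh n) (Le m) = - scale (q powi (fst n * snd m)) (Le (n + m))"
    "lie_bracket q (Lh n) (Lf m) = scale (q powi (snd n * fst m)) (Lf (n + m))"
    "lie_bracket q (Lh n) (Lg k) = 0"
    "lie_bracket q (Lh n) (Lh k) = scale (q powi (snd n * fst k) - q powi (snd k * fst n)) (Lh (n + k))"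
    "lie_bracket q (Lh n) Ld = 0"
    "lie_bracket q (Lh n) Ld1 = - scale (of_int (fst n)) (Lh n)"
    "lie_bracket q (Lh n) Ld2 = - scale (of_int (snd n)) (Lh n)"
  using assms by (simp_all add: basis_defs lie_bracket_simps gen_bracket_def zero_prod_def)

lemma elt_single: "index_ok y m \<Longrightarrow> \<exists>b. elt y m = Poly_Mapping.single b 1 \<and> gen_degree b = m"
  by (cases y) (auto simp: basis_defs intro: exI[of _ "Egen m"] exI[of _ "Fgen m"])

lemma torus_single: "lie_bracket q (torusT x1 x2) (Poly_Mapping.single b c) = scale (torus_weight x1 x2 (gen_degree b)) (Poly_Mapping.single b c)"
  by (simp add: torusT_def Ld1_def Ld2_def lie_bracket_simps lie_bracket_scale gen_bracket_def torus_weight_def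
      algebra_simps flip: single_add)

lemma torus_bracket:
  "index_ok y m \<Longrightarrow> lie_bracket q (torusT x1 x2) (elt y m) = scale (torus_weight x1 x2 m) (elt y m)"
  "lie_bracket q (torusT x1 x2) Ld = 0" "lie_bracket q (torusT x1 x2) Ld1 = 0" "lie_bracket q (torusT x1 x2) Ld2 = 0"
  using elt_single[of y m] torus_single[of q x1 x2]
  by (auto simp: Ld_def Ld1_def Ld2_def torus_weight_def)

lemma cartan_bracket:
  "lie_bracket q cartanT (Le m) = scale (- 1) (Le m)" "lie_bracket q cartanT (Lf m) = scale 1 (Lf m)"
  "lie_bracket q cartanT (Lg m) = scale 0 (Lg m)" "lie_bracket q cartanT (Lh m) = scale 0 (Lh m)"
  "lie_bracket q cartanT Ld = 0" "lie_bracket q cartanT Ld1 = 0" "lie_bracket q cartanT Ld2 = 0"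
  by (simp_all add: cartanT_def basis_defs lie_bracket_simps gen_bracket_def flip: single_uminus)

lemma shift_Suc: "shift m n (Suc j) = n + shift m n j"
  by (simp add: shift_def algebra_simps prod_eq_iff)

lemma eta_0: "eta q n y 0 m = 1"
  by (cases y) simp_all

lemma eta_Suc:
  "eta q n FE (Suc j) m = eta q n FE j m * q powi (fst n * snd (shift m n j))"
  "eta q n FF (Suc j) m = - eta q n FF j m * q powi (snd n * fst (shift m n j))"
  "eta q n FG (Suc j) m = 0"
  "eta q n FH (Suc j) m = - eta q n FH j m *
     (q powi (snd n * fst (shift m n j)) - q powi (fst n * snd (shift m n j)))"
  by (simp_all add: shift_def)

lemma bracket_Lh_elt:
  assumes "n \<noteq> 0"
  shows "scale (- eta q n y j m) (lie_bracket q (Lh n) (elt y (shift m n j))) = scale (eta q n y (Suc j) m) (elt y (shift m n (Suc j)))"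
proof (cases y)
  case FG
  then show ?thesis by (simp only: elt.simps bracket_Lh[OF assms] eta_Suc) simp
next
  case FH
  show ?thesis unfolding FH elt.simps bracket_Lh[OF assms] eta_Suc scale_pair shift_Suc
    by (simp only: mult.commute)
qed (simp_all only: elt.simps bracket_Lh[OF assms] eta_Suc scale_pair shift_Suc uminus_scale, simp_all)

text \<open>
  The coefficients \<open>\<eta>\<close> of the coproduct formulas are the structure constants of the iterated
  adjoint action of \<open>h\<^sub>n\<close>, up to sign.
\<close>

lemma iterated_bracket_Lh:
  assumes "n \<noteq> 0"
  shows "(lie_bracket q (Lh n) ^^ j) (elt y m) = scale ((- 1) ^ j * eta q n y j m) (elt y (shift m n j))"
proof (induction j)
  case 0
  show ?case by (simp add: shift_def eta_0)
next
  case (Suc j)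
  have "(lie_bracket q (Lh n) ^^ Suc j) (elt y m)
      = scale ((- 1) ^ Suc j) (scale (- eta q n y j m) (lie_bracket q (Lh n) (elt y (shift m n j))))"
    unfolding scale_pair by (simp add: Suc lie_bracket_scale del: eta.simps)
  then show ?case by (simp only: bracket_Lh_elt[OF assms] scale_pair)
qed

section \<open>The natural representation\<close>

text \<open>
  Only linear endomorphisms are admitted, since composition distributes over addition from the left
  only for additive maps.
\<close>

definition end_alg :: "(complex, ('v \<Rightarrow> complex) \<Rightarrow> 'v \<Rightarrow> complex) module" where
  "end_alg = \<lparr>carrier = {\<phi>. \<forall>a f g. \<phi> (\<lambda>v. a * f v + g v) = (\<lambda>v. a * \<phi> f v + \<phi> g v)},
     mult = (\<circ>), one = id, zero = (\<lambda>f v. 0), add = (\<lambda>\<phi> \<psi> f v. \<phi> f v + \<psi> f v), smult = (\<lambda>c \<phi> f v. c * \<phi> f v)\<rparr>"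

lemma end_alg_simps [simp]:
  "\<phi> \<in> carrier end_alg \<longleftrightarrow> (\<forall>a f g. \<phi> (\<lambda>v. a * f v + g v) = (\<lambda>v. a * \<phi> f v + \<phi> g v))"
  "\<phi> \<otimes>\<^bsub>end_alg\<^esub> \<psi> = \<phi> \<circ> \<psi>" "\<one>\<^bsub>end_alg\<^esub> = id" "\<zero>\<^bsub>end_alg\<^esub> = (\<lambda>f v. 0)"
  "\<phi> \<oplus>\<^bsub>end_alg\<^esub> \<psi> = (\<lambda>f v. \<phi> f v + \<psi> f v)" "c \<odot>\<^bsub>end_alg\<^esub> \<phi> = (\<lambda>f v. c * \<phi> f v)"
  by (simp_all add: end_alg_def)

lemma complex_alg_end_alg: "complex_alg (end_alg :: (complex, ('v \<Rightarrow> complex) \<Rightarrow> 'v \<Rightarrow> complex) module)"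
proof -
  have lin: "\<phi> (\<lambda>v. f v + g v) = (\<lambda>v. \<phi> f v + \<phi> g v)" "\<phi> (\<lambda>v. 0) = (\<lambda>v. 0)" "\<phi> (\<lambda>v. a * f v) = (\<lambda>v. a * \<phi> f v)"
    if "\<forall>a f g. \<phi> (\<lambda>v. a * f v + g v) = (\<lambda>v. a * \<phi> f v + \<phi> g v)" for \<phi> :: "('v \<Rightarrow> complex) \<Rightarrow> 'v \<Rightarrow> complex" and a f g
  proof -
    show add: "\<phi> (\<lambda>v. f v + g v) = (\<lambda>v. \<phi> f v + \<phi> g v)" for f g
      using that[rule_format, of 1 f g] by simp
    show zero: "\<phi> (\<lambda>v. 0) = (\<lambda>v. 0)"
      using add[of "\<lambda>v. 0" "\<lambda>v. 0"] by (simp add: fun_eq_iff)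
    show "\<phi> (\<lambda>v. a * f v) = (\<lambda>v. a * \<phi> f v)"
      using that[rule_format, of a f "\<lambda>v. 0"] by (simp add: zero)
  qed
  have neg: "\<exists>\<psi>\<in>carrier end_alg. \<psi> \<oplus>\<^bsub>end_alg\<^esub> \<phi> = \<zero>\<^bsub>end_alg\<^esub>"
    if "\<phi> \<in> carrier end_alg" for \<phi> :: "('v \<Rightarrow> complex) \<Rightarrow> 'v \<Rightarrow> complex"
    using that by (intro bexI[of _ "\<lambda>f v. - \<phi> f v"]) (simp_all add: fun_eq_iff)
  have "ring (end_alg :: (complex, ('v \<Rightarrow> complex) \<Rightarrow> 'v \<Rightarrow> complex) module)"
    by (intro ringI abelian_groupI monoidI neg) (simp_all add: comp_def lin, simp_all add: fun_eq_iff algebra_simps)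
  then show ?thesis
    by (intro complex_alg.intro complex_alg_axioms.intro)
      (simp_all add: comp_def lin, simp_all add: fun_eq_iff algebra_simps)
qed

type_synonym vertex = "bool \<times> int \<times> int"

text \<open>
  The operator of \<open>E\<^sub>i\<^sub>j x\<^sup>m\<^sup>1 y\<^sup>m\<^sup>2\<close> on column vectors over the quantum torus, with \<open>True\<close> for the first
  index. A function is the family of coefficients of such a vector at the monomials
  \<open>x\<^sup>a y\<^sup>b\<close>, and the power of \<open>q\<close> comes from moving \<open>y\<^sup>m\<^sup>2\<close> past \<open>x\<^sup>a\<close>.
\<close>

definition unit_op :: "complex \<Rightarrow> bool \<Rightarrow> bool \<Rightarrow> int \<times> int \<Rightarrow> (vertex \<Rightarrow> complex) \<Rightarrow> vertex \<Rightarrow> complex" where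
  "unit_op q i j m f = (\<lambda>(l, x, y). if l = i then q powi (snd m * (x - fst m)) * f (j, x - fst m, y - snd m) else 0)"

text \<open>
  The derivations \<open>d\<^sub>1\<close>, \<open>d\<^sub>2\<close> multiply a monomial by its degrees.
\<close>

fun natural_rep :: "complex \<Rightarrow> gen \<Rightarrow> (vertex \<Rightarrow> complex) \<Rightarrow> vertex \<Rightarrow> complex" where
  "natural_rep q (Egen m) f = unit_op q True False m f"
| "natural_rep q (Fgen m) f = unit_op q False True m f"
| "natural_rep q (Ggen k) f = unit_op q True True (Rep_nonzero_index k) f"
| "natural_rep q (Hgen k) f = unit_op q False False (Rep_nonzero_index k) f"
| "natural_rep q Dgen f = (\<lambda>(l, x, y). if l then f (l, x, y) else - f (l, x, y))"
| "natural_rep q D1gen f = (\<lambda>(l, x, y). of_int x * f (l, x, y))"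
| "natural_rep q D2gen f = (\<lambda>(l, x, y). of_int y * f (l, x, y))"

definition lie_rep :: "complex \<Rightarrow> lie \<Rightarrow> (vertex \<Rightarrow> complex) \<Rightarrow> vertex \<Rightarrow> complex" where
  "lie_rep q x f v = key_sum (\<lambda>b c. c * natural_rep q b f v) x"

lemma lie_rep_simps:
  "lie_rep q (x + y) f v = lie_rep q x f v + lie_rep q y f v" "lie_rep q (x - y) f v = lie_rep q x f v - lie_rep q y f v"
  "lie_rep q (- x) f v = - lie_rep q x f v" "lie_rep q 0 f v = 0"
  "lie_rep q (Poly_Mapping.single b c) f v = c * natural_rep q b f v"
proof -
  interpret additive_family "\<lambda>b c. c * natural_rep q b f v" by unfold_locales (simp add: distrib_right)
  show "lie_rep q (x + y) f v = lie_rep q x f v + lie_rep q y f v" "lie_rep q (x - y) f v = lie_rep q x f v - lie_rep q y f v"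
    "lie_rep q (- x) f v = - lie_rep q x f v" "lie_rep q 0 f v = 0"
    "lie_rep q (Poly_Mapping.single b c) f v = c * natural_rep q b f v"
    unfolding lie_rep_def by (rule key_sum_add key_sum_diff key_sum_uminus key_sum_0 key_sum_single)+
qed

lemma lie_rep_scale: "lie_rep q (scale c x) f v = c * lie_rep q x f v"
  using order_refl[of "Poly_Mapping.keys x"]
  by (induction x rule: poly_mapping_induct) (simp_all add: lie_rep_simps pm.scale_right_distrib distrib_left)

lemma natural_rep_linear: "natural_rep q b (\<lambda>v. a * f v + g v) v = a * natural_rep q b f v + natural_rep q b g v"
  by (cases b) (auto simp: unit_op_def algebra_simps split: prod.splits)

lemma natural_rep_zero: "natural_rep q b (\<lambda>v. 0) v = 0"
  by (cases b) (auto simp: unit_op_def split: prod.splits)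

lemma lie_rep_linear: "lie_rep q x (\<lambda>v. a * f v + g v) v = a * lie_rep q x f v + lie_rep q x g v"
  using order_refl[of "Poly_Mapping.keys x"]
  by (induction x rule: poly_mapping_induct) (simp_all add: lie_rep_simps natural_rep_linear, simp_all add: algebra_simps)

lemma lie_rep_elt:
  "lie_rep q (Le m) f v = unit_op q True False m f v" "lie_rep q (Lf m) f v = unit_op q False True m f v"
  "lie_rep q (Lg k) f v = (if k = 0 then 0 else unit_op q True True k f v)"
  "lie_rep q (Lh k) f v = (if k = 0 then 0 else unit_op q False False k f v)"
  "lie_rep q Ld f v = natural_rep q Dgen f v"
  by (simp_all add: basis_defs lie_rep_simps)

lemma unit_op_mult:
  assumes "q \<noteq> 0"
  shows "unit_op q i j m (unit_op q j' l k f) v = (if j = j' then q powi (snd m * fst k) * unit_op q i l (m + k) f v else 0)"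
  using assms
  by (auto simp: unit_op_def algebra_simps split: prod.splits simp flip: power_int_add)

lemma unit_op_0:
  "unit_op q i j 0 f v = (if fst v = i then f (j, snd v) else 0)"
  by (auto simp: unit_op_def split: prod.splits)

lemma Rep_index_neq [simp]: "Rep_nonzero_index k \<noteq> 0"
  using Rep_nonzero_index[of k] by simp

lemma unit_op_Dgen:
  "natural_rep q Dgen (unit_op q i j m f) v = (if i then 1 else - 1) * unit_op q i j m f v"
  "unit_op q i j m (natural_rep q Dgen f) v = (if j then 1 else - 1) * unit_op q i j m f v"
  "natural_rep q D1gen (unit_op q i j m f) v - unit_op q i j m (natural_rep q D1gen f) v = of_int (fst m) * unit_op q i j m f v"
  "natural_rep q D2gen (unit_op q i j m f) v - unit_op q i j m (natural_rep q D2gen f) v = of_int (snd m) * unit_op q i j m f v"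
  by (auto simp: unit_op_def algebra_simps split: prod.splits)

lemma natural_rep_bracket:
  assumes "q \<noteq> 0"
  shows "lie_rep q (gen_bracket q a b) f v = natural_rep q a (natural_rep q b f) v - natural_rep q b (natural_rep q a f) v"
proof -
  note eqs = gen_bracket_def ef_bracket_def Let_def lie_rep_simps lie_rep_scale lie_rep_elt unit_op_mult[OF assms]
  have ef: "lie_rep q (ef_bracket q m m') f v
      = unit_op q True False m (unit_op q False True m' f) v - unit_op q False True m' (unit_op q True False m f) v" for m m'
  proof (cases "m + m' = 0")
    case True
    then have "m' = - m" by (simp add: eq_neg_iff_add_eq_0 add.commute)
    then show ?thesis
      by (cases v) (simp add: eqs unit_op_0 mult.commute)
  qed (simp add: eqs add.commute)
  have opp: "k + k' = 0 \<Longrightarrow> q powi (fst k * snd k') = q powi (fst k' * snd k)" for k k' :: "int \<times> int"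
    by (auto simp: eq_neg_iff_add_eq_0[symmetric] add.commute)
  note eqs' = gen_bracket_def Let_def lie_rep_simps lie_rep_scale lie_rep_elt unit_op_mult[OF assms]
  show ?thesis
    by (cases a; cases b)
      (simp_all add: eqs' ef unit_op_Dgen algebra_simps del: natural_rep.simps(5-7),
       auto simp: unit_op_def algebra_simps dest: opp split: prod.splits)
qed

lemma lie_rep_bracket:
  assumes "q \<noteq> 0"
  shows "lie_rep q (lie_bracket q x y) f v = lie_rep q x (lie_rep q y f) v - lie_rep q y (lie_rep q x f) v"
proof -
  have rep_add: "lie_rep q z (\<lambda>v. g v + h v) v = lie_rep q z g v + lie_rep q z h v" for z g h v
    using lie_rep_linear[of q z 1 g h v] by simp
  have zero: "lie_rep q z (\<lambda>v. 0) v = 0" for z v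
    using rep_add[of z "\<lambda>v. 0" "\<lambda>v. 0" v] by simp
  have scale: "lie_rep q z (\<lambda>v. c * g v) v = c * lie_rep q z g v" for z c g v
    using lie_rep_linear[of q z c g "\<lambda>v. 0" v] by (simp add: zero)
  have scale': "natural_rep q b (\<lambda>v. c * g v) v = c * natural_rep q b g v" for b c g v
    using natural_rep_linear[of q b c g "\<lambda>v. 0" v] by (simp add: natural_rep_zero)
  have eta: "lie_rep q (z + z') f = (\<lambda>v. lie_rep q z f v + lie_rep q z' f v)" "lie_rep q 0 f = (\<lambda>v. 0)"
    "lie_rep q (Poly_Mapping.single b c) f = (\<lambda>v. c * natural_rep q b f v)" for z z' b c
    by (simp_all add: fun_eq_iff lie_rep_simps)
  show ?thesis
    using order_refl[of "Poly_Mapping.keys x"]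
  proof (induction x rule: poly_mapping_induct)
    case (single a c)
    show ?case
      using order_refl[of "Poly_Mapping.keys y"]
    proof (induction y rule: poly_mapping_induct)
      case (single b d)
      have "lie_rep q (lie_bracket q (Poly_Mapping.single a c) (Poly_Mapping.single b d)) f v
        = c * d * (natural_rep q a (natural_rep q b f) v - natural_rep q b (natural_rep q a f) v)"
        by (simp add: lie_bracket_simps lie_rep_scale natural_rep_bracket[OF assms])
      also have "\<dots> = lie_rep q (Poly_Mapping.single a c) (lie_rep q (Poly_Mapping.single b d) f) v
          - lie_rep q (Poly_Mapping.single b d) (lie_rep q (Poly_Mapping.single a c) f) v"
        by (simp only: eta) (simp only: lie_rep_simps(5) scale', simp add: algebra_simps)
      finally show ?case .
    next
      case (add p r)
      then show ?case by (simp only: lie_bracket_simps lie_rep_simps(1) eta rep_add) (simp add: algebra_simps)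
    qed (simp add: lie_bracket_simps lie_rep_simps eta zero natural_rep_zero)
  next
    case (add p r)
    then show ?case by (simp only: lie_bracket_simps lie_rep_simps(1) eta rep_add) (simp add: algebra_simps)
  qed (simp add: lie_bracket_simps lie_rep_simps eta zero natural_rep_zero)
qed

text \<open>
  The natural representation extends to the enveloping algebra, and its matrix coefficients are
  linear functionals.
\<close>

lemma functional_exists:
  assumes "q \<noteq> 0"
  shows "\<exists>\<psi>. linear_map (uea (lie_bracket q)) complex_field \<psi> \<and> (\<forall>x. \<psi> (uea_incl (lie_bracket q) x) = lie_rep q x f v)"
proof -
  interpret enveloping "lie_bracket q" .
  interpret V: complex_alg "end_alg :: (complex, (vertex \<Rightarrow> complex) \<Rightarrow> vertex \<Rightarrow> complex) module"
    by (rule complex_alg_end_alg)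
  have minus: "\<phi> \<ominus>\<^bsub>end_alg\<^esub> \<psi> = (\<lambda>f v. \<phi> f v - \<psi> f v)" if "\<phi> \<in> carrier end_alg" "\<psi> \<in> carrier end_alg"
    for \<phi> \<psi> :: "(vertex \<Rightarrow> complex) \<Rightarrow> vertex \<Rightarrow> complex"
  proof -
    have "\<ominus>\<^bsub>end_alg\<^esub> \<psi> = (\<lambda>f v. - \<psi> f v)"
      using that by (intro V.minus_equality) (simp_all add: fun_eq_iff)
    then show ?thesis by (simp add: a_minus_def fun_eq_iff)
  qed
  have lin: "lie_rep q x \<in> carrier end_alg" for x
    by (simp add: fun_eq_iff lie_rep_linear)
  have "\<exists>h. alg_hom UU end_alg h \<and> (\<forall>x. h (iota x) = lie_rep q x)"
  proof (rule UU_hom_exists[OF complex_alg_end_alg lin])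
    show "lie_rep q (lie_bracket q x y) = lie_rep q x \<otimes>\<^bsub>end_alg\<^esub> lie_rep q y \<ominus>\<^bsub>end_alg\<^esub> lie_rep q y \<otimes>\<^bsub>end_alg\<^esub> lie_rep q x" for x y
      by (subst minus[OF V.m_closed[OF lin lin] V.m_closed[OF lin lin]])
        (simp add: fun_eq_iff lie_rep_bracket[OF assms])
  qed (simp_all add: fun_eq_iff lie_rep_simps lie_rep_scale)
  then obtain h where h: "alg_hom UU (end_alg :: (complex, (vertex \<Rightarrow> complex) \<Rightarrow> vertex \<Rightarrow> complex) module) h" "\<And>x. h (iota x) = lie_rep q x"
    by blast
  have "linear_map UU complex_field (\<lambda>X. h X f v)"
    unfolding linear_map_def by (simp add: alg_hom_simps(2,4)[OF h(1)])
  then show ?thesis using h(2) by auto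
qed

section \<open>The three quantizations\<close>

text \<open>
  What the three situations have in common. The last condition makes \<open>\<epsilon>\<close> nonzero in the enveloping
  algebra, detected by a matrix coefficient.
\<close>

locale quantum_torus_twist = jordanian "lie_bracket q" \<tau> \<epsilon>
  for q :: complex and \<tau> \<epsilon> :: lie +
  fixes n :: "int \<times> int"
  assumes q: "q \<noteq> 0"
    and \<tau>_derivations: "lie_bracket q \<tau> Ld1 = 0" "lie_bracket q \<tau> Ld2 = 0"
    and \<epsilon>_derivations: "lie_bracket q \<epsilon> Ld1 = - scale (of_int (fst n)) \<epsilon>" "lie_bracket q \<epsilon> Ld2 = - scale (of_int (snd n)) \<epsilon>"
    and \<epsilon>_\<epsilon>: "lie_bracket q \<epsilon> \<epsilon> = 0"
    and \<epsilon>_acts: "lie_rep q \<epsilon> (\<lambda>_. 1) (False, n) \<noteq> 0"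
begin

lemma U_eq: "U q = UU" and incl_eq: "incl q x = iota x" and constL_eq: "constL q x = cst x"
  and one_minus_pow_eq: "one_minus_pow q \<epsilon> = opow" and risingT_eq: "risingT q a \<tau> j = cT a j"
  by (simp_all add: U_def incl_def constL_def one_minus_pow_def risingT_def fun_eq_iff opow_def cT_def)

lemmas record_eqs = U_eq constL_eq one_minus_pow_eq risingT_eq Let_def

lemma quantization: "quantization q twist.twisted_comult hopf.counit twist.twisted_antipode"
proof -
  obtain \<psi> where \<psi>: "linear_map UU complex_field \<psi>" "\<And>x. \<psi> (iota x) = lie_rep q x (\<lambda>_. 1) (False, n)"
    using functional_exists[OF q] by blast
  interpret C: complex_alg complex_field by (rule complex_alg_complex_field)
  have \<psi>E: "\<psi> E \<noteq> 0" using \<epsilon>_acts by (simp add: \<psi>(2))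
  then have "E \<noteq> \<zero>\<^bsub>UU\<^esub>"
    using linear_map_zero[OF UU.ring_axioms C.ring_axioms \<psi>(1)] by auto
  moreover have "hopf.counit (cst x) = 0" for x
    using linear_map_zero[OF UU.ring_axioms C.ring_axioms alg_hom_linear[OF counit0]]
    by (auto intro!: fps_ext simp: hopf.counit_def const_def counit0_iota)
  ultimately show ?thesis
    unfolding quantization_def record_eqs
    using twist.is_hopf_algebra_twisted noncommutative noncocommutative[OF \<psi>(1) \<psi>E] by simp
qed

lemma derivation: "derivation_formulas q n \<tau> \<epsilon> twist.twisted_comult twist.twisted_antipode"
proof -
  have "lie_bracket q \<epsilon> (- scale k \<epsilon>) = 0" for k
    by (simp add: lie_bracket_simps lie_bracket_scale \<epsilon>_\<epsilon>)
  note d1 = derivation_case[OF \<tau>_derivations(1) \<epsilon>_derivations(1) this lie_bracket_simps(8)]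
    and d2 = derivation_case[OF \<tau>_derivations(2) \<epsilon>_derivations(2) this lie_bracket_simps(8)]
  show ?thesis
    unfolding derivation_formulas_def record_eqs using d1 d2 by simp
qed

end

context jordanian
begin

lemma right_term_1: "right_term 1 x = ctensor UU UU (cst \<tau>) (opow (- 1) \<otimes>\<^bsub>pseries UU\<^esub> cst x)"
  and right_term_2: "right_term 2 x = ctensor UU UU (cT 0 2) (opow (- 2) \<otimes>\<^bsub>pseries UU\<^esub> cst x)"
  by (simp_all add: right_term_def cT_simps[simplified])

lemma zero_smult_pseries:
  "f \<in> carrier (pseries UU) \<Longrightarrow> 0 \<odot>\<^bsub>pseries UU\<^esub> f = \<zero>\<^bsub>pseries UU\<^esub>"
  "X \<in> carrier (pseries UU2.T) \<Longrightarrow> 0 \<odot>\<^bsub>pseries UU2.T\<^esub> X = \<zero>\<^bsub>pseries UU2.T\<^esub>"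
  using Module.module.smult_l_null[OF UU.module_pseries, of f] Module.module.smult_l_null[OF UU2.T.module_pseries, of X]
  by simp_all

text \<open>
  An element of weight zero commutes with the polynomials in \<open>\<tau>\<close>; this accounts for the order of the
  factors in the antipode for \<open>\<tau> = - d / 2\<close>.
\<close>

lemma cT_commute:
  assumes "br \<tau> y = 0"
  shows "cst y \<otimes>\<^bsub>pseries UU\<^esub> cT a 1 = cT a 1 \<otimes>\<^bsub>pseries UU\<^esub> cst y"
proof -
  have "T' * emb UU (iota y) = emb UU (iota y) * T' + scalar 0 * emb UU (iota y)"
    by (rule emb_weight(1)) (use assms in \<open>auto intro!: poly_mapping_eqI\<close>)
  then have "emb UU (iota y) * rise a T' 1 = rise a T' 1 * emb UU (iota y)"
    by (intro rise_intertwine) simp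
  from arg_cong[OF this, of "proj UU"] have "iota y \<otimes>\<^bsub>UU\<^esub> rising UU a T 1 = rising UU a T 1 \<otimes>\<^bsub>UU\<^esub> iota y"
    by (simp only: proj_simps[OF complex_alg_UU] UU.rising_proj[symmetric] proj_TE UU.proj_emb_same iota_simps(3))
  then show ?thesis
    by (simp only: cT_def UU.const_mult[symmetric] iota_simps(3) UU.rising_closed TE_closed)
qed

lemmas formula_simps = right_term_linear anti_term_linear smult_simps a_minus_def hopf.ctensor_closed
  UU2.T.smult_pseries_closed UU.smult_pseries_closed UU.S.minus_add UU2.T.S.minus_add UU.S.a_ac UU2.T.S.a_ac

end

locale f_twist = quantum_torus_twist q \<tau> "Lf n" n for q \<tau> n
begin

lemma Lf_square:
  "lie_bracket q (Lf n) (scale a (Lf m)) = 0" "lie_bracket q (Lf n) (- scale a (Lf m)) = 0"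
  by (simp_all add: lie_bracket_scale lie_bracket_simps bracket_Lf)

lemma fgh_formulas:
  assumes "y \<noteq> FE" "index_ok y m" "lie_bracket q \<tau> (elt y m) = scale r (elt y m)"
  shows "twist.twisted_comult (cst (elt y m)) = ctensor UU UU (cst (elt y m)) (opow r)
      \<oplus>\<^bsub>pseries UU2.T\<^esub> ctensor UU UU \<one>\<^bsub>pseries UU\<^esub> (cst (elt y m))
      \<oplus>\<^bsub>pseries UU2.T\<^esub> (fps_const (beta q n y m) * fps_X) \<odot>\<^bsub>pseries UU2.T\<^esub>
        ctensor UU UU (cst \<tau>) (opow (- 1) \<otimes>\<^bsub>pseries UU\<^esub> cst (Lf (m + n)))"
    and "twist.twisted_antipode (cst (elt y m)) = \<ominus>\<^bsub>pseries UU\<^esub> (opow (- r) \<otimes>\<^bsub>pseries UU\<^esub> cst (elt y m))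
      \<oplus>\<^bsub>pseries UU\<^esub> (fps_const (beta q n y m) * fps_X) \<odot>\<^bsub>pseries UU\<^esub>
        (opow (- r) \<otimes>\<^bsub>pseries UU\<^esub> cst (Lf (m + n)) \<otimes>\<^bsub>pseries UU\<^esub> cT 1 1)"
proof -
  have b: "lie_bracket q (Lf n) (elt y m) = - scale (beta q n y m) (Lf (m + n))"
    using assms(1,2) by (cases y) (simp_all add: bracket_Lf)
  have bb: "lie_bracket q (Lf n) (lie_bracket q (Lf n) (elt y m)) = scale 2 0"
    "lie_bracket q (Lf n) (lie_bracket q (Lf n) (lie_bracket q (Lf n) (elt y m))) = 0"
    by (simp_all add: b Lf_square lie_bracket_simps)
  note nil = comult_nilpotent[OF assms(3) b bb lie_bracket_simps(8)]
  show "twist.twisted_comult (cst (elt y m)) = ctensor UU UU (cst (elt y m)) (opow r)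
      \<oplus>\<^bsub>pseries UU2.T\<^esub> ctensor UU UU \<one>\<^bsub>pseries UU\<^esub> (cst (elt y m))
      \<oplus>\<^bsub>pseries UU2.T\<^esub> (fps_const (beta q n y m) * fps_X) \<odot>\<^bsub>pseries UU2.T\<^esub>
        ctensor UU UU (cst \<tau>) (opow (- 1) \<otimes>\<^bsub>pseries UU\<^esub> cst (Lf (m + n)))"
    unfolding nil(1) right_term_1[symmetric] by (simp add: formula_simps del: One_nat_def)
  show "twist.twisted_antipode (cst (elt y m)) = \<ominus>\<^bsub>pseries UU\<^esub> (opow (- r) \<otimes>\<^bsub>pseries UU\<^esub> cst (elt y m))
      \<oplus>\<^bsub>pseries UU\<^esub> (fps_const (beta q n y m) * fps_X) \<odot>\<^bsub>pseries UU\<^esub>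
        (opow (- r) \<otimes>\<^bsub>pseries UU\<^esub> cst (Lf (m + n)) \<otimes>\<^bsub>pseries UU\<^esub> cT 1 1)"
    unfolding nil(2) anti_term_def[symmetric] by (simp add: formula_simps del: One_nat_def)
qed

text \<open>
  Here \<open>ad(f\<^sub>n)\<close> leads from \<open>e\<close> through \<open>g\<close> and \<open>h\<close> to \<open>f\<close>, and the two paths contribute equally to
  \<open>ad(f\<^sub>n)\<^sup>2 e\<^sub>m = - 2 s f\<^sub>m\<^sub>+\<^sub>2\<^sub>n\<close>.
\<close>

lemma e_formulas:
  assumes "m + n \<noteq> 0" "lie_bracket q \<tau> (Le m) = scale r (Le m)"
  defines "a \<equiv> q powi (snd m * fst n)" and "b \<equiv> q powi (fst m * snd n)" and "s \<equiv> s_coeff q n m"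
  shows "twist.twisted_comult (cst (Le m)) = ctensor UU UU (cst (Le m)) (opow r)
      \<oplus>\<^bsub>pseries UU2.T\<^esub> ctensor UU UU \<one>\<^bsub>pseries UU\<^esub> (cst (Le m))
      \<oplus>\<^bsub>pseries UU2.T\<^esub> (fps_const a * fps_X) \<odot>\<^bsub>pseries UU2.T\<^esub>
        ctensor UU UU (cst \<tau>) (opow (- 1) \<otimes>\<^bsub>pseries UU\<^esub> cst (Lg (m + n)))
      \<ominus>\<^bsub>pseries UU2.T\<^esub> (fps_const b * fps_X) \<odot>\<^bsub>pseries UU2.T\<^esub>
        ctensor UU UU (cst \<tau>) (opow (- 1) \<otimes>\<^bsub>pseries UU\<^esub> cst (Lh (m + n)))
      \<ominus>\<^bsub>pseries UU2.T\<^esub> (fps_const s * fps_X ^ 2) \<odot>\<^bsub>pseries UU2.T\<^esub>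
        ctensor UU UU (cT 0 2) (opow (- 2) \<otimes>\<^bsub>pseries UU\<^esub> cst (Lf (shift m n 2)))"
    and "twist.twisted_antipode (cst (Le m)) =
      (fps_const a * fps_X) \<odot>\<^bsub>pseries UU\<^esub> (opow (- r) \<otimes>\<^bsub>pseries UU\<^esub> cst (Lg (m + n)) \<otimes>\<^bsub>pseries UU\<^esub> cT 1 1)
      \<ominus>\<^bsub>pseries UU\<^esub> (fps_const b * fps_X) \<odot>\<^bsub>pseries UU\<^esub> (opow (- r) \<otimes>\<^bsub>pseries UU\<^esub> cst (Lh (m + n)) \<otimes>\<^bsub>pseries UU\<^esub> cT 1 1)
      \<ominus>\<^bsub>pseries UU\<^esub> opow (- r) \<otimes>\<^bsub>pseries UU\<^esub> cst (Le m)
      \<oplus>\<^bsub>pseries UU\<^esub> (fps_const s * fps_X ^ 2) \<odot>\<^bsub>pseries UU\<^esub> (opow (- r) \<otimes>\<^bsub>pseries UU\<^esub> cst (Lf (shift m n 2)) \<otimes>\<^bsub>pseries UU\<^esub> cT 1 2)"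
proof -
  have br_e: "lie_bracket q (Lf n) (Le m) = - (scale a (Lg (m + n)) - scale b (Lh (m + n)))"
    using assms(1) by (simp add: bracket_Lf ef_bracket_def a_def b_def mult.commute)
  have "a * q powi (fst (m + n) * snd n) = s" "b * q powi (snd (m + n) * fst n) = s"
    using q by (simp_all add: a_def b_def s_def s_coeff_def algebra_simps flip: power_int_add)
  moreover have "m + n + n = shift m n 2"
    by (simp add: shift_def prod_eq_iff)
  ultimately have bb: "lie_bracket q (Lf n) (lie_bracket q (Lf n) (Le m)) = scale 2 (scale (- s) (Lf (shift m n 2)))"
    using assms(1) unfolding br_e
    by (simp add: lie_bracket_simps lie_bracket_scale bracket_Lf scale_pair)
      (auto intro!: poly_mapping_eqI simp: lookup_minus lookup_add)
  have bbb: "lie_bracket q (Lf n) (lie_bracket q (Lf n) (lie_bracket q (Lf n) (Le m))) = 0"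
    unfolding bb by (simp add: scale_pair Lf_square)
  note nil = comult_nilpotent[OF assms(2) br_e bb bbb lie_bracket_simps(8)]
  show "twist.twisted_comult (cst (Le m)) = ctensor UU UU (cst (Le m)) (opow r)
      \<oplus>\<^bsub>pseries UU2.T\<^esub> ctensor UU UU \<one>\<^bsub>pseries UU\<^esub> (cst (Le m))
      \<oplus>\<^bsub>pseries UU2.T\<^esub> (fps_const a * fps_X) \<odot>\<^bsub>pseries UU2.T\<^esub>
        ctensor UU UU (cst \<tau>) (opow (- 1) \<otimes>\<^bsub>pseries UU\<^esub> cst (Lg (m + n)))
      \<ominus>\<^bsub>pseries UU2.T\<^esub> (fps_const b * fps_X) \<odot>\<^bsub>pseries UU2.T\<^esub>
        ctensor UU UU (cst \<tau>) (opow (- 1) \<otimes>\<^bsub>pseries UU\<^esub> cst (Lh (m + n)))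
      \<ominus>\<^bsub>pseries UU2.T\<^esub> (fps_const s * fps_X ^ 2) \<odot>\<^bsub>pseries UU2.T\<^esub>
        ctensor UU UU (cT 0 2) (opow (- 2) \<otimes>\<^bsub>pseries UU\<^esub> cst (Lf (shift m n 2)))"
    unfolding nil(1) right_term_1[symmetric] right_term_2[symmetric]
    by (simp add: formula_simps del: One_nat_def)
  show "twist.twisted_antipode (cst (Le m)) =
      (fps_const a * fps_X) \<odot>\<^bsub>pseries UU\<^esub> (opow (- r) \<otimes>\<^bsub>pseries UU\<^esub> cst (Lg (m + n)) \<otimes>\<^bsub>pseries UU\<^esub> cT 1 1)
      \<ominus>\<^bsub>pseries UU\<^esub> (fps_const b * fps_X) \<odot>\<^bsub>pseries UU\<^esub> (opow (- r) \<otimes>\<^bsub>pseries UU\<^esub> cst (Lh (m + n)) \<otimes>\<^bsub>pseries UU\<^esub> cT 1 1)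
      \<ominus>\<^bsub>pseries UU\<^esub> opow (- r) \<otimes>\<^bsub>pseries UU\<^esub> cst (Le m)
      \<oplus>\<^bsub>pseries UU\<^esub> (fps_const s * fps_X ^ 2) \<odot>\<^bsub>pseries UU\<^esub> (opow (- r) \<otimes>\<^bsub>pseries UU\<^esub> cst (Lf (shift m n 2)) \<otimes>\<^bsub>pseries UU\<^esub> cT 1 2)"
    unfolding nil(2) anti_term_def[symmetric]
    by (simp add: formula_simps del: One_nat_def)
qed

text \<open>
  For \<open>m = - n\<close> the path from \<open>e\<close> to \<open>f\<close> goes through \<open>d\<close>.
\<close>

lemma common_formulas:
  assumes "lie_bracket q \<tau> (Le (- n)) = scale (- 1) (Le (- n))" "lie_bracket q \<tau> Ld = 0"
  shows "f_twist_common_formulas q n \<tau> twist.twisted_comult twist.twisted_antipode"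
proof -
  define b where "b = q powi (- (fst n * snd n))"
  have br_e: "lie_bracket q (Lf n) (Le (- n)) = - scale b Ld"
    by (simp add: bracket_Lf ef_bracket_def b_def mult.commute)
  have bb: "lie_bracket q (Lf n) (lie_bracket q (Lf n) (Le (- n))) = scale 2 (- scale b (Lf n))"
    unfolding br_e by (simp add: lie_bracket_simps lie_bracket_scale bracket_Lf scale_pair mult.commute)
  have bbb: "lie_bracket q (Lf n) (lie_bracket q (Lf n) (lie_bracket q (Lf n) (Le (- n)))) = 0"
    unfolding bb by (simp add: lie_bracket_scale Lf_square)
  note e = comult_nilpotent[OF assms(1) br_e bb bbb lie_bracket_simps(8)]
  have weight: "lie_bracket q \<tau> Ld = scale 0 Ld" using assms(2) by simp
  have br_d: "lie_bracket q (Lf n) Ld = - (- scale 2 (Lf n))" by (simp add: bracket_Lf)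
  have dd: "lie_bracket q (Lf n) (lie_bracket q (Lf n) Ld) = scale 2 0"
    "lie_bracket q (Lf n) (lie_bracket q (Lf n) (lie_bracket q (Lf n) Ld)) = 0"
    by (simp_all add: br_d Lf_square lie_bracket_simps)
  note d = comult_nilpotent[OF weight br_d dd lie_bracket_simps(8)]
  have e1: "twist.twisted_comult (cst (Le (- n))) = ctensor UU UU (cst (Le (- n))) (opow (- 1))
      \<oplus>\<^bsub>pseries UU2.T\<^esub> ctensor UU UU \<one>\<^bsub>pseries UU\<^esub> (cst (Le (- n)))
      \<oplus>\<^bsub>pseries UU2.T\<^esub> (fps_const b * fps_X) \<odot>\<^bsub>pseries UU2.T\<^esub>
        ctensor UU UU (cst \<tau>) (opow (- 1) \<otimes>\<^bsub>pseries UU\<^esub> cst Ld)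
      \<ominus>\<^bsub>pseries UU2.T\<^esub> (fps_const b * fps_X ^ 2) \<odot>\<^bsub>pseries UU2.T\<^esub>
        ctensor UU UU (cT 0 2) (opow (- 2) \<otimes>\<^bsub>pseries UU\<^esub> cst (Lf n))"
    unfolding e(1) right_term_1[symmetric] right_term_2[symmetric]
    by (simp add: formula_simps del: One_nat_def)
  have e2: "twist.twisted_antipode (cst (Le (- n))) =
      (fps_const b * fps_X ^ 2) \<odot>\<^bsub>pseries UU\<^esub> (opow 1 \<otimes>\<^bsub>pseries UU\<^esub> cst (Lf n) \<otimes>\<^bsub>pseries UU\<^esub> cT 1 2)
      \<ominus>\<^bsub>pseries UU\<^esub> opow 1 \<otimes>\<^bsub>pseries UU\<^esub> cst (Le (- n))
      \<oplus>\<^bsub>pseries UU\<^esub> (fps_const b * fps_X) \<odot>\<^bsub>pseries UU\<^esub> (opow 1 \<otimes>\<^bsub>pseries UU\<^esub> cst Ld \<otimes>\<^bsub>pseries UU\<^esub> cT 1 1)"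
    unfolding e(2) using anti_term_def[of "- 1", symmetric]
    by (simp add: formula_simps del: One_nat_def)
  have d1: "twist.twisted_comult (cst Ld) = ctensor UU UU (cst Ld) \<one>\<^bsub>pseries UU\<^esub>
      \<oplus>\<^bsub>pseries UU2.T\<^esub> ctensor UU UU \<one>\<^bsub>pseries UU\<^esub> (cst Ld)
      \<ominus>\<^bsub>pseries UU2.T\<^esub> (fps_const 2 * fps_X) \<odot>\<^bsub>pseries UU2.T\<^esub>
        ctensor UU UU (cst \<tau>) (opow (- 1) \<otimes>\<^bsub>pseries UU\<^esub> cst (Lf n))"
    unfolding d(1) right_term_1[symmetric] opow_0
    by (simp add: formula_simps del: One_nat_def)
  have "anti_term 0 1 (Lf n) = cst (Lf n) \<otimes>\<^bsub>pseries UU\<^esub> cT 1 1"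
    by (simp add: anti_term_def opow_0)
  then have d2: "twist.twisted_antipode (cst Ld) = \<ominus>\<^bsub>pseries UU\<^esub> cst Ld
      \<ominus>\<^bsub>pseries UU\<^esub> (fps_const 2 * fps_X) \<odot>\<^bsub>pseries UU\<^esub> (cst (Lf n) \<otimes>\<^bsub>pseries UU\<^esub> cT 1 1)"
    unfolding d(2) by (simp add: formula_simps opow_0 del: One_nat_def)
  show ?thesis
    unfolding f_twist_common_formulas_def record_eqs b_def[symmetric]
    using e1 e2 d1 d2 derivation by blast
qed

end

text \<open>
  The constant function \<open>1\<close> is mapped to \<open>q\<^sup>0 = 1\<close> at the coefficient of degree \<open>n\<close>, so the matrix
  coefficient at this place is nonzero for each of the two choices of \<open>\<epsilon>\<close>.
\<close>

lemma Lf_acts: "lie_rep q (Lf n) (\<lambda>_. 1) (False, n) \<noteq> 0"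
  and Lh_acts: "n \<noteq> 0 \<Longrightarrow> lie_rep q (Lh n) (\<lambda>_. 1) (False, n) \<noteq> 0"
  by (simp_all add: lie_rep_elt unit_op_def split_beta)

lemma f_twistI:
  assumes "q \<noteq> 0" "lie_bracket q \<tau> (Lf n) = Lf n" "lie_bracket q \<tau> Ld1 = 0" "lie_bracket q \<tau> Ld2 = 0"
  shows "f_twist q \<tau> n"
  using assms by unfold_locales (simp_all add: bracket_Lf Lf_acts)

lemma f_twist_torus:
  assumes "q \<noteq> 0" "lie_bracket q (torusT x1 x2) (Lf n) = Lf n"
  shows "\<exists>\<Delta> \<epsilon> S. quantization q \<Delta> \<epsilon> S \<and> f_twist_torus_formulas q n x1 x2 \<Delta> S"
proof -
  interpret f_twist q "torusT x1 x2" n by (rule f_twistI[OF assms torus_bracket(3,4)])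
  have "scale (torus_weight x1 x2 n) (Lf n) = Lf n"
    using torus_bracket(1)[of FF n q x1 x2] assms(2) by simp
  from arg_cong[OF this, of "\<lambda>p. Poly_Mapping.lookup p (Fgen n)"] have "torus_weight x1 x2 n = 1"
    by (simp add: Lf_def)
  then have "torus_weight x1 x2 (- n) = - 1"
    unfolding torus_weight_def fst_uminus snd_uminus of_int_minus by (simp add: algebra_simps)
  then have "lie_bracket q (torusT x1 x2) (Le (- n)) = scale (- 1) (Le (- n))"
    using torus_bracket(1)[of FE "- n" q x1 x2] by simp
  note common = common_formulas[OF this torus_bracket(2)]
  have "lie_bracket q (torusT x1 x2) (Le m) = scale (torus_weight x1 x2 m) (Le m)" for m
    using torus_bracket(1)[of FE m q x1 x2] by simp
  note e = e_formulas[OF _ this]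
  have "f_twist_torus_formulas q n x1 x2 twist.twisted_comult twist.twisted_antipode"
    unfolding f_twist_torus_formulas_def record_eqs
    using fgh_formulas[OF _ _ torus_bracket(1)] e common by blast
  then show ?thesis using quantization by blast
qed

lemma f_twist_cartan:
  assumes "q \<noteq> 0"
  shows "\<exists>\<Delta> \<epsilon> S. quantization q \<Delta> \<epsilon> S \<and> f_twist_cartan_formulas q n \<Delta> S"
proof -
  interpret f_twist q cartanT n by (rule f_twistI[OF assms lie_bracket_cartanT cartan_bracket(6,7)])
  have weight: "lie_bracket q cartanT (elt y m) = scale (if y = FF then 1 else 0) (elt y m)" if "y \<noteq> FE" for y m
    using that by (cases y) (simp_all only: elt.simps cartan_bracket, simp_all)
  \<comment> \<open>the power (1 - E t) with exponent minus the weight disappears: beta vanishes for f, and g, h have weight 0\<close>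
  have unit: "fps_const (beta q n y m) * fps_X \<odot>\<^bsub>pseries UU\<^esub>
      (opow (- (if y = FF then 1 else 0)) \<otimes>\<^bsub>pseries UU\<^esub> cst (Lf (m + n)) \<otimes>\<^bsub>pseries UU\<^esub> cT 1 1)
    = (fps_const (beta q n y m) * fps_X) \<odot>\<^bsub>pseries UU\<^esub> (cst (Lf (m + n)) \<otimes>\<^bsub>pseries UU\<^esub> cT 1 1)" for y m
    by (cases y) (simp_all add: opow_0 zero_smult_pseries)
  have "lie_bracket q cartanT (Lh m) = 0" for m by (simp add: cartan_bracket)
  from cT_commute[OF this] have commute: "opow 1 \<otimes>\<^bsub>pseries UU\<^esub> cst (Lh m) \<otimes>\<^bsub>pseries UU\<^esub> cT 1 1
      = opow 1 \<otimes>\<^bsub>pseries UU\<^esub> cT 1 1 \<otimes>\<^bsub>pseries UU\<^esub> cst (Lh m)" for m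
    by (simp add: UU.S.m_assoc)
  have "f_twist_cartan_formulas q n twist.twisted_comult twist.twisted_antipode"
    unfolding f_twist_cartan_formulas_def record_eqs
  proof (intro conjI allI impI)
    fix y m assume "y \<noteq> FE \<and> index_ok y m"
    then have ym: "y \<noteq> FE" "index_ok y m" by auto
    note f = fgh_formulas[OF ym weight[OF ym(1)]]
    show "twist.twisted_comult (cst (elt y m)) = ctensor UU UU (cst (elt y m)) (opow (if y = FF then 1 else 0))
      \<oplus>\<^bsub>pseries UU2.T\<^esub> ctensor UU UU \<one>\<^bsub>pseries UU\<^esub> (cst (elt y m))
      \<oplus>\<^bsub>pseries UU2.T\<^esub> (fps_const (beta q n y m) * fps_X) \<odot>\<^bsub>pseries UU2.T\<^esub>
        ctensor UU UU (cst cartanT) (opow (- 1) \<otimes>\<^bsub>pseries UU\<^esub> cst (Lf (m + n)))"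
      by (rule f(1))
    show "twist.twisted_antipode (cst (elt y m)) = \<ominus>\<^bsub>pseries UU\<^esub> (opow (- (if y = FF then 1 else 0)) \<otimes>\<^bsub>pseries UU\<^esub> cst (elt y m))
      \<oplus>\<^bsub>pseries UU\<^esub> (fps_const (beta q n y m) * fps_X) \<odot>\<^bsub>pseries UU\<^esub> (cst (Lf (m + n)) \<otimes>\<^bsub>pseries UU\<^esub> cT 1 1)"
      using f(2) unfolding unit .
  next
    fix m assume m: "m + n \<noteq> 0"
    note e = e_formulas[OF m cartan_bracket(1)]
    show "twist.twisted_comult (cst (Le m)) = ctensor UU UU (cst (Le m)) (opow (- 1))
      \<oplus>\<^bsub>pseries UU2.T\<^esub> ctensor UU UU \<one>\<^bsub>pseries UU\<^esub> (cst (Le m))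
      \<oplus>\<^bsub>pseries UU2.T\<^esub> (fps_const (q powi (snd m * fst n)) * fps_X) \<odot>\<^bsub>pseries UU2.T\<^esub>
        ctensor UU UU (cst cartanT) (opow (- 1) \<otimes>\<^bsub>pseries UU\<^esub> cst (Lg (m + n)))
      \<ominus>\<^bsub>pseries UU2.T\<^esub> (fps_const (q powi (fst m * snd n)) * fps_X) \<odot>\<^bsub>pseries UU2.T\<^esub>
        ctensor UU UU (cst cartanT) (opow (- 1) \<otimes>\<^bsub>pseries UU\<^esub> cst (Lh (m + n)))
      \<ominus>\<^bsub>pseries UU2.T\<^esub> (fps_const (s_coeff q n m) * fps_X ^ 2) \<odot>\<^bsub>pseries UU2.T\<^esub>
        ctensor UU UU (cT 0 2) (opow (- 2) \<otimes>\<^bsub>pseries UU\<^esub> cst (Lf (shift m n 2)))"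
      by (rule e(1))
    show "twist.twisted_antipode (cst (Le m)) =
      (fps_const (q powi (snd m * fst n)) * fps_X) \<odot>\<^bsub>pseries UU\<^esub> (opow 1 \<otimes>\<^bsub>pseries UU\<^esub> cst (Lg (m + n)) \<otimes>\<^bsub>pseries UU\<^esub> cT 1 1)
      \<ominus>\<^bsub>pseries UU\<^esub> (fps_const (q powi (fst m * snd n)) * fps_X) \<odot>\<^bsub>pseries UU\<^esub> (opow 1 \<otimes>\<^bsub>pseries UU\<^esub> cT 1 1 \<otimes>\<^bsub>pseries UU\<^esub> cst (Lh (m + n)))
      \<ominus>\<^bsub>pseries UU\<^esub> opow 1 \<otimes>\<^bsub>pseries UU\<^esub> cst (Le m)
      \<oplus>\<^bsub>pseries UU\<^esub> (fps_const (s_coeff q n m) * fps_X ^ 2) \<odot>\<^bsub>pseries UU\<^esub> (opow 1 \<otimes>\<^bsub>pseries UU\<^esub> cst (Lf (shift m n 2)) \<otimes>\<^bsub>pseries UU\<^esub> cT 1 2)"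
      using e(2) unfolding minus_minus commute .
  qed (rule common_formulas[OF cartan_bracket(1,5)])
  then show ?thesis using quantization by blast
qed

lemma h_twist:
  assumes "q \<noteq> 0" "n \<noteq> 0" "lie_bracket q (torusT x1 x2) (Lh n) = Lh n"
  shows "\<exists>\<Delta> \<epsilon> S. quantization q \<Delta> \<epsilon> S \<and> h_twist_formulas q n x1 x2 \<Delta> S"
proof -
  interpret quantum_torus_twist q "torusT x1 x2" "Lh n" n
    using assms by unfold_locales (simp_all add: bracket_Lh torus_bracket Lh_acts mult.commute)
  have weight: "lie_bracket q (torusT x1 x2) Ld = scale 0 Ld" by (simp add: torus_bracket)
  have d: "lie_bracket q (Lh n) Ld = - 0" "lie_bracket q (Lh n) (lie_bracket q (Lh n) Ld) = scale 2 0"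
    "lie_bracket q (Lh n) (lie_bracket q (Lh n) (lie_bracket q (Lh n) Ld)) = 0"
    by (simp_all add: bracket_Lh[OF assms(2)] lie_bracket_simps)
  note nil = comult_nilpotent[OF weight d lie_bracket_simps(8)]
  have d1: "twist.twisted_comult (cst Ld) = ctensor UU UU (cst Ld) \<one>\<^bsub>pseries UU\<^esub>
      \<oplus>\<^bsub>pseries UU2.T\<^esub> ctensor UU UU \<one>\<^bsub>pseries UU\<^esub> (cst Ld)"
    unfolding nil(1) by (simp add: formula_simps opow_0)
  have d2: "twist.twisted_antipode (cst Ld) = \<ominus>\<^bsub>pseries UU\<^esub> cst Ld"
    unfolding nil(2) by (simp add: formula_simps opow_0)
  have "h_twist_formulas q n x1 x2 twist.twisted_comult twist.twisted_antipode"
    unfolding h_twist_formulas_def record_eqs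
    using comult_family[OF torus_bracket(1) iterated_bracket_Lh[OF assms(2)], unfolded right_term_def anti_term_def]
      derivation d1 d2 by blast
  then show ?thesis using quantization by blast
qed

theorem corollary1p2:
  fixes q :: complex and n :: "int \<times> int"
  assumes "q \<noteq> 0"
  shows "(\<forall>x1 x2. n \<noteq> 0 \<and> lie_bracket q (torusT x1 x2) (Lh n) = Lh n \<longrightarrow>
             (\<exists>\<Delta> \<epsilon> S. quantization q \<Delta> \<epsilon> S \<and> h_twist_formulas q n x1 x2 \<Delta> S)) \<and>
         (\<forall>x1 x2. lie_bracket q (torusT x1 x2) (Lf n) = Lf n \<longrightarrow>
             (\<exists>\<Delta> \<epsilon> S. quantization q \<Delta> \<epsilon> S \<and> f_twist_torus_formulas q n x1 x2 \<Delta> S)) \<and>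
         (\<exists>\<Delta> \<epsilon> S. quantization q \<Delta> \<epsilon> S \<and> f_twist_cartan_formulas q n \<Delta> S)"
  using h_twist[OF assms] f_twist_torus[OF assms] f_twist_cartan[OF assms] by blast

end
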